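(* Let $\Gamma$ be a discrete group having only finitely many finite subgroups up to conjugacy, let $\mathcal{F}$ be the family of all finite subgroups of $\Gamma$, and let $m(\Gamma)=\mathrm{l.c.m.}\{|H| : H\in\mathcal{F}\}$. Assume that there exists a finite dimensional acyclic $\mathbb{Z}[\Gamma]$-chain complex $C_*$ such that for each $i\ge0$, $$C_i\cong\bigoplus_{k=1}^{m_i}\mathbb{Z}\otimes_{H_{i,k}}\mathbb{Z}[\Gamma],$$ with each $m_i$ finite and each $H_{i,k}$ a finite subgroup of $\Gamma$. Let $K$ be a field whose characteristic is prime to $m(\Gamma)$ (i.e. is zero or does not divide $m(\Gamma)$). For a $K[\Gamma]$-module $M$ of finite dimension over $K$, define $$I_K(M)=\sum_{i=0}^{\infty}(-1)^i\dim_K H^i(\Gamma,M).$$ Then, for all $K[\Gamma]$-modules of finite dimension over $K$: (1) $I_K(M)$ is a finite integer. (2) If $M_1|_S\cong M_2|_S$ (as $K[S]$-modules) for every $S\in\mathcal{F}$, then $I_K(M_1)=I_K(M_2)$. (3) If $0\to M''\to M\to M'\to0$ is a short exact sequence of such $K[\Gamma]$-modules, then $I_K(M)=I_K(M')+I_K(M'')$.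
   Context: "Acyclic" means that $C_*$ has the homology of a point as a complex of $\mathbb{Z}[\Gamma]$-modules: $C_i=0$ for $i<0$, $H_0(C_* )\cong\mathbb{Z}$ with trivial $\Gamma$-action, and $H_i(C_* )=0$ for $i>0$. "Finite dimensional" means $C_i=0$ for all sufficiently large $i$. $\mathbb{Z}\otimes_{H}\mathbb{Z}[\Gamma]$ is the permutation module $\mathbb{Z}\otimes_{\mathbb{Z}[H]}\mathbb{Z}[\Gamma]$, with $H$ acting trivially on $\mathbb{Z}$. $H^i(\Gamma,M)$ is group cohomology. *)

theory Defs
  imports
    "HOL-Algebra.Module"
    "HOL-Algebra.AbelCoset"
    "HOL-Algebra.IntRing"
    "HOL-Algebra.Generated_Groups"
    "HOL-Algebra.Group_Action"
    "HOL-Algebra.Free_Abelian_Groups"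
    "HOL-Library.Groups_Big_Fun"
begin

section \<open>Modules over a not necessarily commutative ring\<close>

text \<open>
  The locale \<open>module\<close> of HOL-Algebra requires a commutative ring of scalars.  We reuse its record
  type.  Only the carrier, the addition, the zero and the scalar multiplication of such a record
  matter; the multiplicative fields inherited from rings are never used, and are left
  unspecified in the constructions below.  For a right module, \<open>r \<odot> x\<close> stands for \<open>x r\<close>.
\<close>

locale left_module = R?: ring R + M?: abelian_group M for R (structure) and M (structure) +
  assumes smult_closed [simp, intro]:
      "\<lbrakk>a \<in> carrier R; x \<in> carrier M\<rbrakk> \<Longrightarrow> a \<odot>\<^bsub>M\<^esub> x \<in> carrier M"
    and smult_l_distr:
      "\<lbrakk>a \<in> carrier R; b \<in> carrier R; x \<in> carrier M\<rbrakk> \<Longrightarrow>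
        (a \<oplus>\<^bsub>R\<^esub> b) \<odot>\<^bsub>M\<^esub> x = a \<odot>\<^bsub>M\<^esub> x \<oplus>\<^bsub>M\<^esub> b \<odot>\<^bsub>M\<^esub> x"
    and smult_r_distr:
      "\<lbrakk>a \<in> carrier R; x \<in> carrier M; y \<in> carrier M\<rbrakk> \<Longrightarrow>
        a \<odot>\<^bsub>M\<^esub> (x \<oplus>\<^bsub>M\<^esub> y) = a \<odot>\<^bsub>M\<^esub> x \<oplus>\<^bsub>M\<^esub> a \<odot>\<^bsub>M\<^esub> y"
    and smult_assoc:
      "\<lbrakk>a \<in> carrier R; b \<in> carrier R; x \<in> carrier M\<rbrakk> \<Longrightarrow>
        (a \<otimes>\<^bsub>R\<^esub> b) \<odot>\<^bsub>M\<^esub> x = a \<odot>\<^bsub>M\<^esub> (b \<odot>\<^bsub>M\<^esub> x)"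
    and smult_one [simp]:
      "x \<in> carrier M \<Longrightarrow> \<one>\<^bsub>R\<^esub> \<odot>\<^bsub>M\<^esub> x = x"

locale right_module = R?: ring R + M?: abelian_group M for R (structure) and M (structure) +
  assumes smult_closed [simp, intro]:
      "\<lbrakk>a \<in> carrier R; x \<in> carrier M\<rbrakk> \<Longrightarrow> a \<odot>\<^bsub>M\<^esub> x \<in> carrier M"
    and smult_l_distr:
      "\<lbrakk>a \<in> carrier R; b \<in> carrier R; x \<in> carrier M\<rbrakk> \<Longrightarrow>
        (a \<oplus>\<^bsub>R\<^esub> b) \<odot>\<^bsub>M\<^esub> x = a \<odot>\<^bsub>M\<^esub> x \<oplus>\<^bsub>M\<^esub> b \<odot>\<^bsub>M\<^esub> x"
    and smult_r_distr:
      "\<lbrakk>a \<in> carrier R; x \<in> carrier M; y \<in> carrier M\<rbrakk> \<Longrightarrow>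
        a \<odot>\<^bsub>M\<^esub> (x \<oplus>\<^bsub>M\<^esub> y) = a \<odot>\<^bsub>M\<^esub> x \<oplus>\<^bsub>M\<^esub> a \<odot>\<^bsub>M\<^esub> y"
    and smult_assoc:
      "\<lbrakk>a \<in> carrier R; b \<in> carrier R; x \<in> carrier M\<rbrakk> \<Longrightarrow>
        (a \<otimes>\<^bsub>R\<^esub> b) \<odot>\<^bsub>M\<^esub> x = b \<odot>\<^bsub>M\<^esub> (a \<odot>\<^bsub>M\<^esub> x)"
    and smult_one [simp]:
      "x \<in> carrier M \<Longrightarrow> \<one>\<^bsub>R\<^esub> \<odot>\<^bsub>M\<^esub> x = x"

definition mod_hom ::
    "('r, 'x) ring_scheme \<Rightarrow> ('r, 'a, 'y) module_scheme \<Rightarrow> ('r, 'b, 'z) module_scheme \<Rightarrow> ('a \<Rightarrow> 'b) set"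
  where "mod_hom R M N =
    {f \<in> carrier M \<rightarrow> carrier N.
      (\<forall>x\<in>carrier M. \<forall>y\<in>carrier M. f (x \<oplus>\<^bsub>M\<^esub> y) = f x \<oplus>\<^bsub>N\<^esub> f y) \<and>
      (\<forall>r\<in>carrier R. \<forall>x\<in>carrier M. f (r \<odot>\<^bsub>M\<^esub> x) = r \<odot>\<^bsub>N\<^esub> f x)}"

definition mod_isomorphic ::
    "('r, 'x) ring_scheme \<Rightarrow> ('r, 'a, 'y) module_scheme \<Rightarrow> ('r, 'b, 'z) module_scheme \<Rightarrow> bool"
  where "mod_isomorphic R M N \<longleftrightarrow> (\<exists>f\<in>mod_hom R M N. bij_betw f (carrier M) (carrier N))"

definition zero_module :: "('r, 'a, 'y) module_scheme \<Rightarrow> bool"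
  where "zero_module M \<longleftrightarrow> carrier M = {\<zero>\<^bsub>M\<^esub>}"

definition short_exact ::
    "('r, 'x) ring_scheme \<Rightarrow> ('r, 'a, 'u) module_scheme \<Rightarrow> ('r, 'b, 'v) module_scheme \<Rightarrow>
      ('r, 'c, 'w) module_scheme \<Rightarrow> ('a \<Rightarrow> 'b) \<Rightarrow> ('b \<Rightarrow> 'c) \<Rightarrow> bool"
  where "short_exact R M'' M M' f g \<longleftrightarrow>
    f \<in> mod_hom R M'' M \<and> g \<in> mod_hom R M M' \<and>
    inj_on f (carrier M'') \<and>
    f ` carrier M'' = {x \<in> carrier M. g x = \<zero>\<^bsub>M'\<^esub>} \<and>
    g ` carrier M = carrier M'"

text \<open>The quotient of \<open>M\<close> by the submodule with underlying set \<open>W\<close>.\<close>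

definition quot_module :: "('r, 'a, 'y) module_scheme \<Rightarrow> 'a set \<Rightarrow> ('r, 'a set) module"
  where "quot_module M W =
    \<lparr>carrier = a_rcosets\<^bsub>M\<^esub> W, monoid.mult = undefined, monoid.one = undefined,
     ring.zero = W, ring.add = set_add M, smult = (\<lambda>r X. \<Union>x\<in>X. W +>\<^bsub>M\<^esub> (r \<odot>\<^bsub>M\<^esub> x))\<rparr>"

definition direct_sum :: "'i set \<Rightarrow> ('i \<Rightarrow> ('r, 'a, 'y) module_scheme) \<Rightarrow> ('r, 'i \<Rightarrow> 'a) module"
  where "direct_sum I A =
    \<lparr>carrier = {x \<in> (\<Pi>\<^sub>E k\<in>I. carrier (A k)). finite {k \<in> I. x k \<noteq> \<zero>\<^bsub>A k\<^esub>}},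
     monoid.mult = undefined, monoid.one = undefined,
     ring.zero = (\<lambda>k\<in>I. \<zero>\<^bsub>A k\<^esub>), ring.add = (\<lambda>x y. \<lambda>k\<in>I. x k \<oplus>\<^bsub>A k\<^esub> y k),
     smult = (\<lambda>r x. \<lambda>k\<in>I. r \<odot>\<^bsub>A k\<^esub> x k)\<rparr>"

definition restrict_scalars :: "('k \<Rightarrow> 'r) \<Rightarrow> ('r, 'a, 'y) module_scheme \<Rightarrow> ('k, 'a) module"
  where "restrict_scalars \<phi> M =
    \<lparr>carrier = carrier M, monoid.mult = undefined, monoid.one = undefined,
     ring.zero = ring.zero M, ring.add = ring.add M, smult = (\<lambda>c x. \<phi> c \<odot>\<^bsub>M\<^esub> x)\<rparr>"

subsection \<open>Tensor products\<close>

text \<open>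
  \<open>A \<otimes>\<^sub>R B\<close> for a right \<open>R\<close>-module \<open>A\<close> and an \<open>R\<close>-\<open>S\<close>-bimodule \<open>B\<close>: the free abelian group on
  pairs modulo the usual relations, as a right \<open>S\<close>-module.  The bimodule is passed as two records
  \<open>B\<close> and \<open>B'\<close> on the same abelian group, carrying the left \<open>R\<close>-action and the right \<open>S\<close>-action.
\<close>

definition tensor_relations ::
    "('r, 'x) ring_scheme \<Rightarrow> ('r, 'a, 'y) module_scheme \<Rightarrow> ('r, 'b, 'z) module_scheme \<Rightarrow>
      ('a \<times> 'b \<Rightarrow>\<^sub>0 int) set"
  where "tensor_relations R A B =
    {frag_of (a \<oplus>\<^bsub>A\<^esub> a', b) - frag_of (a, b) - frag_of (a', b) | a a' b.
        a \<in> carrier A \<and> a' \<in> carrier A \<and> b \<in> carrier B} \<union>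
    {frag_of (a, b \<oplus>\<^bsub>B\<^esub> b') - frag_of (a, b) - frag_of (a, b') | a b b'.
        a \<in> carrier A \<and> b \<in> carrier B \<and> b' \<in> carrier B} \<union>
    {frag_of (r \<odot>\<^bsub>A\<^esub> a, b) - frag_of (a, r \<odot>\<^bsub>B\<^esub> b) | r a b.
        r \<in> carrier R \<and> a \<in> carrier A \<and> b \<in> carrier B}"

definition tensor_product ::
    "('r, 'x) ring_scheme \<Rightarrow> ('r, 'a, 'y) module_scheme \<Rightarrow> ('r, 'b, 'z) module_scheme \<Rightarrow>
      ('s, 'b, 'w) module_scheme \<Rightarrow> ('s, ('a \<times> 'b \<Rightarrow>\<^sub>0 int) set) module"
  where "tensor_product R A B B' =
    (let F = free_Abelian_group (carrier A \<times> carrier B);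
         N = generate F (tensor_relations R A B)
     in \<lparr>carrier = carrier (F Mod N), monoid.mult = undefined, monoid.one = undefined,
         ring.zero = monoid.one (F Mod N), ring.add = monoid.mult (F Mod N),
         smult = (\<lambda>s X. \<Union>x\<in>X. N #>\<^bsub>F\<^esub> frag_extend (\<lambda>(a, b). frag_of (a, s \<odot>\<^bsub>B'\<^esub> b)) x)\<rparr>)"

subsection \<open>Finite dimensional vector spaces\<close>

definition finite_basis :: "('k, 'x) ring_scheme \<Rightarrow> ('k, 'a, 'y) module_scheme \<Rightarrow> 'a set \<Rightarrow> bool"
  where "finite_basis K V B \<longleftrightarrow>
    finite B \<and> B \<subseteq> carrier V \<and>
    (\<forall>v\<in>carrier V. \<exists>!c. c \<in> B \<rightarrow>\<^sub>E carrier K \<and> v = (\<Oplus>\<^bsub>V\<^esub>b\<in>B. c b \<odot>\<^bsub>V\<^esub> b))"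

definition finite_dim :: "('k, 'x) ring_scheme \<Rightarrow> ('k, 'a, 'y) module_scheme \<Rightarrow> bool"
  where "finite_dim K V \<longleftrightarrow> (\<exists>B. finite_basis K V B)"

text \<open>Only meaningful for finite dimensional \<open>V\<close>.\<close>

definition vdim :: "('k, 'x) ring_scheme \<Rightarrow> ('k, 'a, 'y) module_scheme \<Rightarrow> nat"
  where "vdim K V = card (SOME B. finite_basis K V B)"

definition ring_char :: "('k, 'x) ring_scheme \<Rightarrow> nat"
  where "ring_char K =
    (if \<exists>n::nat. 0 < n \<and> [n] \<cdot>\<^bsub>K\<^esub> \<one>\<^bsub>K\<^esub> = \<zero>\<^bsub>K\<^esub>
     then LEAST n::nat. 0 < n \<and> [n] \<cdot>\<^bsub>K\<^esub> \<one>\<^bsub>K\<^esub> = \<zero>\<^bsub>K\<^esub> else 0)"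

section \<open>Group rings\<close>

text \<open>
  Elements are finitely supported functions that vanish off \<open>carrier G\<close>.  Hence for a subgroup
  \<open>H\<close>, \<open>group_ring R (G\<lparr>carrier := H\<rparr>)\<close> is literally a subring of \<open>group_ring R G\<close>, and restricting
  a module to it leaves the record unchanged.
\<close>

definition group_ring :: "('r, 'x) ring_scheme \<Rightarrow> ('g, 'y) monoid_scheme \<Rightarrow> ('g \<Rightarrow> 'r) ring"
  where "group_ring R G =
    \<lparr>carrier = {a. (\<forall>g. a g \<in> carrier R) \<and> finite {g. a g \<noteq> \<zero>\<^bsub>R\<^esub>} \<and> {g. a g \<noteq> \<zero>\<^bsub>R\<^esub>} \<subseteq> carrier G},
     monoid.mult = (\<lambda>a b g. if g \<in> carrier G
               then \<Oplus>\<^bsub>R\<^esub>h\<in>{h. a h \<noteq> \<zero>\<^bsub>R\<^esub>}. a h \<otimes>\<^bsub>R\<^esub> b (inv\<^bsub>G\<^esub> h \<otimes>\<^bsub>G\<^esub> g)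
               else \<zero>\<^bsub>R\<^esub>),
     monoid.one = (\<lambda>g. if g = \<one>\<^bsub>G\<^esub> then \<one>\<^bsub>R\<^esub> else \<zero>\<^bsub>R\<^esub>),
     ring.zero = (\<lambda>g. \<zero>\<^bsub>R\<^esub>),
     ring.add = (\<lambda>a b g. a g \<oplus>\<^bsub>R\<^esub> b g)\<rparr>"

text \<open>The element \<open>r g\<close> of the group ring.\<close>

definition gr_single :: "('r, 'x) ring_scheme \<Rightarrow> 'r \<Rightarrow> 'g \<Rightarrow> 'g \<Rightarrow> 'r"
  where "gr_single R r g = (\<lambda>h. if h = g then r else \<zero>\<^bsub>R\<^esub>)"

definition left_regular :: "('r, 'x) ring_scheme \<Rightarrow> ('r, 'r) module"
  where "left_regular R =
    \<lparr>carrier = carrier R, monoid.mult = undefined, monoid.one = undefined,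
     ring.zero = ring.zero R, ring.add = ring.add R, smult = (\<lambda>r x. r \<otimes>\<^bsub>R\<^esub> x)\<rparr>"

definition right_regular :: "('r, 'x) ring_scheme \<Rightarrow> ('r, 'r) module"
  where "right_regular R =
    \<lparr>carrier = carrier R, monoid.mult = undefined, monoid.one = undefined,
     ring.zero = ring.zero R, ring.add = ring.add R, smult = (\<lambda>r x. x \<otimes>\<^bsub>R\<^esub> r)\<rparr>"

text \<open>The group \<open>\<Z>\<close> with trivial action: a group ring element acts through its augmentation.\<close>

definition trivial_int_module :: "('g \<Rightarrow> int, int) module"
  where "trivial_int_module =
    \<lparr>carrier = UNIV, monoid.mult = undefined, monoid.one = undefined,
     ring.zero = 0, ring.add = (+), smult = (\<lambda>a n. (\<Sum>g | a g \<noteq> 0. a g) * n)\<rparr>"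

text \<open>The right \<open>\<Z>[G]\<close>-module \<open>\<Z> \<otimes> \<Z>[G]\<close>, the tensor product being over \<open>\<Z>[H]\<close>.\<close>

definition perm_module ::
    "('g, 'y) monoid_scheme \<Rightarrow> 'g set \<Rightarrow> ('g \<Rightarrow> int, (int \<times> ('g \<Rightarrow> int) \<Rightarrow>\<^sub>0 int) set) module"
  where "perm_module G H =
    tensor_product (group_ring \<Z> (G\<lparr>carrier := H\<rparr>)) trivial_int_module
      (left_regular (group_ring \<Z> G)) (right_regular (group_ring \<Z> G))"

section \<open>Chain complexes of right modules\<close>

definition chain_complex ::
    "('r, 'x) ring_scheme \<Rightarrow> (int \<Rightarrow> ('r, 'a, 'y) module_scheme) \<Rightarrow> (int \<Rightarrow> 'a \<Rightarrow> 'a) \<Rightarrow> bool"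
  where "chain_complex R C d \<longleftrightarrow>
    (\<forall>i. right_module R (C i)) \<and>
    (\<forall>i. d i \<in> mod_hom R (C i) (C (i - 1))) \<and>
    (\<forall>i. \<forall>x\<in>carrier (C i). d (i - 1) (d i x) = \<zero>\<^bsub>C (i - 2)\<^esub>)"

definition homology ::
    "(int \<Rightarrow> ('r, 'a, 'y) module_scheme) \<Rightarrow> (int \<Rightarrow> 'a \<Rightarrow> 'a) \<Rightarrow> int \<Rightarrow> ('r, 'a set) module"
  where "homology C d i =
    quot_module ((C i)\<lparr>carrier := {x \<in> carrier (C i). d i x = \<zero>\<^bsub>C (i - 1)\<^esub>}\<rparr>)
      (d (i + 1) ` carrier (C (i + 1)))"

definition acyclic_complex ::
    "('g, 'x) monoid_scheme \<Rightarrow> (int \<Rightarrow> ('g \<Rightarrow> int, 'a, 'y) module_scheme) \<Rightarrow> (int \<Rightarrow> 'a \<Rightarrow> 'a) \<Rightarrow> bool"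
  where "acyclic_complex G C d \<longleftrightarrow>
    (\<forall>i<0. zero_module (C i)) \<and>
    mod_isomorphic (group_ring \<Z> G) (homology C d 0) trivial_int_module \<and>
    (\<forall>i>0. zero_module (homology C d i))"

definition finite_dimensional_complex :: "(int \<Rightarrow> ('r, 'a, 'y) module_scheme) \<Rightarrow> bool"
  where "finite_dimensional_complex C \<longleftrightarrow> (\<exists>N. \<forall>i>N. zero_module (C i))"

section \<open>Group cohomology\<close>

text \<open>
  \<open>H\<^sup>n(G, M)\<close> for a left \<open>K[G]\<close>-module \<open>M\<close> is the cohomology of the inhomogeneous (bar) cochain
  complex, with the \<open>K\<close>-structure inherited from \<open>M\<close>.  An \<open>n\<close>-cochain is a function on lists of
  length \<open>n\<close> over \<open>G\<close>, and
  \[ (df)(g_1,\dots,g_{n+1}) = g_1 f(g_2,\dots,g_{n+1})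
       + \sum_{i=1}^{n} (-1)^i f(\dots,g_i g_{i+1},\dots) + (-1)^{n+1} f(g_1,\dots,g_n). \]
  The sum is indexed below by \<open>j = i - 1\<close>, as lists are indexed from 0.
\<close>

definition tuples :: "('g, 'x) monoid_scheme \<Rightarrow> nat \<Rightarrow> 'g list set"
  where "tuples G n = {gs. set gs \<subseteq> carrier G \<and> length gs = n}"

definition cochain_module ::
    "('k, 'x) ring_scheme \<Rightarrow> ('g, 'y) monoid_scheme \<Rightarrow> ('g \<Rightarrow> 'k, 'm, 'z) module_scheme \<Rightarrow> nat \<Rightarrow>
      ('k, 'g list \<Rightarrow> 'm) module"
  where "cochain_module K G M n =
    \<lparr>carrier = tuples G n \<rightarrow>\<^sub>E carrier M, monoid.mult = undefined, monoid.one = undefined,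
     ring.zero = (\<lambda>gs\<in>tuples G n. \<zero>\<^bsub>M\<^esub>),
     ring.add = (\<lambda>f f'. \<lambda>gs\<in>tuples G n. f gs \<oplus>\<^bsub>M\<^esub> f' gs),
     smult = (\<lambda>c f. \<lambda>gs\<in>tuples G n. gr_single K c \<one>\<^bsub>G\<^esub> \<odot>\<^bsub>M\<^esub> f gs)\<rparr>"

definition codiff ::
    "('k, 'x) ring_scheme \<Rightarrow> ('g, 'y) monoid_scheme \<Rightarrow> ('g \<Rightarrow> 'k, 'm, 'z) module_scheme \<Rightarrow> nat \<Rightarrow>
      ('g list \<Rightarrow> 'm) \<Rightarrow> ('g list \<Rightarrow> 'm)"
  where "codiff K G M n f = (\<lambda>gs\<in>tuples G (Suc n).
    gr_single K \<one>\<^bsub>K\<^esub> (hd gs) \<odot>\<^bsub>M\<^esub> f (tl gs)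
    \<oplus>\<^bsub>M\<^esub> (\<Oplus>\<^bsub>M\<^esub>j\<in>{..<n}. [((- 1 :: int) ^ Suc j)] \<cdot>\<^bsub>M\<^esub>
             f (take j gs @ (gs ! j \<otimes>\<^bsub>G\<^esub> gs ! Suc j) # drop (j + 2) gs))
    \<oplus>\<^bsub>M\<^esub> ([((- 1 :: int) ^ Suc n)] \<cdot>\<^bsub>M\<^esub> f (butlast gs)))"

definition cocycles ::
    "('k, 'x) ring_scheme \<Rightarrow> ('g, 'y) monoid_scheme \<Rightarrow> ('g \<Rightarrow> 'k, 'm, 'z) module_scheme \<Rightarrow> nat \<Rightarrow>
      ('g list \<Rightarrow> 'm) set"
  where "cocycles K G M n =
    {f \<in> carrier (cochain_module K G M n). codiff K G M n f = \<zero>\<^bsub>cochain_module K G M (Suc n)\<^esub>}"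

definition coboundaries ::
    "('k, 'x) ring_scheme \<Rightarrow> ('g, 'y) monoid_scheme \<Rightarrow> ('g \<Rightarrow> 'k, 'm, 'z) module_scheme \<Rightarrow> nat \<Rightarrow>
      ('g list \<Rightarrow> 'm) set"
  where "coboundaries K G M n =
    (case n of 0 \<Rightarrow> {\<zero>\<^bsub>cochain_module K G M 0\<^esub>}
     | Suc k \<Rightarrow> codiff K G M k ` carrier (cochain_module K G M k))"

definition group_cohomology ::
    "('k, 'x) ring_scheme \<Rightarrow> ('g, 'y) monoid_scheme \<Rightarrow> ('g \<Rightarrow> 'k, 'm, 'z) module_scheme \<Rightarrow> nat \<Rightarrow>
      ('k, ('g list \<Rightarrow> 'm) set) module"
  where "group_cohomology K G M n =
    quot_module ((cochain_module K G M n)\<lparr>carrier := cocycles K G M n\<rparr>) (coboundaries K G M n)"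

section \<open>Finite subgroups and the Euler characteristic\<close>

definition finite_subgroups :: "('g, 'x) monoid_scheme \<Rightarrow> 'g set set"
  where "finite_subgroups G = {H. subgroup H G \<and> finite H}"

definition finitely_many_up_to_conj :: "('g, 'x) monoid_scheme \<Rightarrow> 'g set set \<Rightarrow> bool"
  where "finitely_many_up_to_conj G \<F> \<longleftrightarrow>
    finite (orbits G \<F> (\<lambda>g H. g <#\<^bsub>G\<^esub> H #>\<^bsub>G\<^esub> inv\<^bsub>G\<^esub> g))"

definition lcm_finite_subgroups :: "('g, 'x) monoid_scheme \<Rightarrow> nat"
  where "lcm_finite_subgroups G = Lcm (card ` finite_subgroups G)"

definition fin_dim_group_module ::
    "('k, 'x) ring_scheme \<Rightarrow> ('g, 'y) monoid_scheme \<Rightarrow> ('g \<Rightarrow> 'k, 'm, 'z) module_scheme \<Rightarrow> bool"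
  where "fin_dim_group_module K G M \<longleftrightarrow>
    left_module (group_ring K G) M \<and>
    finite_dim K (restrict_scalars (\<lambda>c. gr_single K c \<one>\<^bsub>G\<^esub>) M)"

text \<open>
  \<open>Sum_any\<close> sums over the (finite) support; the alternating sum is a genuine one whenever
  \<open>euler_char_finite\<close> holds.
\<close>

definition euler_char_finite ::
    "('k, 'x) ring_scheme \<Rightarrow> ('g, 'y) monoid_scheme \<Rightarrow> ('g \<Rightarrow> 'k, 'm, 'z) module_scheme \<Rightarrow> bool"
  where "euler_char_finite K G M \<longleftrightarrow>
    (\<forall>i. finite_dim K (group_cohomology K G M i)) \<and>
    finite {i. \<not> zero_module (group_cohomology K G M i)}"

definition euler_char ::
    "('k, 'x) ring_scheme \<Rightarrow> ('g, 'y) monoid_scheme \<Rightarrow> ('g \<Rightarrow> 'k, 'm, 'z) module_scheme \<Rightarrow> int"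
  where "euler_char K G M =
    Sum_any (\<lambda>i. (- 1) ^ i * int (vdim K (group_cohomology K G M i)))"

end

theory Submission
  imports Defs
begin

text \<open>
  For a \<open>K[G]\<close>-module \<open>V\<close> let \<open>\<chi>(V)\<close> be the alternating sum of the dimensions of \<open>H\<^sup>n(G, V)\<close>.
  If \<open>C = \<Oplus>\<^sub>k \<Z> \<otimes> \<Z>[G]\<close> is a permutation module with stabilisers \<open>H\<^sub>k\<close> of order invertible in \<open>K\<close>, averaging
  over the \<open>H\<^sub>k\<close> contracts the bar complex of \<open>Hom(C, V)\<close> in positive degrees, so that its Euler characteristic
  is the dimension of its invariants \<open>\<Oplus>\<^sub>k V\<^sup>H\<close> with \<open>H = H\<^sub>k\<close>, which only depends on the restrictions of
  \<open>V\<close> to the \<open>H\<^sub>k\<close>.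

  The terms of the given resolution are free abelian, so it splits over \<open>\<Z>\<close> and remains exact under
  \<open>Hom(_, V)\<close>.  It is cut into short exact sequences \<open>0 \<rightarrow> L\<^sub>p \<rightarrow> Hom(C\<^sub>p, V) \<rightarrow> L\<^sub>p\<^sub>+\<^sub>1 \<rightarrow> 0\<close> of
  \<open>K[G]\<close>-modules with \<open>L\<^sub>0 = V\<close> and \<open>L\<^sub>p = 0\<close> for large \<open>p\<close>.  The long exact sequence then gives, by
  descending induction on \<open>p\<close>, that \<open>\<chi>(V)\<close> is finite and equal to the alternating sum of
  the dimensions of the invariants of \<open>Hom(C\<^sub>p, V)\<close>; it also gives the additivity of \<open>\<chi>\<close>.
\<close>

section \<open>Dimensions of subquotients\<close>

text \<open>A cochain space consists of all functions on tuples of group elements and is infinite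
  dimensional in general, even when its cohomology is small. The counting therefore uses the
  dimension of one subspace relative to another, and the long exact sequence becomes an identity
  between such numbers in which the ranks of the connecting maps cancel.

  The induction has to descend because nothing is known at first about the cohomology of
  \<open>V\<close>, while the far end is zero and the middle terms are computed; finiteness passes
  from the middle and right terms to the left one.

  Invertibility of \<open>|H|\<close> in \<open>K\<close> comes from the characteristic, as
  \<open>|H|\<close> divides \<open>m(\<Gamma>)\<close>. Beyond this the averaging rests on one
  fact: additive maps out of a permutation module are the same as \<open>H\<close>-invariant
  functions on the group, one for each summand. The same fact gives the dimension of the invariants,
  and it provides the additive lifts from which the splitting over the integers is built degree by
  degree, starting at the augmentation.\<close>

locale vspace = left_module K V for K (structure) and V (structure) +
  assumes field_K: "field K"

definition subspace_of :: "('k, 'x) ring_scheme \<Rightarrow> ('k, 'v, 'y) module_scheme \<Rightarrow> 'v set \<Rightarrow> bool"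
  where "subspace_of K V U \<longleftrightarrow> U \<subseteq> carrier V \<and> \<zero>\<^bsub>V\<^esub> \<in> U \<and>
    (\<forall>x\<in>U. \<forall>y\<in>U. x \<oplus>\<^bsub>V\<^esub> y \<in> U) \<and> (\<forall>c\<in>carrier K. \<forall>x\<in>U. c \<odot>\<^bsub>V\<^esub> x \<in> U)"

definition line_extend :: "('k, 'x) ring_scheme \<Rightarrow> ('k, 'v, 'y) module_scheme \<Rightarrow> 'v set \<Rightarrow> 'v \<Rightarrow> 'v set"
  where "line_extend K V E v = {e \<oplus>\<^bsub>V\<^esub> c \<odot>\<^bsub>V\<^esub> v | e c. e \<in> E \<and> c \<in> carrier K}"

text \<open>\<open>reldim K V A C n\<close> means that \<open>C / A\<close> has dimension \<open>n\<close>, expressed by a chain of \<open>n\<close> one-dimensional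
  extensions inside \<open>V\<close> so that no quotient has to be formed.\<close>

inductive reldim :: "('k, 'x) ring_scheme \<Rightarrow> ('k, 'v, 'y) module_scheme \<Rightarrow> 'v set \<Rightarrow> 'v set \<Rightarrow> nat \<Rightarrow> bool"
  for K V A where
  reldim_refl: "reldim K V A A 0"
| reldim_Suc: "reldim K V A E n \<Longrightarrow> v \<in> carrier V \<Longrightarrow> v \<notin> E \<Longrightarrow> reldim K V A (line_extend K V E v) (Suc n)"

lemma subspace_ofD:
  assumes "subspace_of K V U"
  shows "U \<subseteq> carrier V" "\<zero>\<^bsub>V\<^esub> \<in> U" "\<And>x y. x \<in> U \<Longrightarrow> y \<in> U \<Longrightarrow> x \<oplus>\<^bsub>V\<^esub> y \<in> U"
    "\<And>c x. c \<in> carrier K \<Longrightarrow> x \<in> U \<Longrightarrow> c \<odot>\<^bsub>V\<^esub> x \<in> U" "\<And>x. x \<in> U \<Longrightarrow> x \<in> carrier V"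
  using assms by (auto simp: subspace_of_def)

context left_module begin

lemma smult_zero_scalar [simp]: "x \<in> carrier M \<Longrightarrow> \<zero>\<^bsub>R\<^esub> \<odot>\<^bsub>M\<^esub> x = \<zero>\<^bsub>M\<^esub>"
proof -
  assume x: "x \<in> carrier M"
  have "\<zero>\<^bsub>R\<^esub> \<odot>\<^bsub>M\<^esub> x \<oplus>\<^bsub>M\<^esub> \<zero>\<^bsub>R\<^esub> \<odot>\<^bsub>M\<^esub> x = \<zero>\<^bsub>R\<^esub> \<odot>\<^bsub>M\<^esub> x"
    using x smult_l_distr[of "\<zero>\<^bsub>R\<^esub>" "\<zero>\<^bsub>R\<^esub>" x] by simp
  then show ?thesis using x
    by (metis M.add.l_cancel_one' R.zero_closed smult_closed)
qed

lemma smult_zero [simp]: "c \<in> carrier R \<Longrightarrow> c \<odot>\<^bsub>M\<^esub> \<zero>\<^bsub>M\<^esub> = \<zero>\<^bsub>M\<^esub>"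
proof -
  assume c: "c \<in> carrier R"
  have "c \<odot>\<^bsub>M\<^esub> \<zero>\<^bsub>M\<^esub> \<oplus>\<^bsub>M\<^esub> c \<odot>\<^bsub>M\<^esub> \<zero>\<^bsub>M\<^esub> = c \<odot>\<^bsub>M\<^esub> \<zero>\<^bsub>M\<^esub>"
    using c smult_r_distr[of c "\<zero>\<^bsub>M\<^esub>" "\<zero>\<^bsub>M\<^esub>"] by simp
  then show ?thesis using c
    by (metis M.add.l_cancel_one' M.zero_closed smult_closed)
qed

end

section \<open>Subspaces and one-dimensional extensions\<close>

context vspace begin

lemma inverse_scalar:
  assumes "c \<in> carrier K" "c \<noteq> \<zero>\<^bsub>K\<^esub>"
  obtains c' where "c' \<in> carrier K" "c' \<otimes>\<^bsub>K\<^esub> c = \<one>\<^bsub>K\<^esub>"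
proof -
  interpret F: field K by (rule field_K)
  have "c \<in> Units K" using F.field_Units assms by auto
  then show ?thesis using that[of "inv\<^bsub>K\<^esub> c"] by simp
qed

lemma smult_a_inv_scalar: "c \<in> carrier K \<Longrightarrow> x \<in> carrier V \<Longrightarrow> (\<ominus>\<^bsub>K\<^esub> c) \<odot>\<^bsub>V\<^esub> x = \<ominus>\<^bsub>V\<^esub> (c \<odot>\<^bsub>V\<^esub> x)"
  using smult_l_distr[of "\<ominus>\<^bsub>K\<^esub> c" c x]
  by (metis M.minus_equality R.add.inv_closed R.l_neg smult_closed smult_zero_scalar)

lemma smult_a_inv: "c \<in> carrier K \<Longrightarrow> x \<in> carrier V \<Longrightarrow> c \<odot>\<^bsub>V\<^esub> (\<ominus>\<^bsub>V\<^esub> x) = \<ominus>\<^bsub>V\<^esub> (c \<odot>\<^bsub>V\<^esub> x)"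
  using smult_r_distr[of c "\<ominus>\<^bsub>V\<^esub> x" x]
  by (metis M.add.inv_closed M.l_neg M.minus_equality smult_closed smult_zero)

lemma subspace_a_inv: "subspace_of K V U \<Longrightarrow> x \<in> U \<Longrightarrow> \<ominus>\<^bsub>V\<^esub> x \<in> U"
  using smult_a_inv_scalar[of "\<one>\<^bsub>K\<^esub>" x] subspace_ofD[of K V U]
  by (metis R.add.inv_closed R.one_closed smult_one)

lemma subspace_minus: "subspace_of K V U \<Longrightarrow> x \<in> U \<Longrightarrow> y \<in> U \<Longrightarrow> x \<ominus>\<^bsub>V\<^esub> y \<in> U"
  unfolding a_minus_def using subspace_a_inv subspace_ofD(3) by metis

lemma subspace_add_cancel:
  "subspace_of K V U \<Longrightarrow> x \<in> U \<Longrightarrow> y \<in> carrier V \<Longrightarrow> x \<oplus>\<^bsub>V\<^esub> y \<in> U \<longleftrightarrow> y \<in> U"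
proof
  assume a: "subspace_of K V U" "x \<in> U" "y \<in> carrier V" "x \<oplus>\<^bsub>V\<^esub> y \<in> U"
  have "y = \<ominus>\<^bsub>V\<^esub> x \<oplus>\<^bsub>V\<^esub> (x \<oplus>\<^bsub>V\<^esub> y)"
    using a subspace_ofD[OF a(1)] by (simp add: M.r_neg1)
  then show "y \<in> U" using a subspace_a_inv subspace_ofD(3)[OF a(1)] by metis
qed (auto dest: subspace_ofD)

lemma subspace_add_cancel':
  "subspace_of K V U \<Longrightarrow> x \<in> U \<Longrightarrow> y \<in> carrier V \<Longrightarrow> y \<oplus>\<^bsub>V\<^esub> x \<in> U \<longleftrightarrow> y \<in> U"
  using subspace_add_cancel[of U x y] subspace_ofD[of K V U] M.a_comm by metis

lemma subspace_smult_cancel: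
  "subspace_of K V U \<Longrightarrow> c \<in> carrier K \<Longrightarrow> c \<noteq> \<zero>\<^bsub>K\<^esub> \<Longrightarrow> x \<in> carrier V \<Longrightarrow> c \<odot>\<^bsub>V\<^esub> x \<in> U \<longleftrightarrow> x \<in> U"
  using inverse_scalar[of c] subspace_ofD[of K V U] smult_assoc smult_one by metis

lemma subspace_carrier: "subspace_of K V (carrier V)"
  by (auto simp: subspace_of_def)

lemma subspace_zero: "subspace_of K V {\<zero>\<^bsub>V\<^esub>}"
  by (auto simp: subspace_of_def)

lemma subspace_Int: "subspace_of K V U \<Longrightarrow> subspace_of K V W \<Longrightarrow> subspace_of K V (U \<inter> W)"
  by (auto simp: subspace_of_def)

lemma subspace_line_extend:
  assumes "subspace_of K V E" "v \<in> carrier V"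
  shows "subspace_of K V (line_extend K V E v)"
  unfolding subspace_of_def
proof (intro conjI ballI)
  note E = subspace_ofD[OF assms(1)]
  show "line_extend K V E v \<subseteq> carrier V" using assms E by (auto simp: line_extend_def)
  show "\<zero>\<^bsub>V\<^esub> \<in> line_extend K V E v" using assms E
    by (force simp: line_extend_def intro!: exI[of _ "\<zero>\<^bsub>V\<^esub>"] exI[of _ "\<zero>\<^bsub>K\<^esub>"])
  show "x \<oplus>\<^bsub>V\<^esub> y \<in> line_extend K V E v" if xy: "x \<in> line_extend K V E v" "y \<in> line_extend K V E v" for x y
  proof -
    obtain e c e' c' where *: "x = e \<oplus>\<^bsub>V\<^esub> c \<odot>\<^bsub>V\<^esub> v" "y = e' \<oplus>\<^bsub>V\<^esub> c' \<odot>\<^bsub>V\<^esub> v"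
      "e \<in> E" "e' \<in> E" "c \<in> carrier K" "c' \<in> carrier K" using xy by (auto simp: line_extend_def)
    have "x \<oplus>\<^bsub>V\<^esub> y = (e \<oplus>\<^bsub>V\<^esub> e') \<oplus>\<^bsub>V\<^esub> (c \<oplus>\<^bsub>K\<^esub> c') \<odot>\<^bsub>V\<^esub> v"
      using * assms E by (simp add: smult_l_distr M.a_ac)
    then show ?thesis using * E by (auto simp: line_extend_def intro!: exI)
  qed
  show "a \<odot>\<^bsub>V\<^esub> x \<in> line_extend K V E v" if x: "x \<in> line_extend K V E v" and a: "a \<in> carrier K" for x a
  proof -
    obtain e c where *: "x = e \<oplus>\<^bsub>V\<^esub> c \<odot>\<^bsub>V\<^esub> v" "e \<in> E" "c \<in> carrier K"
      using x by (auto simp: line_extend_def)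
    have "a \<odot>\<^bsub>V\<^esub> x = a \<odot>\<^bsub>V\<^esub> e \<oplus>\<^bsub>V\<^esub> (a \<otimes>\<^bsub>K\<^esub> c) \<odot>\<^bsub>V\<^esub> v"
      using * assms E a by (simp add: smult_r_distr smult_assoc)
    then show ?thesis using * E a by (auto simp: line_extend_def intro!: exI)
  qed
qed

lemma line_extend_upper: "subspace_of K V E \<Longrightarrow> v \<in> carrier V \<Longrightarrow> E \<subseteq> line_extend K V E v"
  using subspace_ofD[of K V E] by (force simp: line_extend_def intro!: exI[of _ "\<zero>\<^bsub>K\<^esub>"])

lemma line_extend_gen: "subspace_of K V E \<Longrightarrow> v \<in> carrier V \<Longrightarrow> v \<in> line_extend K V E v"
  using subspace_ofD[of K V E] by (force simp: line_extend_def intro!: exI[of _ "\<zero>\<^bsub>V\<^esub>"] exI[of _ "\<one>\<^bsub>K\<^esub>"])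

lemma line_extend_least:
  "subspace_of K V U \<Longrightarrow> E \<subseteq> U \<Longrightarrow> v \<in> U \<Longrightarrow> line_extend K V E v \<subseteq> U"
  using subspace_ofD[of K V U] by (auto simp: line_extend_def)

text \<open>Steinitz exchange: the coefficient of \<open>v\<close> in \<open>u\<close> is nonzero
  because \<open>u\<close> lies outside \<open>E\<close>, so the expression for \<open>u\<close> can
  be solved for \<open>v\<close>.\<close>

lemma line_extend_exchange:
  assumes "subspace_of K V E" "v \<in> carrier V" "u \<in> line_extend K V E v" "u \<notin> E"
  shows "v \<in> line_extend K V E u" "line_extend K V E u = line_extend K V E v"
proof -
  note E = subspace_ofD[OF assms(1)]
  have u: "u \<in> carrier V" using assms subspace_ofD(1)[OF subspace_line_extend] by blast
  obtain e c where *: "u = e \<oplus>\<^bsub>V\<^esub> c \<odot>\<^bsub>V\<^esub> v" "e \<in> E" "c \<in> carrier K"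
    using assms(3) by (auto simp: line_extend_def)
  have c0: "c \<noteq> \<zero>\<^bsub>K\<^esub>" using assms * E by auto
  note S = subspace_line_extend[OF assms(1) u]
  have "e \<oplus>\<^bsub>V\<^esub> c \<odot>\<^bsub>V\<^esub> v \<in> line_extend K V E u" using line_extend_gen[OF assms(1) u] * by simp
  then have "c \<odot>\<^bsub>V\<^esub> v \<in> line_extend K V E u"
    using subspace_add_cancel[OF S, of e] * line_extend_upper[OF assms(1) u] assms(2) by auto
  then show v: "v \<in> line_extend K V E u" using subspace_smult_cancel[OF S *(3) c0 assms(2)] by simp
  show "line_extend K V E u = line_extend K V E v"
    using v assms line_extend_least[OF S line_extend_upper[OF assms(1) u] v]
      line_extend_least[OF subspace_line_extend[OF assms(1,2)] line_extend_upper[OF assms(1,2)] assms(3)]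
    by auto
qed

section \<open>Calculus of relative dimension\<close>

lemma reldim_subspace:
  assumes "subspace_of K V A" "reldim K V A E n"
  shows "subspace_of K V E \<and> A \<subseteq> E"
  using assms(2)
proof induct
  case reldim_refl then show ?case using assms by auto
next
  case (reldim_Suc E n v)
  then show ?case using subspace_line_extend line_extend_upper by blast
qed

lemma reldim_trans:
  assumes "reldim K V B C n" "reldim K V A B m"
  shows "reldim K V A C (m + n)"
  using assms by induct (auto intro: reldim.intros)

text \<open>Adjoining \<open>u\<close> to every member of the chain keeps each step strict: if
  \<open>v\<close> fell into \<open>E + K u\<close>, exchange would put \<open>u\<close> into
  \<open>E + K v\<close>, but \<open>u\<close> lies outside the top of the chain.\<close>

lemma reldim_translate:
  assumes "subspace_of K V A" "reldim K V A E n" "u \<in> carrier V" "u \<notin> E"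
  shows "reldim K V (line_extend K V A u) (line_extend K V E u) n"
  using assms(2,4)
proof induct
  case reldim_refl show ?case by (rule reldim.reldim_refl)
next
  case (reldim_Suc E n v)
  have E: "subspace_of K V E" using reldim_subspace assms reldim_Suc by blast
  note Ev = subspace_line_extend[OF E \<open>v \<in> carrier V\<close>] and Eu = subspace_line_extend[OF E assms(3)]
  have uE: "u \<notin> E" using reldim_Suc line_extend_upper[OF E] by blast
  have 1: "v \<notin> line_extend K V E u"
    using line_extend_exchange[OF E assms(3), of v] reldim_Suc line_extend_gen by blast
  have "line_extend K V (line_extend K V E u) v = line_extend K V (line_extend K V E v) u" (is "?L = ?R")
  proof
    note L = subspace_line_extend[OF Eu \<open>v \<in> carrier V\<close>] and R = subspace_line_extend[OF Ev assms(3)]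
    note U = line_extend_upper[OF Eu \<open>v \<in> carrier V\<close>] line_extend_upper[OF Ev assms(3)]
      line_extend_upper[OF E \<open>v \<in> carrier V\<close>] line_extend_upper[OF E assms(3)]
    note G = line_extend_gen[OF Eu \<open>v \<in> carrier V\<close>] line_extend_gen[OF Ev assms(3)]
      line_extend_gen[OF E \<open>v \<in> carrier V\<close>] line_extend_gen[OF E assms(3)]
    show "?L \<subseteq> ?R" using U G by (intro line_extend_least R) auto
    show "?R \<subseteq> ?L" using U G by (intro line_extend_least L) auto
  qed
  then show ?case using reldim.reldim_Suc[OF reldim_Suc.hyps(2)[OF uE] \<open>v \<in> carrier V\<close> 1] by simp
qed

text \<open>Intersect the chain with \<open>U\<close> and look at its last step. If \<open>U\<close>
  already lies in \<open>E\<close>, this step counts towards \<open>Z\<close> over \<open>U\<close>.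
  Otherwise some \<open>u\<close> in \<open>U\<close> outside \<open>E\<close> generates the same
  extension of \<open>E\<close>; the step then counts towards \<open>U\<close> over
  \<open>A\<close>, and the chain from \<open>U \<inter> E\<close> to \<open>E\<close> is moved up
  by \<open>u\<close> to one from \<open>U\<close> to \<open>Z\<close>.\<close>

lemma reldim_split:
  assumes "subspace_of K V A" "reldim K V A Z n" "subspace_of K V U" "A \<subseteq> U" "U \<subseteq> Z"
  shows "\<exists>i j. reldim K V A U i \<and> reldim K V U Z j \<and> i + j = n"
  using assms(2-)
proof (induct arbitrary: U)
  case reldim_refl then have "U = A" by auto then show ?case using reldim.reldim_refl by fastforce
next
  case (reldim_Suc E n v)
  have E: "subspace_of K V E" "A \<subseteq> E" using reldim_subspace assms reldim_Suc by blast+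
  obtain i j where ij: "reldim K V A (U \<inter> E) i" "reldim K V (U \<inter> E) E j" "i + j = n"
    using reldim_Suc.hyps(2)[of "U \<inter> E"] subspace_Int E reldim_Suc.prems by blast
  show ?case
  proof (cases "U \<subseteq> E")
    case True
    then have "U \<inter> E = U" by auto
    then show ?thesis using ij reldim_Suc.hyps(3,4) reldim.reldim_Suc[of K V U E j v] by (metis add_Suc_right)
  next
    case False
    then obtain u where u: "u \<in> U" "u \<notin> E" by auto
    have uc: "u \<in> carrier V" using u reldim_Suc subspace_ofD by metis
    have Z: "line_extend K V E u = line_extend K V E v"
      using line_extend_exchange(2)[OF E(1) \<open>v \<in> carrier V\<close>, of u] u reldim_Suc by auto
    have I: "subspace_of K V (U \<inter> E)" using subspace_Int E reldim_Suc by auto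
    have "U \<subseteq> line_extend K V (U \<inter> E) u"
    proof
      fix x assume x: "x \<in> U"
      then have "x \<in> line_extend K V E u" using Z reldim_Suc by auto
      then obtain e c where *: "x = e \<oplus>\<^bsub>V\<^esub> c \<odot>\<^bsub>V\<^esub> u" "e \<in> E" "c \<in> carrier K"
        by (auto simp: line_extend_def)
      have "e \<in> U" using x * subspace_add_cancel'[OF \<open>subspace_of K V U\<close>, of "c \<odot>\<^bsub>V\<^esub> u" e]
         subspace_ofD[OF \<open>subspace_of K V U\<close>] subspace_ofD[OF E(1)] u by auto
      then show "x \<in> line_extend K V (U \<inter> E) u" using * by (auto simp: line_extend_def)
    qed
    then have U: "line_extend K V (U \<inter> E) u = U"
      using line_extend_least[OF \<open>subspace_of K V U\<close>, of "U \<inter> E" u] u by auto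
    have "reldim K V A U (Suc i)" using reldim.reldim_Suc[OF ij(1) uc] u U by auto
    moreover have "reldim K V U (line_extend K V E u) j" using reldim_translate[OF I ij(2) uc u(2)] U by simp
    ultimately show ?thesis using Z ij(3) by auto
  qed
qed

lemma reldim_self: "subspace_of K V A \<Longrightarrow> reldim K V A A n \<Longrightarrow> n = 0"
proof (cases n)
  case (Suc m)
  assume *: "subspace_of K V A" "reldim K V A A n"
  from *(2) Suc obtain E v where E: "reldim K V A E m" "v \<in> carrier V" "v \<notin> E" "A = line_extend K V E v"
    by (auto elim: reldim.cases)
  have "subspace_of K V E" "A \<subseteq> E" using reldim_subspace[OF *(1) E(1)] by auto
  then show ?thesis using E line_extend_gen by blast
qed auto

text \<open>By exchange nothing lies strictly between \<open>E\<close> and \<open>E + K v\<close>,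
  so the member just below the top of any chain is \<open>E\<close> itself.\<close>

lemma reldim_line_extend:
  assumes "subspace_of K V E" "v \<in> carrier V" "v \<notin> E" "reldim K V E (line_extend K V E v) n"
  shows "n = 1"
  using assms(4)
proof (cases rule: reldim.cases)
  case reldim_refl then show ?thesis using line_extend_gen[OF assms(1,2)] assms(3) by auto
next
  case (reldim_Suc E' m w)
  have E': "subspace_of K V E'" "E \<subseteq> E'" using reldim_subspace[OF assms(1) reldim_Suc(3)] by auto
  have sub: "E' \<subseteq> line_extend K V E v" using line_extend_upper[OF E'(1) reldim_Suc(4)] reldim_Suc by simp
  have "E' = E"
  proof (rule ccontr)
    assume "E' \<noteq> E"
    then obtain u where u: "u \<in> E'" "u \<notin> E" using E' by auto
    then have "v \<in> E'" using line_extend_exchange(1)[OF assms(1,2), of u] sub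
      line_extend_least[OF E'] by blast
    then have "line_extend K V E v \<subseteq> E'" using line_extend_least[OF E'] by blast
    then show False using reldim_Suc line_extend_gen[OF E'(1)] by auto
  qed
  then show ?thesis using reldim_self[OF assms(1)] reldim_Suc by auto
qed

text \<open>As in the Jordan-Hoelder theorem, the second chain is split at the last proper member of
  the first one, and the final line has dimension one by \<open>reldim_line_extend\<close>.\<close>

lemma reldim_unique:
  assumes "subspace_of K V A" "reldim K V A Z n" "reldim K V A Z m"
  shows "n = m"
  using assms(2,3)
proof (induct arbitrary: m)
  case reldim_refl then show ?case using reldim_self[OF assms(1)] by auto
next
  case (reldim_Suc E n v)
  have E: "subspace_of K V E" "A \<subseteq> E" using reldim_subspace assms reldim_Suc by blast+
  obtain i j where "reldim K V A E i" "reldim K V E (line_extend K V E v) j" "i + j = m"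
    using reldim_split[OF assms(1) reldim_Suc.prems E] line_extend_upper[OF E(1)] reldim_Suc by blast
  then show ?case using reldim_Suc.hyps reldim_line_extend[OF E(1)] by fastforce
qed

end

section \<open>Linear maps and their effect on relative dimension\<close>

lemma (in abelian_group) a_inv_zero [simp]: "\<ominus> \<zero> = \<zero>"
  using minus_equality[of \<zero> \<zero>] by simp

lemma (in abelian_group) minus_eq_zero_iff:
  "x \<in> carrier G \<Longrightarrow> y \<in> carrier G \<Longrightarrow> x \<ominus> y = \<zero> \<longleftrightarrow> x = y"
proof
  assume a: "x \<in> carrier G" "y \<in> carrier G" "x \<ominus> y = \<zero>"
  then have "x \<oplus> \<ominus> y \<oplus> y = \<zero> \<oplus> y" by (simp add: a_minus_def)
  then show "x = y" using a by (simp add: a_assoc l_neg)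
qed (simp add: a_minus_def r_neg)

lemma mod_homD:
  assumes "f \<in> mod_hom R M N"
  shows "\<And>x. x \<in> carrier M \<Longrightarrow> f x \<in> carrier N"
    "\<And>x y. x \<in> carrier M \<Longrightarrow> y \<in> carrier M \<Longrightarrow> f (x \<oplus>\<^bsub>M\<^esub> y) = f x \<oplus>\<^bsub>N\<^esub> f y"
    "\<And>r x. r \<in> carrier R \<Longrightarrow> x \<in> carrier M \<Longrightarrow> f (r \<odot>\<^bsub>M\<^esub> x) = r \<odot>\<^bsub>N\<^esub> f x"
  using assms by (auto simp: mod_hom_def)

locale linear_map = V: vspace K V + W: vspace K W
  for K (structure) and V (structure) and W (structure) +
  fixes f
  assumes hom: "f \<in> mod_hom K V W"
begin

lemmas map_closed [simp, intro] = mod_homD(1)[OF hom]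
  and map_add = mod_homD(2)[OF hom]
  and map_smult = mod_homD(3)[OF hom]

lemma map_zero [simp]: "f \<zero>\<^bsub>V\<^esub> = \<zero>\<^bsub>W\<^esub>"
  using map_smult[of "\<zero>\<^bsub>K\<^esub>" "\<zero>\<^bsub>V\<^esub>"] by simp

lemma map_a_inv: "x \<in> carrier V \<Longrightarrow> f (\<ominus>\<^bsub>V\<^esub> x) = \<ominus>\<^bsub>W\<^esub> (f x)"
  using map_smult[of "\<ominus>\<^bsub>K\<^esub> \<one>\<^bsub>K\<^esub>" x] by (simp add: V.smult_a_inv_scalar W.smult_a_inv_scalar)

lemma map_minus: "x \<in> carrier V \<Longrightarrow> y \<in> carrier V \<Longrightarrow> f (x \<ominus>\<^bsub>V\<^esub> y) = f x \<ominus>\<^bsub>W\<^esub> f y"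
  by (simp add: a_minus_def map_add map_a_inv)

lemma map_minus_null: "x \<in> carrier V \<Longrightarrow> z \<in> carrier V \<Longrightarrow> f z = \<zero>\<^bsub>W\<^esub> \<Longrightarrow> f (x \<ominus>\<^bsub>V\<^esub> z) = f x"
  by (simp add: map_minus) (simp add: a_minus_def)

definition "ker = {x \<in> carrier V. f x = \<zero>\<^bsub>W\<^esub>}"

lemma subspace_ker: "subspace_of K V ker"
  by (auto simp: subspace_of_def ker_def map_add map_smult)

lemma subspace_image: "subspace_of K V U \<Longrightarrow> subspace_of K W (f ` U)"
  unfolding subspace_of_def
  by (auto simp: map_add[symmetric] map_smult[symmetric] subset_iff) (metis map_zero image_eqI)

lemma subspace_vimage: "subspace_of K W U \<Longrightarrow> subspace_of K V {x \<in> carrier V. f x \<in> U}"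
  by (auto simp: subspace_of_def map_add map_smult)

lemma eq_image_iff: "x \<in> carrier V \<Longrightarrow> y \<in> carrier V \<Longrightarrow> f x = f y \<longleftrightarrow> x \<ominus>\<^bsub>V\<^esub> y \<in> ker"
  using W.M.minus_eq_zero_iff[of "f x" "f y"] by (simp add: ker_def map_minus)

lemma inj_on_iff_ker: "inj_on f (carrier V) \<longleftrightarrow> ker = {\<zero>\<^bsub>V\<^esub>}"
proof
  assume i: "inj_on f (carrier V)"
  show "ker = {\<zero>\<^bsub>V\<^esub>}"
  proof (intro equalityI subsetI)
    fix x assume "x \<in> ker"
    then have "x \<in> carrier V" "f x = f \<zero>\<^bsub>V\<^esub>" by (auto simp: ker_def)
    then show "x \<in> {\<zero>\<^bsub>V\<^esub>}" using inj_onD[OF i] by blast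
  qed (simp add: ker_def)
next
  assume "ker = {\<zero>\<^bsub>V\<^esub>}"
  then have "x = y" if "x \<in> carrier V" "y \<in> carrier V" "f x = f y" for x y
    using eq_image_iff[OF that(1,2)] V.M.minus_eq_zero_iff[OF that(1,2)] that(3) by blast
  then show "inj_on f (carrier V)" by (rule inj_onI)
qed

text \<open>If \<open>f x = f e\<close>, then \<open>x - e\<close> is a kernel element which lies in
  \<open>C\<close>, so the hypothesis constrains only the part of the kernel inside
  \<open>C\<close>. This local form is what rank-nullity and the filtration of function spaces use,
  where the full kernel may leave the lower subspace.\<close>

lemma image_mem_iff:
  assumes "subspace_of K V E" "ker \<inter> C \<subseteq> E" "subspace_of K V C" "E \<subseteq> C" "x \<in> C"
  shows "f x \<in> f ` E \<longleftrightarrow> x \<in> E"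
proof
  assume "f x \<in> f ` E"
  then obtain e where e: "e \<in> E" "f x = f e" by auto
  have c: "x \<in> carrier V" "e \<in> carrier V" using e subspace_ofD(5)[OF assms(1)] subspace_ofD(5)[OF assms(3) assms(5)] by auto
  have "x \<ominus>\<^bsub>V\<^esub> e \<in> C" using assms e V.subspace_minus by blast
  then have "x \<ominus>\<^bsub>V\<^esub> e \<in> E" using eq_image_iff[OF c] e assms by auto
  then have "x \<ominus>\<^bsub>V\<^esub> e \<oplus>\<^bsub>V\<^esub> e \<in> E" using subspace_ofD(3)[OF assms(1)] e by blast
  then show "x \<in> E" using c by (simp add: a_minus_def V.M.a_assoc V.M.l_neg)
qed auto

lemma image_line_extend:
  assumes "E \<subseteq> carrier V" "v \<in> carrier V"
  shows "f ` line_extend K V E v = line_extend K W (f ` E) (f v)"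
proof -
  have "f (e \<oplus>\<^bsub>V\<^esub> c \<odot>\<^bsub>V\<^esub> v) = f e \<oplus>\<^bsub>W\<^esub> c \<odot>\<^bsub>W\<^esub> f v" if "e \<in> E" "c \<in> carrier K" for e c
  proof -
    have "e \<in> carrier V" using that assms by auto
    then show ?thesis using that assms by (simp add: map_add map_smult)
  qed
  then show ?thesis by (force simp: line_extend_def)
qed

lemma reldim_image:
  assumes "subspace_of K V A" "reldim K V A C n" "ker \<inter> C \<subseteq> A"
  shows "reldim K W (f ` A) (f ` C) n"
  using assms(2,3)
proof induct
  case reldim_refl show ?case by (rule reldim.reldim_refl)
next
  case (reldim_Suc E n v)
  have E: "subspace_of K V E" "A \<subseteq> E" using V.reldim_subspace assms(1) reldim_Suc by blast+
  note C = V.subspace_line_extend[OF E(1) \<open>v \<in> carrier V\<close>]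
    V.line_extend_upper[OF E(1) \<open>v \<in> carrier V\<close>] V.line_extend_gen[OF E(1) \<open>v \<in> carrier V\<close>]
  have "f v \<notin> f ` E" using image_mem_iff[OF E(1) _ C] reldim_Suc E by blast
  moreover have "reldim K W (f ` A) (f ` E) n" using reldim_Suc C by auto
  ultimately show ?case
    using reldim.reldim_Suc[of K W "f ` A" "f ` E" n "f v"] image_line_extend[of E v] reldim_Suc
      subspace_ofD(1)[OF E(1)] by auto
qed

text \<open>The chain of images is lifted from the top down. If its last step adjoins
  \<open>w = f v\<close> to \<open>E\<close>, then \<open>C\<close> is cut back to the elements
  mapped into \<open>E\<close>, and \<open>v\<close> is the vector that restores \<open>C\<close>.
  Hence \<open>C\<close> varies in the induction while \<open>A\<close> stays fixed.\<close>

lemma reldim_vimage: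
  assumes "subspace_of K V A" "subspace_of K V C" "A \<subseteq> C" "ker \<inter> C \<subseteq> A" "reldim K W (f ` A) (f ` C) n"
  shows "reldim K V A C n"
proof -
  have "reldim K V A C n" if "reldim K W X Y n" "X = f ` A" "Y = f ` C"
     "subspace_of K V C" "A \<subseteq> C" "ker \<inter> C \<subseteq> A" for X Y C
    using that
  proof (induct arbitrary: C)
    case reldim_refl
    have "x \<in> A" if "x \<in> C" for x using reldim_refl that image_mem_iff[OF assms(1), of C x] by auto
    then have "A = C" using reldim_refl by auto
    then show ?case using reldim.reldim_refl by auto
  next
    case (reldim_Suc E n w)
    have E: "subspace_of K W E" "X \<subseteq> E" using W.reldim_subspace reldim_Suc subspace_image assms(1) by blast+
    have "w \<in> f ` C" using reldim_Suc W.line_extend_gen[OF E(1)] by auto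
    then obtain v where v: "v \<in> C" "f v = w" by auto
    define C' where "C' = C \<inter> {x \<in> carrier V. f x \<in> E}"
    have C': "subspace_of K V C'" unfolding C'_def
      using V.subspace_Int[OF reldim_Suc(7) subspace_vimage[OF E(1)]] .
    have sub: "E \<subseteq> f ` C" using W.line_extend_upper[OF E(1) \<open>w \<in> carrier W\<close>] \<open>line_extend K W E w = f ` C\<close> by simp
    have im: "f ` C' = E" unfolding C'_def using sub subspace_ofD(1)[OF reldim_Suc(7)] by blast
    have AC': "A \<subseteq> C'" using subspace_ofD(1)[OF assms(1)] \<open>A \<subseteq> C\<close> E(2) \<open>X = f ` A\<close> unfolding C'_def by auto
    have "ker \<inter> C' \<subseteq> A" using \<open>ker \<inter> C \<subseteq> A\<close> unfolding C'_def by blast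
    then have "reldim K V A C' n"
      using reldim_Suc.hyps(2)[OF \<open>X = f ` A\<close> im[symmetric] C' AC'] by blast
    moreover have vc: "v \<in> carrier V" "v \<notin> C'" using v \<open>w \<notin> E\<close> subspace_ofD(1)[OF reldim_Suc(7)] by (auto simp: C'_def)
    moreover have "line_extend K V C' v = C"
    proof
      show "line_extend K V C' v \<subseteq> C" using V.line_extend_least[OF reldim_Suc(7), of C' v] v by (auto simp: C'_def)
      note L = V.subspace_line_extend[OF C' vc(1)]
      show "C \<subseteq> line_extend K V C' v"
      proof
        fix x assume x: "x \<in> C"
        have "f ` line_extend K V C' v = f ` C"
          using image_line_extend[OF subspace_ofD(1)[OF C'] vc(1)] im v reldim_Suc by auto
        then have "f x \<in> f ` line_extend K V C' v" using x by auto
        moreover have "ker \<inter> C \<subseteq> line_extend K V C' v"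
          using AC' V.line_extend_upper[OF C' vc(1)] reldim_Suc by blast
        moreover have "line_extend K V C' v \<subseteq> C" by fact
        ultimately show "x \<in> line_extend K V C' v"
          using image_mem_iff[OF L _ reldim_Suc(7) _ x] by blast
      qed
    qed
    ultimately show ?case using reldim.reldim_Suc by metis
  qed
  from this[OF assms(5) refl refl assms(2-4)] show ?thesis .
qed

end

context vspace begin

text \<open>The last hypothesis says that \<open>E = A + (E \<inter> U)\<close>.\<close>

lemma reldim_second_iso:
  assumes "subspace_of K V A" "subspace_of K V U" "reldim K V A E n"
    "\<forall>x\<in>E. \<exists>a\<in>A. \<exists>u\<in>U. x = a \<oplus>\<^bsub>V\<^esub> u"
  shows "reldim K V (A \<inter> U) (E \<inter> U) n"
  using assms(3,4)
proof induct
  case reldim_refl show ?case by (rule reldim.reldim_refl)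
next
  case (reldim_Suc E n v)
  have E: "subspace_of K V E" "A \<subseteq> E" using reldim_subspace assms(1) reldim_Suc by blast+
  note C = subspace_line_extend[OF E(1) \<open>v \<in> carrier V\<close>]
    line_extend_upper[OF E(1) \<open>v \<in> carrier V\<close>] line_extend_gen[OF E(1) \<open>v \<in> carrier V\<close>]
  obtain a u where au: "a \<in> A" "u \<in> U" "v = a \<oplus>\<^bsub>V\<^esub> u" using reldim_Suc C by blast
  have uc: "u \<in> carrier V" "a \<in> carrier V" using au subspace_ofD(5)[OF assms(1)] subspace_ofD(5)[OF assms(2)] by auto
  have uE: "u \<notin> E" using subspace_add_cancel[OF E(1), of a u] au E uc \<open>v \<notin> E\<close> by auto
  have uL: "u \<in> line_extend K V E v" using subspace_add_cancel[OF C(1), of a u] C au E uc by auto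
  have L: "line_extend K V E u = line_extend K V E v"
    using line_extend_exchange(2)[OF E(1) \<open>v \<in> carrier V\<close> uL uE] .
  have "line_extend K V (E \<inter> U) u = line_extend K V E u \<inter> U"
  proof
    show "line_extend K V (E \<inter> U) u \<subseteq> line_extend K V E u \<inter> U"
      using line_extend_least[OF assms(2), of "E \<inter> U" u] au by (auto simp: line_extend_def)
    show "line_extend K V E u \<inter> U \<subseteq> line_extend K V (E \<inter> U) u"
    proof
      fix x assume x: "x \<in> line_extend K V E u \<inter> U"
      then obtain e c where *: "x = e \<oplus>\<^bsub>V\<^esub> c \<odot>\<^bsub>V\<^esub> u" "e \<in> E" "c \<in> carrier K"
        by (auto simp: line_extend_def)
      have "e \<in> U" using x * subspace_add_cancel'[OF assms(2), of "c \<odot>\<^bsub>V\<^esub> u" e]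
         subspace_ofD[OF assms(2)] subspace_ofD[OF E(1)] au by auto
      then show "x \<in> line_extend K V (E \<inter> U) u" using * by (auto simp: line_extend_def)
    qed
  qed
  moreover have "reldim K V (A \<inter> U) (E \<inter> U) n" using reldim_Suc C by blast
  ultimately show ?case using reldim.reldim_Suc[of K V "A \<inter> U" "E \<inter> U" n u] uE uc L by auto
qed

end

context linear_map begin

lemma reldim_rank_nullity:
  assumes "subspace_of K V A" "subspace_of K V C" "A \<subseteq> C" "reldim K V A C n"
  shows "\<exists>i j. reldim K W (f ` A) (f ` C) i \<and> reldim K V (A \<inter> ker) (C \<inter> ker) j \<and> i + j = n"
proof -
  define D where "D = {a \<oplus>\<^bsub>V\<^esub> k | a k. a \<in> A \<and> k \<in> C \<inter> ker}"
  note A = subspace_ofD[OF assms(1)] and C = subspace_ofD[OF assms(2)] and k = subspace_ofD[OF subspace_ker]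
  have D: "subspace_of K V D" unfolding subspace_of_def
  proof (intro conjI ballI)
    show "D \<subseteq> carrier V" using A C by (auto simp: D_def)
    show "\<zero>\<^bsub>V\<^esub> \<in> D" using A(2) C(2) k(2) by (force simp: D_def intro!: exI[of _ "\<zero>\<^bsub>V\<^esub>"])
    show "x \<oplus>\<^bsub>V\<^esub> y \<in> D" if xy: "x \<in> D" "y \<in> D" for x y
    proof -
      obtain a k a' k' where *: "x = a \<oplus>\<^bsub>V\<^esub> k" "y = a' \<oplus>\<^bsub>V\<^esub> k'" "a \<in> A" "a' \<in> A"
        "k \<in> C \<inter> ker" "k' \<in> C \<inter> ker" using xy by (auto simp: D_def)
      have "x \<oplus>\<^bsub>V\<^esub> y = (a \<oplus>\<^bsub>V\<^esub> a') \<oplus>\<^bsub>V\<^esub> (k \<oplus>\<^bsub>V\<^esub> k')" using * A(5) C(5) by (simp add: V.M.a_ac)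
      moreover have "a \<oplus>\<^bsub>V\<^esub> a' \<in> A" "k \<oplus>\<^bsub>V\<^esub> k' \<in> C \<inter> ker" using * A(3) C(3) k(3) by auto
      ultimately show ?thesis unfolding D_def by blast
    qed
    show "c \<odot>\<^bsub>V\<^esub> x \<in> D" if xy: "x \<in> D" "c \<in> carrier K" for x c
    proof -
      obtain a k where *: "x = a \<oplus>\<^bsub>V\<^esub> k" "a \<in> A" "k \<in> C \<inter> ker" using xy by (auto simp: D_def)
      have "c \<odot>\<^bsub>V\<^esub> x = c \<odot>\<^bsub>V\<^esub> a \<oplus>\<^bsub>V\<^esub> c \<odot>\<^bsub>V\<^esub> k" using * A(5) C(5) xy by (simp add: V.smult_r_distr)
      moreover have "c \<odot>\<^bsub>V\<^esub> a \<in> A" "c \<odot>\<^bsub>V\<^esub> k \<in> C \<inter> ker" using * A(4) C(4) k(4) xy by auto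
      ultimately show ?thesis unfolding D_def by blast
    qed
  qed
  have AD: "A \<subseteq> D"
  proof
    fix a assume "a \<in> A"
    then have "a = a \<oplus>\<^bsub>V\<^esub> \<zero>\<^bsub>V\<^esub>" "a \<in> A" using A by auto
    then show "a \<in> D" using C k unfolding D_def by blast
  qed
  have kD: "ker \<inter> C \<subseteq> D"
  proof
    fix x assume "x \<in> ker \<inter> C"
    then have "x = \<zero>\<^bsub>V\<^esub> \<oplus>\<^bsub>V\<^esub> x" "x \<in> C \<inter> ker" using C by auto
    then show "x \<in> D" using A unfolding D_def by blast
  qed
  have DC: "D \<subseteq> C" using C assms(3) by (auto simp: D_def)
  obtain i j where ij: "reldim K V A D j" "reldim K V D C i" "j + i = n"
    using V.reldim_split[OF assms(1,4) D AD DC] by auto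
  have "f ` D = f ` A"
  proof
    show "f ` A \<subseteq> f ` D" using AD by auto
    show "f ` D \<subseteq> f ` A"
      using A(5) C(5) by (auto simp: D_def map_add ker_def)
  qed
  then have 1: "reldim K W (f ` A) (f ` C) i" using reldim_image[OF D ij(2)] kD by auto
  have "reldim K V (A \<inter> ker) (D \<inter> ker) j"
  proof (rule V.reldim_second_iso[OF assms(1) subspace_ker ij(1)])
    show "\<forall>x\<in>D. \<exists>a\<in>A. \<exists>u\<in>ker. x = a \<oplus>\<^bsub>V\<^esub> u" by (auto simp: D_def)
  qed
  moreover have "D \<inter> ker = C \<inter> ker" using kD DC by auto
  ultimately show ?thesis using 1 ij by (metis add.commute)
qed

end

definition rdim :: "('k, 'x) ring_scheme \<Rightarrow> ('k, 'v, 'y) module_scheme \<Rightarrow> 'v set \<Rightarrow> 'v set \<Rightarrow> nat"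
  where "rdim K V A C = (THE n. reldim K V A C n)"

lemma (in vspace) rdim_eq: "subspace_of K V A \<Longrightarrow> reldim K V A C n \<Longrightarrow> rdim K V A C = n"
  unfolding rdim_def using reldim_unique by blast

section \<open>Constructions of vector spaces\<close>

text \<open>The hypothesis on the scalar zero stands in for additive inverses, since it makes
  \<open>(-1) x\<close> an inverse of \<open>x\<close>.\<close>

lemma vspaceI:
  fixes K :: "('k, 'x) ring_scheme" and V :: "('k, 'v, 'y) module_scheme"
  assumes "field K"
    and "\<And>x y. x \<in> carrier V \<Longrightarrow> y \<in> carrier V \<Longrightarrow> x \<oplus>\<^bsub>V\<^esub> y \<in> carrier V"
    and "\<zero>\<^bsub>V\<^esub> \<in> carrier V"
    and "\<And>x y z. x \<in> carrier V \<Longrightarrow> y \<in> carrier V \<Longrightarrow> z \<in> carrier V \<Longrightarrow> x \<oplus>\<^bsub>V\<^esub> y \<oplus>\<^bsub>V\<^esub> z = x \<oplus>\<^bsub>V\<^esub> (y \<oplus>\<^bsub>V\<^esub> z)"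
    and "\<And>x y. x \<in> carrier V \<Longrightarrow> y \<in> carrier V \<Longrightarrow> x \<oplus>\<^bsub>V\<^esub> y = y \<oplus>\<^bsub>V\<^esub> x"
    and "\<And>x. x \<in> carrier V \<Longrightarrow> \<zero>\<^bsub>V\<^esub> \<oplus>\<^bsub>V\<^esub> x = x"
    and smult_closed: "\<And>c x. c \<in> carrier K \<Longrightarrow> x \<in> carrier V \<Longrightarrow> c \<odot>\<^bsub>V\<^esub> x \<in> carrier V"
    and l_distr: "\<And>c c' x. c \<in> carrier K \<Longrightarrow> c' \<in> carrier K \<Longrightarrow> x \<in> carrier V \<Longrightarrow>
      (c \<oplus>\<^bsub>K\<^esub> c') \<odot>\<^bsub>V\<^esub> x = c \<odot>\<^bsub>V\<^esub> x \<oplus>\<^bsub>V\<^esub> c' \<odot>\<^bsub>V\<^esub> x"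
    and "\<And>c x y. c \<in> carrier K \<Longrightarrow> x \<in> carrier V \<Longrightarrow> y \<in> carrier V \<Longrightarrow>
      c \<odot>\<^bsub>V\<^esub> (x \<oplus>\<^bsub>V\<^esub> y) = c \<odot>\<^bsub>V\<^esub> x \<oplus>\<^bsub>V\<^esub> c \<odot>\<^bsub>V\<^esub> y"
    and "\<And>c c' x. c \<in> carrier K \<Longrightarrow> c' \<in> carrier K \<Longrightarrow> x \<in> carrier V \<Longrightarrow>
      (c \<otimes>\<^bsub>K\<^esub> c') \<odot>\<^bsub>V\<^esub> x = c \<odot>\<^bsub>V\<^esub> (c' \<odot>\<^bsub>V\<^esub> x)"
    and one: "\<And>x. x \<in> carrier V \<Longrightarrow> \<one>\<^bsub>K\<^esub> \<odot>\<^bsub>V\<^esub> x = x"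
    and zero: "\<And>x. x \<in> carrier V \<Longrightarrow> \<zero>\<^bsub>K\<^esub> \<odot>\<^bsub>V\<^esub> x = \<zero>\<^bsub>V\<^esub>"
  shows "vspace K V"
proof -
  interpret F: field K by fact
  have "abelian_group V"
  proof (rule abelian_groupI)
    fix x assume x: "x \<in> carrier V"
    have "(\<ominus>\<^bsub>K\<^esub> \<one>\<^bsub>K\<^esub>) \<odot>\<^bsub>V\<^esub> x \<oplus>\<^bsub>V\<^esub> x = \<zero>\<^bsub>V\<^esub>"
      using l_distr[of "\<ominus>\<^bsub>K\<^esub> \<one>\<^bsub>K\<^esub>" "\<one>\<^bsub>K\<^esub>" x] x one zero by (simp add: F.l_neg)
    then show "\<exists>y\<in>carrier V. y \<oplus>\<^bsub>V\<^esub> x = \<zero>\<^bsub>V\<^esub>" using smult_closed x by blast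
  qed (use assms in auto)
  then show ?thesis using assms
    by (simp add: vspace_def vspace_axioms_def left_module_def left_module_axioms_def F.ring_axioms)
qed

text \<open>The operations of \<open>Q\<close> are described only on values of \<open>\<pi>\<close>,
  so their independence of representatives is contained in the last two hypotheses, and every axiom
  is inherited from \<open>V\<close>.\<close>

lemma (in vspace) vspace_image:
  fixes Q :: "('a, 'q, 'z) module_scheme"
  assumes "carrier Q = \<pi> ` carrier V" "\<zero>\<^bsub>Q\<^esub> = \<pi> \<zero>\<^bsub>V\<^esub>"
    and "\<And>x y. x \<in> carrier V \<Longrightarrow> y \<in> carrier V \<Longrightarrow> \<pi> x \<oplus>\<^bsub>Q\<^esub> \<pi> y = \<pi> (x \<oplus>\<^bsub>V\<^esub> y)"
    and "\<And>c x. c \<in> carrier K \<Longrightarrow> x \<in> carrier V \<Longrightarrow> c \<odot>\<^bsub>Q\<^esub> \<pi> x = \<pi> (c \<odot>\<^bsub>V\<^esub> x)"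
  shows "vspace K Q" "\<pi> \<in> mod_hom K V Q"
proof -
  show "vspace K Q"
    by (rule vspaceI[OF field_K])
      (auto simp: assms M.a_assoc smult_l_distr smult_r_distr smult_assoc intro: arg_cong[OF M.a_comm])
  show "\<pi> \<in> mod_hom K V Q" by (auto simp: mod_hom_def assms)
qed

lemma (in vspace) vspace_subspace:
  assumes "subspace_of K V U"
  shows "vspace K (V\<lparr>carrier := U\<rparr>)"
  using subspace_ofD[OF assms]
  by (intro vspaceI[OF field_K]) (auto simp: M.a_ac smult_l_distr smult_r_distr smult_assoc)

lemma (in vspace) subspace_of_carrier_update:
  "W \<subseteq> U \<Longrightarrow> U \<subseteq> carrier V \<Longrightarrow> subspace_of K (V\<lparr>carrier := U\<rparr>) W \<longleftrightarrow> subspace_of K V W"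
  by (auto simp: subspace_of_def)

text \<open>The inclusion of \<open>U\<close> has trivial kernel, so chains can be pushed forward
  and pulled back along it.\<close>

lemma (in vspace) reldim_carrier_update:
  assumes "subspace_of K V U" "subspace_of K V A" "A \<subseteq> U" "C \<subseteq> U" "subspace_of K V C"
  shows "reldim K (V\<lparr>carrier := U\<rparr>) A C n \<longleftrightarrow> reldim K V A C n"
proof -
  interpret U: vspace K "V\<lparr>carrier := U\<rparr>" by (rule vspace_subspace) fact
  interpret I: linear_map K "V\<lparr>carrier := U\<rparr>" V id
    by (intro linear_map.intro linear_map_axioms.intro U.vspace_axioms vspace_axioms)
      (use subspace_ofD[OF assms(1)] in \<open>auto simp: mod_hom_def\<close>)
  have A: "subspace_of K (V\<lparr>carrier := U\<rparr>) A" "subspace_of K (V\<lparr>carrier := U\<rparr>) C"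
    using assms subspace_of_carrier_update[OF _ subspace_ofD(1)[OF assms(1)]] by auto
  have k: "I.ker \<subseteq> A" using subspace_ofD(2)[OF assms(2)] by (auto simp: I.ker_def)
  have "A \<subseteq> C" if "reldim K V A C n" using reldim_subspace[OF assms(2) that] by auto
  then show ?thesis using I.reldim_image[OF A(1), of C n] I.reldim_vimage[OF A, of n] k by auto
qed

section \<open>Function spaces\<close>

definition fun_mod :: "'s set \<Rightarrow> ('k, 'v, 'y) module_scheme \<Rightarrow> ('k, 's \<Rightarrow> 'v) module"
  where "fun_mod S V = \<lparr>carrier = S \<rightarrow>\<^sub>E carrier V, monoid.mult = undefined, monoid.one = undefined,
     ring.zero = (\<lambda>s\<in>S. \<zero>\<^bsub>V\<^esub>), ring.add = (\<lambda>f f'. \<lambda>s\<in>S. f s \<oplus>\<^bsub>V\<^esub> f' s),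
     smult = (\<lambda>c f. \<lambda>s\<in>S. c \<odot>\<^bsub>V\<^esub> f s)\<rparr>"

lemma fun_mod_simps [simp]:
  "carrier (fun_mod S V) = S \<rightarrow>\<^sub>E carrier V"
  "\<zero>\<^bsub>fun_mod S V\<^esub> = (\<lambda>s\<in>S. \<zero>\<^bsub>V\<^esub>)"
  "f \<oplus>\<^bsub>fun_mod S V\<^esub> f' = (\<lambda>s\<in>S. f s \<oplus>\<^bsub>V\<^esub> f' s)"
  "c \<odot>\<^bsub>fun_mod S V\<^esub> f = (\<lambda>s\<in>S. c \<odot>\<^bsub>V\<^esub> f s)"
  by (auto simp: fun_mod_def)

lemma (in vspace) vspace_fun_mod: "vspace K (fun_mod S V)"
proof (rule vspaceI[OF field_K])
  show "x \<oplus>\<^bsub>fun_mod S V\<^esub> y = y \<oplus>\<^bsub>fun_mod S V\<^esub> x" if "x \<in> carrier (fun_mod S V)" "y \<in> carrier (fun_mod S V)" for x y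
    using that by (auto intro!: restrict_ext M.a_comm)
  show "\<zero>\<^bsub>fun_mod S V\<^esub> \<oplus>\<^bsub>fun_mod S V\<^esub> x = x" if "x \<in> carrier (fun_mod S V)" for x
    using that by (intro ext) (auto simp: PiE_iff extensional_def)
  show "\<one>\<^bsub>K\<^esub> \<odot>\<^bsub>fun_mod S V\<^esub> x = x" if "x \<in> carrier (fun_mod S V)" for x
    using that by (intro ext) (auto simp: PiE_iff extensional_def)
qed (auto intro!: restrict_ext simp: PiE_iff M.a_assoc smult_l_distr smult_r_distr smult_assoc)

lemma (in vspace) eval_mod_hom: "s \<in> S \<Longrightarrow> (\<lambda>f. f s) \<in> mod_hom K (fun_mod S V) V"
  by (auto simp: mod_hom_def)

text \<open>Filter by support: evaluation at \<open>t\<close> sends the functions supported on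
  \<open>insert t T\<close> onto a subspace of \<open>V\<close>, and its kernel among them consists
  of the functions supported on \<open>T\<close>.\<close>

lemma (in vspace) reldim_fun_mod:
  assumes "finite S" "reldim K V {\<zero>\<^bsub>V\<^esub>} (carrier V) n"
  shows "\<exists>m. reldim K (fun_mod S V) {\<zero>\<^bsub>fun_mod S V\<^esub>} (carrier (fun_mod S V)) m"
proof -
  interpret P: vspace K "fun_mod S V" by (rule vspace_fun_mod)
  define E where "E T = {f \<in> carrier (fun_mod S V). \<forall>s\<in>S - T. f s = \<zero>\<^bsub>V\<^esub>}" for T
  have E: "subspace_of K (fun_mod S V) (E T)" for T
    unfolding subspace_of_def E_def by auto
  have "\<exists>m. reldim K (fun_mod S V) {\<zero>\<^bsub>fun_mod S V\<^esub>} (E T) m" if "finite T" "T \<subseteq> S" for T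
    using that
  proof (induct T)
    case empty
    have "f = \<zero>\<^bsub>fun_mod S V\<^esub>" if "f \<in> E {}" for f
      using that by (intro ext) (auto simp: E_def PiE_def extensional_def)
    moreover have "\<zero>\<^bsub>fun_mod S V\<^esub> \<in> E {}" by (auto simp: E_def)
    ultimately have "E {} = {\<zero>\<^bsub>fun_mod S V\<^esub>}" by blast
    then show ?case by (metis reldim_refl)
  next
    case (insert t T)
    then obtain m where m: "reldim K (fun_mod S V) {\<zero>\<^bsub>fun_mod S V\<^esub>} (E T) m" by blast
    interpret ev: linear_map K "fun_mod S V" V "\<lambda>f. f t"
      by (intro linear_map.intro linear_map_axioms.intro P.vspace_axioms vspace_axioms eval_mod_hom)
        (use insert in auto)
    have sub: "E T \<subseteq> E (insert t T)" by (auto simp: E_def)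
    have "(\<lambda>f. f t) ` E T = {\<zero>\<^bsub>V\<^esub>}"
    proof -
      have "f t = \<zero>\<^bsub>V\<^esub>" if "f \<in> E T" for f using that insert by (auto simp: E_def)
      moreover have "E T \<noteq> {}" using subspace_ofD(2)[OF E] by auto
      ultimately show ?thesis by auto
    qed
    moreover have im: "subspace_of K V ((\<lambda>f. f t) ` E (insert t T))" by (rule ev.subspace_image[OF E])
    then have im2: "{\<zero>\<^bsub>V\<^esub>} \<subseteq> (\<lambda>f. f t) ` E (insert t T)" "(\<lambda>f. f t) ` E (insert t T) \<subseteq> carrier V"
      using subspace_ofD(1,2)[OF im] by auto
    then obtain i where "reldim K V {\<zero>\<^bsub>V\<^esub>} ((\<lambda>f. f t) ` E (insert t T)) i"
      using reldim_split[OF subspace_zero assms(2) im im2] by blast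
    moreover have "ev.ker \<inter> E (insert t T) \<subseteq> E T" by (auto simp: E_def ev.ker_def)
    ultimately have "reldim K (fun_mod S V) (E T) (E (insert t T)) i"
      using ev.reldim_vimage[OF E E sub] by simp
    then show ?case using P.reldim_trans m by blast
  qed
  from this[OF assms(1)] obtain m where "reldim K (fun_mod S V) {\<zero>\<^bsub>fun_mod S V\<^esub>} (E S) m" by auto
  moreover have "E S = carrier (fun_mod S V)" by (auto simp: E_def)
  ultimately show ?thesis by auto
qed

section \<open>Quotient spaces and finite bases\<close>

context vspace begin

lemma coset_eq_iff:
  assumes "subspace_of K V B" "x \<in> carrier V" "y \<in> carrier V"
  shows "B +>\<^bsub>V\<^esub> x = B +>\<^bsub>V\<^esub> y \<longleftrightarrow> x \<ominus>\<^bsub>V\<^esub> y \<in> B"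
proof
  assume eq: "B +>\<^bsub>V\<^esub> x = B +>\<^bsub>V\<^esub> y"
  have "x \<in> B +>\<^bsub>V\<^esub> x" using assms subspace_ofD(2)[OF assms(1)] unfolding a_r_coset_def' by force
  then have "x \<in> B +>\<^bsub>V\<^esub> y" using eq by simp
  then obtain b where b: "b \<in> B" "x = b \<oplus>\<^bsub>V\<^esub> y" unfolding a_r_coset_def' by auto
  then have "x \<ominus>\<^bsub>V\<^esub> y = b" using assms subspace_ofD[OF assms(1)]
    by (simp add: a_minus_def M.a_assoc M.r_neg)
  then show "x \<ominus>\<^bsub>V\<^esub> y \<in> B" using b by simp
next
  assume d: "x \<ominus>\<^bsub>V\<^esub> y \<in> B"
  have sub: "B +>\<^bsub>V\<^esub> x \<subseteq> B +>\<^bsub>V\<^esub> y" if "x \<ominus>\<^bsub>V\<^esub> y \<in> B" "x \<in> carrier V" "y \<in> carrier V" for x y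
  proof
    fix z assume "z \<in> B +>\<^bsub>V\<^esub> x"
    then obtain b where b: "b \<in> B" "z = b \<oplus>\<^bsub>V\<^esub> x" unfolding a_r_coset_def' by auto
    have "z = (b \<oplus>\<^bsub>V\<^esub> (x \<ominus>\<^bsub>V\<^esub> y)) \<oplus>\<^bsub>V\<^esub> y"
      using b that subspace_ofD(5)[OF assms(1)] by (simp add: a_minus_def M.a_assoc M.l_neg)
    moreover have "b \<oplus>\<^bsub>V\<^esub> (x \<ominus>\<^bsub>V\<^esub> y) \<in> B" using subspace_ofD(3)[OF assms(1)] b that by blast
    ultimately show "z \<in> B +>\<^bsub>V\<^esub> y" unfolding a_r_coset_def' by blast
  qed
  have "y \<ominus>\<^bsub>V\<^esub> x = \<ominus>\<^bsub>V\<^esub> (x \<ominus>\<^bsub>V\<^esub> y)" using assms by (simp add: a_minus_def M.minus_add M.a_comm)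
  then have "y \<ominus>\<^bsub>V\<^esub> x \<in> B" using subspace_a_inv[OF assms(1) d] by simp
  then show "B +>\<^bsub>V\<^esub> x = B +>\<^bsub>V\<^esub> y" using sub d assms by blast
qed

lemma
  assumes "subspace_of K V B"
  shows vspace_quot_module: "vspace K (quot_module V B)"
    and quot_map_hom: "(\<lambda>x. B +>\<^bsub>V\<^esub> x) \<in> mod_hom K V (quot_module V B)"
proof -
  note B = subspace_ofD[OF assms]
  interpret AS: abelian_subgroup B V
    by (intro abelian_subgroupI3 additive_subgroup.intro M.abelian_group_axioms)
      (use B subspace_a_inv[OF assms] in \<open>auto intro!: subgroup.intro simp: a_inv_def[symmetric]\<close>)
  have 1: "carrier (quot_module V B) = (\<lambda>x. B +>\<^bsub>V\<^esub> x) ` carrier V"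
    by (auto simp: quot_module_def A_RCOSETS_def')
  have 2: "\<zero>\<^bsub>quot_module V B\<^esub> = B +>\<^bsub>V\<^esub> \<zero>\<^bsub>V\<^esub>"
    using B by (simp add: quot_module_def)
  have 3: "(B +>\<^bsub>V\<^esub> x) \<oplus>\<^bsub>quot_module V B\<^esub> (B +>\<^bsub>V\<^esub> y) = B +>\<^bsub>V\<^esub> (x \<oplus>\<^bsub>V\<^esub> y)"
    if "x \<in> carrier V" "y \<in> carrier V" for x y
    using that AS.a_rcos_sum by (simp add: quot_module_def)
  have 4: "c \<odot>\<^bsub>quot_module V B\<^esub> (B +>\<^bsub>V\<^esub> x) = B +>\<^bsub>V\<^esub> (c \<odot>\<^bsub>V\<^esub> x)"
    if "x \<in> carrier V" "c \<in> carrier K" for x c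
  proof -
    \<comment> \<open>The scalar product in \<open>quot_module\<close> is a union over all
      representatives \<open>y\<close> of the coset, so these must all yield one and the same
      coset.\<close>
    have "B +>\<^bsub>V\<^esub> (c \<odot>\<^bsub>V\<^esub> y) = B +>\<^bsub>V\<^esub> (c \<odot>\<^bsub>V\<^esub> x)" if y: "y \<in> B +>\<^bsub>V\<^esub> x" for y
    proof -
      obtain b where b: "b \<in> B" "y = b \<oplus>\<^bsub>V\<^esub> x" using y unfolding a_r_coset_def' by auto
      have bV: "b \<in> carrier V" using b B by auto
      have "c \<odot>\<^bsub>V\<^esub> y \<ominus>\<^bsub>V\<^esub> c \<odot>\<^bsub>V\<^esub> x = c \<odot>\<^bsub>V\<^esub> b"
        using that \<open>x \<in> carrier V\<close> \<open>c \<in> carrier K\<close> b bV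
        by (simp add: smult_r_distr a_minus_def M.a_assoc M.r_neg)
      then show ?thesis using b bV B(4) \<open>x \<in> carrier V\<close> \<open>c \<in> carrier K\<close> by (subst coset_eq_iff[OF assms]) auto
    qed
    moreover have "B +>\<^bsub>V\<^esub> x \<noteq> {}" using B(2) unfolding a_r_coset_def' by blast
    ultimately show ?thesis by (simp add: quot_module_def)
  qed
  show "vspace K (quot_module V B)" "(\<lambda>x. B +>\<^bsub>V\<^esub> x) \<in> mod_hom K V (quot_module V B)"
    using vspace_image[OF 1 2 3 4] by auto
qed

text \<open>Basis vectors are adjoined one at a time, \<open>sp T\<close> being the span of
  \<open>T\<close>. Uniqueness of coefficients keeps the next vector \<open>t\<close> outside
  \<open>sp T\<close>, since otherwise its coefficient at \<open>t\<close> would be both one and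
  zero.\<close>

lemma reldim_of_finite_basis:
  assumes "finite_basis K V S"
  shows "reldim K V {\<zero>\<^bsub>V\<^esub>} (carrier V) (card S)"
proof -
  have S: "finite S" "S \<subseteq> carrier V" and ex1: "\<And>v. v \<in> carrier V \<Longrightarrow>
    \<exists>!c. c \<in> S \<rightarrow>\<^sub>E carrier K \<and> v = (\<Oplus>\<^bsub>V\<^esub>b\<in>S. c b \<odot>\<^bsub>V\<^esub> b)"
    using assms by (auto simp: finite_basis_def)
  define comb where "comb c = (\<Oplus>\<^bsub>V\<^esub>b\<in>S. c b \<odot>\<^bsub>V\<^esub> b)" for c
  have fn: "(\<lambda>b. c b \<odot>\<^bsub>V\<^esub> b) \<in> S \<rightarrow> carrier V" if "c \<in> S \<rightarrow> carrier K" for c using that S by auto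
  have comb_closed: "comb c \<in> carrier V" if "c \<in> S \<rightarrow> carrier K" for c
    unfolding comb_def using fn[OF that] by (rule M.finsum_closed)
  have comb_add: "comb (\<lambda>b. c b \<oplus>\<^bsub>K\<^esub> d b) = comb c \<oplus>\<^bsub>V\<^esub> comb d"
    if "c \<in> S \<rightarrow> carrier K" "d \<in> S \<rightarrow> carrier K" for c d
  proof -
    have "comb (\<lambda>b. c b \<oplus>\<^bsub>K\<^esub> d b) = (\<Oplus>\<^bsub>V\<^esub>b\<in>S. c b \<odot>\<^bsub>V\<^esub> b \<oplus>\<^bsub>V\<^esub> d b \<odot>\<^bsub>V\<^esub> b)"
      unfolding comb_def using that S fn by (intro M.finsum_cong') (auto simp: smult_l_distr Pi_iff subset_iff)
    then show ?thesis unfolding comb_def using M.finsum_addf[OF fn fn] that by simp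
  qed
  have comb_single: "comb (\<lambda>b. if b = s then k else \<zero>\<^bsub>K\<^esub>) = k \<odot>\<^bsub>V\<^esub> s" if "s \<in> S" "k \<in> carrier K" for s k
  proof -
    have "comb (\<lambda>b. if b = s then k else \<zero>\<^bsub>K\<^esub>) = (\<Oplus>\<^bsub>V\<^esub>b\<in>S. if s = b then k \<odot>\<^bsub>V\<^esub> b else \<zero>\<^bsub>V\<^esub>)"
      unfolding comb_def using that S by (intro M.finsum_cong') auto
    then show ?thesis using M.add.finprod_singleton[of s S "\<lambda>b. k \<odot>\<^bsub>V\<^esub> b"] that S by auto
  qed
  have inj: "c b = d b" if "c \<in> S \<rightarrow> carrier K" "d \<in> S \<rightarrow> carrier K" "comb c = comb d" "b \<in> S" for c d b
  proof -
    \<comment> \<open>Uniqueness in \<open>finite_basis\<close> concerns extensional coefficient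
      functions only, hence the passage to restrictions.\<close>
    have "comb c = comb (restrict c S)" "comb d = comb (restrict d S)"
      unfolding comb_def using that S by (auto intro!: M.finsum_cong' simp: Pi_iff subset_iff)
    moreover have "restrict c S \<in> S \<rightarrow>\<^sub>E carrier K" "restrict d S \<in> S \<rightarrow>\<^sub>E carrier K" using that by auto
    moreover note e1 = ex1[OF comb_closed[OF that(1)]]
    obtain c0 where "\<And>c'. c' \<in> S \<rightarrow>\<^sub>E carrier K \<Longrightarrow> comb c = comb c' \<Longrightarrow> c' = c0"
      using e1 unfolding comb_def by (elim ex1E) blast
    ultimately have "restrict c S = restrict d S" using that(3) by metis
    then show ?thesis using that(4) by (metis restrict_apply')
  qed
  define sp where "sp T = comb ` {c \<in> S \<rightarrow> carrier K. \<forall>b\<in>S - T. c b = \<zero>\<^bsub>K\<^esub>}" for T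
  have main: "reldim K V {\<zero>\<^bsub>V\<^esub>} (sp T) (card T)" if "finite T" "T \<subseteq> S" for T
    using that
  proof (induct T)
    case empty
    have "comb c = \<zero>\<^bsub>V\<^esub>" if "c \<in> S \<rightarrow> carrier K" "\<forall>b\<in>S. c b = \<zero>\<^bsub>K\<^esub>" for c
    proof -
      have "comb c = (\<Oplus>\<^bsub>V\<^esub>b\<in>S. \<zero>\<^bsub>V\<^esub>)" unfolding comb_def using that S by (intro M.finsum_cong') auto
      then show ?thesis by simp
    qed
    moreover have "(\<lambda>b. \<zero>\<^bsub>K\<^esub>) \<in> {c \<in> S \<rightarrow> carrier K. \<forall>b\<in>S - {}. c b = \<zero>\<^bsub>K\<^esub>}" by auto
    ultimately have "sp {} = {\<zero>\<^bsub>V\<^esub>}" unfolding sp_def by fastforce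
    then show ?case by (simp add: reldim_refl)
  next
    case (insert t T)
    then have tV: "t \<in> carrier V" "t \<in> S" using S by auto
    have "t \<notin> sp T"
    proof
      assume "t \<in> sp T"
      then obtain c where c: "t = comb c" "c \<in> S \<rightarrow> carrier K" "\<forall>b\<in>S - T. c b = \<zero>\<^bsub>K\<^esub>" by (auto simp: sp_def)
      have "comb (\<lambda>b. if b = t then \<one>\<^bsub>K\<^esub> else \<zero>\<^bsub>K\<^esub>) = comb c" using comb_single[of t "\<one>\<^bsub>K\<^esub>"] tV c by simp
      then have "(if t = t then \<one>\<^bsub>K\<^esub> else \<zero>\<^bsub>K\<^esub>) = c t" using tV c(2) by (intro inj) auto
      then have "\<one>\<^bsub>K\<^esub> = \<zero>\<^bsub>K\<^esub>" using c insert by auto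
      then show False using field.axioms(1)[OF field_K] domain.one_not_zero by metis
    qed
    moreover have "line_extend K V (sp T) t = sp (insert t T)"
    proof
      show "line_extend K V (sp T) t \<subseteq> sp (insert t T)"
      proof
        fix x assume "x \<in> line_extend K V (sp T) t"
        then obtain c k where *: "x = comb c \<oplus>\<^bsub>V\<^esub> k \<odot>\<^bsub>V\<^esub> t" "c \<in> S \<rightarrow> carrier K" "\<forall>b\<in>S - T. c b = \<zero>\<^bsub>K\<^esub>" "k \<in> carrier K"
          by (auto simp: sp_def line_extend_def)
        then have "x = comb (\<lambda>b. c b \<oplus>\<^bsub>K\<^esub> (if b = t then k else \<zero>\<^bsub>K\<^esub>))"
          using comb_single tV by (subst comb_add) auto
        then show "x \<in> sp (insert t T)" using * unfolding sp_def by (intro image_eqI) (auto split: if_splits)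
      qed
      show "sp (insert t T) \<subseteq> line_extend K V (sp T) t"
      proof
        fix x assume "x \<in> sp (insert t T)"
        then obtain c where *: "x = comb c" "c \<in> S \<rightarrow> carrier K" "\<forall>b\<in>S - insert t T. c b = \<zero>\<^bsub>K\<^esub>"
          by (auto simp: sp_def)
        have ct: "c t \<in> carrier K" using * tV by auto
        have "comb c = comb (\<lambda>b. (if b = t then \<zero>\<^bsub>K\<^esub> else c b) \<oplus>\<^bsub>K\<^esub> (if b = t then c t else \<zero>\<^bsub>K\<^esub>))"
          unfolding comb_def using * S tV by (intro M.finsum_cong') (auto simp: Pi_iff subset_iff)
        also have "\<dots> = comb (\<lambda>b. if b = t then \<zero>\<^bsub>K\<^esub> else c b) \<oplus>\<^bsub>V\<^esub> c t \<odot>\<^bsub>V\<^esub> t"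
          using * ct comb_single tV by (subst comb_add) (auto simp: Pi_iff)
        finally have "x = comb (\<lambda>b. if b = t then \<zero>\<^bsub>K\<^esub> else c b) \<oplus>\<^bsub>V\<^esub> c t \<odot>\<^bsub>V\<^esub> t" using * by simp
        moreover have "comb (\<lambda>b. if b = t then \<zero>\<^bsub>K\<^esub> else c b) \<in> sp T"
          unfolding sp_def using * by (intro imageI) auto
        ultimately show "x \<in> line_extend K V (sp T) t" using ct unfolding line_extend_def by blast
      qed
    qed
    ultimately show ?case using reldim_Suc[of K V _ "sp T" "card T" t] insert tV by auto
  qed
  moreover have "sp S = carrier V"
  proof
    show "sp S \<subseteq> carrier V" using comb_closed by (auto simp: sp_def)
    show "carrier V \<subseteq> sp S"
    proof
      fix v assume "v \<in> carrier V"
      then obtain c where "c \<in> S \<rightarrow>\<^sub>E carrier K" "v = comb c" using ex1 unfolding comb_def by blast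
      then show "v \<in> sp S" unfolding sp_def by blast
    qed
  qed
  ultimately show ?thesis using main[OF S(1) subset_refl] by simp
qed

text \<open>The vectors adjoined along the chain serve as a basis; the statement is about an
  arbitrary member \<open>E\<close> so that the induction can follow the chain.\<close>

lemma finite_basis_of_reldim:
  assumes "reldim K V {\<zero>\<^bsub>V\<^esub>} E n"
  shows "\<exists>S. finite S \<and> card S = n \<and> S \<subseteq> E \<and>
    (\<forall>v\<in>E. \<exists>!c. c \<in> S \<rightarrow>\<^sub>E carrier K \<and> v = (\<Oplus>\<^bsub>V\<^esub>b\<in>S. c b \<odot>\<^bsub>V\<^esub> b))"
  using assms
proof induct
  case reldim_refl
  show ?case by (rule exI[of _ "{}"]) simp
next
  case (reldim_Suc E n v)
  have E: "subspace_of K V E" using reldim_subspace[OF subspace_zero] reldim_Suc by blast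
  note EE = subspace_ofD[OF E] and v = \<open>v \<in> carrier V\<close>
  obtain S where S: "finite S" "card S = n" "S \<subseteq> E" and
    ex1: "\<forall>v\<in>E. \<exists>!c. c \<in> S \<rightarrow>\<^sub>E carrier K \<and> v = (\<Oplus>\<^bsub>V\<^esub>b\<in>S. c b \<odot>\<^bsub>V\<^esub> b)" using reldim_Suc by blast
  have vS: "v \<notin> S" using S reldim_Suc by auto
  define comb where "comb c = (\<Oplus>\<^bsub>V\<^esub>b\<in>S. c b \<odot>\<^bsub>V\<^esub> b)" for c
  have comb_E: "comb c \<in> E" if "c \<in> S \<rightarrow> carrier K" for c
  proof -
    have "(\<Oplus>\<^bsub>V\<^esub>b\<in>T. c b \<odot>\<^bsub>V\<^esub> b) \<in> E" if "finite T" "T \<subseteq> S" for T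
      using that
    proof (induct T)
      case empty then show ?case using EE by simp
    next
      case (insert t T)
      have "(\<lambda>b. c b \<odot>\<^bsub>V\<^esub> b) \<in> insert t T \<rightarrow> carrier V" using insert \<open>c \<in> S \<rightarrow> carrier K\<close> S(3) EE(1) by blast
      then have "(\<Oplus>\<^bsub>V\<^esub>b\<in>insert t T. c b \<odot>\<^bsub>V\<^esub> b) = c t \<odot>\<^bsub>V\<^esub> t \<oplus>\<^bsub>V\<^esub> (\<Oplus>\<^bsub>V\<^esub>b\<in>T. c b \<odot>\<^bsub>V\<^esub> b)"
        using insert(1,2) by (intro M.finsum_insert) auto
      moreover have "c t \<odot>\<^bsub>V\<^esub> t \<in> E" using insert(4) \<open>c \<in> S \<rightarrow> carrier K\<close> S(3) by (intro EE(4)) auto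
      ultimately show ?case using insert(3,4) EE(3) by simp
    qed
    then show ?thesis unfolding comb_def using S(1) by auto
  qed
  have comb_ins: "(\<Oplus>\<^bsub>V\<^esub>b\<in>insert v S. c b \<odot>\<^bsub>V\<^esub> b) = comb (restrict c S) \<oplus>\<^bsub>V\<^esub> c v \<odot>\<^bsub>V\<^esub> v"
    if "c \<in> insert v S \<rightarrow> carrier K" for c
  proof -
    have "(\<lambda>b. c b \<odot>\<^bsub>V\<^esub> b) \<in> insert v S \<rightarrow> carrier V" using that v S(3) EE(1) by blast
    then have "(\<Oplus>\<^bsub>V\<^esub>b\<in>insert v S. c b \<odot>\<^bsub>V\<^esub> b) = c v \<odot>\<^bsub>V\<^esub> v \<oplus>\<^bsub>V\<^esub> (\<Oplus>\<^bsub>V\<^esub>b\<in>S. c b \<odot>\<^bsub>V\<^esub> b)"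
      using S(1) vS by (intro M.finsum_insert) auto
    moreover have "(\<Oplus>\<^bsub>V\<^esub>b\<in>S. c b \<odot>\<^bsub>V\<^esub> b) = comb (restrict c S)"
      unfolding comb_def using that S(3) EE(1) by (intro M.finsum_cong') (auto simp: Pi_iff subset_iff)
    moreover have "comb (restrict c S) \<in> carrier V" using that by (intro EE(5) comb_E) auto
    ultimately show ?thesis using that v by (simp add: M.a_comm)
  qed
  have "\<exists>!c. c \<in> insert v S \<rightarrow>\<^sub>E carrier K \<and> x = (\<Oplus>\<^bsub>V\<^esub>b\<in>insert v S. c b \<odot>\<^bsub>V\<^esub> b)"
    if x: "x \<in> line_extend K V E v" for x
  proof -
    obtain e k where ek: "x = e \<oplus>\<^bsub>V\<^esub> k \<odot>\<^bsub>V\<^esub> v" "e \<in> E" "k \<in> carrier K" using x by (auto simp: line_extend_def)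
    obtain c where c: "c \<in> S \<rightarrow>\<^sub>E carrier K" "e = comb c" using ex1 ek unfolding comb_def by blast
    show ?thesis
    proof (rule ex1I[of _ "c(v := k)"])
      have 1: "c(v := k) \<in> insert v S \<rightarrow>\<^sub>E carrier K" using c ek by (auto simp: PiE_def extensional_def)
      moreover have "restrict (c(v := k)) S = c" using c vS by (intro ext) (auto simp: PiE_def extensional_def)
      ultimately show "c(v := k) \<in> insert v S \<rightarrow>\<^sub>E carrier K \<and> x = (\<Oplus>\<^bsub>V\<^esub>b\<in>insert v S. (c(v := k)) b \<odot>\<^bsub>V\<^esub> b)"
        using ek c comb_ins[of "c(v := k)"] by (auto simp: PiE_iff Pi_iff)
      fix d assume d: "d \<in> insert v S \<rightarrow>\<^sub>E carrier K \<and> x = (\<Oplus>\<^bsub>V\<^esub>b\<in>insert v S. d b \<odot>\<^bsub>V\<^esub> b)"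
      define f where "f = comb (restrict d S)"
      have fE: "f \<in> E" unfolding f_def using d by (intro comb_E) (auto simp: PiE_iff Pi_iff)
      have eq: "f \<oplus>\<^bsub>V\<^esub> d v \<odot>\<^bsub>V\<^esub> v = e \<oplus>\<^bsub>V\<^esub> k \<odot>\<^bsub>V\<^esub> v" using d ek comb_ins[of d] by (auto simp: f_def PiE_iff Pi_iff)
      have dv: "d v \<in> carrier K" using d by auto
      have cc: "e \<in> carrier V" "f \<in> carrier V" using fE ek EE by auto
      \<comment> \<open>Comparing the two expansions puts a multiple of \<open>v\<close> into
        \<open>E\<close>. As \<open>v\<close> is outside \<open>E\<close>, the two coefficients of
        \<open>v\<close> agree, and uniqueness in \<open>E\<close> settles the others.\<close>
      have "(d v \<ominus>\<^bsub>K\<^esub> k) \<odot>\<^bsub>V\<^esub> v = d v \<odot>\<^bsub>V\<^esub> v \<ominus>\<^bsub>V\<^esub> k \<odot>\<^bsub>V\<^esub> v"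
        using dv ek v by (simp add: a_minus_def smult_l_distr smult_a_inv_scalar)
      also have "\<dots> = \<ominus>\<^bsub>V\<^esub> f \<oplus>\<^bsub>V\<^esub> (f \<oplus>\<^bsub>V\<^esub> d v \<odot>\<^bsub>V\<^esub> v) \<ominus>\<^bsub>V\<^esub> k \<odot>\<^bsub>V\<^esub> v"
        using cc dv v by (simp add: M.r_neg1)
      also have "\<dots> = \<ominus>\<^bsub>V\<^esub> f \<oplus>\<^bsub>V\<^esub> e" unfolding eq using cc ek v
        by (simp add: a_minus_def M.a_assoc M.r_neg)
      finally have "(d v \<ominus>\<^bsub>K\<^esub> k) \<odot>\<^bsub>V\<^esub> v \<in> E" using fE ek(2) EE(3) subspace_a_inv[OF E] by simp
      then have "d v \<ominus>\<^bsub>K\<^esub> k = \<zero>\<^bsub>K\<^esub>"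
        using subspace_smult_cancel[OF E, of "d v \<ominus>\<^bsub>K\<^esub> k" v] v dv ek(3) \<open>v \<notin> E\<close> by auto
      then have dk: "d v = k" using R.minus_eq_zero_iff dv ek by auto
      then have "f = e" using eq cc v ek by simp
      then have "e = comb (restrict d S)" by (simp add: f_def)
      moreover have "restrict d S \<in> S \<rightarrow>\<^sub>E carrier K" using d by auto
      moreover have "\<exists>!c. c \<in> S \<rightarrow>\<^sub>E carrier K \<and> e = comb c" using ex1 ek(2) unfolding comb_def by blast
      ultimately have "restrict d S = c" using c by (elim ex1E) blast
      then show "d = c(v := k)" using dk d vS by (intro ext) (auto simp: PiE_def extensional_def)
    qed
  qed
  moreover have "insert v S \<subseteq> line_extend K V E v" using line_extend_upper[OF E v] line_extend_gen[OF E v] S by auto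
  ultimately show ?case using S vS by (intro exI[of _ "insert v S"]) auto
qed

lemma finite_basis_iff_reldim: "(\<exists>S. finite_basis K V S \<and> card S = n) \<longleftrightarrow> reldim K V {\<zero>\<^bsub>V\<^esub>} (carrier V) n"
proof
  assume "reldim K V {\<zero>\<^bsub>V\<^esub>} (carrier V) n"
  from finite_basis_of_reldim[OF this] obtain S where
    "finite S" "card S = n" "S \<subseteq> carrier V"
    "\<forall>v\<in>carrier V. \<exists>!c. c \<in> S \<rightarrow>\<^sub>E carrier K \<and> v = (\<Oplus>\<^bsub>V\<^esub>b\<in>S. c b \<odot>\<^bsub>V\<^esub> b)" by (elim exE conjE)
  then show "\<exists>S. finite_basis K V S \<and> card S = n" unfolding finite_basis_def by blast
qed (auto intro: reldim_of_finite_basis)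

lemma finite_dim_iff: "finite_dim K V \<longleftrightarrow> (\<exists>n. reldim K V {\<zero>\<^bsub>V\<^esub>} (carrier V) n)"
  unfolding finite_dim_def using finite_basis_iff_reldim by blast

lemma vdim_eq:
  assumes "reldim K V {\<zero>\<^bsub>V\<^esub>} (carrier V) n"
  shows "vdim K V = n"
proof -
  have "finite_basis K V (SOME B. finite_basis K V B)"
    using assms finite_basis_iff_reldim by (metis someI_ex)
  then show ?thesis
    unfolding vdim_def using reldim_of_finite_basis reldim_unique[OF subspace_zero] assms by blast
qed

lemma reldim_quot_module:
  assumes "subspace_of K V B"
  shows "reldim K (quot_module V B) {\<zero>\<^bsub>quot_module V B\<^esub>} (carrier (quot_module V B)) n \<longleftrightarrow>
    reldim K V B (carrier V) n"
proof -
  interpret Q: vspace K "quot_module V B" by (rule vspace_quot_module) fact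
  interpret q: linear_map K V "quot_module V B" "\<lambda>x. B +>\<^bsub>V\<^esub> x"
    by (intro linear_map.intro linear_map_axioms.intro Q.vspace_axioms vspace_axioms quot_map_hom) fact
  note B = subspace_ofD[OF assms]
  have *: "B +>\<^bsub>V\<^esub> x = \<zero>\<^bsub>quot_module V B\<^esub> \<longleftrightarrow> x \<in> B" if "x \<in> carrier V" for x
    using coset_eq_iff[OF assms that, of "\<zero>\<^bsub>V\<^esub>"] that
    by (simp add: a_minus_def)
  have k: "q.ker = B" using * B by (auto simp: q.ker_def)
  have 1: "(\<lambda>x. B +>\<^bsub>V\<^esub> x) ` B = {\<zero>\<^bsub>quot_module V B\<^esub>}" using * B by auto
  have 2: "(\<lambda>x. B +>\<^bsub>V\<^esub> x) ` carrier V = carrier (quot_module V B)"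
    by (auto simp: quot_module_def A_RCOSETS_def')
  show ?thesis using q.reldim_image[OF assms, of "carrier V" n] 
      q.reldim_vimage[OF assms subspace_carrier B(1), of n] k 1 2 by auto
qed

text \<open>Serves to read a cohomology group, a quotient of a record with restricted carrier, as a
  pair of subspaces of the cochain space.\<close>

lemma reldim_subquotient:
  assumes "subspace_of K V Z" "subspace_of K V B" "B \<subseteq> Z"
  defines "Q \<equiv> quot_module (V\<lparr>carrier := Z\<rparr>) B"
  shows "reldim K Q {\<zero>\<^bsub>Q\<^esub>} (carrier Q) n \<longleftrightarrow> reldim K V B Z n"
proof -
  interpret Z: vspace K "V\<lparr>carrier := Z\<rparr>" by (rule vspace_subspace) fact
  have "subspace_of K (V\<lparr>carrier := Z\<rparr>) B" using assms subspace_of_carrier_update[OF _ subspace_ofD(1)[OF assms(1)]] by auto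
  then show ?thesis unfolding Q_def
    using Z.reldim_quot_module[of B n] reldim_carrier_update[OF assms(1,2), of Z n] assms by simp
qed

end

section \<open>Short exact sequences of cochain complexes\<close>

definition cyc :: "(nat \<Rightarrow> ('k, 'v, 'y) module_scheme) \<Rightarrow> (nat \<Rightarrow> 'v \<Rightarrow> 'v) \<Rightarrow> nat \<Rightarrow> 'v set"
  where "cyc V \<delta> n = {x \<in> carrier (V n). \<delta> n x = \<zero>\<^bsub>V (Suc n)\<^esub>}"

definition bnd :: "(nat \<Rightarrow> ('k, 'v, 'y) module_scheme) \<Rightarrow> (nat \<Rightarrow> 'v \<Rightarrow> 'v) \<Rightarrow> nat \<Rightarrow> 'v set"
  where "bnd V \<delta> n = (case n of 0 \<Rightarrow> {\<zero>\<^bsub>V 0\<^esub>} | Suc k \<Rightarrow> \<delta> k ` carrier (V k))"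

definition total_finite ::
    "('k, 'x) ring_scheme \<Rightarrow> (nat \<Rightarrow> ('k, 'v, 'y) module_scheme) \<Rightarrow> (nat \<Rightarrow> 'v \<Rightarrow> 'v) \<Rightarrow> bool"
  where "total_finite K V \<delta> \<longleftrightarrow>
    (\<forall>n. \<exists>k. reldim K (V n) (bnd V \<delta> n) (cyc V \<delta> n) k) \<and> finite {n. bnd V \<delta> n \<noteq> cyc V \<delta> n}"

definition hdim ::
    "('k, 'x) ring_scheme \<Rightarrow> (nat \<Rightarrow> ('k, 'v, 'y) module_scheme) \<Rightarrow> (nat \<Rightarrow> 'v \<Rightarrow> 'v) \<Rightarrow> nat \<Rightarrow> nat"
  where "hdim K V \<delta> n = rdim K (V n) (bnd V \<delta> n) (cyc V \<delta> n)"

definition cx_euler ::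
    "('k, 'x) ring_scheme \<Rightarrow> (nat \<Rightarrow> ('k, 'v, 'y) module_scheme) \<Rightarrow> (nat \<Rightarrow> 'v \<Rightarrow> 'v) \<Rightarrow> int"
  where "cx_euler K V \<delta> = Sum_any (\<lambda>n. (- 1) ^ n * int (hdim K V \<delta> n))"

section \<open>Cohomology of one cochain complex\<close>

locale cochain_cx =
  fixes K :: "('k, 'x) ring_scheme" and V :: "nat \<Rightarrow> ('k, 'v, 'y) module_scheme" and \<delta> :: "nat \<Rightarrow> 'v \<Rightarrow> 'v"
  assumes vs: "\<And>n. vspace K (V n)"
    and \<delta>_hom: "\<And>n. \<delta> n \<in> mod_hom K (V n) (V (Suc n))"
    and \<delta>_\<delta>: "\<And>n x. x \<in> carrier (V n) \<Longrightarrow> \<delta> (Suc n) (\<delta> n x) = \<zero>\<^bsub>V (Suc (Suc n))\<^esub>"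
begin

lemma lin: "linear_map K (V n) (V (Suc n)) (\<delta> n)"
  by (intro linear_map.intro linear_map_axioms.intro vs \<delta>_hom)

lemma cyc_ker: "cyc V \<delta> n = linear_map.ker (V n) (V (Suc n)) (\<delta> n)"
  using linear_map.ker_def[OF lin] by (simp add: cyc_def)

lemma subspace_cyc: "subspace_of K (V n) (cyc V \<delta> n)"
  unfolding cyc_ker by (rule linear_map.subspace_ker[OF lin])

lemma subspace_bnd: "subspace_of K (V n) (bnd V \<delta> n)"
  using vspace.subspace_zero[OF vs] linear_map.subspace_image[OF lin vspace.subspace_carrier[OF vs]]
  by (auto simp: bnd_def split: nat.split)

lemma bnd_cyc: "bnd V \<delta> n \<subseteq> cyc V \<delta> n"
  using linear_map.map_zero[OF lin] \<delta>_\<delta> mod_homD(1)[OF \<delta>_hom] subspace_ofD(2)[OF subspace_cyc]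
  by (auto simp: bnd_def cyc_def split: nat.split)

lemma hdim_eq: "reldim K (V n) (bnd V \<delta> n) (cyc V \<delta> n) k \<Longrightarrow> hdim K V \<delta> n = k"
  unfolding hdim_def by (rule vspace.rdim_eq[OF vs subspace_bnd])

lemma hdim_0_iff:
  assumes "total_finite K V \<delta>"
  shows "hdim K V \<delta> n = 0 \<longleftrightarrow> bnd V \<delta> n = cyc V \<delta> n"
proof -
  obtain k where k: "reldim K (V n) (bnd V \<delta> n) (cyc V \<delta> n) k" using assms by (auto simp: total_finite_def)
  have "k = 0 \<Longrightarrow> bnd V \<delta> n = cyc V \<delta> n" using k by (auto elim: reldim.cases)
  moreover have "bnd V \<delta> n = cyc V \<delta> n \<Longrightarrow> k = 0"
    using k vspace.reldim_self[OF vs subspace_bnd] by metis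
  ultimately show ?thesis using hdim_eq[OF k] by auto
qed

lemma cx_euler_sum:
  assumes "total_finite K V \<delta>" "{n. bnd V \<delta> n \<noteq> cyc V \<delta> n} \<subseteq> {..<N}"
  shows "cx_euler K V \<delta> = (\<Sum>n<N. (- 1) ^ n * int (hdim K V \<delta> n))"
  unfolding cx_euler_def using assms(2) hdim_0_iff[OF assms(1)]
  by (intro Sum_any.expand_superset) auto

end

section \<open>The long exact sequence by counting\<close>

locale cx_exact = X: cochain_cx K V' \<delta>' + Y: cochain_cx K V \<delta> + Z: cochain_cx K V'' \<delta>''
  for K :: "('k, 'x) ring_scheme" and V' :: "nat \<Rightarrow> ('k, 'a, 'w) module_scheme" and \<delta>'
    and V :: "nat \<Rightarrow> ('k, 'b, 'y) module_scheme" and \<delta>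
    and V'' :: "nat \<Rightarrow> ('k, 'c, 'z) module_scheme" and \<delta>'' +
  fixes i :: "nat \<Rightarrow> 'a \<Rightarrow> 'b" and p :: "nat \<Rightarrow> 'b \<Rightarrow> 'c"
  assumes i_hom: "\<And>n. i n \<in> mod_hom K (V' n) (V n)" and p_hom: "\<And>n. p n \<in> mod_hom K (V n) (V'' n)"
    and i_comm: "\<And>n x. x \<in> carrier (V' n) \<Longrightarrow> i (Suc n) (\<delta>' n x) = \<delta> n (i n x)"
    and p_comm: "\<And>n x. x \<in> carrier (V n) \<Longrightarrow> p (Suc n) (\<delta> n x) = \<delta>'' n (p n x)"
    and i_inj: "\<And>n. inj_on (i n) (carrier (V' n))"
    and ex: "\<And>n. i n ` carrier (V' n) = {x \<in> carrier (V n). p n x = \<zero>\<^bsub>V'' n\<^esub>}"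
    and p_surj: "\<And>n. p n ` carrier (V n) = carrier (V'' n)"
begin

lemma i_lin: "linear_map K (V' n) (V n) (i n)"
  by (intro linear_map.intro linear_map_axioms.intro X.vs Y.vs i_hom)

lemma p_lin: "linear_map K (V n) (V'' n) (p n)"
  by (intro linear_map.intro linear_map_axioms.intro Y.vs Z.vs p_hom)

abbreviation "I n \<equiv> i n ` carrier (V' n)"
abbreviation "By n \<equiv> bnd V \<delta> n"
abbreviation "Zy n \<equiv> cyc V \<delta> n"

lemma subI: "subspace_of K (V n) (I n)"
  by (rule linear_map.subspace_image[OF i_lin vspace.subspace_carrier[OF X.vs]])

lemma p_ker: "linear_map.ker (V n) (V'' n) (p n) = I n"
  by (simp add: linear_map.ker_def[OF p_lin] ex)

lemma i_ker: "linear_map.ker (V' n) (V n) (i n) = {\<zero>\<^bsub>V' n\<^esub>}"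
  using i_inj linear_map.inj_on_iff_ker[OF i_lin] by blast

lemma i_zero_iff: "x \<in> carrier (V' n) \<Longrightarrow> i n x = \<zero>\<^bsub>V n\<^esub> \<longleftrightarrow> x = \<zero>\<^bsub>V' n\<^esub>"
  using i_ker[of n] unfolding linear_map.ker_def[OF i_lin] by blast

lemma i_cyc: "i n ` cyc V' \<delta>' n = Zy n \<inter> I n"
proof -
  have "\<delta> n (i n x) = \<zero>\<^bsub>V (Suc n)\<^esub> \<longleftrightarrow> \<delta>' n x = \<zero>\<^bsub>V' (Suc n)\<^esub>" if "x \<in> carrier (V' n)" for x
    using i_comm[OF that] i_zero_iff[of "\<delta>' n x" "Suc n"] mod_homD(1)[OF X.\<delta>_hom that] by simp
  then show ?thesis using mod_homD(1)[OF i_hom] by (auto simp: cyc_def)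
qed

lemma p_bnd: "p n ` By n = bnd V'' \<delta>'' n"
proof (cases n)
  case 0 then show ?thesis using linear_map.map_zero[OF p_lin] by (simp add: bnd_def)
next
  case (Suc k)
  have "p (Suc k) ` \<delta> k ` carrier (V k) = \<delta>'' k ` p k ` carrier (V k)" by (force simp: p_comm)
  then show ?thesis using Suc by (simp add: bnd_def p_surj)
qed

lemma p_cyc: "p n ` Zy n \<subseteq> cyc V'' \<delta>'' n"
  using mod_homD(1)[OF p_hom] linear_map.map_zero[OF p_lin]
  by (auto simp: cyc_def p_comm[symmetric])

lemma reldim_i:
  "reldim K (V' n) (bnd V' \<delta>' n) (cyc V' \<delta>' n) k \<longleftrightarrow> reldim K (V n) (i n ` bnd V' \<delta>' n) (Zy n \<inter> I n) k"
proof -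
  have "linear_map.ker (V' n) (V n) (i n) \<subseteq> bnd V' \<delta>' n"
    using i_ker subspace_ofD(2)[OF X.subspace_bnd] by auto
  then show ?thesis
    using linear_map.reldim_image[OF i_lin X.subspace_bnd, of n "cyc V' \<delta>' n" k]
      linear_map.reldim_vimage[OF i_lin X.subspace_bnd X.subspace_cyc X.bnd_cyc, of n k] i_cyc by auto
qed

text \<open>The connecting homomorphism enters only through its rank: the image of the cocycles of \<open>V\<close> has
  the same codimension in the cocycles of \<open>V''\<close> as the coboundaries of \<open>V'\<close> have in those
  coboundaries of \<open>V\<close> which lie in \<open>V'\<close>.\<close>

lemma reldim_connecting:
  assumes "reldim K (V'' n) (p n ` Zy n) (cyc V'' \<delta>'' n) r"
  shows "reldim K (V (Suc n)) (i (Suc n) ` bnd V' \<delta>' (Suc n)) (By (Suc n) \<inter> I (Suc n)) r"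
proof -
  interpret p: linear_map K "V n" "V'' n" "p n" by (rule p_lin)
  interpret d: linear_map K "V n" "V (Suc n)" "\<delta> n" by (rule Y.lin)
  \<comment> \<open>\<open>P\<close> consists of the cochains whose coboundary comes from
    \<open>V'\<close>, and \<open>S\<close> of those which differ from a cocycle by an element
    coming from \<open>V'\<close>. The map \<open>p\<close> compares \<open>P\<close> over
    \<open>S\<close> with the hypothesis; the differential, whose kernel lies in \<open>S\<close>,
    compares it with the conclusion.\<close>
  define P where "P = {x \<in> carrier (V n). p n x \<in> cyc V'' \<delta>'' n}"
  define S where "S = {x \<in> carrier (V n). p n x \<in> p n ` Zy n}"
  have P: "subspace_of K (V n) P" unfolding P_def by (rule p.subspace_vimage[OF Z.subspace_cyc])
  have S: "subspace_of K (V n) S" unfolding S_def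
    by (intro p.subspace_vimage p.subspace_image Y.subspace_cyc)
  have SP: "S \<subseteq> P" using p_cyc by (auto simp: S_def P_def)
  have ZS: "Zy n \<subseteq> S" using subspace_ofD(1)[OF Y.subspace_cyc] by (auto simp: S_def)
  have IS: "I n \<subseteq> S"
  proof
    fix x assume "x \<in> I n"
    then have x: "x \<in> carrier (V n)" "p n x = \<zero>\<^bsub>V'' n\<^esub>" using ex by auto
    moreover have "\<zero>\<^bsub>V'' n\<^esub> \<in> p n ` Zy n" using subspace_ofD(2)[OF p.subspace_image[OF Y.subspace_cyc]] .
    ultimately show "x \<in> S" by (auto simp: S_def)
  qed
  have pS: "p n ` S = p n ` Zy n" using ZS by (auto simp: S_def)
  have pP: "p n ` P = cyc V'' \<delta>'' n"
  proof
    show "cyc V'' \<delta>'' n \<subseteq> p n ` P"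
    proof
      fix y assume y: "y \<in> cyc V'' \<delta>'' n"
      then have "y \<in> p n ` carrier (V n)" using p_surj by (auto simp: cyc_def)
      then show "y \<in> p n ` P" using y by (auto simp: P_def)
    qed
  qed (auto simp: P_def)
  have "reldim K (V n) S P r"
    using p.reldim_vimage[OF S P SP, of r] assms pS pP p_ker IS by (simp add: le_infI1)
  then have *: "reldim K (V (Suc n)) (\<delta> n ` S) (\<delta> n ` P) r"
    using d.reldim_image[OF S, of P r] ZS Y.cyc_ker by (simp add: le_infI1)
  have "x \<in> P \<longleftrightarrow> \<delta> n x \<in> I (Suc n)" if "x \<in> carrier (V n)" for x
    using that mod_homD(1)[OF p_hom that] mod_homD(1)[OF Y.\<delta>_hom that]
    by (simp add: P_def cyc_def ex p_comm)
  then have "\<delta> n ` P = By (Suc n) \<inter> I (Suc n)" using subspace_ofD(1)[OF P] by (auto simp: bnd_def)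
  moreover have "\<delta> n ` S = i (Suc n) ` bnd V' \<delta>' (Suc n)"
  proof -
    have 1: "i (Suc n) ` bnd V' \<delta>' (Suc n) = \<delta> n ` I n" by (force simp: bnd_def i_comm)
    have "\<delta> n x \<in> \<delta> n ` I n" if "x \<in> S" for x
    proof -
      obtain z where z: "x \<in> carrier (V n)" "z \<in> Zy n" "p n x = p n z"
        using \<open>x \<in> S\<close> unfolding S_def by blast
      have zV: "z \<in> carrier (V n)" using z by (auto simp: cyc_def)
      have "x \<ominus>\<^bsub>V n\<^esub> z \<in> I n" using p.eq_image_iff[OF z(1) zV] z p_ker by simp
      moreover have "\<delta> n (x \<ominus>\<^bsub>V n\<^esub> z) = \<delta> n x"
        using d.map_minus_null[OF z(1) zV] z(2) by (simp add: cyc_def)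
      ultimately show ?thesis by (metis image_eqI)
    qed
    then show ?thesis using 1 IS by auto
  qed
  ultimately show ?thesis using * by simp
qed

text \<open>Let \<open>h\<close>, \<open>h'\<close>, \<open>h''\<close> be the dimensions in degree
  \<open>n\<close> and \<open>\<rho> n\<close> the rank of the connecting map into degree
  \<open>n\<close>. Counting gives \<open>h = h' + h'' - \<rho> n - \<rho> (n + 1)\<close>, and the
  correction telescopes in the alternating sum. Finiteness on the left follows because
  \<open>h'\<close> is \<open>\<rho> n\<close> plus a number bounded by \<open>h\<close>.\<close>

lemma
  assumes "total_finite K V \<delta>" "total_finite K V'' \<delta>''"
  shows total_finite_sub: "total_finite K V' \<delta>'"
    and cx_euler_add: "cx_euler K V \<delta> = cx_euler K V' \<delta>' + cx_euler K V'' \<delta>''"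
proof -
  \<comment> \<open>Rank-nullity for \<open>p\<close> divides \<open>h\<close> into an image part
    and a part inside \<open>V'\<close>, while \<open>h''\<close> is divided at the image of the
    cocycles. The image parts \<open>t\<close> and \<open>t'\<close> agree because \<open>p\<close>
    maps coboundaries onto coboundaries.\<close>
  have "\<exists>r s. reldim K (V'' n) (p n ` Zy n) (cyc V'' \<delta>'' n) r \<and>
      reldim K (V n) (By n \<inter> I n) (Zy n \<inter> I n) s \<and>
      hdim K V \<delta> n + r = s + hdim K V'' \<delta>'' n" for n
  proof -
    obtain h where h: "reldim K (V n) (By n) (Zy n) h" using assms by (auto simp: total_finite_def)
    obtain h'' where h'': "reldim K (V'' n) (bnd V'' \<delta>'' n) (cyc V'' \<delta>'' n) h''"
      using assms by (auto simp: total_finite_def)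
    note pZ = linear_map.subspace_image[OF p_lin Y.subspace_cyc]
    obtain t s where ts: "reldim K (V'' n) (p n ` By n) (p n ` Zy n) t"
      "reldim K (V n) (By n \<inter> I n) (Zy n \<inter> I n) s" "t + s = h"
      using linear_map.reldim_rank_nullity[OF p_lin Y.subspace_bnd Y.subspace_cyc Y.bnd_cyc h] p_ker by auto
    have "bnd V'' \<delta>'' n \<subseteq> p n ` Zy n" using p_bnd Y.bnd_cyc by blast
    then obtain t' r where tr: "reldim K (V'' n) (bnd V'' \<delta>'' n) (p n ` Zy n) t'"
      "reldim K (V'' n) (p n ` Zy n) (cyc V'' \<delta>'' n) r" "t' + r = h''"
      using vspace.reldim_split[OF Z.vs Z.subspace_bnd h'' pZ _ p_cyc] by blast
    have "t = t'" using vspace.reldim_unique[OF Z.vs Z.subspace_bnd tr(1)] ts(1) p_bnd by auto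
    then show ?thesis using ts tr Y.hdim_eq[OF h] Z.hdim_eq[OF h''] by auto
  qed
  then obtain r s where r: "\<And>n. reldim K (V'' n) (p n ` Zy n) (cyc V'' \<delta>'' n) (r n)"
    and s: "\<And>n. reldim K (V n) (By n \<inter> I n) (Zy n \<inter> I n) (s n)"
    and h: "\<And>n. hdim K V \<delta> n + r n = s n + hdim K V'' \<delta>'' n" by metis
  \<comment> \<open>The connecting map raises the degree by one, so the rank \<open>r k\<close>
    belongs to degree \<open>k + 1\<close>, and nothing arrives in degree 0.\<close>
  define \<rho> where "\<rho> n = (case n of 0 \<Rightarrow> 0 | Suc k \<Rightarrow> r k)" for n
  have \<rho>: "reldim K (V n) (i n ` bnd V' \<delta>' n) (By n \<inter> I n) (\<rho> n)" for n
  proof (cases n)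
    case 0
    have "By 0 \<inter> I 0 = i 0 ` bnd V' \<delta>' 0"
      using subspace_ofD(2)[OF subI] linear_map.map_zero[OF i_lin] by (auto simp: bnd_def)
    then show ?thesis using 0 by (simp add: \<rho>_def reldim_refl)
  next
    case (Suc k) then show ?thesis using reldim_connecting[OF r[of k]] by (simp add: \<rho>_def)
  qed
  have V': "reldim K (V' n) (bnd V' \<delta>' n) (cyc V' \<delta>' n) (\<rho> n + s n)" for n
    unfolding reldim_i using vspace.reldim_trans[OF Y.vs s \<rho>] .
  have h': "hdim K V' \<delta>' n = \<rho> n + s n" for n by (rule X.hdim_eq[OF V'])
  have "finite ({n. By n \<noteq> Zy n} \<union> {n. bnd V'' \<delta>'' n \<noteq> cyc V'' \<delta>'' n})"
    using assms by (auto simp: total_finite_def)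
  then obtain m where m: "{n. By n \<noteq> Zy n} \<union> {n. bnd V'' \<delta>'' n \<noteq> cyc V'' \<delta>'' n} \<subseteq> {..<m}"
    by (meson finite_nat_iff_bounded)
  have hz: "hdim K V \<delta> n = 0" "hdim K V'' \<delta>'' n = 0" if "n \<ge> m" for n
    using m that by (auto simp: Y.hdim_0_iff[OF assms(1)] Z.hdim_0_iff[OF assms(2)])
  have rz: "r n = 0" if "n \<ge> m" for n
  proof -
    have "bnd V'' \<delta>'' n = cyc V'' \<delta>'' n" using m that by auto
    then have "p n ` Zy n = cyc V'' \<delta>'' n" using p_bnd Y.bnd_cyc p_cyc by blast
    then show ?thesis
      using r[of n] vspace.reldim_self[OF Z.vs Z.subspace_cyc] by metis
  qed
  have sz: "s n = 0" if "n \<ge> m" for n using h[of n] hz[OF that] rz[OF that] by simp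
  have \<rho>z: "\<rho> n = 0" if "n \<ge> Suc m" for n using that rz by (auto simp: \<rho>_def split: nat.split)
  have bz: "bnd V' \<delta>' n = cyc V' \<delta>' n" if "n \<ge> Suc m" for n
    using V'[of n] sz[of n] \<rho>z[of n] that by (auto elim: reldim.cases)
  \<comment> \<open>The bound is \<open>Suc m\<close> instead of \<open>m\<close> because of the
    degree shift in \<open>\<rho>\<close>.\<close>
  have fin': "{n. bnd V' \<delta>' n \<noteq> cyc V' \<delta>' n} \<subseteq> {..<Suc m}" using bz not_less by auto
  show tf: "total_finite K V' \<delta>'"
    unfolding total_finite_def using V' finite_subset[OF fin'] by blast
  have tel: "(\<Sum>n<N. (- 1) ^ n * (int (\<rho> n) + int (\<rho> (Suc n)))) = - ((- 1) ^ N * int (\<rho> N))" for N :: nat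
    by (induct N) (auto simp: \<rho>_def algebra_simps)
  have id: "int (hdim K V \<delta> n) = int (hdim K V' \<delta>' n) + int (hdim K V'' \<delta>'' n) - (int (\<rho> n) + int (\<rho> (Suc n)))" for n
    using h[of n] h'[of n] by (simp add: \<rho>_def)
  have "cx_euler K V \<delta> = (\<Sum>n<Suc m. (- 1) ^ n * int (hdim K V \<delta> n))"
    using m by (intro Y.cx_euler_sum assms) auto
  also have "\<dots> = (\<Sum>n<Suc m. (- 1) ^ n * int (hdim K V' \<delta>' n)) + (\<Sum>n<Suc m. (- 1) ^ n * int (hdim K V'' \<delta>'' n))
      - (\<Sum>n<Suc m. (- 1) ^ n * (int (\<rho> n) + int (\<rho> (Suc n))))"
    unfolding id by (simp add: sum.distrib sum_subtractf algebra_simps)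
  also have "\<dots> = cx_euler K V' \<delta>' + cx_euler K V'' \<delta>''"
    unfolding tel \<rho>z[OF order_refl] using X.cx_euler_sum[OF tf fin'] Z.cx_euler_sum[OF assms(2), of "Suc m"] m
    by force
  finally show "cx_euler K V \<delta> = cx_euler K V' \<delta>' + cx_euler K V'' \<delta>''" .
qed

end

section \<open>The bar complex\<close>

text \<open>Representations are given by a space and an action instead of a module over the group
  ring, so that homomorphism groups and their stable subspaces become representations without
  extending the action to group ring elements.\<close>

locale krep = G: group G + V: vspace K V for G :: "('g, 'gz) monoid_scheme" and K :: "('k, 'x) ring_scheme"
    and V :: "('k, 'v, 'y) module_scheme" +
  fixes act :: "'g \<Rightarrow> 'v \<Rightarrow> 'v"
  assumes act_closed [simp, intro]: "\<And>g x. g \<in> carrier G \<Longrightarrow> x \<in> carrier V \<Longrightarrow> act g x \<in> carrier V"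
    and act_add: "\<And>g x y. g \<in> carrier G \<Longrightarrow> x \<in> carrier V \<Longrightarrow> y \<in> carrier V \<Longrightarrow>
      act g (x \<oplus>\<^bsub>V\<^esub> y) = act g x \<oplus>\<^bsub>V\<^esub> act g y"
    and act_smult: "\<And>g c x. g \<in> carrier G \<Longrightarrow> c \<in> carrier K \<Longrightarrow> x \<in> carrier V \<Longrightarrow>
      act g (c \<odot>\<^bsub>V\<^esub> x) = c \<odot>\<^bsub>V\<^esub> act g x"
    and act_one [simp]: "\<And>x. x \<in> carrier V \<Longrightarrow> act \<one>\<^bsub>G\<^esub> x = x"
    and act_mult: "\<And>g h x. g \<in> carrier G \<Longrightarrow> h \<in> carrier G \<Longrightarrow> x \<in> carrier V \<Longrightarrow>
      act (g \<otimes>\<^bsub>G\<^esub> h) x = act g (act h x)"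
begin

lemma act_hom: "g \<in> carrier G \<Longrightarrow> act g \<in> mod_hom K V V"
  by (auto simp: mod_hom_def act_add act_smult)

lemma act_lin: "g \<in> carrier G \<Longrightarrow> linear_map K V V (act g)"
  by (intro linear_map.intro linear_map_axioms.intro V.vspace_axioms act_hom)

lemma act_zero [simp]: "g \<in> carrier G \<Longrightarrow> act g \<zero>\<^bsub>V\<^esub> = \<zero>\<^bsub>V\<^esub>"
  by (rule linear_map.map_zero[OF act_lin])

lemma act_a_inv: "g \<in> carrier G \<Longrightarrow> x \<in> carrier V \<Longrightarrow> act g (\<ominus>\<^bsub>V\<^esub> x) = \<ominus>\<^bsub>V\<^esub> act g x"
  by (rule linear_map.map_a_inv[OF act_lin])

lemma act_inv_cancel [simp]:
  "g \<in> carrier G \<Longrightarrow> x \<in> carrier V \<Longrightarrow> act g (act (inv\<^bsub>G\<^esub> g) x) = x"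
  "g \<in> carrier G \<Longrightarrow> x \<in> carrier V \<Longrightarrow> act (inv\<^bsub>G\<^esub> g) (act g x) = x"
  by (simp_all add: act_mult[symmetric])

end

text \<open>The bar differential without its first summand; the recursion makes \<open>d\<^sup>2 = 0\<close> an induction free of
  double sums.\<close>

fun bar_rest :: "('g, 'gz) monoid_scheme \<Rightarrow> ('k, 'v, 'y) module_scheme \<Rightarrow> ('g list \<Rightarrow> 'v) \<Rightarrow> 'g list \<Rightarrow> 'v" where
  "bar_rest G V f [] = \<zero>\<^bsub>V\<^esub>"
| "bar_rest G V f [y] = \<ominus>\<^bsub>V\<^esub> f []"
| "bar_rest G V f (y # g # gs) =
    \<ominus>\<^bsub>V\<^esub> f ((y \<otimes>\<^bsub>G\<^esub> g) # gs) \<oplus>\<^bsub>V\<^esub> \<ominus>\<^bsub>V\<^esub> bar_rest G V (\<lambda>zs. f (y # zs)) (g # gs)"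

definition bar :: "('g, 'gz) monoid_scheme \<Rightarrow> ('k, 'v, 'y) module_scheme \<Rightarrow> nat \<Rightarrow> ('k, 'g list \<Rightarrow> 'v) module"
  where "bar G V n = fun_mod (tuples G n) V"

definition bar_d :: "('g, 'gz) monoid_scheme \<Rightarrow> ('k, 'v, 'y) module_scheme \<Rightarrow> ('g \<Rightarrow> 'v \<Rightarrow> 'v) \<Rightarrow> nat \<Rightarrow>
    ('g list \<Rightarrow> 'v) \<Rightarrow> 'g list \<Rightarrow> 'v"
  where "bar_d G V act n f = (\<lambda>gs\<in>tuples G (Suc n). act (hd gs) (f (tl gs)) \<oplus>\<^bsub>V\<^esub> bar_rest G V f gs)"

lemma tuples_0 [simp]: "tuples G 0 = {[]}"
  by (auto simp: tuples_def)

lemma Cons_in_tuples [simp]: "x # xs \<in> tuples G (Suc n) \<longleftrightarrow> x \<in> carrier G \<and> xs \<in> tuples G n"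
  by (auto simp: tuples_def)

lemma tuples_SucE:
  assumes "gs \<in> tuples G (Suc n)"
  obtains y hs where "gs = y # hs" "y \<in> carrier G" "hs \<in> tuples G n"
  using assms by (cases gs) (auto simp: tuples_def)

lemma tuples_Suc0 [simp]: "gs \<in> tuples G (Suc 0) \<longleftrightarrow> (\<exists>g\<in>carrier G. gs = [g])"
  by (cases gs) (auto simp: tuples_def)

section \<open>The recursive part of the bar differential\<close>

context
  fixes G :: "('g, 'gz) monoid_scheme" and V :: "('k, 'v, 'y) module_scheme"
  assumes G: "group G" and V: "abelian_group V"
begin

interpretation G: group G by (rule G)
interpretation V: abelian_group V by (rule V)

lemma bar_rest_closed:
  assumes "f \<in> tuples G n \<rightarrow> carrier V" "gs \<in> tuples G (Suc n)"
  shows "bar_rest G V f gs \<in> carrier V"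
  using assms
proof (induct n arbitrary: f gs)
  case 0 then show ?case by auto
next
  case (Suc n)
  obtain y g hs where gs: "gs = y # g # hs" "y \<in> carrier G" "g \<in> carrier G" "hs \<in> tuples G n"
    using Suc.prems(2) by (auto elim!: tuples_SucE)
  have "bar_rest G V (\<lambda>zs. f (y # zs)) (g # hs) \<in> carrier V" by (rule Suc.hyps) (use gs Suc in auto)
  moreover have "f ((y \<otimes>\<^bsub>G\<^esub> g) # hs) \<in> carrier V" using Suc(2) gs by auto
  ultimately show ?case using gs by simp
qed

lemma bar_rest_cong:
  assumes "\<And>zs. zs \<in> tuples G n \<Longrightarrow> f zs = f' zs" "gs \<in> tuples G (Suc n)"
  shows "bar_rest G V f gs = bar_rest G V f' gs"
  using assms
proof (induct n arbitrary: f f' gs)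
  case 0 then show ?case by auto
next
  case (Suc n)
  obtain y g hs where gs: "gs = y # g # hs" "y \<in> carrier G" "g \<in> carrier G" "hs \<in> tuples G n"
    using Suc.prems(2) by (auto elim!: tuples_SucE)
  have "bar_rest G V (\<lambda>zs. f (y # zs)) (g # hs) = bar_rest G V (\<lambda>zs. f' (y # zs)) (g # hs)"
    by (rule Suc.hyps) (use gs Suc in auto)
  then show ?case using gs Suc(2) by simp
qed

lemma bar_rest_add:
  assumes "f \<in> tuples G n \<rightarrow> carrier V" "f' \<in> tuples G n \<rightarrow> carrier V" "gs \<in> tuples G (Suc n)"
  shows "bar_rest G V (\<lambda>zs. f zs \<oplus>\<^bsub>V\<^esub> f' zs) gs = bar_rest G V f gs \<oplus>\<^bsub>V\<^esub> bar_rest G V f' gs"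
  using assms
proof (induct n arbitrary: f f' gs)
  case 0 then show ?case by (auto simp: V.minus_add)
next
  case (Suc n)
  obtain y g hs where gs: "gs = y # g # hs" "y \<in> carrier G" "g \<in> carrier G" "hs \<in> tuples G n"
    using Suc.prems(3) by (auto elim!: tuples_SucE)
  have *: "(\<lambda>zs. f (y # zs)) \<in> tuples G n \<rightarrow> carrier V" "(\<lambda>zs. f' (y # zs)) \<in> tuples G n \<rightarrow> carrier V"
    using gs Suc.prems by auto
  have "bar_rest G V (\<lambda>zs. f (y # zs) \<oplus>\<^bsub>V\<^esub> f' (y # zs)) (g # hs) =
      bar_rest G V (\<lambda>zs. f (y # zs)) (g # hs) \<oplus>\<^bsub>V\<^esub> bar_rest G V (\<lambda>zs. f' (y # zs)) (g # hs)"
    using Suc.hyps[OF *] gs by auto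
  moreover have "bar_rest G V (\<lambda>zs. f (y # zs)) (g # hs) \<in> carrier V"
     "bar_rest G V (\<lambda>zs. f' (y # zs)) (g # hs) \<in> carrier V"
    using bar_rest_closed[OF *(1)] bar_rest_closed[OF *(2)] gs by auto
  moreover have "f ((y \<otimes>\<^bsub>G\<^esub> g) # hs) \<in> carrier V" "f' ((y \<otimes>\<^bsub>G\<^esub> g) # hs) \<in> carrier V"
    using Suc.prems gs by auto
  ultimately show ?case using gs by (simp add: V.minus_add V.a_ac)
qed

text \<open>Only additivity matters here. The lemma is applied with \<open>\<phi>\<close> a
  negation, a scalar, the action of a group element, and a map of representations.\<close>

lemma bar_rest_map:
  assumes "\<And>x. x \<in> carrier V \<Longrightarrow> \<phi> (\<ominus>\<^bsub>V\<^esub> x) = \<ominus>\<^bsub>W\<^esub> \<phi> x"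
    and "\<And>x y. x \<in> carrier V \<Longrightarrow> y \<in> carrier V \<Longrightarrow> \<phi> (x \<oplus>\<^bsub>V\<^esub> y) = \<phi> x \<oplus>\<^bsub>W\<^esub> \<phi> y"
    and "f \<in> tuples G n \<rightarrow> carrier V" "gs \<in> tuples G (Suc n)"
  shows "bar_rest G W (\<lambda>zs. \<phi> (f zs)) gs = \<phi> (bar_rest G V f gs)"
  using assms(3,4)
proof (induct n arbitrary: f gs)
  case 0 then show ?case using assms(1) by auto
next
  case (Suc n)
  obtain y g hs where gs: "gs = y # g # hs" "y \<in> carrier G" "g \<in> carrier G" "hs \<in> tuples G n"
    using Suc.prems(2) by (auto elim!: tuples_SucE)
  have *: "(\<lambda>zs. f (y # zs)) \<in> tuples G n \<rightarrow> carrier V" using gs Suc.prems by auto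
  have "bar_rest G W (\<lambda>zs. \<phi> (f (y # zs))) (g # hs) = \<phi> (bar_rest G V (\<lambda>zs. f (y # zs)) (g # hs))"
    using Suc.hyps[OF *] gs by auto
  moreover have "bar_rest G V (\<lambda>zs. f (y # zs)) (g # hs) \<in> carrier V" using bar_rest_closed[OF *] gs by auto
  moreover have "f ((y \<otimes>\<^bsub>G\<^esub> g) # hs) \<in> carrier V" using Suc.prems gs by auto
  ultimately show ?case using gs assms(1,2) by simp
qed

lemma bar_rest_a_inv:
  assumes "f \<in> tuples G n \<rightarrow> carrier V" "gs \<in> tuples G (Suc n)"
  shows "bar_rest G V (\<lambda>zs. \<ominus>\<^bsub>V\<^esub> f zs) gs = \<ominus>\<^bsub>V\<^esub> bar_rest G V f gs"
  using assms by (intro bar_rest_map) (auto simp: V.minus_add)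

text \<open>After splitting off the first entry \<open>y\<close>, the contribution in which
  \<open>y\<close> is multiplied into the next argument (the function \<open>R\<close>) occurs twice
  with opposite signs, once from the outer and once from the inner operator; associativity
  identifies the two. What remains is the same expression for the function with \<open>y\<close>
  fixed.\<close>

lemma bar_rest_bar_rest:
  assumes "f \<in> tuples G n \<rightarrow> carrier V" "gs \<in> tuples G (Suc (Suc n))"
  shows "bar_rest G V (bar_rest G V f) gs = \<zero>\<^bsub>V\<^esub>"
  using assms
proof (induct n arbitrary: f gs)
  case 0
  then obtain y g where gs: "gs = [y, g]" "y \<in> carrier G" "g \<in> carrier G"
    by (auto elim!: tuples_SucE)
  then show ?case using 0 by (simp add: V.r_neg)
next
  case (Suc n)
  obtain y g h hs where gs: "gs = y # g # h # hs" "y \<in> carrier G" "g \<in> carrier G" "h \<in> carrier G"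
    "hs \<in> tuples G n" using Suc.prems(2) by (auto elim!: tuples_SucE)
  define R where "R zs = f ((y \<otimes>\<^bsub>G\<^esub> hd zs) # tl zs)" for zs
  have fy: "(\<lambda>zs. f (y # zs)) \<in> tuples G n \<rightarrow> carrier V" using Suc.prems gs by auto
  have R: "R \<in> tuples G (Suc n) \<rightarrow> carrier V"
    using Suc.prems gs by (auto simp: R_def elim!: tuples_SucE)
  have bfy: "bar_rest G V (\<lambda>zs. f (y # zs)) \<in> tuples G (Suc n) \<rightarrow> carrier V"
    using bar_rest_closed[OF fy] by blast
  have tl: "g # h # hs \<in> tuples G (Suc (Suc n))" using gs by auto
  have X: "bar_rest G V f ((y \<otimes>\<^bsub>G\<^esub> g) # h # hs) \<in> carrier V"
    using Suc.prems gs by (intro bar_rest_closed) auto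
  have "bar_rest G V (\<lambda>zs. bar_rest G V f (y # zs)) (g # h # hs) =
      bar_rest G V (\<lambda>zs. \<ominus>\<^bsub>V\<^esub> R zs \<oplus>\<^bsub>V\<^esub> \<ominus>\<^bsub>V\<^esub> bar_rest G V (\<lambda>zs. f (y # zs)) zs) (g # h # hs)"
    by (rule bar_rest_cong[OF _ tl]) (auto simp: R_def elim!: tuples_SucE)
  also have "\<dots> = bar_rest G V (\<lambda>zs. \<ominus>\<^bsub>V\<^esub> R zs) (g # h # hs) \<oplus>\<^bsub>V\<^esub>
      bar_rest G V (\<lambda>zs. \<ominus>\<^bsub>V\<^esub> bar_rest G V (\<lambda>zs. f (y # zs)) zs) (g # h # hs)"
    using R bfy by (intro bar_rest_add[OF _ _ tl]) auto
  also have "\<dots> = \<ominus>\<^bsub>V\<^esub> bar_rest G V R (g # h # hs) \<oplus>\<^bsub>V\<^esub>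
      \<ominus>\<^bsub>V\<^esub> bar_rest G V (bar_rest G V (\<lambda>zs. f (y # zs))) (g # h # hs)"
    using bar_rest_a_inv[OF R tl] bar_rest_a_inv[OF bfy tl] by simp
  also have "bar_rest G V R (g # h # hs) = bar_rest G V f ((y \<otimes>\<^bsub>G\<^esub> g) # h # hs)"
    using gs by (simp add: R_def G.m_assoc)
  also have "bar_rest G V (bar_rest G V (\<lambda>zs. f (y # zs))) (g # h # hs) = \<zero>\<^bsub>V\<^esub>"
    by (rule Suc.hyps[OF fy tl])
  finally show ?case using gs X by (simp add: V.l_neg)
qed

lemma finsum_a_inv:
  assumes "finite A" "f \<in> A \<rightarrow> carrier V"
  shows "(\<Oplus>\<^bsub>V\<^esub>j\<in>A. \<ominus>\<^bsub>V\<^esub> f j) = \<ominus>\<^bsub>V\<^esub> (\<Oplus>\<^bsub>V\<^esub>j\<in>A. f j)"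
  using assms by (induct A) (auto simp: V.minus_add Pi_iff)

lemma int_sign: "x \<in> carrier V \<Longrightarrow> [((- 1 :: int) ^ Suc j)] \<cdot>\<^bsub>V\<^esub> x = \<ominus>\<^bsub>V\<^esub> ([((- 1 :: int) ^ j)] \<cdot>\<^bsub>V\<^esub> x)"
  by (simp add: V.add.int_pow_neg)

text \<open>The link to the explicit formula in \<open>codiff\<close>: the summand
  \<open>j = 0\<close> is the first term of the recursion, and shifting the index in the others
  reverses all signs of the sum for the shorter list.\<close>

lemma bar_rest_eq_sum:
  assumes "f \<in> tuples G n \<rightarrow> carrier V" "gs \<in> tuples G (Suc n)"
  shows "bar_rest G V f gs =
    (\<Oplus>\<^bsub>V\<^esub>j\<in>{..<n}. [((- 1 :: int) ^ Suc j)] \<cdot>\<^bsub>V\<^esub> f (take j gs @ (gs ! j \<otimes>\<^bsub>G\<^esub> gs ! Suc j) # drop (j + 2) gs))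
    \<oplus>\<^bsub>V\<^esub> ([((- 1 :: int) ^ Suc n)] \<cdot>\<^bsub>V\<^esub> f (butlast gs))"
  using assms
proof (induct n arbitrary: f gs)
  case 0
  then obtain y where gs: "gs = [y]" "y \<in> carrier G" by auto
  then show ?case using 0 int_sign[of "f []" 0] by simp
next
  case (Suc n)
  obtain y g hs where gs: "gs = y # g # hs" "y \<in> carrier G" "g \<in> carrier G" "hs \<in> tuples G n"
    using Suc.prems(2) by (auto elim!: tuples_SucE)
  let ?m = "\<lambda>j gs. take j gs @ (gs ! j \<otimes>\<^bsub>G\<^esub> gs ! Suc j) # drop (j + 2) gs"
  have fy: "(\<lambda>zs. f (y # zs)) \<in> tuples G n \<rightarrow> carrier V" using Suc.prems gs by auto
  have merge: "?m j zs \<in> tuples G k" if "zs \<in> tuples G (Suc k)" "j < k" for j k zs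
  proof -
    have zs: "set zs \<subseteq> carrier G" "length zs = Suc k" using that by (auto simp: tuples_def)
    then have "zs ! j \<in> carrier G" "zs ! Suc j \<in> carrier G" using that by (auto intro: nth_mem[THEN subsetD[OF zs(1)]])
    moreover have "set (take j zs) \<subseteq> carrier G" "set (drop (j + 2) zs) \<subseteq> carrier G"
      using zs set_take_subset[of j zs] set_drop_subset[of "j + 2" zs] by auto
    ultimately show ?thesis using zs that by (auto simp: tuples_def)
  qed
  define t where "t j = [((- 1 :: int) ^ Suc j)] \<cdot>\<^bsub>V\<^esub> f (?m j gs)" for j
  define u where "u j = [((- 1 :: int) ^ Suc j)] \<cdot>\<^bsub>V\<^esub> f (y # ?m j (g # hs))" for j
  have tc: "t \<in> {..<Suc n} \<rightarrow> carrier V"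
  proof
    fix j assume "j \<in> {..<Suc n}"
    then have "f (?m j gs) \<in> carrier V" using merge[OF Suc.prems(2)] Suc.prems(1) by blast
    then show "t j \<in> carrier V" unfolding t_def by (rule V.add.int_pow_closed)
  qed
  have uc: "u \<in> {..<n} \<rightarrow> carrier V"
  proof
    fix j assume "j \<in> {..<n}"
    then have "f (y # ?m j (g # hs)) \<in> carrier V" using merge[of "g # hs" n j] fy gs by auto
    then show "u j \<in> carrier V" unfolding u_def by (rule V.add.int_pow_closed)
  qed
  have tu: "t (Suc j) = \<ominus>\<^bsub>V\<^esub> u j" if "j < n" for j
  proof -
    have "f (y # ?m j (g # hs)) \<in> carrier V" using merge[of "g # hs" n j] fy gs that by auto
    then show ?thesis using int_sign[of "f (y # ?m j (g # hs))" "Suc j"] gs by (simp add: t_def u_def)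
  qed
  have "f ((y \<otimes>\<^bsub>G\<^esub> g) # hs) \<in> carrier V" using gs Suc.prems(1) by auto
  then have t0: "t 0 = \<ominus>\<^bsub>V\<^esub> f ((y \<otimes>\<^bsub>G\<^esub> g) # hs)"
    using gs int_sign[of "f ((y \<otimes>\<^bsub>G\<^esub> g) # hs)" 0] by (auto simp: t_def)
  have tc0: "t 0 \<in> carrier V" using tc by auto
  have sum: "(\<Oplus>\<^bsub>V\<^esub>j\<in>{..<Suc n}. t j) = t 0 \<oplus>\<^bsub>V\<^esub> \<ominus>\<^bsub>V\<^esub> (\<Oplus>\<^bsub>V\<^esub>j\<in>{..<n}. u j)"
  proof -
    have "(\<Oplus>\<^bsub>V\<^esub>j\<in>{..<Suc n}. t j) = t 0 \<oplus>\<^bsub>V\<^esub> (\<Oplus>\<^bsub>V\<^esub>j\<in>Suc ` {..<n}. t j)"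
      unfolding lessThan_Suc_eq_insert_0 using tc by (intro V.finsum_insert) auto
    also have "(\<Oplus>\<^bsub>V\<^esub>j\<in>Suc ` {..<n}. t j) = (\<Oplus>\<^bsub>V\<^esub>j\<in>{..<n}. t (Suc j))"
      using tc by (intro V.add.finprod_reindex) auto
    also have "\<dots> = (\<Oplus>\<^bsub>V\<^esub>j\<in>{..<n}. \<ominus>\<^bsub>V\<^esub> u j)" using tu uc by (intro V.finsum_cong') auto
    also have "\<dots> = \<ominus>\<^bsub>V\<^esub> (\<Oplus>\<^bsub>V\<^esub>j\<in>{..<n}. u j)" using uc by (intro finsum_a_inv) auto
    finally show ?thesis .
  qed
  have bl: "butlast (g # hs) \<in> tuples G n"
    using gs by (auto simp: tuples_def dest: in_set_butlastD)
  define w where "w = [((- 1 :: int) ^ Suc n)] \<cdot>\<^bsub>V\<^esub> f (y # butlast (g # hs))"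
  have fb: "f (y # butlast (g # hs)) \<in> carrier V" using fy bl by auto
  then have wc: "w \<in> carrier V" unfolding w_def by (rule V.add.int_pow_closed)
  have w': "[((- 1 :: int) ^ Suc (Suc n))] \<cdot>\<^bsub>V\<^esub> f (butlast gs) = \<ominus>\<^bsub>V\<^esub> w"
    using int_sign[OF fb, of "Suc n"] gs by (simp add: w_def)
  have "bar_rest G V (\<lambda>zs. f (y # zs)) (g # hs) = (\<Oplus>\<^bsub>V\<^esub>j\<in>{..<n}. u j) \<oplus>\<^bsub>V\<^esub> w"
    unfolding u_def w_def by (rule Suc.hyps[OF fy]) (use gs in auto)
  then have "bar_rest G V f gs = t 0 \<oplus>\<^bsub>V\<^esub> \<ominus>\<^bsub>V\<^esub> ((\<Oplus>\<^bsub>V\<^esub>j\<in>{..<n}. u j) \<oplus>\<^bsub>V\<^esub> w)"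
    using gs t0 by simp
  also have "\<dots> = (\<Oplus>\<^bsub>V\<^esub>j\<in>{..<Suc n}. t j) \<oplus>\<^bsub>V\<^esub> \<ominus>\<^bsub>V\<^esub> w"
    unfolding sum using tc0 uc wc V.finsum_closed[OF uc] by (simp add: V.minus_add V.a_ac)
  finally show ?case unfolding t_def w' .
qed

end

section \<open>The bar complex of a representation\<close>

context krep begin

lemmas rest_closed = bar_rest_closed[OF G.group_axioms V.M.abelian_group_axioms]
  and rest_cong = bar_rest_cong[OF G.group_axioms V.M.abelian_group_axioms]
  and rest_add = bar_rest_add[OF G.group_axioms V.M.abelian_group_axioms]
  and rest_map = bar_rest_map[OF G.group_axioms V.M.abelian_group_axioms]
  and rest_rest = bar_rest_bar_rest[OF G.group_axioms V.M.abelian_group_axioms]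

lemma vspace_bar: "vspace K (bar G V n)"
  unfolding bar_def by (rule V.vspace_fun_mod)

lemma bar_d_Cons:
  "y \<in> carrier G \<Longrightarrow> gs \<in> tuples G n \<Longrightarrow> bar_d G V act n f (y # gs) = act y (f gs) \<oplus>\<^bsub>V\<^esub> bar_rest G V f (y # gs)"
  by (simp add: bar_d_def)

lemma bar_d_hom: "bar_d G V act n \<in> mod_hom K (bar G V n) (bar G V (Suc n))"
proof -
  have cl: "act (hd gs) (f (tl gs)) \<in> carrier V" "bar_rest G V f gs \<in> carrier V" "hd gs \<in> carrier G" "f (tl gs) \<in> carrier V"
    if "gs \<in> tuples G (Suc n)" "f \<in> tuples G n \<rightarrow>\<^sub>E carrier V" for f gs
  proof -
    have "f \<in> tuples G n \<rightarrow> carrier V" using that by auto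
    then show "act (hd gs) (f (tl gs)) \<in> carrier V" "bar_rest G V f gs \<in> carrier V"
      "hd gs \<in> carrier G" "f (tl gs) \<in> carrier V" 
      using that rest_closed[of f n gs] by (auto elim!: tuples_SucE simp: Pi_iff PiE_iff)
  qed
  have "bar_d G V act n (f \<oplus>\<^bsub>bar G V n\<^esub> f') gs = (bar_d G V act n f \<oplus>\<^bsub>bar G V (Suc n)\<^esub> bar_d G V act n f') gs"
    if f: "f \<in> tuples G n \<rightarrow>\<^sub>E carrier V" "f' \<in> tuples G n \<rightarrow>\<^sub>E carrier V" for f f' gs
  proof (cases "gs \<in> tuples G (Suc n)")
    case True
    have "bar_rest G V (\<lambda>zs\<in>tuples G n. f zs \<oplus>\<^bsub>V\<^esub> f' zs) gs = bar_rest G V (\<lambda>zs. f zs \<oplus>\<^bsub>V\<^esub> f' zs) gs"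
      by (rule rest_cong[OF _ True]) simp
    also have "\<dots> = bar_rest G V f gs \<oplus>\<^bsub>V\<^esub> bar_rest G V f' gs" using f True by (intro rest_add) auto
    moreover have "tl gs \<in> tuples G n" using True by (auto elim!: tuples_SucE)
    ultimately show ?thesis using True cl[OF True f(1)] cl[OF True f(2)]
      by (simp add: bar_d_def bar_def act_add V.M.a_ac)
  qed (simp add: bar_d_def bar_def)
  moreover have "bar_d G V act n (c \<odot>\<^bsub>bar G V n\<^esub> f) gs = (c \<odot>\<^bsub>bar G V (Suc n)\<^esub> bar_d G V act n f) gs"
    if f: "f \<in> tuples G n \<rightarrow>\<^sub>E carrier V" "c \<in> carrier K" for f c gs
  proof (cases "gs \<in> tuples G (Suc n)")
    case True
    have "bar_rest G V (\<lambda>zs\<in>tuples G n. c \<odot>\<^bsub>V\<^esub> f zs) gs = bar_rest G V (\<lambda>zs. c \<odot>\<^bsub>V\<^esub> f zs) gs"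
      by (rule rest_cong[OF _ True]) simp
    also have "\<dots> = c \<odot>\<^bsub>V\<^esub> bar_rest G V f gs"
      using f True by (intro rest_map) (auto simp: V.smult_a_inv V.smult_r_distr)
    moreover have "tl gs \<in> tuples G n" using True by (auto elim!: tuples_SucE)
    ultimately show ?thesis using True cl[OF True f(1)] f
      by (simp add: bar_d_def bar_def act_smult V.smult_r_distr)
  qed (simp add: bar_d_def bar_def)
  moreover have "bar_d G V act n f \<in> tuples G (Suc n) \<rightarrow>\<^sub>E carrier V" if "f \<in> tuples G n \<rightarrow>\<^sub>E carrier V" for f
    using cl[OF _ that] by (simp add: bar_d_def)
  ultimately show ?thesis by (auto simp: mod_hom_def) (auto simp: bar_def)
qed

text \<open>The terms without the action vanish by \<open>bar_rest_bar_rest\<close>. Those with it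
  cancel in pairs, since \<open>act (y g)\<close> is \<open>act y\<close> after \<open>act g\<close>
  and \<open>act y\<close> commutes with \<open>bar_rest\<close>.\<close>

lemma bar_d_bar_d:
  assumes "f \<in> carrier (bar G V n)"
  shows "bar_d G V act (Suc n) (bar_d G V act n f) = \<zero>\<^bsub>bar G V (Suc (Suc n))\<^esub>"
proof
  fix gs
  have f: "f \<in> tuples G n \<rightarrow> carrier V" using assms by (auto simp: bar_def)
  show "bar_d G V act (Suc n) (bar_d G V act n f) gs = \<zero>\<^bsub>bar G V (Suc (Suc n))\<^esub> gs"
  proof (cases "gs \<in> tuples G (Suc (Suc n))")
    case True
    then obtain y g hs where gs: "gs = y # g # hs" "y \<in> carrier G" "g \<in> carrier G" "hs \<in> tuples G n"
      by (auto elim!: tuples_SucE)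
    have fc: "f hs \<in> carrier V" using f gs by auto
    have rc: "bar_rest G V f (g # hs) \<in> carrier V" using rest_closed[OF f] gs by auto
    have A: "(\<lambda>zs. act (hd zs) (f (tl zs))) \<in> tuples G (Suc n) \<rightarrow> carrier V"
      using f by (auto elim!: tuples_SucE simp: Pi_iff)
    have "bar_rest G V (bar_d G V act n f) gs =
        bar_rest G V (\<lambda>zs. act (hd zs) (f (tl zs)) \<oplus>\<^bsub>V\<^esub> bar_rest G V f zs) gs"
      by (rule rest_cong[OF _ True]) (simp add: bar_d_def)
    also have "\<dots> = bar_rest G V (\<lambda>zs. act (hd zs) (f (tl zs))) gs \<oplus>\<^bsub>V\<^esub> bar_rest G V (bar_rest G V f) gs"
      using rest_closed[OF f] by (intro rest_add[OF A _ True]) auto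
    also have "bar_rest G V (bar_rest G V f) gs = \<zero>\<^bsub>V\<^esub>" by (rule rest_rest[OF f True])
    also have "bar_rest G V (\<lambda>zs. act (hd zs) (f (tl zs))) gs =
        \<ominus>\<^bsub>V\<^esub> act (y \<otimes>\<^bsub>G\<^esub> g) (f hs) \<oplus>\<^bsub>V\<^esub> \<ominus>\<^bsub>V\<^esub> bar_rest G V (\<lambda>zs. act y (f zs)) (g # hs)"
      using gs by simp
    also have "bar_rest G V (\<lambda>zs. act y (f zs)) (g # hs) = act y (bar_rest G V f (g # hs))"
      using gs f by (intro rest_map) (auto simp: act_a_inv act_add)
    finally have "bar_rest G V (bar_d G V act n f) gs =
        \<ominus>\<^bsub>V\<^esub> act (y \<otimes>\<^bsub>G\<^esub> g) (f hs) \<oplus>\<^bsub>V\<^esub> \<ominus>\<^bsub>V\<^esub> act y (bar_rest G V f (g # hs))"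
      using gs fc rc by simp
    moreover have "bar_d G V act n f (g # hs) = act g (f hs) \<oplus>\<^bsub>V\<^esub> bar_rest G V f (g # hs)"
      using bar_d_Cons gs by simp
    ultimately have "bar_d G V act (Suc n) (bar_d G V act n f) gs =
      (act y (act g (f hs)) \<oplus>\<^bsub>V\<^esub> act y (bar_rest G V f (g # hs))) \<oplus>\<^bsub>V\<^esub>
      \<ominus>\<^bsub>V\<^esub> (act y (act g (f hs)) \<oplus>\<^bsub>V\<^esub> act y (bar_rest G V f (g # hs)))"
      using gs True fc rc by (simp add: bar_d_def act_mult act_add V.M.minus_add)
    then show ?thesis using gs fc rc True by (simp add: V.M.r_neg bar_def)
  qed (simp add: bar_d_def bar_def)
qed

sublocale bar_cx: cochain_cx K "bar G V" "bar_d G V act"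
  by (intro cochain_cx.intro vspace_bar bar_d_hom bar_d_bar_d)

end

section \<open>Functoriality and exactness in the coefficients\<close>

lemma bar_map_hom:
  assumes "\<phi> \<in> mod_hom K V W"
  shows "(\<lambda>f. \<lambda>gs\<in>tuples G n. \<phi> (f gs)) \<in> mod_hom K (bar G V n) (bar G W n)"
  using mod_homD[OF assms] by (auto simp: mod_hom_def bar_def PiE_iff intro!: restrict_ext)

lemma bar_map_bar_d:
  assumes "krep G K V act" "krep G K W act'" "\<phi> \<in> mod_hom K V W"
    and equiv: "\<And>g x. g \<in> carrier G \<Longrightarrow> x \<in> carrier V \<Longrightarrow> \<phi> (act g x) = act' g (\<phi> x)"
    and f: "f \<in> carrier (bar G V n)"
  shows "(\<lambda>gs\<in>tuples G (Suc n). \<phi> (bar_d G V act n f gs)) =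
    bar_d G W act' n (\<lambda>gs\<in>tuples G n. \<phi> (f gs))"
proof
  fix gs
  interpret V: krep G K V act by fact
  interpret W: krep G K W act' by fact
  interpret p: linear_map K V W \<phi>
    by (intro linear_map.intro linear_map_axioms.intro V.V.vspace_axioms W.V.vspace_axioms assms)
  have fc: "f \<in> tuples G n \<rightarrow> carrier V" using f by (auto simp: bar_def)
  show "(\<lambda>gs\<in>tuples G (Suc n). \<phi> (bar_d G V act n f gs)) gs =
    bar_d G W act' n (\<lambda>gs\<in>tuples G n. \<phi> (f gs)) gs"
  proof (cases "gs \<in> tuples G (Suc n)")
    case True
    then obtain y hs where gs: "gs = y # hs" "y \<in> carrier G" "hs \<in> tuples G n" by (rule tuples_SucE)
    have "bar_rest G W (\<lambda>gs\<in>tuples G n. \<phi> (f gs)) gs = bar_rest G W (\<lambda>gs. \<phi> (f gs)) gs"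
      by (rule W.rest_cong[OF _ True]) simp
    also have "\<dots> = \<phi> (bar_rest G V f gs)"
      by (rule V.rest_map[OF _ _ fc True]) (auto simp: p.map_a_inv p.map_add)
    finally show ?thesis using gs fc V.rest_closed[OF fc True] True
      by (auto simp: bar_d_def p.map_add equiv Pi_iff)
  qed (simp add: bar_d_def)
qed

text \<open>Cochains are arbitrary functions on tuples, so exactness can be tested at each tuple and
  preimages chosen independently for different tuples.\<close>

lemma bar_exact:
  assumes "krep G K V' act'" "krep G K V act" "krep G K V'' act''"
    and i: "i \<in> mod_hom K V' V" "\<And>g x. g \<in> carrier G \<Longrightarrow> x \<in> carrier V' \<Longrightarrow> i (act' g x) = act g (i x)"
    and p: "p \<in> mod_hom K V V''" "\<And>g x. g \<in> carrier G \<Longrightarrow> x \<in> carrier V \<Longrightarrow> p (act g x) = act'' g (p x)"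
    and inj: "inj_on i (carrier V')" and ex: "i ` carrier V' = {x \<in> carrier V. p x = \<zero>\<^bsub>V''\<^esub>}"
    and surj: "p ` carrier V = carrier V''"
  shows "cx_exact K (bar G V') (bar_d G V' act') (bar G V) (bar_d G V act) (bar G V'') (bar_d G V'' act'')
    (\<lambda>n f. \<lambda>gs\<in>tuples G n. i (f gs)) (\<lambda>n f. \<lambda>gs\<in>tuples G n. p (f gs))"
proof -
  interpret X: krep G K V' act' by fact
  interpret Y: krep G K V act by fact
  interpret Z: krep G K V'' act'' by fact
  note ic = mod_homD(1)[OF i(1)] and pc = mod_homD(1)[OF p(1)]
  show ?thesis
  proof (rule cx_exact.intro[OF X.bar_cx.cochain_cx_axioms Y.bar_cx.cochain_cx_axioms
      Z.bar_cx.cochain_cx_axioms], rule cx_exact_axioms.intro)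
    fix n
    show "(\<lambda>f. \<lambda>gs\<in>tuples G n. i (f gs)) \<in> mod_hom K (bar G V' n) (bar G V n)"
      "(\<lambda>f. \<lambda>gs\<in>tuples G n. p (f gs)) \<in> mod_hom K (bar G V n) (bar G V'' n)"
      by (rule bar_map_hom[OF i(1)], rule bar_map_hom[OF p(1)])
    show "(\<lambda>gs\<in>tuples G (Suc n). i (bar_d G V' act' n f gs)) = bar_d G V act n (\<lambda>gs\<in>tuples G n. i (f gs))"
      if "f \<in> carrier (bar G V' n)" for f
      using bar_map_bar_d[OF assms(1,2) i(1) _ that] i(2) by blast
    show "(\<lambda>gs\<in>tuples G (Suc n). p (bar_d G V act n f gs)) = bar_d G V'' act'' n (\<lambda>gs\<in>tuples G n. p (f gs))"
      if "f \<in> carrier (bar G V n)" for f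
      using bar_map_bar_d[OF assms(2,3) p(1) _ that] p(2) by blast
    show "inj_on (\<lambda>f. \<lambda>gs\<in>tuples G n. i (f gs)) (carrier (bar G V' n))"
    proof (rule inj_onI, rule ext)
      fix f f' gs assume *: "f \<in> carrier (bar G V' n)" "f' \<in> carrier (bar G V' n)"
        "(\<lambda>gs\<in>tuples G n. i (f gs)) = (\<lambda>gs\<in>tuples G n. i (f' gs))"
      show "f gs = f' gs"
      proof (cases "gs \<in> tuples G n")
        case True
        then have "i (f gs) = i (f' gs)" using fun_cong[OF *(3), of gs] by simp
        then show ?thesis using * True by (auto simp: bar_def PiE_iff intro: inj_onD[OF inj])
      next
        case False then show ?thesis using * by (auto simp: bar_def PiE_iff extensional_def)
      qed
    qed
    show "(\<lambda>f. \<lambda>gs\<in>tuples G n. i (f gs)) ` carrier (bar G V' n) =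
      {x \<in> carrier (bar G V n). (\<lambda>gs\<in>tuples G n. p (x gs)) = \<zero>\<^bsub>bar G V'' n\<^esub>}" (is "?L = ?R")
    proof
      have "p (i x) = \<zero>\<^bsub>V''\<^esub>" if "x \<in> carrier V'" for x using ex that by blast
      then show "?L \<subseteq> ?R" using ic by (auto simp: bar_def PiE_iff intro!: restrict_ext)
      show "?R \<subseteq> ?L"
      proof
        fix f assume f: "f \<in> ?R"
        have "\<exists>x\<in>carrier V'. f gs = i x" if gs: "gs \<in> tuples G n" for gs
        proof -
          have "(\<lambda>gs\<in>tuples G n. p (f gs)) = (\<lambda>gs\<in>tuples G n. \<zero>\<^bsub>V''\<^esub>)" using f by (simp add: bar_def)
          from fun_cong[OF this, of gs] have "p (f gs) = \<zero>\<^bsub>V''\<^esub>" using gs by simp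
          then have "f gs \<in> i ` carrier V'" unfolding ex using f gs by (auto simp: bar_def)
          then show ?thesis by auto
        qed
        then obtain x where x: "\<And>gs. gs \<in> tuples G n \<Longrightarrow> x gs \<in> carrier V' \<and> f gs = i (x gs)" by metis
        show "f \<in> ?L"
        proof (rule image_eqI[of _ _ "restrict x (tuples G n)"])
          show "f = (\<lambda>gs\<in>tuples G n. i (restrict x (tuples G n) gs))"
            using f x by (intro ext) (auto simp: bar_def PiE_iff extensional_def)
        qed (use x in \<open>auto simp: bar_def\<close>)
      qed
    qed
    show "(\<lambda>f. \<lambda>gs\<in>tuples G n. p (f gs)) ` carrier (bar G V n) = carrier (bar G V'' n)" (is "?L = ?R")
    proof
      show "?L \<subseteq> ?R" using pc by (auto simp: bar_def PiE_iff)
      show "?R \<subseteq> ?L"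
      proof
        fix f assume f: "f \<in> ?R"
        have "\<exists>x\<in>carrier V. f gs = p x" if gs: "gs \<in> tuples G n" for gs
        proof -
          have "f gs \<in> p ` carrier V" unfolding surj using f gs by (auto simp: bar_def)
          then show ?thesis by auto
        qed
        then obtain x where x: "\<And>gs. gs \<in> tuples G n \<Longrightarrow> x gs \<in> carrier V \<and> f gs = p (x gs)" by metis
        show "f \<in> ?L"
        proof (rule image_eqI[of _ _ "restrict x (tuples G n)"])
          show "f = (\<lambda>gs\<in>tuples G n. p (restrict x (tuples G n) gs))"
            using f x by (intro ext) (auto simp: bar_def PiE_iff extensional_def)
        qed (use x in \<open>auto simp: bar_def\<close>)
      qed
    qed
  qed
qed

section \<open>Invariants in degree 0 and contraction by averaging\<close>

context krep begin

text \<open>The coboundary of a 0-cochain with value \<open>x\<close> is the function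
  \<open>g \<mapsto> g x - x\<close>, so degree 0 cohomology is the space of invariants.\<close>

lemma cyc_0: "cyc (bar G V) (bar_d G V act) 0 = {f \<in> carrier (bar G V 0). \<forall>g\<in>carrier G. act g (f []) = f []}"
proof -
  have "bar_d G V act 0 f = \<zero>\<^bsub>bar G V (Suc 0)\<^esub> \<longleftrightarrow> (\<forall>g\<in>carrier G. act g (f []) = f [])"
    if f: "f \<in> carrier (bar G V 0)" for f
  proof -
    have fc: "f [] \<in> carrier V" using f by (auto simp: bar_def)
    have *: "bar_d G V act 0 f [g] = \<zero>\<^bsub>V\<^esub> \<longleftrightarrow> act g (f []) = f []" if "g \<in> carrier G" for g
      using V.M.minus_eq_zero_iff[of "act g (f [])" "f []"] that fc by (simp add: bar_d_def a_minus_def)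
    show ?thesis
    proof
      assume "bar_d G V act 0 f = \<zero>\<^bsub>bar G V (Suc 0)\<^esub>"
      then show "\<forall>g\<in>carrier G. act g (f []) = f []" using * by (simp add: bar_def)
    next
      assume a: "\<forall>g\<in>carrier G. act g (f []) = f []"
      show "bar_d G V act 0 f = \<zero>\<^bsub>bar G V (Suc 0)\<^esub>"
      proof
        fix gs show "bar_d G V act 0 f gs = \<zero>\<^bsub>bar G V (Suc 0)\<^esub> gs"
        proof (cases "gs \<in> tuples G (Suc 0)")
          case True then obtain g where g: "gs = [g]" "g \<in> carrier G" by auto
          show ?thesis using *[OF g(2)] a g by (simp add: bar_def)
        qed (simp add: bar_def bar_d_def)
      qed
    qed
  qed
  then show ?thesis by (auto simp: cyc_def)
qed

text \<open>If \<open>V\<close> carries an averaging operator on functions \<open>G \<rightarrow> V\<close>, then \<open>(h f)(g\<^sub>1, \<dots>) = T (y \<mapsto> f(y, g\<^sub>1, \<dots>))\<close>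
  is a contracting homotopy in positive degrees.\<close>

lemma averaging_acyclic:
  fixes T :: "('g \<Rightarrow> 'v) \<Rightarrow> 'v"
  assumes closed: "\<And>F. F \<in> carrier G \<rightarrow> carrier V \<Longrightarrow> T F \<in> carrier V"
    and cong: "\<And>F F'. F \<in> carrier G \<rightarrow> carrier V \<Longrightarrow> (\<And>y. y \<in> carrier G \<Longrightarrow> F y = F' y) \<Longrightarrow> T F = T F'"
    and add: "\<And>F F'. F \<in> carrier G \<rightarrow> carrier V \<Longrightarrow> F' \<in> carrier G \<rightarrow> carrier V \<Longrightarrow>
      T (\<lambda>y. F y \<oplus>\<^bsub>V\<^esub> F' y) = T F \<oplus>\<^bsub>V\<^esub> T F'"
    and orbit: "\<And>x. x \<in> carrier V \<Longrightarrow> T (\<lambda>y. act y x) = x"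
    and shift: "\<And>F g. F \<in> carrier G \<rightarrow> carrier V \<Longrightarrow> g \<in> carrier G \<Longrightarrow> T (\<lambda>y. F (y \<otimes>\<^bsub>G\<^esub> g)) = act g (T F)"
  shows "bnd (bar G V) (bar_d G V act) (Suc n) = cyc (bar G V) (bar_d G V act) (Suc n)"
proof
  show "cyc (bar G V) (bar_d G V act) (Suc n) \<subseteq> bnd (bar G V) (bar_d G V act) (Suc n)"
  proof
    fix f assume "f \<in> cyc (bar G V) (bar_d G V act) (Suc n)"
    then have fE: "f \<in> tuples G (Suc n) \<rightarrow>\<^sub>E carrier V" and df: "bar_d G V act (Suc n) f = \<zero>\<^bsub>bar G V (Suc (Suc n))\<^esub>"
      by (auto simp: cyc_def bar_def)
    have T_zero: "T (\<lambda>y. \<zero>\<^bsub>V\<^esub>) = \<zero>\<^bsub>V\<^esub>"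
      using add[of "\<lambda>y. \<zero>\<^bsub>V\<^esub>" "\<lambda>y. \<zero>\<^bsub>V\<^esub>"] closed[of "\<lambda>y. \<zero>\<^bsub>V\<^esub>"] by auto
    have T_neg: "T (\<lambda>y. \<ominus>\<^bsub>V\<^esub> F y) = \<ominus>\<^bsub>V\<^esub> T F" if F: "F \<in> carrier G \<rightarrow> carrier V" for F
    proof -
      have F': "(\<lambda>y. \<ominus>\<^bsub>V\<^esub> F y) \<in> carrier G \<rightarrow> carrier V" using F by auto
      have "T (\<lambda>y. \<ominus>\<^bsub>V\<^esub> F y \<oplus>\<^bsub>V\<^esub> F y) = T (\<lambda>y. \<zero>\<^bsub>V\<^esub>)" using F by (intro cong V.M.l_neg) (auto simp: Pi_iff)
      then have "T (\<lambda>y. \<ominus>\<^bsub>V\<^esub> F y) \<oplus>\<^bsub>V\<^esub> T F = \<zero>\<^bsub>V\<^esub>" using add[OF F' F] T_zero by simp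
      then show ?thesis using V.M.minus_equality closed[OF F] closed[OF F'] by simp
    qed
    have T_rest: "bar_rest G V (\<lambda>zs. T (\<lambda>y. F y zs)) gs = T (\<lambda>y. bar_rest G V (F y) gs)"
      if "\<And>y. y \<in> carrier G \<Longrightarrow> F y \<in> tuples G m \<rightarrow> carrier V" "gs \<in> tuples G (Suc m)" for F gs m
      using that
    proof (induct m arbitrary: F gs)
      case 0
      then have "(\<lambda>y. F y []) \<in> carrier G \<rightarrow> carrier V" by auto
      then show ?case using 0 T_neg by auto
    next
      case (Suc m)
      obtain y g hs where gs: "gs = y # g # hs" "y \<in> carrier G" "g \<in> carrier G" "hs \<in> tuples G m"
        using Suc.prems(2) by (auto elim!: tuples_SucE)
      have F': "(\<lambda>zs. F x (y # zs)) \<in> tuples G m \<rightarrow> carrier V" if "x \<in> carrier G" for x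
        using Suc.prems(1)[OF that] gs by auto
      have IH: "bar_rest G V (\<lambda>zs. T (\<lambda>x. F x (y # zs))) (g # hs) = T (\<lambda>x. bar_rest G V (\<lambda>zs. F x (y # zs)) (g # hs))"
        using Suc.hyps[of "\<lambda>x zs. F x (y # zs)" "g # hs", OF F'] gs by simp
      have 1: "(\<lambda>x. F x ((y \<otimes>\<^bsub>G\<^esub> g) # hs)) \<in> carrier G \<rightarrow> carrier V" using Suc.prems(1) gs by (auto simp: Pi_iff)
      have 2: "(\<lambda>x. bar_rest G V (\<lambda>zs. F x (y # zs)) (g # hs)) \<in> carrier G \<rightarrow> carrier V"
        by (rule Pi_I, rule rest_closed[OF F']) (use gs in auto)
      have 3: "(\<lambda>x. \<ominus>\<^bsub>V\<^esub> F x ((y \<otimes>\<^bsub>G\<^esub> g) # hs)) \<in> carrier G \<rightarrow> carrier V"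
         "(\<lambda>x. \<ominus>\<^bsub>V\<^esub> bar_rest G V (\<lambda>zs. F x (y # zs)) (g # hs)) \<in> carrier G \<rightarrow> carrier V" using 1 2 by auto
      show ?case using gs IH add[OF 3] T_neg[OF 1] T_neg[OF 2] by simp
    qed
    define h where "h = (\<lambda>gs\<in>tuples G n. T (\<lambda>y. f (y # gs)))"
    have fy: "(\<lambda>y. f (y # gs)) \<in> carrier G \<rightarrow> carrier V" if "gs \<in> tuples G n" for gs
      using fE that by auto
    have h: "h \<in> carrier (bar G V n)" using closed[OF fy] by (simp add: h_def bar_def)
    moreover have "bar_d G V act n h = f"
    proof
      fix gs show "bar_d G V act n h gs = f gs"
      proof (cases "gs \<in> tuples G (Suc n)")
        case True
        then obtain g hs where gs: "gs = g # hs" "g \<in> carrier G" "hs \<in> tuples G n" by (rule tuples_SucE)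
        have fgs: "f gs \<in> carrier V" using fE True by auto
        have fy': "(\<lambda>zs. f (y # zs)) \<in> tuples G n \<rightarrow> carrier V" if "y \<in> carrier G" for y using that fE by auto
        have rc: "bar_rest G V (\<lambda>zs. f (y # zs)) gs \<in> carrier V" if "y \<in> carrier G" for y
          by (rule rest_closed[OF fy'[OF that] True])
        have sc: "f ((y \<otimes>\<^bsub>G\<^esub> g) # hs) \<in> carrier V" if "y \<in> carrier G" for y using fE gs that by auto
        \<comment> \<open>The cocycle condition at \<open>y # gs\<close> is solved for the term
          \<open>y f(gs)\<close>. Applying \<open>T\<close> in the variable \<open>y\<close> turns
          this term into \<open>f gs\<close> by \<open>orbit\<close> and the right-hand side into
          the coboundary of \<open>h\<close> by \<open>shift\<close>.\<close>
        have "act y (f gs) = f ((y \<otimes>\<^bsub>G\<^esub> g) # hs) \<oplus>\<^bsub>V\<^esub> bar_rest G V (\<lambda>zs. f (y # zs)) gs" if y: "y \<in> carrier G" for y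
        proof -
          have "bar_d G V act (Suc n) f (y # gs) = \<zero>\<^bsub>V\<^esub>" using df y True by (simp add: bar_def)
          then have "act y (f gs) \<ominus>\<^bsub>V\<^esub> (f ((y \<otimes>\<^bsub>G\<^esub> g) # hs) \<oplus>\<^bsub>V\<^esub> bar_rest G V (\<lambda>zs. f (y # zs)) gs) = \<zero>\<^bsub>V\<^esub>"
            using y True gs rc[OF y] sc[OF y] by (simp add: bar_d_Cons a_minus_def V.M.minus_add)
          then show ?thesis using V.M.minus_eq_zero_iff y fgs rc[OF y] sc[OF y] by auto
        qed
        then have "T (\<lambda>y. act y (f gs)) = T (\<lambda>y. f ((y \<otimes>\<^bsub>G\<^esub> g) # hs) \<oplus>\<^bsub>V\<^esub> bar_rest G V (\<lambda>zs. f (y # zs)) gs)"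
          using fgs by (intro cong) auto
        also have "\<dots> = T (\<lambda>y. f ((y \<otimes>\<^bsub>G\<^esub> g) # hs)) \<oplus>\<^bsub>V\<^esub> T (\<lambda>y. bar_rest G V (\<lambda>zs. f (y # zs)) gs)"
          using rc sc by (intro add) auto
        also have "T (\<lambda>y. f ((y \<otimes>\<^bsub>G\<^esub> g) # hs)) = act g (h hs)"
          using shift[OF fy[OF gs(3)] gs(2)] gs by (simp add: h_def)
        also have "T (\<lambda>y. bar_rest G V (\<lambda>zs. f (y # zs)) gs) = bar_rest G V (\<lambda>zs. T (\<lambda>y. f (y # zs))) gs"
          by (rule T_rest[symmetric, OF fy' True])
        also have "\<dots> = bar_rest G V h gs"
          by (rule rest_cong[OF _ True]) (simp add: h_def)
        finally show ?thesis using orbit[OF fgs] gs by (simp add: bar_d_Cons)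
      next
        case False then show ?thesis using fE by (auto simp: bar_d_def PiE_iff extensional_def)
      qed
    qed
    ultimately show "f \<in> bnd (bar G V) (bar_d G V act) (Suc n)" by (auto simp: bnd_def)
  qed
qed (rule bar_cx.bnd_cyc)

end

lemma (in cochain_cx) euler_concentrated:
  assumes "\<And>n. bnd V \<delta> (Suc n) = cyc V \<delta> (Suc n)" "reldim K (V 0) {\<zero>\<^bsub>V 0\<^esub>} (cyc V \<delta> 0) k"
  shows "total_finite K V \<delta>" "cx_euler K V \<delta> = int k"
proof -
  have 0: "reldim K (V 0) (bnd V \<delta> 0) (cyc V \<delta> 0) k" using assms(2) by (simp add: bnd_def)
  have "\<exists>k. reldim K (V n) (bnd V \<delta> n) (cyc V \<delta> n) k" for n
  proof (cases n)
    case (Suc m)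
    then show ?thesis using assms(1)[of m] reldim_refl[of K "V n" "cyc V \<delta> n"] by auto
  qed (use 0 in auto)
  moreover have sub: "{n. bnd V \<delta> n \<noteq> cyc V \<delta> n} \<subseteq> {..<1}"
  proof
    fix n assume "n \<in> {n. bnd V \<delta> n \<noteq> cyc V \<delta> n}"
    then show "n \<in> {..<1}" using assms(1) by (cases n) auto
  qed
  ultimately show tf: "total_finite K V \<delta>"
    unfolding total_finite_def using finite_subset by blast
  show "cx_euler K V \<delta> = int k" using cx_euler_sum[OF tf sub] hdim_eq[OF 0] by simp
qed

subsection \<open>Modules over group rings\<close>

lemma gr_single_mult:
  assumes "ring R" "group G" "c \<in> carrier R" "d \<in> carrier R" "g \<in> carrier G" "h \<in> carrier G"
  shows "gr_single R c g \<otimes>\<^bsub>group_ring R G\<^esub> gr_single R d h = gr_single R (c \<otimes>\<^bsub>R\<^esub> d) (g \<otimes>\<^bsub>G\<^esub> h)"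
proof
  interpret R: ring R by fact
  interpret G: group G by fact
  fix x
  have *: "inv\<^bsub>G\<^esub> g \<otimes>\<^bsub>G\<^esub> x = h \<longleftrightarrow> x = g \<otimes>\<^bsub>G\<^esub> h" if "x \<in> carrier G"
    using assms that by (metis G.inv_solve_left)
  show "(gr_single R c g \<otimes>\<^bsub>group_ring R G\<^esub> gr_single R d h) x = gr_single R (c \<otimes>\<^bsub>R\<^esub> d) (g \<otimes>\<^bsub>G\<^esub> h) x"
  \<comment> \<open>The product of \<open>group_ring\<close> is a sum over the support of the left
    factor, which is empty for \<open>c = 0\<close> and a single point otherwise.\<close>
  proof (cases "c = \<zero>\<^bsub>R\<^esub>")
    case True
    then have "{k. gr_single R c g k \<noteq> \<zero>\<^bsub>R\<^esub>} = {}" by (auto simp: gr_single_def)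
    then show ?thesis using True assms by (auto simp: group_ring_def gr_single_def)
  next
    case False
    then have "{k. gr_single R c g k \<noteq> \<zero>\<^bsub>R\<^esub>} = {g}" by (auto simp: gr_single_def)
    then show ?thesis using assms * by (auto simp: group_ring_def gr_single_def)
  qed
qed

lemma gr_single_closed: "ring R \<Longrightarrow> c \<in> carrier R \<Longrightarrow> g \<in> carrier G \<Longrightarrow> gr_single R c g \<in> carrier (group_ring R G)"
  by (auto simp: group_ring_def gr_single_def ring.ring_simprules(2))

lemma gr_single_add:
  "ring R \<Longrightarrow> c \<in> carrier R \<Longrightarrow> d \<in> carrier R \<Longrightarrow>
    gr_single R c g \<oplus>\<^bsub>group_ring R G\<^esub> gr_single R d g = gr_single R (c \<oplus>\<^bsub>R\<^esub> d) g"
  by (auto simp: group_ring_def gr_single_def ring.ring_simprules(2,8))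

lemma gr_single_one: "gr_single R \<one>\<^bsub>R\<^esub> \<one>\<^bsub>G\<^esub> = \<one>\<^bsub>group_ring R G\<^esub>"
  by (auto simp: group_ring_def gr_single_def)

lemma gr_single_zero: "gr_single R \<zero>\<^bsub>R\<^esub> g = \<zero>\<^bsub>group_ring R G\<^esub>"
  by (auto simp: group_ring_def gr_single_def)

abbreviation "scal K G M \<equiv> restrict_scalars (\<lambda>c. gr_single K c \<one>\<^bsub>G\<^esub>) M"
abbreviation "gact K M \<equiv> (\<lambda>g x. gr_single K \<one>\<^bsub>K\<^esub> g \<odot>\<^bsub>M\<^esub> x)"

lemma restrict_scalars_simps [simp]:
  "carrier (restrict_scalars \<phi> M) = carrier M" "\<zero>\<^bsub>restrict_scalars \<phi> M\<^esub> = \<zero>\<^bsub>M\<^esub>"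
  "x \<oplus>\<^bsub>restrict_scalars \<phi> M\<^esub> y = x \<oplus>\<^bsub>M\<^esub> y" "c \<odot>\<^bsub>restrict_scalars \<phi> M\<^esub> x = \<phi> c \<odot>\<^bsub>M\<^esub> x"
  "\<ominus>\<^bsub>restrict_scalars \<phi> M\<^esub> x = \<ominus>\<^bsub>M\<^esub> x"
  by (auto simp: restrict_scalars_def a_inv_def m_inv_def)

lemma krep_of_module:
  assumes "group G" "field K" "left_module (group_ring K G) M"
  shows "krep G K (scal K G M) (gact K M)"
proof -
  interpret G: group G by fact
  interpret K: field K by fact
  interpret M: left_module "group_ring K G" M by fact
  note s = gr_single_closed[OF K.ring_axioms] gr_single_mult[OF K.ring_axioms G.group_axioms, symmetric]
    gr_single_add[OF K.ring_axioms, symmetric] gr_single_one gr_single_zero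
  have "vspace K (scal K G M)"
    apply (rule vspaceI[OF assms(2)])
    using s(2)[of _ _ "\<one>\<^bsub>G\<^esub>" "\<one>\<^bsub>G\<^esub>"]
    by (auto simp: s(1) M.M.a_ac gr_single_one gr_single_zero[where G=G]
       gr_single_add[OF K.ring_axioms, symmetric, where G=G] M.smult_l_distr M.smult_r_distr M.smult_assoc M.smult_one M.smult_zero_scalar)
  moreover have "gr_single K \<one>\<^bsub>K\<^esub> g \<odot>\<^bsub>M\<^esub> (gr_single K c \<one>\<^bsub>G\<^esub> \<odot>\<^bsub>M\<^esub> x) = gr_single K c \<one>\<^bsub>G\<^esub> \<odot>\<^bsub>M\<^esub> (gr_single K \<one>\<^bsub>K\<^esub> g \<odot>\<^bsub>M\<^esub> x)"
    if "g \<in> carrier G" "c \<in> carrier K" "x \<in> carrier M" for g c x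
    using that by (simp add: M.smult_assoc[symmetric] s(1) gr_single_mult[OF K.ring_axioms G.group_axioms])
  ultimately show ?thesis
    by (intro krep.intro krep_axioms.intro assms)
      (auto simp: s(1) M.smult_r_distr gr_single_one M.smult_assoc[symmetric]
        gr_single_mult[OF K.ring_axioms G.group_axioms] M.smult_one)
qed

lemma bar_rest_restrict_scalars: "bar_rest G (restrict_scalars \<phi> M) f gs = bar_rest G M f gs"
  by (induct G M f gs rule: bar_rest.induct) simp_all

lemma cochain_module_eq: "cochain_module K G M n = bar G (scal K G M) n"
  by (simp add: cochain_module_def bar_def fun_mod_def)

lemma codiff_eq:
  assumes "group G" "field K" "left_module (group_ring K G) M" "f \<in> carrier (bar G (scal K G M) n)"
  shows "codiff K G M n f = bar_d G (scal K G M) (gact K M) n f"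
proof -
  interpret G: group G by fact
  interpret M: left_module "group_ring K G" M by fact
  interpret R: krep G K "scal K G M" "gact K M" by (rule krep_of_module) fact+
  have f: "f \<in> tuples G n \<rightarrow> carrier M" using assms(4) by (auto simp: bar_def)
  show ?thesis unfolding codiff_def bar_d_def bar_rest_restrict_scalars
  proof (rule restrict_ext)
    fix gs assume gs: "gs \<in> tuples G (Suc n)"
    obtain y hs where ys: "gs = y # hs" "y \<in> carrier G" "hs \<in> tuples G n" using gs by (rule tuples_SucE)
    let ?t = "\<lambda>j. [((- 1 :: int) ^ Suc j)] \<cdot>\<^bsub>M\<^esub> f (take j gs @ (gs ! j \<otimes>\<^bsub>G\<^esub> gs ! Suc j) # drop (j + 2) gs)"
    have "?t \<in> {..<n} \<rightarrow> carrier M"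
    proof
      fix j assume j: "j \<in> {..<n}"
      have zs: "set gs \<subseteq> carrier G" "length gs = Suc n" using gs by (auto simp: tuples_def)
      then have "gs ! j \<in> carrier G" "gs ! Suc j \<in> carrier G" using j by (auto intro: nth_mem[THEN subsetD[OF zs(1)]])
      moreover have "set (take j gs) \<subseteq> carrier G" "set (drop (j + 2) gs) \<subseteq> carrier G"
        using zs set_take_subset[of j gs] set_drop_subset[of "j + 2" gs] by auto
      ultimately have "take j gs @ (gs ! j \<otimes>\<^bsub>G\<^esub> gs ! Suc j) # drop (j + 2) gs \<in> tuples G n"
        using zs j by (auto simp: tuples_def)
      then have "f (take j gs @ (gs ! j \<otimes>\<^bsub>G\<^esub> gs ! Suc j) # drop (j + 2) gs) \<in> carrier M" using f by blast
      then show "?t j \<in> carrier M" by (rule M.M.add.int_pow_closed)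
    qed
    then have "(\<Oplus>\<^bsub>M\<^esub>j\<in>{..<n}. ?t j) \<in> carrier M" by (rule M.M.finsum_closed)
    moreover have "[((- 1 :: int) ^ Suc n)] \<cdot>\<^bsub>M\<^esub> f (butlast gs) \<in> carrier M"
    proof (rule M.M.add.int_pow_closed)
      have "butlast gs \<in> tuples G n" using gs by (auto simp: tuples_def dest: in_set_butlastD)
      then show "f (butlast gs) \<in> carrier M" using f by blast
    qed
    moreover have "gr_single K \<one>\<^bsub>K\<^esub> (hd gs) \<odot>\<^bsub>M\<^esub> f (tl gs) \<in> carrier M"
      using R.act_closed[of "hd gs" "f (tl gs)"] ys f by auto
    ultimately show "gr_single K \<one>\<^bsub>K\<^esub> (hd gs) \<odot>\<^bsub>M\<^esub> f (tl gs) \<oplus>\<^bsub>M\<^esub> (\<Oplus>\<^bsub>M\<^esub>j\<in>{..<n}. ?t j)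
      \<oplus>\<^bsub>M\<^esub> ([((- 1 :: int) ^ Suc n)] \<cdot>\<^bsub>M\<^esub> f (butlast gs)) =
      gr_single K \<one>\<^bsub>K\<^esub> (hd gs) \<odot>\<^bsub>M\<^esub> f (tl gs) \<oplus>\<^bsub>scal K G M\<^esub> bar_rest G M f gs"
      using bar_rest_eq_sum[OF assms(1) M.M.abelian_group_axioms f gs] M.M.a_assoc by simp
  qed
qed

text \<open>Everything about cohomology groups is moved to pairs of coboundaries and cocycles here;
  the later arguments work with \<open>total_finite\<close> and \<open>cx_euler\<close>
  only.\<close>

lemma group_cohomology_bar:
  fixes M :: "('g \<Rightarrow> 'k, 'm) module"
  assumes "group G" "field K" "left_module (group_ring K G) M"
  defines "V \<equiv> bar G (scal K G M)" and "\<delta> \<equiv> bar_d G (scal K G M) (gact K M)"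
  shows "euler_char_finite K G M \<longleftrightarrow> total_finite K V \<delta>"
    and "total_finite K V \<delta> \<Longrightarrow> euler_char K G M = cx_euler K V \<delta>"
proof -
  interpret R: krep G K "scal K G M" "gact K M" by (rule krep_of_module) fact+
  interpret cochain_cx K V \<delta> unfolding V_def \<delta>_def by (rule R.bar_cx.cochain_cx_axioms)
  have z: "cocycles K G M n = cyc V \<delta> n" for n
    using codiff_eq[OF assms(1-3)] by (auto simp: cocycles_def cyc_def V_def \<delta>_def cochain_module_eq)
  have b: "coboundaries K G M n = bnd V \<delta> n" for n
    using codiff_eq[OF assms(1-3)] 
    by (auto simp: coboundaries_def bnd_def V_def \<delta>_def cochain_module_eq split: nat.split)
  have H: "group_cohomology K G M n = quot_module ((V n)\<lparr>carrier := cyc V \<delta> n\<rparr>) (bnd V \<delta> n)" for n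
    unfolding group_cohomology_def z b by (simp add: V_def cochain_module_eq)
  have vH: "vspace K (group_cohomology K G M n)" for n
  proof -
    interpret Z: vspace K "(V n)\<lparr>carrier := cyc V \<delta> n\<rparr>" by (rule vspace.vspace_subspace[OF vs subspace_cyc])
    have "subspace_of K ((V n)\<lparr>carrier := cyc V \<delta> n\<rparr>) (bnd V \<delta> n)"
      using vspace.subspace_of_carrier_update[OF vs bnd_cyc] subspace_ofD(1)[OF subspace_cyc] subspace_bnd by metis
    then show ?thesis unfolding H by (rule Z.vspace_quot_module)
  qed
  have d: "reldim K (group_cohomology K G M n) {\<zero>\<^bsub>group_cohomology K G M n\<^esub>} (carrier (group_cohomology K G M n)) k \<longleftrightarrow>
    reldim K (V n) (bnd V \<delta> n) (cyc V \<delta> n) k" for n k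
    unfolding H by (rule vspace.reldim_subquotient[OF vs subspace_cyc subspace_bnd bnd_cyc])
  have 0: "zero_module (group_cohomology K G M n) \<longleftrightarrow> bnd V \<delta> n = cyc V \<delta> n" for n
  proof -
    have "zero_module (group_cohomology K G M n) \<longleftrightarrow>
      reldim K (group_cohomology K G M n) {\<zero>\<^bsub>group_cohomology K G M n\<^esub>} (carrier (group_cohomology K G M n)) 0"
      unfolding zero_module_def
      using reldim_refl[of K "group_cohomology K G M n" "{\<zero>\<^bsub>group_cohomology K G M n\<^esub>}"]
      by (auto elim: reldim.cases)
    also have "\<dots> \<longleftrightarrow> bnd V \<delta> n = cyc V \<delta> n"
      unfolding d using reldim_refl[of K "V n" "bnd V \<delta> n"] by (auto elim: reldim.cases)
    finally show ?thesis .
  qed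
  show "euler_char_finite K G M \<longleftrightarrow> total_finite K V \<delta>"
    unfolding euler_char_finite_def total_finite_def vspace.finite_dim_iff[OF vH] d 0 ..
  assume tf: "total_finite K V \<delta>"
  have "vdim K (group_cohomology K G M n) = hdim K V \<delta> n" for n
  proof -
    obtain k where k: "reldim K (V n) (bnd V \<delta> n) (cyc V \<delta> n) k" using tf by (auto simp: total_finite_def)
    show ?thesis using vspace.vdim_eq[OF vH] d k hdim_eq[OF k] by metis
  qed
  then show "euler_char K G M = cx_euler K V \<delta>" by (simp add: euler_char_def cx_euler_def)
qed

section \<open>Permutation modules and their duals\<close>

lemma (in krep) krep_subspace:
  assumes U: "subspace_of K V U" and stable: "\<And>g x. g \<in> carrier G \<Longrightarrow> x \<in> U \<Longrightarrow> act g x \<in> U"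
  shows "krep G K (V\<lparr>carrier := U\<rparr>) act"
  using subspace_ofD[OF U] stable
  by (intro krep.intro krep_axioms.intro G.group_axioms V.vspace_subspace[OF U])
    (auto simp: act_add act_smult act_mult)

section \<open>Representations on groups of additive maps\<close>

text \<open>The functions are extensional, so that agreement on \<open>carrier C\<close> is
  equality. No equivariance is imposed: these are homomorphisms over the integers.\<close>

definition add_homs :: "('a, 'x) ring_scheme \<Rightarrow> ('b, 'y) ring_scheme \<Rightarrow> ('a \<Rightarrow> 'b) set"
  where "add_homs C V = {f \<in> carrier C \<rightarrow>\<^sub>E carrier V. \<forall>x\<in>carrier C. \<forall>y\<in>carrier C. f (x \<oplus>\<^bsub>C\<^esub> y) = f x \<oplus>\<^bsub>V\<^esub> f y}"

definition hom_rep :: "('c, 'x) ring_scheme \<Rightarrow> ('k, 'v, 'y) module_scheme \<Rightarrow> ('k, 'c \<Rightarrow> 'v) module"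
  where "hom_rep C V = (fun_mod (carrier C) V)\<lparr>carrier := add_homs C V\<rparr>"

text \<open>The usual conjugation action on homomorphisms. As \<open>C\<close> is a right module,
  the inverse of \<open>g\<close> acting from the left on \<open>c\<close> is \<open>c g\<close>,
  whence the absence of an inverse in the formula.\<close>

definition hom_act :: "('c, 'x) ring_scheme \<Rightarrow> ('c \<Rightarrow> 'g \<Rightarrow> 'c) \<Rightarrow> ('g \<Rightarrow> 'v \<Rightarrow> 'v) \<Rightarrow> 'g \<Rightarrow> ('c \<Rightarrow> 'v) \<Rightarrow> 'c \<Rightarrow> 'v"
  where "hom_act C ract act g l = (\<lambda>c\<in>carrier C. act g (l (ract c g)))"

lemma hom_rep_simps [simp]:
  "carrier (hom_rep C V) = add_homs C V"
  "\<zero>\<^bsub>hom_rep C V\<^esub> = (\<lambda>s\<in>carrier C. \<zero>\<^bsub>V\<^esub>)"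
  "f \<oplus>\<^bsub>hom_rep C V\<^esub> f' = (\<lambda>s\<in>carrier C. f s \<oplus>\<^bsub>V\<^esub> f' s)"
  "c \<odot>\<^bsub>hom_rep C V\<^esub> f = (\<lambda>s\<in>carrier C. c \<odot>\<^bsub>V\<^esub> f s)"
  by (auto simp: hom_rep_def)

lemma add_homsD:
  assumes "f \<in> add_homs C V"
  shows "\<And>x. x \<in> carrier C \<Longrightarrow> f x \<in> carrier V"
    "\<And>x y. x \<in> carrier C \<Longrightarrow> y \<in> carrier C \<Longrightarrow> f (x \<oplus>\<^bsub>C\<^esub> y) = f x \<oplus>\<^bsub>V\<^esub> f y"
    "f \<in> extensional (carrier C)"
  using assms by (auto simp: add_homs_def PiE_iff)

lemma add_homsI:
  assumes "\<And>x. x \<in> carrier C \<Longrightarrow> f x \<in> carrier V"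
    "\<And>x y. x \<in> carrier C \<Longrightarrow> y \<in> carrier C \<Longrightarrow> x \<oplus>\<^bsub>C\<^esub> y \<in> carrier C \<Longrightarrow> f (x \<oplus>\<^bsub>C\<^esub> y) = f x \<oplus>\<^bsub>V\<^esub> f y"
    "abelian_group C"
  shows "restrict f (carrier C) \<in> add_homs C V"
proof -
  interpret abelian_group C by fact
  show ?thesis using assms by (auto simp: add_homs_def)
qed

lemma add_homs_zero:
  assumes "abelian_group C" "abelian_group V" "f \<in> add_homs C V"
  shows "f \<zero>\<^bsub>C\<^esub> = \<zero>\<^bsub>V\<^esub>"
proof -
  interpret C: abelian_group C by fact
  interpret V: abelian_group V by fact
  have "f \<zero>\<^bsub>C\<^esub> \<oplus>\<^bsub>V\<^esub> f \<zero>\<^bsub>C\<^esub> = f \<zero>\<^bsub>C\<^esub>" using add_homsD(2)[OF assms(3), of "\<zero>\<^bsub>C\<^esub>" "\<zero>\<^bsub>C\<^esub>"] by simp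
  then show ?thesis using add_homsD(1)[OF assms(3), of "\<zero>\<^bsub>C\<^esub>"] V.add.l_cancel_one' by simp
qed

lemma add_homs_a_inv:
  assumes "abelian_group C" "abelian_group V" "f \<in> add_homs C V" "x \<in> carrier C"
  shows "f (\<ominus>\<^bsub>C\<^esub> x) = \<ominus>\<^bsub>V\<^esub> f x"
proof -
  interpret C: abelian_group C by fact
  interpret V: abelian_group V by fact
  have "f (\<ominus>\<^bsub>C\<^esub> x) \<oplus>\<^bsub>V\<^esub> f x = \<zero>\<^bsub>V\<^esub>"
    using add_homsD(2)[OF assms(3), of "\<ominus>\<^bsub>C\<^esub> x" x] assms(4) add_homs_zero[OF assms(1-3)] by (simp add: C.l_neg)
  then show ?thesis using add_homsD(1)[OF assms(3)] assms(4) V.minus_equality by simp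
qed

locale right_gmod = G: group G + C: abelian_group C
  for G :: "('g, 'gz) monoid_scheme" and C :: "('c, 'cz) ring_scheme" +
  fixes ract :: "'c \<Rightarrow> 'g \<Rightarrow> 'c"
  assumes ract_closed [simp, intro]: "\<And>x g. x \<in> carrier C \<Longrightarrow> g \<in> carrier G \<Longrightarrow> ract x g \<in> carrier C"
    and ract_add: "\<And>x y g. x \<in> carrier C \<Longrightarrow> y \<in> carrier C \<Longrightarrow> g \<in> carrier G \<Longrightarrow>
      ract (x \<oplus>\<^bsub>C\<^esub> y) g = ract x g \<oplus>\<^bsub>C\<^esub> ract y g"
    and ract_one [simp]: "\<And>x. x \<in> carrier C \<Longrightarrow> ract x \<one>\<^bsub>G\<^esub> = x"
    and ract_mult: "\<And>x g h. x \<in> carrier C \<Longrightarrow> g \<in> carrier G \<Longrightarrow> h \<in> carrier G \<Longrightarrow>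
      ract x (g \<otimes>\<^bsub>G\<^esub> h) = ract (ract x g) h"

locale hom_module = C: right_gmod G C ract + V: krep G K V act
  for G :: "('g, 'gz) monoid_scheme" and C :: "('c, 'cz) ring_scheme" and ract
    and K :: "('k, 'x) ring_scheme" and V :: "('k, 'v, 'y) module_scheme" and act
begin

lemma subspace_add_homs: "subspace_of K (fun_mod (carrier C) V) (add_homs C V)"
  unfolding subspace_of_def
  by (auto simp: add_homs_def V.V.M.a_ac V.V.smult_r_distr PiE_iff extensional_def)

lemma hom_act_closed:
  assumes "g \<in> carrier G" "l \<in> add_homs C V"
  shows "hom_act C ract act g l \<in> add_homs C V"
  unfolding hom_act_def
  by (rule add_homsI[OF _ _ C.C.abelian_group_axioms])
    (use assms add_homsD[OF assms(2)] in \<open>auto simp: C.ract_add V.act_add\<close>)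

lemma krep_hom: "krep G K (hom_rep C V) (hom_act C ract act)"
proof (intro krep.intro krep_axioms.intro)
  show "group G" by (rule C.G.group_axioms)
  show "vspace K (hom_rep C V)" unfolding hom_rep_def
    by (rule vspace.vspace_subspace[OF V.V.vspace_fun_mod subspace_add_homs])
  show "hom_act C ract act \<one>\<^bsub>G\<^esub> l = l" if "l \<in> carrier (hom_rep C V)" for l
    using that add_homsD[of l C V] by (intro ext) (auto simp: hom_act_def extensional_def)
  show "hom_act C ract act g l \<in> carrier (hom_rep C V)" if "g \<in> carrier G" "l \<in> carrier (hom_rep C V)" for g l
    using that hom_act_closed by simp
qed (auto simp: hom_act_def V.act_add V.act_smult V.act_mult C.ract_mult add_homsD(1)
  intro!: restrict_ext)

end

section \<open>Duals of permutation modules\<close>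

text \<open>A permutation module seen through its maps into \<open>V\<close>: the elements
  \<open>e k x\<close> generate, by \<open>uniq\<close>, and the only relations that maps into
  \<open>V\<close> can detect are \<open>e k (h x) = e k x\<close>, by \<open>univ\<close>. No
  isomorphism with a concrete module has to be carried along.\<close>

locale permutation_hom = hom_module G C ract K V act
  for G :: "('g, 'gz) monoid_scheme" and C :: "('c, 'cz) ring_scheme" and ract
    and K :: "('k, 'x) ring_scheme" and V :: "('k, 'v, 'y) module_scheme" and act +
  fixes I :: "'i set" and H :: "'i \<Rightarrow> 'g set" and e :: "'i \<Rightarrow> 'c"
  assumes I: "finite I" and H: "\<And>k. k \<in> I \<Longrightarrow> subgroup (H k) G" "\<And>k. k \<in> I \<Longrightarrow> finite (H k)"
    and e: "\<And>k. k \<in> I \<Longrightarrow> e k \<in> carrier C" "\<And>k h. k \<in> I \<Longrightarrow> h \<in> H k \<Longrightarrow> ract (e k) h = e k"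
    and uniq: "\<And>l l'. l \<in> add_homs C V \<Longrightarrow> l' \<in> add_homs C V \<Longrightarrow>
      (\<And>k x. k \<in> I \<Longrightarrow> x \<in> carrier G \<Longrightarrow> l (ract (e k) x) = l' (ract (e k) x)) \<Longrightarrow> l = l'"
    and univ: "\<And>u. (\<And>k x. k \<in> I \<Longrightarrow> x \<in> carrier G \<Longrightarrow> u k x \<in> carrier V) \<Longrightarrow>
      (\<And>k h x. k \<in> I \<Longrightarrow> h \<in> H k \<Longrightarrow> x \<in> carrier G \<Longrightarrow> u k (h \<otimes>\<^bsub>G\<^esub> x) = u k x) \<Longrightarrow>
      \<exists>l\<in>add_homs C V. \<forall>k\<in>I. \<forall>x\<in>carrier G. l (ract (e k) x) = u k x"
begin

interpretation hom: krep G K "hom_rep C V" "hom_act C ract act" by (rule krep_hom)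

lemma H_mem: "k \<in> I \<Longrightarrow> h \<in> H k \<Longrightarrow> h \<in> carrier G"
  using H(1) subgroup.mem_carrier by metis

lemma smult_nat: "v \<in> carrier V \<Longrightarrow> ([n] \<cdot>\<^bsub>K\<^esub> \<one>\<^bsub>K\<^esub>) \<odot>\<^bsub>V\<^esub> v = [n] \<cdot>\<^bsub>V\<^esub> v" for n :: nat
  by (induct n) (auto simp: V.V.smult_l_distr)

lemma act_finsum:
  assumes "finite A" "f \<in> A \<rightarrow> carrier V" "g \<in> carrier G"
  shows "act g (\<Oplus>\<^bsub>V\<^esub>h\<in>A. f h) = (\<Oplus>\<^bsub>V\<^esub>h\<in>A. act g (f h))"
  using assms by (induct A) (auto simp: V.act_add Pi_iff)

text \<open>Right multiplication by \<open>h'\<close> permutes \<open>H k\<close>. This makes the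
  mean over \<open>H k\<close> a function of the coset of \<open>x\<close>, as \<open>univ\<close>
  demands.\<close>

lemma finsum_translate:
  assumes "k \<in> I" "h' \<in> H k" "f \<in> carrier G \<rightarrow> carrier V" "x \<in> carrier G"
  shows "(\<Oplus>\<^bsub>V\<^esub>h\<in>H k. f (h \<otimes>\<^bsub>G\<^esub> (h' \<otimes>\<^bsub>G\<^esub> x))) = (\<Oplus>\<^bsub>V\<^esub>h\<in>H k. f (h \<otimes>\<^bsub>G\<^esub> x))"
proof -
  interpret S: subgroup "H k" G by (rule H(1)[OF assms(1)])
  have "(\<lambda>h. h \<otimes>\<^bsub>G\<^esub> h') ` H k = H k"
  proof
    show "H k \<subseteq> (\<lambda>h. h \<otimes>\<^bsub>G\<^esub> h') ` H k"
    proof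
      fix h assume h: "h \<in> H k"
      then have "h = (h \<otimes>\<^bsub>G\<^esub> inv\<^bsub>G\<^esub> h') \<otimes>\<^bsub>G\<^esub> h'" using assms H_mem by (simp add: C.G.m_assoc)
      moreover have "h \<otimes>\<^bsub>G\<^esub> inv\<^bsub>G\<^esub> h' \<in> H k" using h assms by simp
      ultimately show "h \<in> (\<lambda>h. h \<otimes>\<^bsub>G\<^esub> h') ` H k" by blast
    qed
  qed (use assms in auto)
  moreover have "inj_on (\<lambda>h. h \<otimes>\<^bsub>G\<^esub> h') (H k)" using assms H_mem by (auto intro!: inj_onI)
  ultimately have "(\<Oplus>\<^bsub>V\<^esub>h\<in>H k. f (h \<otimes>\<^bsub>G\<^esub> x)) = (\<Oplus>\<^bsub>V\<^esub>h\<in>H k. f ((h \<otimes>\<^bsub>G\<^esub> h') \<otimes>\<^bsub>G\<^esub> x))"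
    using V.V.M.add.finprod_reindex[of "\<lambda>h. f (h \<otimes>\<^bsub>G\<^esub> x)" "\<lambda>h. h \<otimes>\<^bsub>G\<^esub> h'" "H k"] assms H_mem by (auto simp: Pi_iff)
  also have "\<dots> = (\<Oplus>\<^bsub>V\<^esub>h\<in>H k. f (h \<otimes>\<^bsub>G\<^esub> (h' \<otimes>\<^bsub>G\<^esub> x)))"
    using assms H_mem by (intro V.V.M.finsum_cong') (auto simp: C.G.m_assoc)
  finally show ?thesis ..
qed

text \<open>The averaging operator sends \<open>F\<close> to the homomorphism whose value at \<open>e\<^sub>k x\<close> is the mean over \<open>h \<in> H\<^sub>k\<close>
  of \<open>(h x)\<^sup>-\<^sup>1 F(h x)(e\<^sub>k)\<close>.\<close>

theorem hom_acyclic: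
  assumes char: "\<And>k. k \<in> I \<Longrightarrow> [card (H k)] \<cdot>\<^bsub>K\<^esub> \<one>\<^bsub>K\<^esub> \<noteq> \<zero>\<^bsub>K\<^esub>"
  shows "bnd (bar G (hom_rep C V)) (bar_d G (hom_rep C V) (hom_act C ract act)) (Suc n) =
    cyc (bar G (hom_rep C V)) (bar_d G (hom_rep C V) (hom_act C ract act)) (Suc n)"
proof -
  have "\<exists>c\<in>carrier K. c \<otimes>\<^bsub>K\<^esub> ([card (H k)] \<cdot>\<^bsub>K\<^esub> \<one>\<^bsub>K\<^esub>) = \<one>\<^bsub>K\<^esub>" if "k \<in> I" for k
    using V.V.inverse_scalar[OF _ char[OF that]] by (metis V.V.R.add.nat_pow_closed V.V.R.one_closed)
  then obtain c where c: "\<And>k. k \<in> I \<Longrightarrow> c k \<in> carrier K"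
    "\<And>k. k \<in> I \<Longrightarrow> c k \<otimes>\<^bsub>K\<^esub> ([card (H k)] \<cdot>\<^bsub>K\<^esub> \<one>\<^bsub>K\<^esub>) = \<one>\<^bsub>K\<^esub>" by metis
  define w where "w F k y = act (inv\<^bsub>G\<^esub> y) (F y (e k))" for F :: "'g \<Rightarrow> 'c \<Rightarrow> 'v" and k y
  define u where "u F k x = c k \<odot>\<^bsub>V\<^esub> (\<Oplus>\<^bsub>V\<^esub>h\<in>H k. w F k (h \<otimes>\<^bsub>G\<^esub> x))" for F k x
  define P where "P F l \<longleftrightarrow> l \<in> add_homs C V \<and> (\<forall>k\<in>I. \<forall>x\<in>carrier G. l (ract (e k) x) = u F k x)" for F l
  \<comment> \<open>\<open>univ\<close> supplies a homomorphism with the prescribed values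
    \<open>u F\<close>. It is unique by \<open>uniq\<close>, which is also how every law of
    \<open>T\<close> is verified: both sides are compared at the elements
    \<open>e k x\<close>.\<close>
  define T where "T F = (SOME l. P F l)" for F
  have w: "w F k \<in> carrier G \<rightarrow> carrier V" if "F \<in> carrier G \<rightarrow> add_homs C V" "k \<in> I" for F k
  proof
    fix y assume y: "y \<in> carrier G"
    then have "F y \<in> add_homs C V" using that by auto
    from add_homsD(1)[OF this e(1)[OF that(2)]] show "w F k y \<in> carrier V" using y by (simp add: w_def)
  qed
  have wh: "(\<lambda>h. w F k (h \<otimes>\<^bsub>G\<^esub> x)) \<in> H k \<rightarrow> carrier V"
    if "F \<in> carrier G \<rightarrow> add_homs C V" "k \<in> I" "x \<in> carrier G" for F k x
    using w[OF that(1,2)] that H_mem by (auto simp: Pi_iff)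
  have uc: "u F k x \<in> carrier V" if "F \<in> carrier G \<rightarrow> add_homs C V" "k \<in> I" "x \<in> carrier G" for F k x
    using V.V.M.finsum_closed[OF wh[OF that]] c(1) that by (simp add: u_def)
  have T: "P F (T F)" if F: "F \<in> carrier G \<rightarrow> add_homs C V" for F
  proof -
    have "\<exists>l\<in>add_homs C V. \<forall>k\<in>I. \<forall>x\<in>carrier G. l (ract (e k) x) = u F k x"
    proof (rule univ[OF uc[OF F]])
      show "u F k (h \<otimes>\<^bsub>G\<^esub> x) = u F k x" if "k \<in> I" "h \<in> H k" "x \<in> carrier G" for k h x
        unfolding u_def using finsum_translate[OF that(1,2) w[OF F that(1)] that(3)] by simp
    qed
    then obtain l where "P F l" unfolding P_def by blast
    then show ?thesis unfolding T_def by (rule someI[of "P F"])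
  qed
  then have Tc: "T F \<in> add_homs C V" and Te: "\<And>k x. k \<in> I \<Longrightarrow> x \<in> carrier G \<Longrightarrow> T F (ract (e k) x) = u F k x"
    if "F \<in> carrier G \<rightarrow> add_homs C V" for F using that unfolding P_def by blast+
  have ec: "ract (e k) x \<in> carrier C" if "k \<in> I" "x \<in> carrier G" for k x using e that by auto
  show ?thesis
  proof (rule hom.averaging_acyclic[where T = T])
    show "T F \<in> carrier (hom_rep C V)" if "F \<in> carrier G \<rightarrow> carrier (hom_rep C V)" for F
      using that Tc by simp
    show "T F = T F'" if "F \<in> carrier G \<rightarrow> carrier (hom_rep C V)" and FF: "\<And>y. y \<in> carrier G \<Longrightarrow> F y = F' y" for F F'
    proof -
      have F: "F \<in> carrier G \<rightarrow> add_homs C V" using that by auto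
      have "u F k x = u F' k x" if "k \<in> I" "x \<in> carrier G" for k x
      proof -
        have "w F k (h \<otimes>\<^bsub>G\<^esub> x) = w F' k (h \<otimes>\<^bsub>G\<^esub> x)" if "h \<in> H k" for h
          using FF H_mem[OF \<open>k \<in> I\<close> that] \<open>x \<in> carrier G\<close> by (simp add: w_def)
        then have "(\<Oplus>\<^bsub>V\<^esub>h\<in>H k. w F' k (h \<otimes>\<^bsub>G\<^esub> x)) = (\<Oplus>\<^bsub>V\<^esub>h\<in>H k. w F k (h \<otimes>\<^bsub>G\<^esub> x))"
          using wh[OF F that] by (intro V.V.M.finsum_cong') auto
        then show ?thesis by (simp add: u_def)
      qed
      \<comment> \<open>Both functions prescribe the same values, so the two predicates coincide and
        with them the chosen homomorphisms.\<close>
      then have "P F = P F'" by (auto simp: P_def)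
      then show ?thesis by (simp add: T_def)
    qed
    show "T (\<lambda>y. F y \<oplus>\<^bsub>hom_rep C V\<^esub> F' y) = T F \<oplus>\<^bsub>hom_rep C V\<^esub> T F'"
      if "F \<in> carrier G \<rightarrow> carrier (hom_rep C V)" "F' \<in> carrier G \<rightarrow> carrier (hom_rep C V)" for F F'
    proof -
      have F: "F \<in> carrier G \<rightarrow> add_homs C V" "F' \<in> carrier G \<rightarrow> add_homs C V" using that by auto
      have FF: "(\<lambda>y. F y \<oplus>\<^bsub>hom_rep C V\<^esub> F' y) \<in> carrier G \<rightarrow> add_homs C V"
        using that hom.V.M.a_closed by (auto simp: Pi_iff simp del: hom_rep_simps(3))
      have TT: "T F \<oplus>\<^bsub>hom_rep C V\<^esub> T F' \<in> add_homs C V"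
        using hom.V.M.a_closed[of "T F" "T F'"] Tc F by (simp del: hom_rep_simps(3))
      show ?thesis
      proof (rule uniq[OF Tc[OF FF] TT])
        fix k x assume kx: "k \<in> I" "x \<in> carrier G"
        have "w (\<lambda>y. F y \<oplus>\<^bsub>hom_rep C V\<^esub> F' y) k y = w F k y \<oplus>\<^bsub>V\<^esub> w F' k y" if "y \<in> carrier G" for y
        proof -
          have "F y \<in> add_homs C V" "F' y \<in> add_homs C V" using F that by auto
          from add_homsD(1)[OF this(1) e(1)[OF kx(1)]] add_homsD(1)[OF this(2) e(1)[OF kx(1)]]
          show ?thesis using that e(1)[OF kx(1)] by (simp add: w_def V.act_add)
        qed
        then have "(\<Oplus>\<^bsub>V\<^esub>h\<in>H k. w (\<lambda>y. F y \<oplus>\<^bsub>hom_rep C V\<^esub> F' y) k (h \<otimes>\<^bsub>G\<^esub> x)) =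
          (\<Oplus>\<^bsub>V\<^esub>h\<in>H k. w F k (h \<otimes>\<^bsub>G\<^esub> x) \<oplus>\<^bsub>V\<^esub> w F' k (h \<otimes>\<^bsub>G\<^esub> x))"
          using kx wh[OF F(1) kx] wh[OF F(2) kx] H_mem by (intro V.V.M.finsum_cong') auto
        also have "\<dots> = (\<Oplus>\<^bsub>V\<^esub>h\<in>H k. w F k (h \<otimes>\<^bsub>G\<^esub> x)) \<oplus>\<^bsub>V\<^esub> (\<Oplus>\<^bsub>V\<^esub>h\<in>H k. w F' k (h \<otimes>\<^bsub>G\<^esub> x))"
          by (rule V.V.M.finsum_addf[OF wh[OF F(1) kx] wh[OF F(2) kx]])
        finally have "u (\<lambda>y. F y \<oplus>\<^bsub>hom_rep C V\<^esub> F' y) k x = u F k x \<oplus>\<^bsub>V\<^esub> u F' k x"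
          using V.V.smult_r_distr[OF c(1)[OF kx(1)] V.V.M.finsum_closed[OF wh[OF F(1) kx]] V.V.M.finsum_closed[OF wh[OF F(2) kx]]]
          by (simp add: u_def)
        then show "T (\<lambda>y. F y \<oplus>\<^bsub>hom_rep C V\<^esub> F' y) (ract (e k) x) = (T F \<oplus>\<^bsub>hom_rep C V\<^esub> T F') (ract (e k) x)"
          using Te[OF FF kx] Te[OF F(1) kx] Te[OF F(2) kx] ec[OF kx] by simp
      qed
    qed
    show "T (\<lambda>y. hom_act C ract act y l) = l" if "l \<in> carrier (hom_rep C V)" for l
    proof -
      have l: "l \<in> add_homs C V" using that by simp
      have F: "(\<lambda>y. hom_act C ract act y l) \<in> carrier G \<rightarrow> add_homs C V" using hom_act_closed l by auto
      show ?thesis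
      proof (rule uniq[OF Tc[OF F] l])
        fix k x assume kx: "k \<in> I" "x \<in> carrier G"
        have lc: "l (ract (e k) x) \<in> carrier V" using add_homsD(1)[OF l ec[OF kx]] .
        have "w (\<lambda>y. hom_act C ract act y l) k (h \<otimes>\<^bsub>G\<^esub> x) = l (ract (e k) x)" if h: "h \<in> H k" for h
        proof -
          have "ract (e k) (h \<otimes>\<^bsub>G\<^esub> x) = ract (e k) x"
            using e kx h H_mem by (simp add: C.ract_mult)
          then show ?thesis using e kx H_mem[OF kx(1) h] lc by (simp add: w_def hom_act_def)
        qed
        then have "(\<Oplus>\<^bsub>V\<^esub>h\<in>H k. w (\<lambda>y. hom_act C ract act y l) k (h \<otimes>\<^bsub>G\<^esub> x)) = (\<Oplus>\<^bsub>V\<^esub>h\<in>H k. l (ract (e k) x))"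
          using lc by (intro V.V.M.finsum_cong') auto
        also have "\<dots> = [card (H k)] \<cdot>\<^bsub>V\<^esub> l (ract (e k) x)" by (rule V.V.M.add.finprod_const[OF lc])
        finally have "u (\<lambda>y. hom_act C ract act y l) k x = l (ract (e k) x)"
          using c[OF kx(1)] lc by (simp add: u_def smult_nat[symmetric] V.V.smult_assoc[symmetric])
        then show "T (\<lambda>y. hom_act C ract act y l) (ract (e k) x) = l (ract (e k) x)" using Te[OF F kx] by simp
      qed
    qed
    show "T (\<lambda>y. F (y \<otimes>\<^bsub>G\<^esub> g)) = hom_act C ract act g (T F)"
      if "F \<in> carrier G \<rightarrow> carrier (hom_rep C V)" "g \<in> carrier G" for F g
    proof -
      have F: "F \<in> carrier G \<rightarrow> add_homs C V" "(\<lambda>y. F (y \<otimes>\<^bsub>G\<^esub> g)) \<in> carrier G \<rightarrow> add_homs C V" using that by auto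
      show ?thesis
      proof (rule uniq[OF Tc[OF F(2)] hom_act_closed[OF that(2) Tc[OF F(1)]]])
        fix k x assume kx: "k \<in> I" "x \<in> carrier G"
        have xg: "x \<otimes>\<^bsub>G\<^esub> g \<in> carrier G" using kx that by auto
        have Fc: "F y (e k) \<in> carrier V" if "y \<in> carrier G" for y
        proof -
          have "F y \<in> add_homs C V" using F that by auto
          from add_homsD(1)[OF this e(1)[OF kx(1)]] show ?thesis .
        qed
        \<comment> \<open>With \<open>y = h x\<close>, the inverse of \<open>y\<close> is
          \<open>g\<close> times the inverse of \<open>y g\<close>; so translating the argument by
          \<open>g\<close> brings out the action of \<open>g\<close>.\<close>
        have ww: "w (\<lambda>y. F (y \<otimes>\<^bsub>G\<^esub> g)) k (h \<otimes>\<^bsub>G\<^esub> x) = act g (w F k (h \<otimes>\<^bsub>G\<^esub> (x \<otimes>\<^bsub>G\<^esub> g)))" if h: "h \<in> H k" for h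
        proof -
          define y where "y = h \<otimes>\<^bsub>G\<^esub> x"
          have y: "y \<in> carrier G" "h \<otimes>\<^bsub>G\<^esub> (x \<otimes>\<^bsub>G\<^esub> g) = y \<otimes>\<^bsub>G\<^esub> g"
            using H_mem[OF kx(1) h] kx \<open>g \<in> carrier G\<close> by (auto simp: y_def C.G.m_assoc)
          then show ?thesis using Fc \<open>g \<in> carrier G\<close>
            by (simp add: w_def y_def[symmetric] C.G.inv_mult_group V.act_mult)
        qed
        have "(\<Oplus>\<^bsub>V\<^esub>h\<in>H k. w (\<lambda>y. F (y \<otimes>\<^bsub>G\<^esub> g)) k (h \<otimes>\<^bsub>G\<^esub> x)) = (\<Oplus>\<^bsub>V\<^esub>h\<in>H k. act g (w F k (h \<otimes>\<^bsub>G\<^esub> (x \<otimes>\<^bsub>G\<^esub> g))))"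
          using ww wh[OF F(1) kx(1) xg] that(2) by (intro V.V.M.finsum_cong') auto
        also have "\<dots> = act g (\<Oplus>\<^bsub>V\<^esub>h\<in>H k. w F k (h \<otimes>\<^bsub>G\<^esub> (x \<otimes>\<^bsub>G\<^esub> g)))"
          by (rule act_finsum[OF H(2)[OF kx(1)] wh[OF F(1) kx(1) xg] that(2), symmetric])
        finally have "u (\<lambda>y. F (y \<otimes>\<^bsub>G\<^esub> g)) k x = act g (u F k (x \<otimes>\<^bsub>G\<^esub> g))"
          using V.act_smult[OF that(2) c(1)[OF kx(1)] V.V.M.finsum_closed[OF wh[OF F(1) kx(1) xg]]] by (simp add: u_def)
        then show "T (\<lambda>y. F (y \<otimes>\<^bsub>G\<^esub> g)) (ract (e k) x) = hom_act C ract act g (T F) (ract (e k) x)"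
          using Te[OF F(2) kx] Te[OF F(1) kx(1) xg] ec[OF kx] e(1)[OF kx(1)] kx that(2)
          by (simp add: hom_act_def C.ract_mult)
      qed
    qed
  qed
qed

definition "fixed_tuples = {v \<in> carrier (fun_mod I V). \<forall>k\<in>I. \<forall>h\<in>H k. act h (v k) = v k}"

lemma subspace_fixed_tuples: "subspace_of K (fun_mod I V) fixed_tuples"
  using H_mem by (auto simp: subspace_of_def fixed_tuples_def V.act_add V.act_smult PiE_iff extensional_def)

text \<open>Frobenius reciprocity: an invariant \<open>l\<close> satisfies
  \<open>l (e k x) = act (inv x) (l (e k))\<close>. Evaluation at the \<open>e k\<close> is
  therefore injective on invariants, its values are fixed by the \<open>H k\<close>, and the same
  formula, fed into \<open>univ\<close>, turns any fixed tuple into an invariant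
  homomorphism.\<close>

theorem reldim_hom_cocycles:
  "reldim K (bar G (hom_rep C V) 0) {\<zero>\<^bsub>bar G (hom_rep C V) 0\<^esub>}
      (cyc (bar G (hom_rep C V)) (bar_d G (hom_rep C V) (hom_act C ract act)) 0) n \<longleftrightarrow>
    reldim K (fun_mod I V) {\<zero>\<^bsub>fun_mod I V\<^esub>} fixed_tuples n"
proof -
  define Z where "Z = cyc (bar G (hom_rep C V)) (bar_d G (hom_rep C V) (hom_act C ract act)) 0"
  define ev where "ev f = (\<lambda>k\<in>I. f [] (e k))" for f :: "'g list \<Rightarrow> 'c \<Rightarrow> 'v"
  have fE: "f [] \<in> add_homs C V" if "f \<in> carrier (bar G (hom_rep C V) 0)" for f using that by (auto simp: bar_def)
  interpret ev: linear_map K "bar G (hom_rep C V) 0" "fun_mod I V" ev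
  proof (intro linear_map.intro linear_map_axioms.intro hom.vspace_bar V.V.vspace_fun_mod)
    show "ev \<in> mod_hom K (bar G (hom_rep C V) 0) (fun_mod I V)"
    proof -
      have "(f \<oplus>\<^bsub>bar G (hom_rep C V) 0\<^esub> f') [] = f [] \<oplus>\<^bsub>hom_rep C V\<^esub> f' []" for f f'
        by (simp add: bar_def)
      then have 1: "ev (f \<oplus>\<^bsub>bar G (hom_rep C V) 0\<^esub> f') = ev f \<oplus>\<^bsub>fun_mod I V\<^esub> ev f'" for f f'
        using e(1) by (auto simp: ev_def intro!: restrict_ext)
      have "(a \<odot>\<^bsub>bar G (hom_rep C V) 0\<^esub> f) [] = a \<odot>\<^bsub>hom_rep C V\<^esub> f []" for f a
        by (simp add: bar_def)
      then have 2: "ev (a \<odot>\<^bsub>bar G (hom_rep C V) 0\<^esub> f) = a \<odot>\<^bsub>fun_mod I V\<^esub> ev f" for f a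
        using e(1) by (auto simp: ev_def intro!: restrict_ext)
      have "ev f \<in> carrier (fun_mod I V)" if "f \<in> carrier (bar G (hom_rep C V) 0)" for f
        using add_homsD(1)[OF fE[OF that] e(1)] by (simp add: ev_def)
      then show ?thesis unfolding mod_hom_def using 1 2 by blast
    qed
  qed
  have Z: "Z = {f \<in> carrier (bar G (hom_rep C V) 0). \<forall>g\<in>carrier G. hom_act C ract act g (f []) = f []}"
    unfolding Z_def by (rule hom.cyc_0)
  have subZ: "subspace_of K (bar G (hom_rep C V) 0) Z" unfolding Z_def by (rule hom.bar_cx.subspace_cyc)
  have inv: "f [] (ract (e k) x) = act (inv\<^bsub>G\<^esub> x) (f [] (e k))" if f: "f \<in> Z" and kx: "k \<in> I" "x \<in> carrier G" for f k x
  proof -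
    have fc: "f [] \<in> add_homs C V" "hom_act C ract act (inv\<^bsub>G\<^esub> x) (f []) = f []" using f kx fE by (auto simp: Z)
    have "f [] (ract (e k) x) = hom_act C ract act (inv\<^bsub>G\<^esub> x) (f []) (ract (e k) x)" by (simp only: fc(2))
    also have "\<dots> = act (inv\<^bsub>G\<^esub> x) (f [] (ract (ract (e k) x) (inv\<^bsub>G\<^esub> x)))"
      using e(1) kx by (simp add: hom_act_def)
    finally show ?thesis using e(1) kx by (simp add: C.ract_mult[symmetric])
  qed
  have k0: "ev.ker \<inter> Z \<subseteq> {\<zero>\<^bsub>bar G (hom_rep C V) 0\<^esub>}"
  proof
    fix f assume f: "f \<in> ev.ker \<inter> Z"
    then have fc: "f \<in> carrier (bar G (hom_rep C V) 0)" and z: "ev f = \<zero>\<^bsub>fun_mod I V\<^esub>" by (auto simp: ev.ker_def)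
    have "f [] = \<zero>\<^bsub>hom_rep C V\<^esub>"
    proof (rule uniq[OF fE[OF fc]])
      show "\<zero>\<^bsub>hom_rep C V\<^esub> \<in> add_homs C V" using hom.V.M.zero_closed by (simp del: hom_rep_simps(2))
      fix k x assume kx: "k \<in> I" "x \<in> carrier G"
      have "f [] (e k) = \<zero>\<^bsub>V\<^esub>" using fun_cong[OF z, of k] kx by (simp add: ev_def)
      then show "f [] (ract (e k) x) = \<zero>\<^bsub>hom_rep C V\<^esub> (ract (e k) x)"
        using inv[of f k x] f kx e(1) by simp
    qed
    then show "f \<in> {\<zero>\<^bsub>bar G (hom_rep C V) 0\<^esub>}"
      using fc by (auto simp: bar_def PiE_iff extensional_def intro!: ext)
  qed
  have im: "ev ` Z = fixed_tuples"
  proof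
    show "ev ` Z \<subseteq> fixed_tuples"
    proof
      fix v assume "v \<in> ev ` Z"
      then obtain f where f: "f \<in> Z" "v = ev f" by auto
      have "act h (v k) = v k" if kh: "k \<in> I" "h \<in> H k" for k h
      proof -
        have hG: "h \<in> carrier G" "inv\<^bsub>G\<^esub> h \<in> H k" "inv\<^bsub>G\<^esub> h \<in> carrier G"
          using H_mem kh subgroup.m_inv_closed[OF H(1)] by auto
        have "f [] (e k) = act h (f [] (e k))" using inv[OF f(1) kh(1) hG(3)] e(2)[OF kh(1) hG(2)] hG by simp
        then show ?thesis using f kh by (simp add: ev_def)
      qed
      moreover have "v \<in> carrier (fun_mod I V)" using f subspace_ofD(1)[OF subZ] ev.map_closed by blast
      ultimately show "v \<in> fixed_tuples" by (auto simp: fixed_tuples_def)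
    qed
    show "fixed_tuples \<subseteq> ev ` Z"
    proof
      fix v assume v: "v \<in> fixed_tuples"
      then have vc: "v k \<in> carrier V" if "k \<in> I" for k using that by (auto simp: fixed_tuples_def)
      have "\<exists>l\<in>add_homs C V. \<forall>k\<in>I. \<forall>x\<in>carrier G. l (ract (e k) x) = act (inv\<^bsub>G\<^esub> x) (v k)"
      proof (rule univ)
        show "act (inv\<^bsub>G\<^esub> (h \<otimes>\<^bsub>G\<^esub> x)) (v k) = act (inv\<^bsub>G\<^esub> x) (v k)" if "k \<in> I" "h \<in> H k" "x \<in> carrier G" for k h x
        proof -
          have "inv\<^bsub>G\<^esub> h \<in> H k" using subgroup.m_inv_closed[OF H(1)] that by auto
          then have "act (inv\<^bsub>G\<^esub> h) (v k) = v k" using v that by (auto simp: fixed_tuples_def)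
          then show ?thesis using that H_mem vc by (simp add: C.G.inv_mult_group V.act_mult)
        qed
      qed (use vc in auto)
      then obtain l where l: "l \<in> add_homs C V" "\<And>k x. k \<in> I \<Longrightarrow> x \<in> carrier G \<Longrightarrow> l (ract (e k) x) = act (inv\<^bsub>G\<^esub> x) (v k)" by blast
      have "hom_act C ract act g l = l" if g: "g \<in> carrier G" for g
      proof (rule uniq[OF hom_act_closed[OF g l(1)] l(1)])
        fix k x assume kx: "k \<in> I" "x \<in> carrier G"
        have "l (ract (ract (e k) x) g) = act (inv\<^bsub>G\<^esub> (x \<otimes>\<^bsub>G\<^esub> g)) (v k)"
          using l(2)[of k "x \<otimes>\<^bsub>G\<^esub> g"] kx g e(1) by (simp add: C.ract_mult)
        then show "hom_act C ract act g l (ract (e k) x) = l (ract (e k) x)"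
          using kx g e(1) vc l(2) by (simp add: hom_act_def C.G.inv_mult_group V.act_mult)
      qed
      then have "(\<lambda>gs\<in>tuples G 0. l) \<in> Z" using l(1) by (auto simp: Z bar_def)
      moreover have "ev (\<lambda>gs\<in>tuples G 0. l) = v"
      proof
        fix k show "ev (\<lambda>gs\<in>tuples G 0. l) k = v k"
          using l(2)[of k "\<one>\<^bsub>G\<^esub>"] e(1)[of k] vc[of k] v
          by (cases "k \<in> I") (auto simp: ev_def fixed_tuples_def PiE_iff extensional_def)
      qed
      ultimately show "v \<in> ev ` Z" by (metis image_eqI)
    qed
  qed
  have im0: "ev ` {\<zero>\<^bsub>bar G (hom_rep C V) 0\<^esub>} = {\<zero>\<^bsub>fun_mod I V\<^esub>}" using ev.map_zero by simp
  show ?thesis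
    using ev.reldim_image[OF ev.V.subspace_zero _ k0, of n] ev.reldim_vimage[OF ev.V.subspace_zero subZ _ k0, of n]
      subspace_ofD(2)[OF subZ] im im0 unfolding Z_def[symmetric] by auto
qed

end

section \<open>The module \<open>\<Z> \<otimes> \<Z>[G]\<close>\<close>

abbreviation "int_delta g \<equiv> gr_single \<Z> 1 g"

lemma ring_Z: "ring \<Z>"
  using int_is_cring cring.axioms(1) by blast

lemma finsum_int: "finsum \<Z> f A = sum f A"
proof (induct A rule: infinite_finite_induct)
  case (insert x A)
  then show ?case using abelian_monoid.finsum_insert[of \<Z> A x f] ring.is_abelian_group[OF ring_Z]
    by (simp add: abelian_group_def)
qed (use abelian_monoid.finsum_infinite[of \<Z>] abelian_monoid.finsum_empty[of \<Z>]
    ring.is_abelian_group[OF ring_Z] in \<open>auto simp: abelian_group_def\<close>)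

lemma group_ring_int_simps:
  "carrier (group_ring \<Z> G) = {a. finite {g. a g \<noteq> 0} \<and> {g. a g \<noteq> 0} \<subseteq> carrier G}"
  "a \<oplus>\<^bsub>group_ring \<Z> G\<^esub> b = (\<lambda>g. a g + b g)"
  "\<zero>\<^bsub>group_ring \<Z> G\<^esub> = (\<lambda>g. 0)"
  "(a \<otimes>\<^bsub>group_ring \<Z> G\<^esub> b) g = (if g \<in> carrier G then \<Sum>h | a h \<noteq> 0. a h * b (inv\<^bsub>G\<^esub> h \<otimes>\<^bsub>G\<^esub> g) else 0)"
  by (auto simp: group_ring_def finsum_int)

lemma int_single_apply: "gr_single \<Z> n g h = (if h = g then n else 0)"
  by (simp add: gr_single_def)

lemma sum_single: "(\<Sum>g | gr_single \<Z> n x g \<noteq> 0. gr_single \<Z> n x g) = n"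
proof (cases "n = 0")
  case False
  then have "{g. gr_single \<Z> n x g \<noteq> 0} = {x}" by (auto simp: int_single_apply)
  then show ?thesis by (simp add: int_single_apply)
qed (simp add: int_single_apply)

lemma frag_cmul_sum_left: "(\<Sum>i\<in>A. frag_cmul (c i) x) = frag_cmul (\<Sum>i\<in>A. c i) x"
  by (induct A rule: infinite_finite_induct) (simp_all add: frag_cmul_distrib)

text \<open>The ring structure of the integral group ring enters as an assumption; it is later taken
  from the module \<open>C\<close>, whose right module structure contains it.\<close>

locale coset_module =
  fixes G :: "('g, 'gz) monoid_scheme" and H :: "'g set"
  assumes group_G: "group G" and subgroup_H: "subgroup H G" and ring_ZG: "ring (group_ring \<Z> G)"
begin

interpretation G: group G by (rule group_G)
interpretation ZG: ring "group_ring \<Z> G" by (rule ring_ZG)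

abbreviation "R \<equiv> group_ring \<Z> (G\<lparr>carrier := H\<rparr>)"
abbreviation "ZG \<equiv> group_ring \<Z> G"
definition "pairs = (UNIV :: int set) \<times> carrier ZG"
abbreviation "F \<equiv> free_Abelian_group pairs"
abbreviation "rels \<equiv> tensor_relations R trivial_int_module (left_regular ZG)"
definition "N = generate F rels"
definition "cl f = N #>\<^bsub>F\<^esub> f"

lemma H_sub: "H \<subseteq> carrier G"
  using subgroup_H by (rule subgroup.subset)

lemma R_sub: "r \<in> carrier R \<Longrightarrow> r \<in> carrier ZG"
  using H_sub by (auto simp: group_ring_int_simps)

lemma single_ZG: "x \<in> carrier G \<Longrightarrow> gr_single \<Z> n x \<in> carrier ZG"
  by (auto simp: group_ring_int_simps int_single_apply)

lemma single_R: "x \<in> H \<Longrightarrow> gr_single \<Z> n x \<in> carrier R"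
  by (auto simp: group_ring_int_simps int_single_apply)

lemma single_mult:
  "x \<in> carrier G \<Longrightarrow> y \<in> carrier G \<Longrightarrow>
    gr_single \<Z> m x \<otimes>\<^bsub>ZG\<^esub> gr_single \<Z> n y = gr_single \<Z> (m * n) (x \<otimes>\<^bsub>G\<^esub> y)"
  using gr_single_mult[OF ring_Z group_G, of m n x y] by simp

lemma rels_cases:
  assumes "r \<in> rels"
  obtains (left) n n' a where "a \<in> carrier ZG" "r = frag_of (n + n', a) - frag_of (n, a) - frag_of (n', a)"
  | (right) n a a' where "a \<in> carrier ZG" "a' \<in> carrier ZG"
      "r = frag_of (n, a \<oplus>\<^bsub>ZG\<^esub> a') - frag_of (n, a) - frag_of (n, a')"
  | (scalar) n s a where "s \<in> carrier R" "a \<in> carrier ZG"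
      "r = frag_of ((\<Sum>g | s g \<noteq> 0. s g) * n, a) - frag_of (n, s \<otimes>\<^bsub>ZG\<^esub> a)"
  using assms unfolding tensor_relations_def
  by (auto simp: trivial_int_module_def left_regular_def)

lemma
  assumes "a \<in> carrier ZG"
  shows rel_left: "frag_of (n + n', a) - frag_of (n, a) - frag_of (n', a) \<in> rels"
    and rel_right: "a' \<in> carrier ZG \<Longrightarrow> frag_of (n, a \<oplus>\<^bsub>ZG\<^esub> a') - frag_of (n, a) - frag_of (n, a') \<in> rels"
    and rel_scalar: "s \<in> carrier R \<Longrightarrow>
      frag_of ((\<Sum>g | s g \<noteq> 0. s g) * n, a) - frag_of (n, s \<otimes>\<^bsub>ZG\<^esub> a) \<in> rels"
  using assms unfolding tensor_relations_def
  by (auto simp: trivial_int_module_def left_regular_def)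

lemma keys_diff_sub: "Poly_Mapping.keys a \<subseteq> S \<Longrightarrow> Poly_Mapping.keys b \<subseteq> S \<Longrightarrow> Poly_Mapping.keys (a - b) \<subseteq> S"
  for a b :: "'z \<Rightarrow>\<^sub>0 int"
  using keys_diff[of a b] by blast

lemma keys_add_sub: "Poly_Mapping.keys a \<subseteq> S \<Longrightarrow> Poly_Mapping.keys b \<subseteq> S \<Longrightarrow> Poly_Mapping.keys (a + b) \<subseteq> S"
  for a b :: "'z \<Rightarrow>\<^sub>0 int"
  using keys_add[of a b] by blast

lemma rels_sub: "rels \<subseteq> carrier F"
proof
  fix r assume "r \<in> rels"
  then show "r \<in> carrier F"
  proof (cases rule: rels_cases)
    case (left n n' a)
    then show ?thesis unfolding carrier_free_Abelian_group_iff left(2)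
      by (intro keys_diff_sub) (simp_all add: pairs_def)
  next
    case (right n a a')
    then show ?thesis unfolding carrier_free_Abelian_group_iff right(3)
      by (intro keys_diff_sub) (simp_all add: pairs_def)
  next
    case (scalar n t a)
    then show ?thesis unfolding carrier_free_Abelian_group_iff scalar(3)
      by (intro keys_diff_sub) (simp_all add: pairs_def R_sub)
  qed
qed

lemma subgroup_N: "subgroup N F"
  unfolding N_def by (rule group.generate_is_subgroup[OF group_free_Abelian_group rels_sub])

lemma N_0: "0 \<in> N"
  using subgroup.one_closed[OF subgroup_N] by simp

lemma N_sub: "n \<in> N \<Longrightarrow> n \<in> carrier F"
  using subgroup.subset[OF subgroup_N] by blast

lemma N_add: "m \<in> N \<Longrightarrow> n \<in> N \<Longrightarrow> m + n \<in> N"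
  using subgroup.m_closed[OF subgroup_N] by simp

lemma N_minus: "n \<in> N \<Longrightarrow> - n \<in> N"
  using subgroup.m_inv_closed[OF subgroup_N] N_sub by force

lemma rels_N: "r \<in> rels \<Longrightarrow> r \<in> N"
  unfolding N_def by (rule generate.incl)

lemma N_induct [consumes 1, case_names zero rel minus add]:
  assumes "n \<in> N" "P 0" "\<And>r. r \<in> rels \<Longrightarrow> P r" "\<And>a. P a \<Longrightarrow> P (- a)" "\<And>a b. P a \<Longrightarrow> P b \<Longrightarrow> P (a + b)"
  shows "P n"
  using assms(1) unfolding N_def
proof induct
  case (inv h)
  then show ?case using assms rels_sub by (simp add: subset_iff)
qed (use assms in auto)

lemma cl_eq: "cl f = {n + f | n. n \<in> N}"
  by (auto simp: cl_def r_coset_def)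

lemma cl_eq_iff: "cl f = cl f' \<longleftrightarrow> f - f' \<in> N"
proof
  assume "cl f = cl f'"
  moreover have "f \<in> cl f" using N_0 by (force simp: cl_eq)
  ultimately obtain n where "n \<in> N" "f = n + f'" by (auto simp: cl_eq)
  then show "f - f' \<in> N" by simp
next
  assume d: "f - f' \<in> N"
  have "cl f \<subseteq> cl f'" if "f - f' \<in> N" for f f'
  proof
    fix x assume "x \<in> cl f"
    then obtain n where n: "n \<in> N" "x = n + f" by (auto simp: cl_eq)
    then have "x = (n + (f - f')) + f'" "n + (f - f') \<in> N" using N_add that by auto
    then show "x \<in> cl f'" unfolding cl_eq by blast
  qed
  from this[OF d] this[of f' f] N_minus[OF d] show "cl f = cl f'" by auto
qed

section \<open>Operations and generators of the tensor product\<close>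

lemma perm_module_unfold: "perm_module G H =
  \<lparr>carrier = carrier (F Mod N), monoid.mult = undefined, monoid.one = undefined,
   ring.zero = monoid.one (F Mod N), ring.add = monoid.mult (F Mod N),
   smult = (\<lambda>s X. \<Union>x\<in>X. N #>\<^bsub>F\<^esub> frag_extend (\<lambda>(a, b). frag_of (a, b \<otimes>\<^bsub>ZG\<^esub> s)) x)\<rparr>"
  by (simp add: perm_module_def tensor_product_def Let_def N_def pairs_def trivial_int_module_def
      left_regular_def right_regular_def)

lemma perm_carrier: "carrier (perm_module G H) = cl ` carrier F"
  by (simp add: perm_module_unfold carrier_FactGroup cl_def)

lemma perm_zero: "\<zero>\<^bsub>perm_module G H\<^esub> = cl 0"
  by (simp add: perm_module_unfold cl_eq)

lemma perm_add: "f \<in> carrier F \<Longrightarrow> f' \<in> carrier F \<Longrightarrow> cl f \<oplus>\<^bsub>perm_module G H\<^esub> cl f' = cl (f + f')"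
proof -
  assume f: "f \<in> carrier F" "f' \<in> carrier F"
  have "N \<lhd> F" using comm_group.subgroup_imp_normal[OF abelian_free_Abelian_group subgroup_N] .
  from normal.rcos_sum[OF this f] show ?thesis by (simp add: perm_module_unfold cl_def)
qed

text \<open>Right multiplication by \<open>s\<close> in the second component carries each defining
  relation to a relation of the same kind, hence \<open>N\<close> into \<open>N\<close>. All members
  of a coset thus have equivalent images, and the union in the definition collapses to one
  coset.\<close>

lemma perm_smult:
  assumes "s \<in> carrier ZG" "f \<in> carrier F"
  shows "s \<odot>\<^bsub>perm_module G H\<^esub> cl f = cl (frag_extend (\<lambda>(n, b). frag_of (n, b \<otimes>\<^bsub>ZG\<^esub> s)) f)"
proof -
  define E where "E = frag_extend (\<lambda>(n :: int, b). frag_of (n, b \<otimes>\<^bsub>ZG\<^esub> s))"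
  have EN: "E n \<in> N" if "n \<in> N" for n
    using that
  proof (induct rule: N_induct)
    case (rel r)
    then have "E r \<in> rels"
    proof (cases rule: rels_cases)
      case (left n n' a)
      then show ?thesis using rel_left[of "a \<otimes>\<^bsub>ZG\<^esub> s" n n'] assms by (simp add: E_def frag_extend_diff)
    next
      case (right n a a')
      then show ?thesis using rel_right[of "a \<otimes>\<^bsub>ZG\<^esub> s" "a' \<otimes>\<^bsub>ZG\<^esub> s" n] assms
        by (simp add: E_def frag_extend_diff ZG.l_distr)
    next
      case (scalar n t a)
      then show ?thesis using rel_scalar[of "a \<otimes>\<^bsub>ZG\<^esub> s" t n] assms R_sub
        by (simp add: E_def frag_extend_diff ZG.m_assoc)
    qed
    then show ?case by (rule rels_N)
  qed (auto simp: E_def frag_extend_minus frag_extend_add N_0 N_minus N_add)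
  have "cl (E x) = cl (E f)" if x: "x \<in> cl f" for x
  proof -
    obtain n where n: "n \<in> N" "x = n + f" using x by (auto simp: cl_eq)
    then show ?thesis using EN by (simp add: cl_eq_iff E_def frag_extend_add)
  qed
  moreover have "f \<in> cl f" using N_0 by (force simp: cl_eq)
  ultimately have "(\<Union>x\<in>cl f. cl (E x)) = cl (E f)" by blast
  then show ?thesis by (simp add: perm_module_unfold cl_def E_def)
qed

text \<open>The pure tensor of 1 and \<open>x\<close>, which corresponds to the coset
  \<open>H x\<close>.\<close>

definition "point x = cl (frag_of (1, int_delta x))"

lemma point_frag: "x \<in> carrier G \<Longrightarrow> frag_of (1, int_delta x) \<in> carrier F"
  by (simp add: pairs_def single_ZG)

lemma point_closed: "x \<in> carrier G \<Longrightarrow> point x \<in> carrier (perm_module G H)"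
  using point_frag by (auto simp: point_def perm_carrier)

lemma point_smult: "x \<in> carrier G \<Longrightarrow> g \<in> carrier G \<Longrightarrow> int_delta g \<odot>\<^bsub>perm_module G H\<^esub> point x = point (x \<otimes>\<^bsub>G\<^esub> g)"
  unfolding point_def by (subst perm_smult[OF single_ZG point_frag]) (simp_all add: single_mult)

lemma zero_smult: "g \<in> carrier G \<Longrightarrow> int_delta g \<odot>\<^bsub>perm_module G H\<^esub> cl 0 = cl 0"
  by (subst perm_smult[OF single_ZG]) auto

text \<open>The scalar \<open>h\<close> moves across the tensor sign and acts on the integers
  through its augmentation, which is 1.\<close>

lemma point_H: "h \<in> H \<Longrightarrow> point h = point \<one>\<^bsub>G\<^esub>"
proof -
  assume h: "h \<in> H"
  have "frag_of (1, int_delta \<one>\<^bsub>G\<^esub>) - frag_of (1, int_delta h) \<in> rels"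
    using rel_scalar[of "int_delta \<one>\<^bsub>G\<^esub>" "int_delta h" 1] h H_sub single_ZG[of "\<one>\<^bsub>G\<^esub>" 1] single_R[OF h, of 1]
    by (auto simp: sum_single single_mult subset_iff)
  from rels_N[OF this] show ?thesis unfolding point_def by (simp add: cl_eq_iff[symmetric])
qed

text \<open>Here \<open>Q\<close> plays the part of a subgroup containing all relations; the lemma
  says that the points generate the tensor product. Bilinearity on the left reduces a pair
  \<open>(n, a)\<close> to \<open>(1, a)\<close>, bilinearity on the right reduces \<open>a\<close>
  to multiples \<open>m x\<close> of group elements, and the scalar relation moves \<open>m\<close>
  into the first component.\<close>

lemma F_generated:
  assumes 0: "Q 0" and diff: "\<And>f g. Q f \<Longrightarrow> Q g \<Longrightarrow> Q (f - g)" and rels: "\<And>r. r \<in> rels \<Longrightarrow> Q r"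
    and point: "\<And>x. x \<in> carrier G \<Longrightarrow> Q (frag_of (1, int_delta x))" and f: "f \<in> carrier F"
  shows "Q f"
proof -
  have add: "Q (f + g)" if "Q f" "Q g" for f g
    using diff[OF that(1) diff[OF 0 that(2)]] by simp
  have A: "Q (frag_of (n + n', a)) \<longleftrightarrow> Q (frag_of (n, a))" if a: "a \<in> carrier ZG" "Q (frag_of (n', a))" for n n' a
  proof
    note r = rels[OF rel_left[OF a(1), of n n']]
    show "Q (frag_of (n + n', a))" if "Q (frag_of (n, a))"
      using add[OF add[OF r that] a(2)] by simp
    show "Q (frag_of (n, a))" if "Q (frag_of (n + n', a))"
      using diff[OF diff[OF that a(2)] r] by simp
  qed
  have 1: "Q (frag_of (n, a))" if a: "a \<in> carrier ZG" "Q (frag_of (1, a))" for n a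
  proof (induct n rule: int_induct[where k = 1])
    case base then show ?case by fact
  next
    case (step1 i) then show ?case using A[OF a, of i] by simp
  next
    case (step2 i) then show ?case using A[OF a, of "i - 1"] by simp
  qed
  have 2: "Q (frag_of (1, gr_single \<Z> m x))" if x: "x \<in> carrier G" for m x
  proof -
    have "frag_of (m, int_delta x) - frag_of (1, gr_single \<Z> m x) \<in> rels"
      using rel_scalar[of "int_delta x" "gr_single \<Z> m \<one>\<^bsub>G\<^esub>" 1] x
        single_R[of "\<one>\<^bsub>G\<^esub>" m] subgroup.one_closed[OF subgroup_H] single_ZG[OF x, of 1]
      by (simp add: sum_single single_mult)
    from diff[OF 1[OF single_ZG[OF x] point[OF x], of m] rels[OF this]] show ?thesis by simp
  qed
  have 3: "Q (frag_of (1, a))" if "finite S" "{g. a g \<noteq> 0} \<subseteq> S" "S \<subseteq> carrier G" for a S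
    using that
  proof (induct S arbitrary: a)
    case empty
    then have a: "a = (\<lambda>g. 0)" by auto
    then have "a \<in> carrier ZG" "a \<oplus>\<^bsub>ZG\<^esub> a = a" by (auto simp: group_ring_int_simps)
    \<comment> \<open>The relation expressing additivity for \<open>0 + 0 = 0\<close> is minus the
      pair \<open>(1, 0)\<close>.\<close>
    then have "Q (0 - frag_of (1, a))" using rels[OF rel_right[of a a 1]] by simp
    from diff[OF 0 this] show ?case by simp
  next
    case (insert x S)
    define b where "b = a(x := 0)"
    have fin: "finite {g. a g \<noteq> 0}" using insert finite_subset by blast
    have xG: "x \<in> carrier G" using insert by auto
    have "{g. b g \<noteq> 0} \<subseteq> {g. a g \<noteq> 0}" by (auto simp: b_def)
    then have bZ: "b \<in> carrier ZG"
      using insert fin finite_subset[of "{g. b g \<noteq> 0}"] unfolding group_ring_int_simps by blast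
    have "Q (frag_of (1, b))" using insert by (intro insert(3)) (auto simp: b_def)
    moreover have "a = b \<oplus>\<^bsub>ZG\<^esub> gr_single \<Z> (a x) x"
      by (auto simp: group_ring_int_simps int_single_apply b_def)
    moreover note rels[OF rel_right[OF bZ single_ZG[OF xG, of "a x"], of 1]]
    ultimately show ?case using add[OF add[OF _ _] 2[OF xG, of "a x"], of _ "frag_of (1, b)"] by fastforce
  qed
  show ?thesis
  proof (rule free_Abelian_group_induct[of f pairs])
    show "Q (frag_of p)" if "p \<in> pairs" for p
    proof -
      obtain n a where p: "p = (n, a)" "a \<in> carrier ZG" using \<open>p \<in> pairs\<close> by (cases p) (auto simp: pairs_def)
      then have "Q (frag_of (1, a))" by (intro 3[of "{g. a g \<noteq> 0}"]) (auto simp: group_ring_int_simps)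
      then show ?thesis using 1 p by simp
    qed
  qed (use 0 diff f in auto)
qed

section \<open>Comparison with the free abelian group on cosets\<close>

text \<open>The image of the tensor of 1 and \<open>a\<close> under the isomorphism of the tensor
  product with the free abelian group on the cosets \<open>H g\<close>.\<close>

definition "coset_sum a = (\<Sum>g | a g \<noteq> 0. frag_cmul (a g) (frag_of (H #>\<^bsub>G\<^esub> g)))" for a :: "'g \<Rightarrow> int"

lemma coset_sum_superset:
  assumes "finite A" "{g. a g \<noteq> 0} \<subseteq> A"
  shows "coset_sum a = (\<Sum>g\<in>A. frag_cmul (a g) (frag_of (H #>\<^bsub>G\<^esub> g)))"
  unfolding coset_sum_def using assms by (intro sum.mono_neutral_left) auto

lemma coset_sum_add:
  assumes "a \<in> carrier ZG" "b \<in> carrier ZG"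
  shows "coset_sum (a \<oplus>\<^bsub>ZG\<^esub> b) = coset_sum a + coset_sum b"
proof -
  define A where "A = {g. a g \<noteq> 0} \<union> {g. b g \<noteq> 0}"
  have A: "finite A" using assms by (simp add: A_def group_ring_int_simps)
  have "coset_sum (a \<oplus>\<^bsub>ZG\<^esub> b) = (\<Sum>g\<in>A. frag_cmul ((a \<oplus>\<^bsub>ZG\<^esub> b) g) (frag_of (H #>\<^bsub>G\<^esub> g)))"
    by (rule coset_sum_superset[OF A]) (auto simp: A_def group_ring_int_simps)
  also have "\<dots> = coset_sum a + coset_sum b"
    using coset_sum_superset[OF A, of a] coset_sum_superset[OF A, of b]
    by (simp add: group_ring_int_simps frag_cmul_distrib sum.distrib A_def)
  finally show ?thesis .
qed

text \<open>Each \<open>h\<close> in the support of \<open>r\<close> lies in \<open>H\<close>, so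
  the substitution \<open>g \<mapsto> h g\<close> does not change the coset \<open>H g\<close>, and
  \<open>h\<close> contributes \<open>r h\<close> times the coset sum of \<open>b\<close>. Summing
  over \<open>h\<close> leaves the augmentation of \<open>r\<close>.\<close>

lemma coset_sum_mult:
  assumes r: "r \<in> carrier R" and b: "b \<in> carrier ZG"
  shows "coset_sum (r \<otimes>\<^bsub>ZG\<^esub> b) = frag_cmul (\<Sum>g | r g \<noteq> 0. r g) (coset_sum b)"
proof -
  define X where "X = {h. r h \<noteq> 0}"
  define Y where "Y = {g. b g \<noteq> 0}"
  define A where "A = (\<lambda>(h, g). h \<otimes>\<^bsub>G\<^esub> g) ` (X \<times> Y)"
  have X: "finite X" "X \<subseteq> H" and Y: "finite Y" "Y \<subseteq> carrier G"
    using assms by (auto simp: X_def Y_def group_ring_int_simps)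
  have XG: "X \<subseteq> carrier G" using X H_sub by auto
  have A: "finite A" "A \<subseteq> carrier G" using X Y XG by (auto simp: A_def)
  have supp: "{g. (r \<otimes>\<^bsub>ZG\<^esub> b) g \<noteq> 0} \<subseteq> A"
  proof
    fix g assume "g \<in> {g. (r \<otimes>\<^bsub>ZG\<^esub> b) g \<noteq> 0}"
    then have g: "g \<in> carrier G" "(\<Sum>h\<in>X. r h * b (inv\<^bsub>G\<^esub> h \<otimes>\<^bsub>G\<^esub> g)) \<noteq> 0"
      by (auto simp: group_ring_int_simps X_def split: if_splits)
    then obtain h where h: "h \<in> X" "r h * b (inv\<^bsub>G\<^esub> h \<otimes>\<^bsub>G\<^esub> g) \<noteq> 0" by (meson sum.not_neutral_contains_not_neutral)
    then have "inv\<^bsub>G\<^esub> h \<otimes>\<^bsub>G\<^esub> g \<in> Y" by (auto simp: Y_def)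
    moreover have "g = h \<otimes>\<^bsub>G\<^esub> (inv\<^bsub>G\<^esub> h \<otimes>\<^bsub>G\<^esub> g)" using h g XG by (auto simp: G.m_assoc[symmetric])
    ultimately show "g \<in> A" using h unfolding A_def by (intro image_eqI[of _ _ "(h, inv\<^bsub>G\<^esub> h \<otimes>\<^bsub>G\<^esub> g)"]) auto
  qed
  have fixed: "(\<Sum>g\<in>A. frag_cmul (r h * b (inv\<^bsub>G\<^esub> h \<otimes>\<^bsub>G\<^esub> g)) (frag_of (H #>\<^bsub>G\<^esub> g))) = frag_cmul (r h) (coset_sum b)"
    if h: "h \<in> X" for h
  proof -
    have hG: "h \<in> carrier G" "h \<in> H" using h X XG by auto
    have "(\<Sum>g\<in>A. frag_cmul (r h * b (inv\<^bsub>G\<^esub> h \<otimes>\<^bsub>G\<^esub> g)) (frag_of (H #>\<^bsub>G\<^esub> g))) =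
      (\<Sum>g\<in>(\<otimes>\<^bsub>G\<^esub>) h ` Y. frag_cmul (r h * b (inv\<^bsub>G\<^esub> h \<otimes>\<^bsub>G\<^esub> g)) (frag_of (H #>\<^bsub>G\<^esub> g)))"
    proof (rule sum.mono_neutral_right[OF A(1)])
      show "(\<otimes>\<^bsub>G\<^esub>) h ` Y \<subseteq> A" using h by (auto simp: A_def)
      show "\<forall>g\<in>A - (\<otimes>\<^bsub>G\<^esub>) h ` Y. frag_cmul (r h * b (inv\<^bsub>G\<^esub> h \<otimes>\<^bsub>G\<^esub> g)) (frag_of (H #>\<^bsub>G\<^esub> g)) = 0"
      proof
        fix g assume g: "g \<in> A - (\<otimes>\<^bsub>G\<^esub>) h ` Y"
        then have gG: "g \<in> carrier G" using A by auto
        have "inv\<^bsub>G\<^esub> h \<otimes>\<^bsub>G\<^esub> g \<notin> Y"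
        proof
          assume "inv\<^bsub>G\<^esub> h \<otimes>\<^bsub>G\<^esub> g \<in> Y"
          moreover have "g = h \<otimes>\<^bsub>G\<^esub> (inv\<^bsub>G\<^esub> h \<otimes>\<^bsub>G\<^esub> g)" using hG gG by (simp add: G.m_assoc[symmetric])
          ultimately show False using g by blast
        qed
        then show "frag_cmul (r h * b (inv\<^bsub>G\<^esub> h \<otimes>\<^bsub>G\<^esub> g)) (frag_of (H #>\<^bsub>G\<^esub> g)) = 0" by (simp add: Y_def)
      qed
    qed
    also have "\<dots> = (\<Sum>g\<in>Y. frag_cmul (r h * b (inv\<^bsub>G\<^esub> h \<otimes>\<^bsub>G\<^esub> (h \<otimes>\<^bsub>G\<^esub> g))) (frag_of (H #>\<^bsub>G\<^esub> (h \<otimes>\<^bsub>G\<^esub> g))))"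
      using hG Y by (subst sum.reindex) (auto simp: inj_on_def subset_iff)
    also have "\<dots> = (\<Sum>g\<in>Y. frag_cmul (r h * b g) (frag_of (H #>\<^bsub>G\<^esub> g)))"
    proof (rule sum.cong[OF refl])
      fix g assume "g \<in> Y"
      then have gG: "g \<in> carrier G" using Y by auto
      have "H #>\<^bsub>G\<^esub> (h \<otimes>\<^bsub>G\<^esub> g) = (H #>\<^bsub>G\<^esub> h) #>\<^bsub>G\<^esub> g" using G.coset_mult_assoc[OF H_sub hG(1) gG] by simp
      also have "H #>\<^bsub>G\<^esub> h = H" using G.coset_join2[OF hG(1) subgroup_H hG(2)] .
      finally show "frag_cmul (r h * b (inv\<^bsub>G\<^esub> h \<otimes>\<^bsub>G\<^esub> (h \<otimes>\<^bsub>G\<^esub> g))) (frag_of (H #>\<^bsub>G\<^esub> (h \<otimes>\<^bsub>G\<^esub> g))) =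
        frag_cmul (r h * b g) (frag_of (H #>\<^bsub>G\<^esub> g))" using hG gG by (simp add: G.m_assoc[symmetric])
    qed
    also have "\<dots> = frag_cmul (r h) (coset_sum b)" by (simp add: coset_sum_def Y_def frag_cmul_sum)
    finally show ?thesis .
  qed
  have "coset_sum (r \<otimes>\<^bsub>ZG\<^esub> b) = (\<Sum>g\<in>A. frag_cmul ((r \<otimes>\<^bsub>ZG\<^esub> b) g) (frag_of (H #>\<^bsub>G\<^esub> g)))"
    by (rule coset_sum_superset[OF A(1) supp])
  also have "\<dots> = (\<Sum>g\<in>A. \<Sum>h\<in>X. frag_cmul (r h * b (inv\<^bsub>G\<^esub> h \<otimes>\<^bsub>G\<^esub> g)) (frag_of (H #>\<^bsub>G\<^esub> g)))"
    using A(2) by (intro sum.cong) (auto simp: group_ring_int_simps X_def frag_cmul_sum_left)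
  also have "\<dots> = (\<Sum>h\<in>X. frag_cmul (r h) (coset_sum b))"
    using fixed by (subst sum.swap) simp
  also have "\<dots> = frag_cmul (\<Sum>g | r g \<noteq> 0. r g) (coset_sum b)" by (simp add: frag_cmul_sum_left X_def)
  finally show ?thesis .
qed

definition "to_cosets = frag_extend (\<lambda>(n, a). frag_cmul n (coset_sum a))"

lemma to_cosets_N: "n \<in> N \<Longrightarrow> to_cosets n = 0"
proof (induct rule: N_induct)
  case (rel r)
  then show ?case
    by (cases rule: rels_cases)
      (simp_all add: to_cosets_def frag_extend_diff frag_cmul_distrib frag_cmul_distrib2 coset_sum_add coset_sum_mult
        mult.commute)
qed (simp_all add: to_cosets_def frag_extend_minus frag_extend_add)

lemma to_cosets_keys: "f \<in> carrier F \<Longrightarrow> Poly_Mapping.keys (to_cosets f) \<subseteq> (\<lambda>x. H #>\<^bsub>G\<^esub> x) ` carrier G"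
proof -
  assume f: "f \<in> carrier F"
  have "Poly_Mapping.keys (coset_sum a) \<subseteq> (\<lambda>x. H #>\<^bsub>G\<^esub> x) ` carrier G" if "a \<in> carrier ZG" for a
  proof -
    have "Poly_Mapping.keys (coset_sum a) \<subseteq> (\<Union>g\<in>{g. a g \<noteq> 0}. Poly_Mapping.keys (frag_cmul (a g) (frag_of (H #>\<^bsub>G\<^esub> g))))"
      unfolding coset_sum_def by (rule keys_sum)
    also have "\<dots> \<subseteq> (\<lambda>x. H #>\<^bsub>G\<^esub> x) ` carrier G" using that by (auto simp: group_ring_int_simps)
    finally show ?thesis .
  qed
  then have *: "Poly_Mapping.keys (frag_cmul n (coset_sum a)) \<subseteq> (\<lambda>x. H #>\<^bsub>G\<^esub> x) ` carrier G"
    if "(n, a) \<in> pairs" for n a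
    by (rule subset_trans[OF keys_cmul]) (use that \<open>\<And>a. a \<in> carrier ZG \<Longrightarrow> _\<close> in \<open>simp add: pairs_def\<close>)
  have "(\<Union>p\<in>Poly_Mapping.keys f. Poly_Mapping.keys ((\<lambda>(n, a). frag_cmul n (coset_sum a)) p)) \<subseteq> (\<lambda>x. H #>\<^bsub>G\<^esub> x) ` carrier G"
  proof (rule UN_least)
    fix p assume "p \<in> Poly_Mapping.keys f"
    then have "p \<in> pairs" using f by auto
    then show "Poly_Mapping.keys ((\<lambda>(n, a). frag_cmul n (coset_sum a)) p) \<subseteq> (\<lambda>x. H #>\<^bsub>G\<^esub> x) ` carrier G"
      using * by (cases p) simp
  qed
  then show ?thesis unfolding to_cosets_def by (rule subset_trans[OF keys_frag_extend])
qed

text \<open>\<open>u\<close> is constant on cosets and extends to the free abelian group on them.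
  Composing with \<open>to_cosets\<close>, which kills \<open>N\<close>, gives a map that does not
  depend on the representative of a tensor.\<close>

lemma perm_univ:
  assumes V: "abelian_group V" and u: "\<And>x. x \<in> carrier G \<Longrightarrow> u x \<in> carrier V"
    and inv: "\<And>h x. h \<in> H \<Longrightarrow> x \<in> carrier G \<Longrightarrow> u (h \<otimes>\<^bsub>G\<^esub> x) = u x"
  obtains l where "\<And>p. p \<in> carrier (perm_module G H) \<Longrightarrow> l p \<in> carrier V"
    "\<And>p q. p \<in> carrier (perm_module G H) \<Longrightarrow> q \<in> carrier (perm_module G H) \<Longrightarrow>
      l (p \<oplus>\<^bsub>perm_module G H\<^esub> q) = l p \<oplus>\<^bsub>V\<^esub> l q"
    "\<And>x. x \<in> carrier G \<Longrightarrow> l (point x) = u x"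
proof -
  interpret V: abelian_group V by fact
  define cs where "cs = (\<lambda>x. H #>\<^bsub>G\<^esub> x) ` carrier G"
  define v where "v X = u (SOME x. x \<in> carrier G \<and> X = H #>\<^bsub>G\<^esub> x)" for X
  have v: "v (H #>\<^bsub>G\<^esub> x) = u x" if x: "x \<in> carrier G" for x
  proof -
    define y where "y = (SOME y. y \<in> carrier G \<and> H #>\<^bsub>G\<^esub> x = H #>\<^bsub>G\<^esub> y)"
    have y: "y \<in> carrier G" "H #>\<^bsub>G\<^esub> x = H #>\<^bsub>G\<^esub> y"
      using someI[of "\<lambda>y. y \<in> carrier G \<and> H #>\<^bsub>G\<^esub> x = H #>\<^bsub>G\<^esub> y" x] x by (auto simp: y_def)
    then have "y \<in> H #>\<^bsub>G\<^esub> x" using G.rcos_self[OF y(1) subgroup_H] by simp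
    then obtain h where "h \<in> H" "y = h \<otimes>\<^bsub>G\<^esub> x" by (auto simp: r_coset_def)
    then have "u y = u x" using inv x by simp
    then show ?thesis by (simp add: v_def y_def)
  qed
  have "v ` cs \<subseteq> carrier (add_monoid V)" using u v by (auto simp: cs_def)
  then obtain h where h: "h \<in> hom (free_Abelian_group cs) (add_monoid V)" "\<And>X. X \<in> cs \<Longrightarrow> h (frag_of X) = v X"
    using comm_group.free_Abelian_group_universal[OF V.a_comm_group] by blast
  have tc: "to_cosets f \<in> carrier (free_Abelian_group cs)" if "f \<in> carrier F" for f
    using to_cosets_keys[OF that] by (simp add: cs_def)
  define l where "l X = h (to_cosets (SOME f. f \<in> carrier F \<and> X = cl f))" for X
  have l: "l (cl f) = h (to_cosets f)" if f: "f \<in> carrier F" for f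
  proof -
    define f' where "f' = (SOME f'. f' \<in> carrier F \<and> cl f = cl f')"
    have f': "f' \<in> carrier F" "cl f = cl f'"
      using someI[of "\<lambda>f'. f' \<in> carrier F \<and> cl f = cl f'" f] f by (auto simp: f'_def)
    then have "to_cosets (f - f') = 0" using to_cosets_N cl_eq_iff by blast
    then have "to_cosets f = to_cosets f'" by (simp add: to_cosets_def frag_extend_diff)
    then show ?thesis by (simp add: l_def f'_def)
  qed
  show ?thesis
  proof (rule that[of l])
    show "l p \<in> carrier V" if "p \<in> carrier (perm_module G H)" for p
      using that hom_in_carrier[OF h(1)] tc by (auto simp: perm_carrier l)
    show "l (p \<oplus>\<^bsub>perm_module G H\<^esub> q) = l p \<oplus>\<^bsub>V\<^esub> l q"
      if pq: "p \<in> carrier (perm_module G H)" "q \<in> carrier (perm_module G H)" for p q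
    proof -
      obtain f g where fg: "p = cl f" "f \<in> carrier F" "q = cl g" "g \<in> carrier F"
        using pq unfolding perm_carrier by blast
      have "f + g \<in> carrier F" using keys_add_sub[of f pairs g] fg by simp
      moreover have "to_cosets (f + g) = to_cosets f + to_cosets g" by (simp add: to_cosets_def frag_extend_add)
      ultimately show ?thesis using hom_mult[OF h(1) tc[OF fg(2)] tc[OF fg(4)]] fg
        by (simp add: perm_add l)
    qed
    show "l (point x) = u x" if x: "x \<in> carrier G" for x
    proof -
      have "coset_sum (int_delta x) = frag_of (H #>\<^bsub>G\<^esub> x)"
        using coset_sum_superset[of "{x}" "int_delta x"] by (auto simp: int_single_apply)
      then show ?thesis using l[OF point_frag[OF x]] h(2)[of "H #>\<^bsub>G\<^esub> x"] v x
        by (simp add: point_def to_cosets_def cs_def)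
    qed
  qed
qed

end

section \<open>Modules isomorphic to finite sums of permutation modules\<close>

abbreviation "zact C \<equiv> (\<lambda>x g. int_delta g \<odot>\<^bsub>C\<^esub> x)"

lemma right_gmod_of_module:
  assumes "group G" "right_module (group_ring \<Z> G) C"
  shows "right_gmod G C (zact C)"
proof -
  interpret G: group G by fact
  interpret C: right_module "group_ring \<Z> G" C by fact
  have s: "int_delta g \<in> carrier (group_ring \<Z> G)" if "g \<in> carrier G" for g
    using that by (auto simp: group_ring_int_simps int_single_apply)
  have one: "int_delta \<one>\<^bsub>G\<^esub> = \<one>\<^bsub>group_ring \<Z> G\<^esub>" using gr_single_one[of \<Z> G] by simp
  have mult: "int_delta (g \<otimes>\<^bsub>G\<^esub> h) = int_delta g \<otimes>\<^bsub>group_ring \<Z> G\<^esub> int_delta h"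
    if "g \<in> carrier G" "h \<in> carrier G" for g h
    using gr_single_mult[OF ring_Z assms(1), of 1 1 g h] that by simp
  show ?thesis
    by (intro right_gmod.intro right_gmod_axioms.intro G.group_axioms C.M.abelian_group_axioms)
      (auto simp: s one mult C.smult_r_distr C.smult_assoc C.smult_one)
qed

locale perm_iso =
  fixes G :: "('g, 'gz) monoid_scheme" and C :: "('g \<Rightarrow> int, 'c, 'cz) module_scheme"
    and I :: "'i set" and H :: "'i \<Rightarrow> 'g set" and \<phi>
  assumes group_G: "group G" and mod_C: "right_module (group_ring \<Z> G) C"
    and I: "finite I" and H: "\<And>k. k \<in> I \<Longrightarrow> subgroup (H k) G"
    and \<phi>: "\<phi> \<in> mod_hom (group_ring \<Z> G) C (direct_sum I (\<lambda>k. perm_module G (H k)))"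
      "bij_betw \<phi> (carrier C) (carrier (direct_sum I (\<lambda>k. perm_module G (H k))))"
begin

interpretation G: group G by (rule group_G)
interpretation C: right_module "group_ring \<Z> G" C by (rule mod_C)
interpretation C': right_gmod G C "zact C" by (rule right_gmod_of_module[OF group_G mod_C])

lemma perm_mod: "k \<in> I \<Longrightarrow> coset_module G (H k)"
  by (intro coset_module.intro group_G H C.R.ring_axioms)

abbreviation "A k \<equiv> perm_module G (H k)"
abbreviation "D \<equiv> direct_sum I A"

lemma D_simps:
  "carrier D = (\<Pi>\<^sub>E k\<in>I. carrier (A k))" "x \<oplus>\<^bsub>D\<^esub> y = (\<lambda>k\<in>I. x k \<oplus>\<^bsub>A k\<^esub> y k)"
  "s \<odot>\<^bsub>D\<^esub> x = (\<lambda>k\<in>I. s \<odot>\<^bsub>A k\<^esub> x k)"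
  using I by (auto simp: direct_sum_def)

lemma A_closed: "k \<in> I \<Longrightarrow> p \<in> carrier (A k) \<Longrightarrow> q \<in> carrier (A k) \<Longrightarrow> p \<oplus>\<^bsub>A k\<^esub> q \<in> carrier (A k)"
proof -
  assume a: "k \<in> I" "p \<in> carrier (A k)" "q \<in> carrier (A k)"
  interpret c: coset_module G "H k" by (rule perm_mod[OF a(1)])
  obtain f g where fg: "p = c.cl f" "f \<in> carrier c.F" "q = c.cl g" "g \<in> carrier c.F"
    using a(2,3) unfolding c.perm_carrier by blast
  then have "f + g \<in> carrier c.F" using c.keys_add_sub[of f c.pairs g] by simp
  then show ?thesis using fg c.perm_add c.perm_carrier by auto
qed

text \<open>Identities are verified in \<open>C\<close>, which is known to be a module, by
  injectivity of \<open>\<phi>\<close>. On the side of the summands such verifications come down to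
  closure, the zero laws and the action on points.\<close>

lemma A_zero:
  assumes "k \<in> I"
  shows "\<zero>\<^bsub>A k\<^esub> \<in> carrier (A k)" "p \<in> carrier (A k) \<Longrightarrow> p \<oplus>\<^bsub>A k\<^esub> \<zero>\<^bsub>A k\<^esub> = p"
    "p \<in> carrier (A k) \<Longrightarrow> \<zero>\<^bsub>A k\<^esub> \<oplus>\<^bsub>A k\<^esub> p = p"
    "g \<in> carrier G \<Longrightarrow> int_delta g \<odot>\<^bsub>A k\<^esub> \<zero>\<^bsub>A k\<^esub> = \<zero>\<^bsub>A k\<^esub>"
proof -
  interpret c: coset_module G "H k" by (rule perm_mod[OF assms])
  have 0: "(0 :: int \<times> ('g \<Rightarrow> int) \<Rightarrow>\<^sub>0 int) \<in> carrier c.F" by simp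
  show "\<zero>\<^bsub>A k\<^esub> \<in> carrier (A k)" using 0 unfolding c.perm_zero c.perm_carrier by blast
  show "p \<in> carrier (A k) \<Longrightarrow> p \<oplus>\<^bsub>A k\<^esub> \<zero>\<^bsub>A k\<^esub> = p" "p \<in> carrier (A k) \<Longrightarrow> \<zero>\<^bsub>A k\<^esub> \<oplus>\<^bsub>A k\<^esub> p = p"
    using c.perm_add[OF 0] c.perm_add[OF _ 0] by (auto simp: c.perm_zero c.perm_carrier)
  show "g \<in> carrier G \<Longrightarrow> int_delta g \<odot>\<^bsub>A k\<^esub> \<zero>\<^bsub>A k\<^esub> = \<zero>\<^bsub>A k\<^esub>" by (simp add: c.perm_zero c.zero_smult)
qed

definition "inj_at k p = inv_into (carrier C) \<phi> (\<lambda>j\<in>I. if j = k then p else \<zero>\<^bsub>A j\<^esub>)"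

text \<open>The element \<open>1 \<otimes> 1\<close> of the \<open>k\<close>-th summand, carried to
  \<open>C\<close> by the inverse of \<open>\<phi>\<close>; it becomes \<open>e k\<close> in
  \<open>permutation_hom\<close>.\<close>

definition "gen k = inj_at k (coset_module.point G (H k) \<one>\<^bsub>G\<^esub>)"

lemma \<phi>_inv: "y \<in> carrier D \<Longrightarrow> inv_into (carrier C) \<phi> y \<in> carrier C" "y \<in> carrier D \<Longrightarrow> \<phi> (inv_into (carrier C) \<phi> y) = y"
  using \<phi>(2) by (auto simp: bij_betw_def intro: inv_into_into f_inv_into_f)

lemma \<phi>_inj: "x \<in> carrier C \<Longrightarrow> y \<in> carrier C \<Longrightarrow> \<phi> x = \<phi> y \<Longrightarrow> x = y"
  using \<phi>(2) by (auto simp: bij_betw_def dest: inj_onD)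

lemma single_closed: "k \<in> I \<Longrightarrow> p \<in> carrier (A k) \<Longrightarrow> (\<lambda>j\<in>I. if j = k then p else \<zero>\<^bsub>A j\<^esub>) \<in> carrier D"
  using A_zero(1) by (auto simp: D_simps)

lemma inj_at: "k \<in> I \<Longrightarrow> p \<in> carrier (A k) \<Longrightarrow> inj_at k p \<in> carrier C"
  "k \<in> I \<Longrightarrow> p \<in> carrier (A k) \<Longrightarrow> \<phi> (inj_at k p) = (\<lambda>j\<in>I. if j = k then p else \<zero>\<^bsub>A j\<^esub>)"
  unfolding inj_at_def using \<phi>_inv single_closed by auto

lemma inj_at_add:
  assumes "k \<in> I" "p \<in> carrier (A k)" "q \<in> carrier (A k)"
  shows "inj_at k (p \<oplus>\<^bsub>A k\<^esub> q) = inj_at k p \<oplus>\<^bsub>C\<^esub> inj_at k q"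
proof (rule \<phi>_inj)
  show "\<phi> (inj_at k (p \<oplus>\<^bsub>A k\<^esub> q)) = \<phi> (inj_at k p \<oplus>\<^bsub>C\<^esub> inj_at k q)"
    unfolding mod_homD(2)[OF \<phi>(1) inj_at(1)[OF assms(1,2)] inj_at(1)[OF assms(1,3)]]
      inj_at(2)[OF assms(1) A_closed[OF assms]] inj_at(2)[OF assms(1,2)] inj_at(2)[OF assms(1,3)] D_simps
    using A_zero by (auto intro!: restrict_ext)
qed (use inj_at(1) assms A_closed in auto)

lemma inj_at_point:
  assumes "k \<in> I" "x \<in> carrier G"
  shows "inj_at k (coset_module.point G (H k) x) = zact C (gen k) x"
proof (rule \<phi>_inj)
  interpret c: coset_module G "H k" by (rule perm_mod[OF assms(1)])
  have p: "c.point x \<in> carrier (A k)" "c.point \<one>\<^bsub>G\<^esub> \<in> carrier (A k)" using c.point_closed assms by auto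
  have g: "gen k \<in> carrier C" unfolding gen_def by (rule inj_at(1)[OF assms(1) p(2)])
  have s: "int_delta x \<in> carrier (group_ring \<Z> G)" using c.single_ZG assms by simp
  show "inj_at k (c.point x) \<in> carrier C" using inj_at(1) p assms by simp
  show "zact C (gen k) x \<in> carrier C" using C'.ract_closed g assms by simp
  show "\<phi> (inj_at k (c.point x)) = \<phi> (zact C (gen k) x)"
    unfolding mod_homD(3)[OF \<phi>(1) s g] inj_at(2)[OF assms(1) p(1)] D_simps
    unfolding gen_def inj_at(2)[OF assms(1) p(2)]
    using A_zero(4) assms c.point_smult[of "\<one>\<^bsub>G\<^esub>" x] by (auto intro!: restrict_ext)
qed

lemma gen_closed: "k \<in> I \<Longrightarrow> gen k \<in> carrier C"
  unfolding gen_def using inj_at(1) coset_module.point_closed[OF perm_mod] by simp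

lemma gen_fixed:
  assumes "k \<in> I" "h \<in> H k"
  shows "zact C (gen k) h = gen k"
proof -
  have "h \<in> carrier G" using assms H subgroup.mem_carrier by metis
  then show ?thesis
    using inj_at_point[of k h] coset_module.point_H[OF perm_mod[OF assms(1)] assms(2)] assms(1)
    by (simp add: gen_def)
qed

text \<open>Agreement spreads from the translates of \<open>gen k\<close> to the whole
  \<open>k\<close>-th summand by \<open>F_generated\<close>, and from the summands to
  \<open>C\<close> by adding the components of an element one index at a time.\<close>

lemma uniq:
  assumes V: "abelian_group V" and l: "l \<in> add_homs C V" "l' \<in> add_homs C V"
    and eq: "\<And>k x. k \<in> I \<Longrightarrow> x \<in> carrier G \<Longrightarrow> l (zact C (gen k) x) = l' (zact C (gen k) x)"
  shows "l = l'"
proof -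
  interpret V: abelian_group V by fact
  note zero = add_homs_zero[OF C.M.abelian_group_axioms V] and add = add_homsD(2) and cl = add_homsD(1)
  have at: "l (inj_at k p) = l' (inj_at k p)" if k: "k \<in> I" and p: "p \<in> carrier (A k)" for k p
  proof -
    interpret c: coset_module G "H k" by (rule perm_mod[OF k])
    define Q where "Q f \<longleftrightarrow> f \<in> carrier c.F \<and> l (inj_at k (c.cl f)) = l' (inj_at k (c.cl f))" for f
    have cA: "c.cl f \<in> carrier (A k)" if "f \<in> carrier c.F" for f using that c.perm_carrier by auto
    have Q0: "Q 0"
    proof -
      have "inj_at k (c.cl 0) \<oplus>\<^bsub>C\<^esub> inj_at k (c.cl 0) = inj_at k (c.cl 0)"
        using inj_at_add[OF k cA cA, of 0 0] c.perm_add[of 0 0] by simp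
      then have "inj_at k (c.cl 0) = \<zero>\<^bsub>C\<^esub>" using inj_at(1)[OF k cA, of 0] C.M.add.l_cancel_one' by simp
      then show ?thesis by (simp add: Q_def zero[OF l(1)] zero[OF l(2)])
    qed
    have "Q f" if "f \<in> carrier c.F" for f
    proof (rule c.F_generated[where Q = Q, OF Q0 _ _ _ that])
      show "Q (f - g)" if "Q f" "Q g" for f g
      proof -
        have F: "f \<in> carrier c.F" "g \<in> carrier c.F" "f - g \<in> carrier c.F"
          using that c.keys_diff_sub[of f c.pairs g] by (auto simp: Q_def simp del: carrier_free_Abelian_group_iff)
             (simp_all add: Q_def)
        \<comment> \<open>\<open>F_generated\<close> asks for differences while
          \<open>inj_at\<close> is additive, so \<open>f\<close> is written as
          \<open>(f - g) + g\<close> and the value at \<open>g\<close> is cancelled in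
          \<open>V\<close>.\<close>
        have "inj_at k (c.cl f) = inj_at k (c.cl (f - g)) \<oplus>\<^bsub>C\<^esub> inj_at k (c.cl g)"
          using inj_at_add[OF k cA[OF F(3)] cA[OF F(2)]] c.perm_add[OF F(3,2)] by simp
        then have e: "m (inj_at k (c.cl f)) = m (inj_at k (c.cl (f - g))) \<oplus>\<^bsub>V\<^esub> m (inj_at k (c.cl g))"
          if "m \<in> add_homs C V" for m
          using add[OF that inj_at(1)[OF k cA[OF F(3)]] inj_at(1)[OF k cA[OF F(2)]]] by simp
        note ic = inj_at(1)[OF k cA[OF F(3)]] inj_at(1)[OF k cA[OF F(2)]]
        have "l (inj_at k (c.cl (f - g))) \<oplus>\<^bsub>V\<^esub> l (inj_at k (c.cl g)) = l' (inj_at k (c.cl (f - g))) \<oplus>\<^bsub>V\<^esub> l (inj_at k (c.cl g))"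
          using e[OF l(1)] e[OF l(2)] that by (simp add: Q_def)
        then show ?thesis using cl[OF l(1) ic(1)] cl[OF l(2) ic(1)] cl[OF l(1) ic(2)] F V.add.right_cancel by (simp add: Q_def)
      qed
      show "Q r" if "r \<in> c.rels" for r
      proof -
        have "c.cl r = c.cl 0" using c.cl_eq_iff[of r 0] c.rels_N[OF that] by simp
        then show ?thesis using Q0 c.rels_sub that by (auto simp: Q_def simp del: carrier_free_Abelian_group_iff)
      qed
      show "Q (frag_of (1, int_delta x))" if "x \<in> carrier G" for x
        using inj_at_point[OF k that] eq[OF k that] c.point_frag[OF that] by (simp add: Q_def c.point_def)
    qed
    then show ?thesis using p unfolding c.perm_carrier by (auto simp: Q_def simp del: carrier_free_Abelian_group_iff)
  qed
  show ?thesis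
  proof
    fix c show "l c = l' c"
    proof (cases "c \<in> carrier C")
      case True
      define y where "y = \<phi> c"
      have y: "y \<in> carrier D" using mod_homD(1)[OF \<phi>(1)] True by (simp add: y_def)
      \<comment> \<open>\<open>t J\<close> is the part of \<open>c\<close> with components in
        \<open>J\<close>; it runs from 0 at the empty set to \<open>c\<close> at
        \<open>J = I\<close>.\<close>
      define t where "t J = inv_into (carrier C) \<phi> (\<lambda>j\<in>I. if j \<in> J then y j else \<zero>\<^bsub>A j\<^esub>)" for J
      have tD: "(\<lambda>j\<in>I. if j \<in> J then y j else \<zero>\<^bsub>A j\<^esub>) \<in> carrier D" for J
        using y A_zero(1) by (auto simp: D_simps)
      have t: "t J \<in> carrier C" "\<phi> (t J) = (\<lambda>j\<in>I. if j \<in> J then y j else \<zero>\<^bsub>A j\<^esub>)" for J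
        using \<phi>_inv[OF tD] by (auto simp: t_def)
      have "l (t J) = l' (t J)" if "finite J" "J \<subseteq> I" for J
        using that
      proof (induct J)
        case empty
        have "t {} \<oplus>\<^bsub>C\<^esub> t {} = t {}"
        proof (rule \<phi>_inj)
          show "\<phi> (t {} \<oplus>\<^bsub>C\<^esub> t {}) = \<phi> (t {})"
            unfolding mod_homD(2)[OF \<phi>(1) t(1) t(1)] t(2) D_simps using A_zero by (auto intro!: restrict_ext)
        qed (use t in auto)
        then have "t {} = \<zero>\<^bsub>C\<^esub>" using t(1)[of "{}"] C.M.add.l_cancel_one' by simp
        then show ?case by (simp add: zero[OF l(1)] zero[OF l(2)])
      next
        case (insert k J)
        then have k: "k \<in> I" and yk: "y k \<in> carrier (A k)" using y by (auto simp: D_simps)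
        have "t (insert k J) = t J \<oplus>\<^bsub>C\<^esub> inj_at k (y k)"
        proof (rule \<phi>_inj)
          have yj: "y j \<in> carrier (A j)" if "j \<in> I" for j using y that by (auto simp: D_simps)
          show "\<phi> (t (insert k J)) = \<phi> (t J \<oplus>\<^bsub>C\<^esub> inj_at k (y k))"
            unfolding mod_homD(2)[OF \<phi>(1) t(1) inj_at(1)[OF k yk]] t(2) inj_at(2)[OF k yk] D_simps
          proof (rule restrict_ext)
            fix j assume j: "j \<in> I"
            show "(if j \<in> insert k J then y j else \<zero>\<^bsub>A j\<^esub>) =
              (\<lambda>j\<in>I. if j \<in> J then y j else \<zero>\<^bsub>A j\<^esub>) j \<oplus>\<^bsub>A j\<^esub> (\<lambda>j\<in>I. if j = k then y k else \<zero>\<^bsub>A j\<^esub>) j"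
              using j A_zero[OF j] yj[OF j] insert(2) by (cases "j = k") auto
          qed
        qed (use t inj_at(1)[OF k yk] in auto)
        then show ?case
          using add[OF l(1) t(1) inj_at(1)[OF k yk]] add[OF l(2) t(1) inj_at(1)[OF k yk]] at[OF k yk] insert by simp
      qed
      moreover have "t I = c"
      proof (rule \<phi>_inj[OF t(1) True])
        show "\<phi> (t I) = \<phi> c" unfolding t(2) using y
          by (intro ext) (auto simp: D_simps y_def[symmetric] PiE_iff extensional_def)
      qed
      ultimately show ?thesis using I by blast
    next
      case False
      then show ?thesis using add_homsD(3)[OF l(1)] add_homsD(3)[OF l(2)] by (simp add: extensional_def)
    qed
  qed
qed

text \<open>Each summand is treated by \<open>perm_univ\<close>, and the resulting maps are added
  over the components. On a translate of \<open>gen k\<close> all components but one are zero, which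
  the maps kill, so that just the value \<open>u k x\<close> survives.\<close>

lemma univ:
  assumes V: "abelian_group V" and u: "\<And>k x. k \<in> I \<Longrightarrow> x \<in> carrier G \<Longrightarrow> u k x \<in> carrier V"
    and inv: "\<And>k h x. k \<in> I \<Longrightarrow> h \<in> H k \<Longrightarrow> x \<in> carrier G \<Longrightarrow> u k (h \<otimes>\<^bsub>G\<^esub> x) = u k x"
  shows "\<exists>l\<in>add_homs C V. \<forall>k\<in>I. \<forall>x\<in>carrier G. l (zact C (gen k) x) = u k x"
proof -
  interpret V: abelian_group V by fact
  have "\<exists>m. (\<forall>p\<in>carrier (A k). m p \<in> carrier V) \<and>
    (\<forall>p\<in>carrier (A k). \<forall>q\<in>carrier (A k). m (p \<oplus>\<^bsub>A k\<^esub> q) = m p \<oplus>\<^bsub>V\<^esub> m q) \<and>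
    (\<forall>x\<in>carrier G. m (coset_module.point G (H k) x) = u k x)" if k: "k \<in> I" for k
  proof -
    interpret c: coset_module G "H k" by (rule perm_mod[OF k])
    obtain m where "\<And>p. p \<in> carrier (A k) \<Longrightarrow> m p \<in> carrier V"
      "\<And>p q. p \<in> carrier (A k) \<Longrightarrow> q \<in> carrier (A k) \<Longrightarrow> m (p \<oplus>\<^bsub>A k\<^esub> q) = m p \<oplus>\<^bsub>V\<^esub> m q"
      "\<And>x. x \<in> carrier G \<Longrightarrow> m (c.point x) = u k x"
      by (rule c.perm_univ[OF V, of "u k"]) (use u[OF k] inv[OF k] in auto)
    then show ?thesis by blast
  qed
  then obtain m where m: "\<And>k p. k \<in> I \<Longrightarrow> p \<in> carrier (A k) \<Longrightarrow> m k p \<in> carrier V"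
    "\<And>k p q. k \<in> I \<Longrightarrow> p \<in> carrier (A k) \<Longrightarrow> q \<in> carrier (A k) \<Longrightarrow> m k (p \<oplus>\<^bsub>A k\<^esub> q) = m k p \<oplus>\<^bsub>V\<^esub> m k q"
    "\<And>k x. k \<in> I \<Longrightarrow> x \<in> carrier G \<Longrightarrow> m k (coset_module.point G (H k) x) = u k x" by metis
  have m0: "m k \<zero>\<^bsub>A k\<^esub> = \<zero>\<^bsub>V\<^esub>" if k: "k \<in> I" for k
    using m(2)[OF k A_zero(1)[OF k] A_zero(1)[OF k]] m(1)[OF k A_zero(1)[OF k]] A_zero(2)[OF k A_zero(1)[OF k]]
      V.add.l_cancel_one' by simp
  define l where "l = (\<lambda>c\<in>carrier C. \<Oplus>\<^bsub>V\<^esub>k\<in>I. m k (\<phi> c k))"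
  have \<phi>k: "\<phi> c k \<in> carrier (A k)" if "c \<in> carrier C" "k \<in> I" for c k
    using mod_homD(1)[OF \<phi>(1) that(1)] that(2) by (auto simp: D_simps)
  have fin: "(\<lambda>k. m k (\<phi> c k)) \<in> I \<rightarrow> carrier V" if "c \<in> carrier C" for c using m(1) \<phi>k[OF that] by auto
  have "l \<in> add_homs C V" unfolding l_def
  proof (rule add_homsI[OF _ _ C.M.abelian_group_axioms])
    show "(\<Oplus>\<^bsub>V\<^esub>k\<in>I. m k (\<phi> c k)) \<in> carrier V" if "c \<in> carrier C" for c
      by (rule V.finsum_closed[OF fin[OF that]])
    show "(\<Oplus>\<^bsub>V\<^esub>k\<in>I. m k (\<phi> (c \<oplus>\<^bsub>C\<^esub> c') k)) = (\<Oplus>\<^bsub>V\<^esub>k\<in>I. m k (\<phi> c k)) \<oplus>\<^bsub>V\<^esub> (\<Oplus>\<^bsub>V\<^esub>k\<in>I. m k (\<phi> c' k))"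
      if c: "c \<in> carrier C" "c' \<in> carrier C" for c c'
    proof -
      have "(\<Oplus>\<^bsub>V\<^esub>k\<in>I. m k (\<phi> (c \<oplus>\<^bsub>C\<^esub> c') k)) = (\<Oplus>\<^bsub>V\<^esub>k\<in>I. m k (\<phi> c k) \<oplus>\<^bsub>V\<^esub> m k (\<phi> c' k))"
        using fin[OF c(1)] fin[OF c(2)] m(2)[OF _ \<phi>k[OF c(1)] \<phi>k[OF c(2)]] mod_homD(2)[OF \<phi>(1) c]
        by (intro V.finsum_cong') (auto simp: D_simps)
      then show ?thesis using V.finsum_addf[OF fin[OF c(1)] fin[OF c(2)]] by simp
    qed
  qed
  moreover have "l (zact C (gen k) x) = u k x" if kx: "k \<in> I" "x \<in> carrier G" for k x
  proof -
    have p: "coset_module.point G (H k) x \<in> carrier (A k)" using coset_module.point_closed[OF perm_mod] kx by simp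
    have "l (zact C (gen k) x) = (\<Oplus>\<^bsub>V\<^esub>j\<in>I. m j (\<phi> (inj_at k (coset_module.point G (H k) x)) j))"
      using inj_at(1)[OF kx(1) p] inj_at_point[OF kx] by (simp add: l_def)
    also have "\<dots> = (\<Oplus>\<^bsub>V\<^esub>j\<in>I. if k = j then u k x else \<zero>\<^bsub>V\<^esub>)"
      using u[OF kx] m(3)[OF kx] m0 by (intro V.finsum_cong') (auto simp: inj_at(2)[OF kx(1) p])
    also have "\<dots> = u k x" using V.add.finprod_singleton[OF kx(1) I, of "\<lambda>_. u k x"] u[OF kx] by simp
    finally show ?thesis .
  qed
  ultimately show ?thesis by blast
qed

lemma permutation_hom:
  assumes "krep G K V act" "\<And>k. k \<in> I \<Longrightarrow> finite (H k)"
  shows "permutation_hom G C (zact C) K V act I H gen"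
proof -
  interpret V: krep G K V act by fact
  show ?thesis
    by (intro permutation_hom.intro hom_module.intro C'.right_gmod_axioms V.krep_axioms permutation_hom_axioms.intro I H
        assms(2) gen_closed gen_fixed uniq[OF V.V.M.abelian_group_axioms] univ[OF V.V.M.abelian_group_axioms])
qed

text \<open>\<open>inv_into\<close> picks a preimage of \<open>r (e k x)\<close> depending only on
  the element \<open>e k x\<close>, so the choice is automatically invariant under
  \<open>H k\<close> and \<open>univ\<close> applies with values in \<open>B\<close>. The lift is
  merely additive, and no compatibility with the group is claimed.\<close>

lemma lift:
  assumes "abelian_group B" "f \<in> add_homs B C" "r \<in> add_homs C C" "\<And>c. c \<in> carrier C \<Longrightarrow> r c \<in> f ` carrier B"
  shows "\<exists>s\<in>add_homs C B. \<forall>c\<in>carrier C. f (s c) = r c"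
proof -
  interpret B: abelian_group B by fact
  define u where "u k x = inv_into (carrier B) f (r (zact C (gen k) x))" for k x
  have gx: "zact C (gen k) x \<in> carrier C" if "k \<in> I" "x \<in> carrier G" for k x
    using C'.ract_closed gen_closed that by simp
  have u: "u k x \<in> carrier B" "f (u k x) = r (zact C (gen k) x)" if "k \<in> I" "x \<in> carrier G" for k x
    using assms(4)[OF gx[OF that]] by (auto simp: u_def intro: inv_into_into f_inv_into_f)
  have "u k (h \<otimes>\<^bsub>G\<^esub> x) = u k x" if "k \<in> I" "h \<in> H k" "x \<in> carrier G" for k h x
  proof -
    have "h \<in> carrier G" using that H subgroup.mem_carrier by metis
    then have "zact C (gen k) (h \<otimes>\<^bsub>G\<^esub> x) = zact C (gen k) x"
      using C'.ract_mult[of "gen k" h x] gen_closed gen_fixed that by simp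
    then show ?thesis by (simp add: u_def)
  qed
  then obtain s where s: "s \<in> add_homs C B" "\<And>k x. k \<in> I \<Longrightarrow> x \<in> carrier G \<Longrightarrow> s (zact C (gen k) x) = u k x"
    using univ[OF assms(1), of u] u(1) by blast
  have "(\<lambda>c\<in>carrier C. f (s c)) = r"
  proof (rule uniq[OF C.M.abelian_group_axioms _ assms(3)])
    show "(\<lambda>c\<in>carrier C. f (s c)) \<in> add_homs C C"
      using add_homsD(1,2)[OF s(1)] add_homsD(1,2)[OF assms(2)]
      by (intro add_homsI C.M.abelian_group_axioms) auto
    show "(\<lambda>c\<in>carrier C. f (s c)) (zact C (gen k) x) = r (zact C (gen k) x)" if "k \<in> I" "x \<in> carrier G" for k x
      using gx[OF that] s(2)[OF that] u(2)[OF that] by simp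
  qed
  then have "f (s c) = r c" if "c \<in> carrier C" for c using that by (metis restrict_apply')
  then show ?thesis using s(1) by blast
qed

end

section \<open>Resolutions and Euler characteristics\<close>

lemma (in krep) euler_zero:
  assumes "carrier V = {\<zero>\<^bsub>V\<^esub>}"
  shows "total_finite K (bar G V) (bar_d G V act)" "cx_euler K (bar G V) (bar_d G V act) = 0"
proof -
  have c: "carrier (bar G V n) = {\<zero>\<^bsub>bar G V n\<^esub>}" for n
    using assms by (auto simp: bar_def PiE_iff extensional_def fun_eq_iff)
  have "cyc (bar G V) (bar_d G V act) n = {\<zero>\<^bsub>bar G V n\<^esub>}" for n
    using c[of n] subspace_ofD(1,2)[OF bar_cx.subspace_cyc[of n]] by blast
  moreover have "bnd (bar G V) (bar_d G V act) n = {\<zero>\<^bsub>bar G V n\<^esub>}" for n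
    using c[of n] subspace_ofD(1,2)[OF bar_cx.subspace_bnd[of n]] by blast
  ultimately show "total_finite K (bar G V) (bar_d G V act)" "cx_euler K (bar G V) (bar_d G V act) = 0"
    using bar_cx.euler_concentrated[of 0] reldim_refl[of K "bar G V 0" "{\<zero>\<^bsub>bar G V 0\<^esub>}"] by simp_all
qed

text \<open>The differential \<open>D p\<close> goes from degree \<open>p + 1\<close> to degree \<open>p\<close>; \<open>lift\<close> is all that is needed of the
  projectivity of the terms as abelian groups.\<close>

locale finite_resolution =
  fixes G :: "('g, 'gz) monoid_scheme" and C :: "nat \<Rightarrow> ('c, 'cz) ring_scheme"
    and ract :: "nat \<Rightarrow> 'c \<Rightarrow> 'g \<Rightarrow> 'c" and D :: "nat \<Rightarrow> 'c \<Rightarrow> 'c" and \<epsilon> :: "'c \<Rightarrow> int" and N :: nat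
  assumes gmod: "\<And>p. right_gmod G (C p) (ract p)"
    and D_closed: "\<And>p x. x \<in> carrier (C (Suc p)) \<Longrightarrow> D p x \<in> carrier (C p)"
    and D_add: "\<And>p x y. x \<in> carrier (C (Suc p)) \<Longrightarrow> y \<in> carrier (C (Suc p)) \<Longrightarrow>
      D p (x \<oplus>\<^bsub>C (Suc p)\<^esub> y) = D p x \<oplus>\<^bsub>C p\<^esub> D p y"
    and D_ract: "\<And>p x g. x \<in> carrier (C (Suc p)) \<Longrightarrow> g \<in> carrier G \<Longrightarrow> D p (ract (Suc p) x g) = ract p (D p x) g"
    and D_D: "\<And>p x. x \<in> carrier (C (Suc (Suc p))) \<Longrightarrow> D p (D (Suc p) x) = \<zero>\<^bsub>C p\<^esub>"
    and D_exact: "\<And>p x. x \<in> carrier (C (Suc p)) \<Longrightarrow> D p x = \<zero>\<^bsub>C p\<^esub> \<Longrightarrow>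
      x \<in> D (Suc p) ` carrier (C (Suc (Suc p)))"
    and \<epsilon>_add: "\<And>x y. x \<in> carrier (C 0) \<Longrightarrow> y \<in> carrier (C 0) \<Longrightarrow> \<epsilon> (x \<oplus>\<^bsub>C 0\<^esub> y) = \<epsilon> x + \<epsilon> y"
    and \<epsilon>_ract: "\<And>x g. x \<in> carrier (C 0) \<Longrightarrow> g \<in> carrier G \<Longrightarrow> \<epsilon> (ract 0 x g) = \<epsilon> x"
    and \<epsilon>_exact: "\<And>x. x \<in> carrier (C 0) \<Longrightarrow> \<epsilon> x = 0 \<longleftrightarrow> x \<in> D 0 ` carrier (C 1)"
    and \<epsilon>_surj: "\<exists>c\<in>carrier (C 0). \<epsilon> c = 1"
    and lift: "\<And>p r. r \<in> add_homs (C p) (C p) \<Longrightarrow> (\<And>c. c \<in> carrier (C p) \<Longrightarrow> r c \<in> D p ` carrier (C (Suc p))) \<Longrightarrow>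
      \<exists>s\<in>add_homs (C p) (C (Suc p)). \<forall>c\<in>carrier (C p). D p (s c) = r c"
    and bounded: "\<And>p. p > N \<Longrightarrow> carrier (C p) = {\<zero>\<^bsub>C p\<^esub>}"
begin

section \<open>Splitting the resolution over the integers\<close>

lemma C_group: "abelian_group (C p)"
  using gmod by (rule right_gmod.axioms)

lemma D_zero: "D p \<zero>\<^bsub>C (Suc p)\<^esub> = \<zero>\<^bsub>C p\<^esub>"
proof -
  interpret A: abelian_group "C (Suc p)" by (rule C_group)
  interpret B: abelian_group "C p" by (rule C_group)
  have "D p \<zero>\<^bsub>C (Suc p)\<^esub> \<oplus>\<^bsub>C p\<^esub> D p \<zero>\<^bsub>C (Suc p)\<^esub> = D p \<zero>\<^bsub>C (Suc p)\<^esub>"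
    using D_add[of "\<zero>\<^bsub>C (Suc p)\<^esub>" p "\<zero>\<^bsub>C (Suc p)\<^esub>"] by simp
  then show ?thesis using D_closed[of "\<zero>\<^bsub>C (Suc p)\<^esub>" p] B.add.l_cancel_one' by simp
qed

lemma D_minus: "x \<in> carrier (C (Suc p)) \<Longrightarrow> y \<in> carrier (C (Suc p)) \<Longrightarrow>
  D p (x \<ominus>\<^bsub>C (Suc p)\<^esub> y) = D p x \<ominus>\<^bsub>C p\<^esub> D p y"
proof -
  assume xy: "x \<in> carrier (C (Suc p))" "y \<in> carrier (C (Suc p))"
  interpret A: abelian_group "C (Suc p)" by (rule C_group)
  interpret B: abelian_group "C p" by (rule C_group)
  have "D p (\<ominus>\<^bsub>C (Suc p)\<^esub> y) \<oplus>\<^bsub>C p\<^esub> D p y = \<zero>\<^bsub>C p\<^esub>"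
    using D_add[of "\<ominus>\<^bsub>C (Suc p)\<^esub> y" p y] xy D_zero by (simp add: A.l_neg)
  then have "D p (\<ominus>\<^bsub>C (Suc p)\<^esub> y) = \<ominus>\<^bsub>C p\<^esub> D p y" using B.minus_equality D_closed xy by simp
  then show ?thesis using D_add[of x p "\<ominus>\<^bsub>C (Suc p)\<^esub> y"] xy by (simp add: a_minus_def)
qed

text \<open>The cycles of degree \<open>p\<close> are a direct summand: at \<open>p = 0\<close> one subtracts \<open>\<epsilon> x\<close> times an
  element of augmentation 1, afterwards a section of the previous differential does the job.\<close>

lemma retraction:
  "\<exists>r\<in>add_homs (C p) (C p). (\<forall>c\<in>carrier (C p). r c \<in> D p ` carrier (C (Suc p))) \<and>
    (\<forall>x\<in>carrier (C (Suc p)). r (D p x) = D p x)"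
proof (induct p)
  case 0
  interpret A: abelian_group "C 0" by (rule C_group)
  obtain c0 where c0: "c0 \<in> carrier (C 0)" "\<epsilon> c0 = 1" using \<epsilon>_surj by blast
  have \<epsilon>0: "\<epsilon> \<zero>\<^bsub>C 0\<^esub> = 0" using \<epsilon>_add[of "\<zero>\<^bsub>C 0\<^esub>" "\<zero>\<^bsub>C 0\<^esub>"] by simp
  have \<epsilon>neg: "\<epsilon> (\<ominus>\<^bsub>C 0\<^esub> x) = - \<epsilon> x" if "x \<in> carrier (C 0)" for x
    using \<epsilon>_add[of "\<ominus>\<^bsub>C 0\<^esub> x" x] that \<epsilon>0 by (simp add: A.l_neg)
  have mult: "[n] \<cdot>\<^bsub>C 0\<^esub> c0 \<in> carrier (C 0)" "\<epsilon> ([n] \<cdot>\<^bsub>C 0\<^esub> c0) = n" for n :: int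
  proof -
    show c: "[n] \<cdot>\<^bsub>C 0\<^esub> c0 \<in> carrier (C 0)" for n :: int using c0(1) by (rule A.add.int_pow_closed)
    have "\<epsilon> ([n] \<cdot>\<^bsub>C 0\<^esub> c0) = n" for n :: int
    proof (induct n rule: int_induct[where k = 0])
      case base show ?case using \<epsilon>0 by (simp add: add_pow_def)
    next
      case (step1 i)
      then show ?case using A.add.int_pow_mult[OF c0(1), of i 1] \<epsilon>_add[OF c c0(1)] c0 by simp
    next
      case (step2 i)
      have "[i] \<cdot>\<^bsub>C 0\<^esub> c0 = [(i - 1)] \<cdot>\<^bsub>C 0\<^esub> c0 \<oplus>\<^bsub>C 0\<^esub> c0"
        using A.add.int_pow_mult[OF c0(1), of "i - 1" 1] c0(1) by simp
      then show ?case using step2 \<epsilon>_add[OF c c0(1), of "i - 1"] c0 by simp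
    qed
    then show "\<epsilon> ([n] \<cdot>\<^bsub>C 0\<^esub> c0) = n" .
  qed
  define r where "r = (\<lambda>x\<in>carrier (C 0). x \<ominus>\<^bsub>C 0\<^esub> [(\<epsilon> x)] \<cdot>\<^bsub>C 0\<^esub> c0)"
  have "r \<in> add_homs (C 0) (C 0)" unfolding r_def
  proof (rule add_homsI[OF _ _ C_group])
    show "x \<oplus>\<^bsub>C 0\<^esub> y \<ominus>\<^bsub>C 0\<^esub> [(\<epsilon> (x \<oplus>\<^bsub>C 0\<^esub> y))] \<cdot>\<^bsub>C 0\<^esub> c0 =
      x \<ominus>\<^bsub>C 0\<^esub> [(\<epsilon> x)] \<cdot>\<^bsub>C 0\<^esub> c0 \<oplus>\<^bsub>C 0\<^esub> (y \<ominus>\<^bsub>C 0\<^esub> [(\<epsilon> y)] \<cdot>\<^bsub>C 0\<^esub> c0)"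
      if "x \<in> carrier (C 0)" "y \<in> carrier (C 0)" for x y
      using that mult A.add.int_pow_mult[OF c0(1)] \<epsilon>_add[OF that]
      by (simp add: a_minus_def A.minus_add A.a_ac)
  qed (use mult in auto)
  moreover have "r c \<in> D 0 ` carrier (C (Suc 0))" if "c \<in> carrier (C 0)" for c
    using that \<epsilon>_exact[of "r c"] mult \<epsilon>_add[of c "\<ominus>\<^bsub>C 0\<^esub> ([(\<epsilon> c)] \<cdot>\<^bsub>C 0\<^esub> c0)"] \<epsilon>neg[OF mult(1)]
    by (simp add: r_def a_minus_def)
  moreover have "r (D 0 x) = D 0 x" if "x \<in> carrier (C (Suc 0))" for x
  proof -
    have "\<epsilon> (D 0 x) = 0" using \<epsilon>_exact[of "D 0 x"] D_closed[OF that] that by simp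
    then have "[(\<epsilon> (D 0 x))] \<cdot>\<^bsub>C 0\<^esub> c0 = \<zero>\<^bsub>C 0\<^esub>" by (simp add: add_pow_def)
    then show ?thesis using D_closed[OF that] by (simp add: r_def a_minus_def)
  qed
  ultimately show ?case by blast
next
  case (Suc p)
  then obtain r where r: "r \<in> add_homs (C p) (C p)" "\<And>c. c \<in> carrier (C p) \<Longrightarrow> r c \<in> D p ` carrier (C (Suc p))"
    "\<And>x. x \<in> carrier (C (Suc p)) \<Longrightarrow> r (D p x) = D p x" by blast
  obtain s where s: "s \<in> add_homs (C p) (C (Suc p))" "\<And>c. c \<in> carrier (C p) \<Longrightarrow> D p (s c) = r c"
    using lift[OF r(1,2)] by blast
  interpret A: abelian_group "C (Suc p)" by (rule C_group)
  interpret B: abelian_group "C p" by (rule C_group)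
  define r' where "r' = (\<lambda>x\<in>carrier (C (Suc p)). x \<ominus>\<^bsub>C (Suc p)\<^esub> s (D p x))"
  have sD: "s (D p x) \<in> carrier (C (Suc p))" if "x \<in> carrier (C (Suc p))" for x
    using add_homsD(1)[OF s(1) D_closed[OF that]] .
  have "r' \<in> add_homs (C (Suc p)) (C (Suc p))" unfolding r'_def
  proof (rule add_homsI[OF _ _ C_group])
    show "x \<oplus>\<^bsub>C (Suc p)\<^esub> y \<ominus>\<^bsub>C (Suc p)\<^esub> s (D p (x \<oplus>\<^bsub>C (Suc p)\<^esub> y)) =
      x \<ominus>\<^bsub>C (Suc p)\<^esub> s (D p x) \<oplus>\<^bsub>C (Suc p)\<^esub> (y \<ominus>\<^bsub>C (Suc p)\<^esub> s (D p y))"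
      if "x \<in> carrier (C (Suc p))" "y \<in> carrier (C (Suc p))" for x y
      using that sD[OF that(1)] sD[OF that(2)] D_add[OF that] add_homsD(2)[OF s(1) D_closed[OF that(1)] D_closed[OF that(2)]]
      by (simp add: a_minus_def A.minus_add A.a_ac)
  qed (use sD in auto)
  moreover have "r' c \<in> D (Suc p) ` carrier (C (Suc (Suc p)))" if c: "c \<in> carrier (C (Suc p))" for c
  proof (rule D_exact)
    show "r' c \<in> carrier (C (Suc p))" using c sD by (simp add: r'_def)
    have "D p (r' c) = D p c \<ominus>\<^bsub>C p\<^esub> D p c"
      using c sD[OF c] D_minus s(2)[OF D_closed[OF c]] r(3)[OF c] by (simp add: r'_def)
    then show "D p (r' c) = \<zero>\<^bsub>C p\<^esub>" using D_closed[OF c] by (simp add: a_minus_def B.r_neg)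
  qed
  moreover have "r' (D (Suc p) x) = D (Suc p) x" if x: "x \<in> carrier (C (Suc (Suc p)))" for x
    using D_closed[OF x] D_D[OF x] add_homs_zero[OF C_group C_group s(1)] by (simp add: r'_def a_minus_def)
  ultimately show ?case by blast
qed

text \<open>The extension is \<open>l \<circ> s\<close>, with \<open>s\<close> an additive lift of
  the retraction through \<open>D p\<close>. For \<open>x\<close> in degree \<open>p + 1\<close>,
  the element \<open>s (D p x) - x\<close> is a cycle, hence a boundary, hence killed by
  \<open>l\<close>.\<close>

lemma extend:
  assumes V: "abelian_group V" and l: "l \<in> add_homs (C (Suc p)) V"
    and zero: "\<And>x. x \<in> carrier (C (Suc (Suc p))) \<Longrightarrow> l (D (Suc p) x) = \<zero>\<^bsub>V\<^esub>"
  shows "\<exists>m\<in>add_homs (C p) V. \<forall>x\<in>carrier (C (Suc p)). m (D p x) = l x"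
proof -
  interpret A: abelian_group "C (Suc p)" by (rule C_group)
  interpret B: abelian_group "C p" by (rule C_group)
  interpret V: abelian_group V by fact
  obtain r where r: "r \<in> add_homs (C p) (C p)" "\<And>c. c \<in> carrier (C p) \<Longrightarrow> r c \<in> D p ` carrier (C (Suc p))"
    "\<And>x. x \<in> carrier (C (Suc p)) \<Longrightarrow> r (D p x) = D p x" using retraction[of p] by blast
  obtain s where s: "s \<in> add_homs (C p) (C (Suc p))" "\<And>c. c \<in> carrier (C p) \<Longrightarrow> D p (s c) = r c"
    using lift[OF r(1,2)] by blast
  have "(\<lambda>c\<in>carrier (C p). l (s c)) \<in> add_homs (C p) V"
    using add_homsD(1,2)[OF s(1)] add_homsD(1,2)[OF l] by (intro add_homsI C_group) auto
  moreover have "l (s (D p x)) = l x" if x: "x \<in> carrier (C (Suc p))" for x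
  proof -
    have sD: "s (D p x) \<in> carrier (C (Suc p))" using add_homsD(1)[OF s(1) D_closed[OF x]] .
    have "D p (s (D p x) \<ominus>\<^bsub>C (Suc p)\<^esub> x) = \<zero>\<^bsub>C p\<^esub>"
      using D_minus[OF sD x] s(2)[OF D_closed[OF x]] r(3)[OF x] D_closed[OF x] by (simp add: a_minus_def B.r_neg)
    then have "s (D p x) \<ominus>\<^bsub>C (Suc p)\<^esub> x \<in> D (Suc p) ` carrier (C (Suc (Suc p)))"
      using sD x by (intro D_exact) auto
    then have z: "l (s (D p x) \<ominus>\<^bsub>C (Suc p)\<^esub> x) = \<zero>\<^bsub>V\<^esub>" using zero by auto
    have "s (D p x) = (s (D p x) \<ominus>\<^bsub>C (Suc p)\<^esub> x) \<oplus>\<^bsub>C (Suc p)\<^esub> x"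
      using sD x by (simp add: a_minus_def A.a_assoc A.l_neg)
    then have "l (s (D p x)) = l (s (D p x) \<ominus>\<^bsub>C (Suc p)\<^esub> x) \<oplus>\<^bsub>V\<^esub> l x"
      using add_homsD(2)[OF l _ x, of "s (D p x) \<ominus>\<^bsub>C (Suc p)\<^esub> x"] sD x by simp
    then show ?thesis using z add_homsD(1)[OF l x] by simp
  qed
  ultimately show ?thesis using D_closed by (intro bexI[of _ "\<lambda>c\<in>carrier (C p). l (s c)"]) auto
qed

section \<open>Cutting the dual complex into short exact sequences\<close>

text \<open>Equivalently, the additive maps on \<open>C p\<close> modulo boundaries; this is the
  kernel of precomposition with \<open>D p\<close>.\<close>

definition "killing V p = {l \<in> add_homs (C p) V. \<forall>x\<in>carrier (C (Suc p)). l (D p x) = \<zero>\<^bsub>V\<^esub>}"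

abbreviation "hact p act \<equiv> hom_act (C p) (ract p) act"
abbreviation "hom_sub V p \<equiv> (hom_rep (C p) V)\<lparr>carrier := killing V p\<rparr>"

lemma hom_module: "krep G K V act \<Longrightarrow> hom_module G (C p) (ract p) K V act"
  by (intro hom_module.intro gmod)

lemma krep_hom_sub:
  assumes "krep G K V act"
  shows "krep G K (hom_sub V p) (hact p act)"
proof -
  interpret V: krep G K V act by fact
  interpret C: right_gmod G "C p" "ract p" by (rule gmod)
  interpret S: right_gmod G "C (Suc p)" "ract (Suc p)" by (rule gmod)
  interpret h: hom_module G "C p" "ract p" K V act by (rule hom_module) fact
  interpret W: krep G K "hom_rep (C p) V" "hact p act" by (rule h.krep_hom)
  show ?thesis
  proof (rule W.krep_subspace)
    show "subspace_of K (hom_rep (C p) V) (killing V p)"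
      unfolding subspace_of_def
    proof (intro conjI ballI)
      show "\<zero>\<^bsub>hom_rep (C p) V\<^esub> \<in> killing V p"
        using W.V.M.zero_closed D_closed by (auto simp: killing_def)
      show "x \<oplus>\<^bsub>hom_rep (C p) V\<^esub> y \<in> killing V p" if "x \<in> killing V p" "y \<in> killing V p" for x y
        using that W.V.M.a_closed[of x y] D_closed by (auto simp: killing_def)
      show "c \<odot>\<^bsub>hom_rep (C p) V\<^esub> x \<in> killing V p" if "x \<in> killing V p" "c \<in> carrier K" for x c
        using that W.V.smult_closed[of c x] D_closed by (auto simp: killing_def)
    qed (auto simp: killing_def)
    show "hact p act g x \<in> killing V p" if "g \<in> carrier G" "x \<in> killing V p" for g x
      using that h.hom_act_closed D_closed D_ract[symmetric] V.act_zero
      by (auto simp: killing_def hom_act_def)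
  qed
qed

abbreviation "tfin K V act \<equiv> total_finite K (bar G V) (bar_d G V act)"
abbreviation "eul K V act \<equiv> cx_euler K (bar G V) (bar_d G V act)"

abbreviation "restr p \<equiv> (\<lambda>l. \<lambda>x\<in>carrier (C (Suc p)). l (D p x))"

text \<open>Surjectivity onto \<open>killing V (Suc p)\<close> is exactness of the dual complex, and
  this is where the splitting enters, through \<open>extend\<close>.\<close>

lemma restrict_hom:
  assumes "krep G K V act"
  shows "restr p \<in> mod_hom K (hom_rep (C p) V) (hom_sub V (Suc p))"
    and "g \<in> carrier G \<Longrightarrow> l \<in> carrier (hom_rep (C p) V) \<Longrightarrow> restr p (hact p act g l) = hact (Suc p) act g (restr p l)"
    and "restr p ` carrier (hom_rep (C p) V) = killing V (Suc p)"
    and "l \<in> add_homs (C p) V \<Longrightarrow> restr p l = \<zero>\<^bsub>hom_sub V (Suc p)\<^esub> \<longleftrightarrow> l \<in> killing V p"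
proof -
  interpret V: krep G K V act by fact
  interpret S: right_gmod G "C (Suc p)" "ract (Suc p)" by (rule gmod)
  have cl: "restr p l \<in> killing V (Suc p)" if l: "l \<in> add_homs (C p) V" for l
  proof -
    have "restr p l \<in> add_homs (C (Suc p)) V"
      using add_homsD(1,2)[OF l] D_closed D_add by (intro add_homsI C_group) auto
    then show ?thesis
      using D_closed D_D add_homs_zero[OF C_group V.V.M.abelian_group_axioms l] by (auto simp: killing_def)
  qed
  show "restr p \<in> mod_hom K (hom_rep (C p) V) (hom_sub V (Suc p))"
    using cl D_closed by (auto simp: mod_hom_def intro!: restrict_ext)
  show "restr p (hact p act g l) = hact (Suc p) act g (restr p l)" if "g \<in> carrier G"
    using that D_closed D_ract by (auto simp: hom_act_def intro!: restrict_ext)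
  show "restr p ` carrier (hom_rep (C p) V) = killing V (Suc p)"
  proof
    show "killing V (Suc p) \<subseteq> restr p ` carrier (hom_rep (C p) V)"
    proof
      fix l assume l: "l \<in> killing V (Suc p)"
      then obtain m where m: "m \<in> add_homs (C p) V" "\<forall>x\<in>carrier (C (Suc p)). m (D p x) = l x"
        using extend[OF V.V.M.abelian_group_axioms, of l p] by (auto simp: killing_def)
      have "l = restr p m" using l m(2) add_homsD(3)[of l "C (Suc p)" V]
        by (intro ext) (auto simp: killing_def extensional_def)
      then show "l \<in> restr p ` carrier (hom_rep (C p) V)" using m(1) by simp
    qed
  qed (use cl in auto)
  show "restr p l = \<zero>\<^bsub>hom_sub V (Suc p)\<^esub> \<longleftrightarrow> l \<in> killing V p" if l: "l \<in> add_homs (C p) V"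
  proof -
    have "restr p l = \<zero>\<^bsub>hom_sub V (Suc p)\<^esub> \<longleftrightarrow> (\<forall>x\<in>carrier (C (Suc p)). l (D p x) = \<zero>\<^bsub>V\<^esub>)"
      by (auto simp: fun_eq_iff restrict_def)
    then show ?thesis using l by (simp add: killing_def)
  qed
qed

text \<open>Additivity along \<open>0 \<rightarrow> V \<rightarrow> Hom (C\<^sub>0, V) \<rightarrow> L\<^sub>1 \<rightarrow> 0\<close> and
  \<open>0 \<rightarrow> L\<^sub>p \<rightarrow> Hom (C\<^sub>p, V) \<rightarrow> L\<^sub>p\<^sub>+\<^sub>1 \<rightarrow> 0\<close>, where \<open>L\<^sub>p = killing V p\<close>.\<close>

theorem euler_resolution:
  assumes "krep G K V act" and X: "\<And>p. tfin K (hom_rep (C p) V) (hact p act)"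
  shows "tfin K V act" "eul K V act = (\<Sum>p\<le>N. (- 1) ^ p * eul K (hom_rep (C p) V) (hact p act))"
proof -
  interpret V: krep G K V act by fact
  define \<chi> where "\<chi> p = eul K (hom_rep (C p) V) (hact p act)" for p
  \<comment> \<open>The factor \<open>(-1) ^ p\<close> turns the claim into a tail of the final
    alternating sum. At \<open>p = Suc N\<close> the tail is empty, matching
    \<open>killing V (Suc N)\<close> being zero.\<close>
  have L: "tfin K (hom_sub V p) (hact p act) \<and>
      (- 1) ^ p * eul K (hom_sub V p) (hact p act) = (\<Sum>j\<in>{p..<Suc N}. (- 1) ^ j * \<chi> j)" if "p \<le> Suc N" for p
    using that
  proof (induct p rule: inc_induct)
    case base
    interpret L: krep G K "hom_sub V (Suc N)" "hact (Suc N) act" by (rule krep_hom_sub) fact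
    have "l = \<zero>\<^bsub>hom_sub V (Suc N)\<^esub>" if l: "l \<in> killing V (Suc N)" for l
    proof
      fix x
      have la: "l \<in> add_homs (C (Suc N)) V" using l by (simp add: killing_def)
      show "l x = \<zero>\<^bsub>hom_sub V (Suc N)\<^esub> x"
        using bounded[of "Suc N"] add_homsD(3)[OF la] add_homs_zero[OF C_group V.V.M.abelian_group_axioms la]
        by (auto simp: extensional_def)
    qed
    then have "killing V (Suc N) \<subseteq> {\<zero>\<^bsub>hom_sub V (Suc N)\<^esub>}" by blast
    moreover have "\<zero>\<^bsub>hom_sub V (Suc N)\<^esub> \<in> killing V (Suc N)" using L.V.M.zero_closed by simp
    ultimately have "carrier (hom_sub V (Suc N)) = {\<zero>\<^bsub>hom_sub V (Suc N)\<^esub>}" by auto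
    then show ?case using L.euler_zero by simp
  next
    case (step p)
    interpret L: krep G K "hom_sub V p" "hact p act" by (rule krep_hom_sub) fact
    interpret L': krep G K "hom_sub V (Suc p)" "hact (Suc p) act" by (rule krep_hom_sub) fact
    interpret h: hom_module G "C p" "ract p" K V act by (rule hom_module) fact
    interpret W: krep G K "hom_rep (C p) V" "hact p act" by (rule h.krep_hom)
    have Lsub: "killing V p \<subseteq> add_homs (C p) V" by (auto simp: killing_def)
    have "cx_exact K (bar G (hom_sub V p)) (bar_d G (hom_sub V p) (hact p act))
      (bar G (hom_rep (C p) V)) (bar_d G (hom_rep (C p) V) (hact p act))
      (bar G (hom_sub V (Suc p))) (bar_d G (hom_sub V (Suc p)) (hact (Suc p) act))
      (\<lambda>n f. \<lambda>gs\<in>tuples G n. id (f gs)) (\<lambda>n f. \<lambda>gs\<in>tuples G n. (\<lambda>x\<in>carrier (C (Suc p)). f gs (D p x)))"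
    proof (rule bar_exact[OF L.krep_axioms W.krep_axioms L'.krep_axioms])
      show "id \<in> mod_hom K (hom_sub V p) (hom_rep (C p) V)" using Lsub by (auto simp: mod_hom_def)
      show "id ` carrier (hom_sub V p) =
        {l \<in> carrier (hom_rep (C p) V). (\<lambda>x\<in>carrier (C (Suc p)). l (D p x)) = \<zero>\<^bsub>hom_sub V (Suc p)\<^esub>}"
        using restrict_hom(4)[OF assms(1), of _ p] Lsub by auto
      show "(\<lambda>l. \<lambda>x\<in>carrier (C (Suc p)). l (D p x)) ` carrier (hom_rep (C p) V) = carrier (hom_sub V (Suc p))"
        using restrict_hom(3)[OF assms(1)] by simp
      show "(\<lambda>x\<in>carrier (C (Suc p)). hact p act g l (D p x)) = hact (Suc p) act g (\<lambda>x\<in>carrier (C (Suc p)). l (D p x))"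
        if "g \<in> carrier G" "l \<in> carrier (hom_rep (C p) V)" for g l
        using restrict_hom(2)[OF assms(1) that] .
      show "restr p \<in> mod_hom K (hom_rep (C p) V) (hom_sub V (Suc p))" by (rule restrict_hom(1)[OF assms(1)])
    qed auto
    then interpret E: cx_exact K "bar G (hom_sub V p)" "bar_d G (hom_sub V p) (hact p act)"
      "bar G (hom_rep (C p) V)" "bar_d G (hom_rep (C p) V) (hact p act)"
      "bar G (hom_sub V (Suc p))" "bar_d G (hom_sub V (Suc p)) (hact (Suc p) act)"
      "\<lambda>n f. \<lambda>gs\<in>tuples G n. id (f gs)" "\<lambda>n f. \<lambda>gs\<in>tuples G n. (\<lambda>x\<in>carrier (C (Suc p)). f gs (D p x))" .
    have tL: "tfin K (hom_sub V (Suc p)) (hact (Suc p) act)" using step by blast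
    note E.total_finite_sub[OF X tL]
    moreover have "(- 1) ^ p * eul K (hom_sub V p) (hact p act) =
      (- 1) ^ p * \<chi> p + (- 1) ^ Suc p * eul K (hom_sub V (Suc p)) (hact (Suc p) act)"
      using E.cx_euler_add[OF X tL] by (simp add: \<chi>_def algebra_simps)
    moreover have "(\<Sum>j\<in>{p..<Suc N}. (- 1) ^ j * \<chi> j) = (- 1) ^ p * \<chi> p + (\<Sum>j\<in>{Suc p..<Suc N}. (- 1) ^ j * \<chi> j)"
      using step by (intro sum.atLeast_Suc_lessThan) auto
    ultimately show ?case using step by metis
  qed
  interpret A: abelian_group "C 0" by (rule C_group)
  interpret F: field K by (rule V.V.field_K)
  interpret L': krep G K "hom_sub V 1" "hact 1 act" by (rule krep_hom_sub) fact
  interpret h: hom_module G "C 0" "ract 0" K V act by (rule hom_module) fact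
  interpret W: krep G K "hom_rep (C 0) V" "hact 0 act" by (rule h.krep_hom)
  obtain c0 where c0: "c0 \<in> carrier (C 0)" "\<epsilon> c0 = 1" using \<epsilon>_surj by blast
  have \<epsilon>0: "\<epsilon> \<zero>\<^bsub>C 0\<^esub> = 0" using \<epsilon>_add[of "\<zero>\<^bsub>C 0\<^esub>" "\<zero>\<^bsub>C 0\<^esub>"] by simp
  \<comment> \<open>The augmentation is integer valued while scalars of \<open>V\<close> lie in
    \<open>K\<close>, so it is composed with the canonical ring map from the integers.\<close>
  define \<kappa> where "\<kappa> n = [n] \<cdot>\<^bsub>K\<^esub> \<one>\<^bsub>K\<^esub>" for n :: int
  have \<kappa>c: "\<kappa> n \<in> carrier K" for n unfolding \<kappa>_def by (rule V.V.R.add.int_pow_closed) simp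
  have \<kappa>_add: "\<kappa> (m + n) = \<kappa> m \<oplus>\<^bsub>K\<^esub> \<kappa> n" for m n
    unfolding \<kappa>_def by (rule V.V.R.add.int_pow_mult) simp
  have \<kappa>1: "\<kappa> 1 = \<one>\<^bsub>K\<^esub>" "\<kappa> 0 = \<zero>\<^bsub>K\<^esub>" by (simp add: \<kappa>_def, simp add: \<kappa>_def add_pow_def)
  \<comment> \<open>\<open>V\<close> is embedded as the maps that factor through the augmentation;
    \<open>m\<close> is recovered as the value at \<open>c0\<close>, which has augmentation
    1.\<close>
  define i where "i m = (\<lambda>c\<in>carrier (C 0). \<kappa> (\<epsilon> c) \<odot>\<^bsub>V\<^esub> m)" for m
  have i: "i m \<in> add_homs (C 0) V" if "m \<in> carrier V" for m
    unfolding i_def using that \<kappa>c \<epsilon>_add \<kappa>_add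
    by (intro add_homsI C_group) (auto simp: V.V.smult_l_distr)
  have "cx_exact K (bar G V) (bar_d G V act)
    (bar G (hom_rep (C 0) V)) (bar_d G (hom_rep (C 0) V) (hact 0 act))
    (bar G (hom_sub V 1)) (bar_d G (hom_sub V 1) (hact 1 act))
    (\<lambda>n f. \<lambda>gs\<in>tuples G n. i (f gs)) (\<lambda>n f. \<lambda>gs\<in>tuples G n. (\<lambda>x\<in>carrier (C 1). f gs (D 0 x)))"
  proof (rule bar_exact[OF assms(1) W.krep_axioms L'.krep_axioms])
    show "i \<in> mod_hom K V (hom_rep (C 0) V)"
      unfolding mod_hom_def using i \<kappa>c
      by (auto simp: i_def V.V.smult_r_distr V.V.smult_assoc[symmetric] F.m_comm intro!: restrict_ext)
    show "i (act g m) = hact 0 act g (i m)" if "g \<in> carrier G" "m \<in> carrier V" for g m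
      using that \<kappa>c \<epsilon>_ract h.C.ract_closed by (auto simp: i_def hom_act_def V.act_smult intro!: restrict_ext)
    show "inj_on i (carrier V)"
    proof (rule inj_onI)
      fix m m' assume m: "m \<in> carrier V" "m' \<in> carrier V" "i m = i m'"
      from fun_cong[OF m(3), of c0] show "m = m'" using m(1,2) c0 by (simp add: i_def \<kappa>1)
    qed
    show "i ` carrier V = {l \<in> carrier (hom_rep (C 0) V). (\<lambda>x\<in>carrier (C 1). l (D 0 x)) = \<zero>\<^bsub>hom_sub V 1\<^esub>}"
    proof -
      have "i ` carrier V = killing V 0"
      proof
        show "i ` carrier V \<subseteq> killing V 0"
        proof
          fix l assume "l \<in> i ` carrier V"
          then obtain m where m: "m \<in> carrier V" "l = i m" by blast
          have "\<epsilon> (D 0 x) = 0" if "x \<in> carrier (C (Suc 0))" for x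
            using \<epsilon>_exact[of "D 0 x"] D_closed[OF that] that by simp
          then show "l \<in> killing V 0" using m i D_closed by (auto simp: killing_def i_def \<kappa>1)
        qed
        show "killing V 0 \<subseteq> i ` carrier V"
        proof
          fix l assume "l \<in> killing V 0"
          then have l: "l \<in> add_homs (C 0) V" and lD: "\<And>x. x \<in> carrier (C (Suc 0)) \<Longrightarrow> l (D 0 x) = \<zero>\<^bsub>V\<^esub>"
            by (auto simp: killing_def)
          define m where "m = l c0"
          have m: "m \<in> carrier V" using add_homsD(1)[OF l c0(1)] by (simp add: m_def)
          \<comment> \<open>Two elements of equal augmentation differ by a boundary, so
            \<open>l\<close> depends on the augmentation alone.\<close>
          have ker: "l c = l c'" if c: "c \<in> carrier (C 0)" "c' \<in> carrier (C 0)" "\<epsilon> c = \<epsilon> c'" for c c'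
          proof -
            have "\<epsilon> (\<ominus>\<^bsub>C 0\<^esub> c') = - \<epsilon> c'"
              using \<epsilon>_add[of "\<ominus>\<^bsub>C 0\<^esub> c'" c'] c \<epsilon>0 by (simp add: A.l_neg)
            then have "\<epsilon> (c \<ominus>\<^bsub>C 0\<^esub> c') = 0" using \<epsilon>_add[of c "\<ominus>\<^bsub>C 0\<^esub> c'"] c by (simp add: a_minus_def)
            then have "c \<ominus>\<^bsub>C 0\<^esub> c' \<in> D 0 ` carrier (C (Suc 0))" using \<epsilon>_exact[of "c \<ominus>\<^bsub>C 0\<^esub> c'"] c by simp
            then have z: "l (c \<ominus>\<^bsub>C 0\<^esub> c') = \<zero>\<^bsub>V\<^esub>" using lD by auto
            have "c = (c \<ominus>\<^bsub>C 0\<^esub> c') \<oplus>\<^bsub>C 0\<^esub> c'" using c by (simp add: a_minus_def A.a_assoc A.l_neg)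
            then have "l c = l (c \<ominus>\<^bsub>C 0\<^esub> c') \<oplus>\<^bsub>V\<^esub> l c'"
              using add_homsD(2)[OF l _ c(2), of "c \<ominus>\<^bsub>C 0\<^esub> c'"] c by simp
            then show ?thesis using z add_homsD(1)[OF l c(2)] by simp
          qed
          \<comment> \<open>For every integer there is a multiple of \<open>c0\<close> with that
            augmentation, on which \<open>l\<close> can be computed from \<open>m = l c0\<close>;
            this pins down \<open>l\<close> everywhere.\<close>
          have "\<exists>y\<in>carrier (C 0). \<epsilon> y = n \<and> l y = \<kappa> n \<odot>\<^bsub>V\<^esub> m" for n
          proof (induct n rule: int_induct[where k = 0])
            case base
            show ?case using \<epsilon>0 m add_homs_zero[OF C_group V.V.M.abelian_group_axioms l]
              by (intro bexI[of _ "\<zero>\<^bsub>C 0\<^esub>"]) (auto simp: \<kappa>1)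
          next
            case (step1 n)
            then obtain y where y: "y \<in> carrier (C 0)" "\<epsilon> y = n" "l y = \<kappa> n \<odot>\<^bsub>V\<^esub> m" by blast
            have "l (y \<oplus>\<^bsub>C 0\<^esub> c0) = \<kappa> (n + 1) \<odot>\<^bsub>V\<^esub> m"
              using add_homsD(2)[OF l y(1) c0(1)] y m \<kappa>c by (simp add: \<kappa>_add \<kappa>1 V.V.smult_l_distr m_def[symmetric])
            then show ?case using y c0 \<epsilon>_add[OF y(1) c0(1)] by (intro bexI[of _ "y \<oplus>\<^bsub>C 0\<^esub> c0"]) auto
          next
            case (step2 n)
            then obtain y where y: "y \<in> carrier (C 0)" "\<epsilon> y = n" "l y = \<kappa> n \<odot>\<^bsub>V\<^esub> m" by blast
            have ec: "\<epsilon> (\<ominus>\<^bsub>C 0\<^esub> c0) = - 1"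
              using \<epsilon>_add[of "\<ominus>\<^bsub>C 0\<^esub> c0" c0] c0 \<epsilon>0 by (simp add: A.l_neg)
            have "\<kappa> (- 1) \<oplus>\<^bsub>K\<^esub> \<one>\<^bsub>K\<^esub> = \<zero>\<^bsub>K\<^esub>" using \<kappa>_add[of "- 1" 1] by (simp add: \<kappa>1)
            then have "\<kappa> (- 1) = \<ominus>\<^bsub>K\<^esub> \<one>\<^bsub>K\<^esub>" using V.V.R.minus_equality \<kappa>c by simp
            then have "\<ominus>\<^bsub>V\<^esub> m = \<kappa> (- 1) \<odot>\<^bsub>V\<^esub> m" using m by (simp add: V.V.smult_a_inv_scalar)
            then have "l (y \<oplus>\<^bsub>C 0\<^esub> \<ominus>\<^bsub>C 0\<^esub> c0) = \<kappa> (n - 1) \<odot>\<^bsub>V\<^esub> m"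
              using add_homsD(2)[OF l y(1), of "\<ominus>\<^bsub>C 0\<^esub> c0"] y m \<kappa>c c0
                add_homs_a_inv[OF C_group V.V.M.abelian_group_axioms l c0(1)] \<kappa>_add[of n "- 1"]
              by (simp add: V.V.smult_l_distr m_def[symmetric])
            then show ?case using y c0 \<epsilon>_add[OF y(1), of "\<ominus>\<^bsub>C 0\<^esub> c0"] ec by (intro bexI[of _ "y \<oplus>\<^bsub>C 0\<^esub> \<ominus>\<^bsub>C 0\<^esub> c0"]) auto
          qed
          then have "l c = \<kappa> (\<epsilon> c) \<odot>\<^bsub>V\<^esub> m" if "c \<in> carrier (C 0)" for c using ker that by metis
          then have "l = i m" using add_homsD(3)[OF l] by (intro ext) (auto simp: i_def extensional_def)
          then show "l \<in> i ` carrier V" using m by blast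
        qed
      qed
      also have "\<dots> = {l \<in> carrier (hom_rep (C 0) V). (\<lambda>x\<in>carrier (C 1). l (D 0 x)) = \<zero>\<^bsub>hom_sub V 1\<^esub>}"
        using restrict_hom(4)[OF assms(1), of _ 0] by (auto simp: killing_def)
      finally show ?thesis .
    qed
    show "(\<lambda>l. \<lambda>x\<in>carrier (C 1). l (D 0 x)) ` carrier (hom_rep (C 0) V) = carrier (hom_sub V 1)"
      using restrict_hom(3)[OF assms(1), of 0] by simp
    show "(\<lambda>l. \<lambda>x\<in>carrier (C 1). l (D 0 x)) \<in> mod_hom K (hom_rep (C 0) V) (hom_sub V 1)"
      using restrict_hom(1)[OF assms(1), of 0] by simp
    show "(\<lambda>x\<in>carrier (C 1). hact 0 act g l (D 0 x)) = hact 1 act g (\<lambda>x\<in>carrier (C 1). l (D 0 x))"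
      if "g \<in> carrier G" "l \<in> carrier (hom_rep (C 0) V)" for g l
      using restrict_hom(2)[OF assms(1) that] by simp
  qed
  then interpret E: cx_exact K "bar G V" "bar_d G V act"
    "bar G (hom_rep (C 0) V)" "bar_d G (hom_rep (C 0) V) (hact 0 act)"
    "bar G (hom_sub V 1)" "bar_d G (hom_sub V 1) (hact 1 act)"
    "\<lambda>n f. \<lambda>gs\<in>tuples G n. i (f gs)" "\<lambda>n f. \<lambda>gs\<in>tuples G n. (\<lambda>x\<in>carrier (C 1). f gs (D 0 x))" .
  have tL: "tfin K (hom_sub V 1) (hact 1 act)" using L[of 1] by simp
  show "tfin K V act" by (rule E.total_finite_sub[OF X tL])
  have "eul K V act = \<chi> 0 - eul K (hom_sub V 1) (hact 1 act)"
    using E.cx_euler_add[OF X tL] by (simp add: \<chi>_def)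
  also have "\<dots> = \<chi> 0 + (\<Sum>j\<in>{1..<Suc N}. (- 1) ^ j * \<chi> j)" using L[of 1] by simp
  also have "\<dots> = (\<Sum>j\<in>{0..<Suc N}. (- 1) ^ j * \<chi> j)" by (subst (2) sum.atLeast_Suc_lessThan) auto
  also have "{0..<Suc N} = {..N}" by auto
  finally show "eul K V act = (\<Sum>p\<le>N. (- 1) ^ p * eul K (hom_rep (C p) V) (hact p act))" by (simp add: \<chi>_def)
qed

end

section \<open>Euler characteristics of duals of permutation modules\<close>

context perm_iso begin

text \<open>All cohomology sits in degree 0, where it is a subspace of finitely many copies of
  \<open>V\<close>. The equivalence in the last conclusion determines the Euler characteristic by
  the dimension of \<open>X\<close>, a space which sees the action only through the subgroups
  \<open>H k\<close>.\<close>

lemma hom_euler: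
  assumes V: "krep G K V act" and fin: "\<And>k. k \<in> I \<Longrightarrow> finite (H k)"
    and char: "\<And>k. k \<in> I \<Longrightarrow> [card (H k)] \<cdot>\<^bsub>K\<^esub> \<one>\<^bsub>K\<^esub> \<noteq> \<zero>\<^bsub>K\<^esub>"
    and dim: "reldim K V {\<zero>\<^bsub>V\<^esub>} (carrier V) n"
  defines "W \<equiv> bar G (hom_rep C V)" and "\<delta> \<equiv> bar_d G (hom_rep C V) (hom_act C (zact C) act)"
    and "X \<equiv> {v \<in> carrier (fun_mod I V). \<forall>k\<in>I. \<forall>h\<in>H k. act h (v k) = v k}"
  shows "total_finite K W \<delta>" "subspace_of K (fun_mod I V) X"
    "reldim K (fun_mod I V) {\<zero>\<^bsub>fun_mod I V\<^esub>} X j \<longleftrightarrow> cx_euler K W \<delta> = int j"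
proof -
  interpret V: krep G K V act by fact
  interpret S: permutation_hom G C "zact C" K V act I H gen by (rule permutation_hom) fact+
  interpret W: krep G K "hom_rep C V" "hom_act C (zact C) act" by (rule S.krep_hom)
  have X: "S.fixed_tuples = X" unfolding S.fixed_tuples_def X_def ..
  interpret P: vspace K "fun_mod I V" by (rule V.V.vspace_fun_mod)
  show sX: "subspace_of K (fun_mod I V) X" using S.subspace_fixed_tuples X by simp
  obtain m where "reldim K (fun_mod I V) {\<zero>\<^bsub>fun_mod I V\<^esub>} (carrier (fun_mod I V)) m"
    using V.V.reldim_fun_mod[OF I dim] by blast
  from P.reldim_split[OF P.subspace_zero this sX] subspace_ofD(1,2)[OF sX]
  obtain i where i: "reldim K (fun_mod I V) {\<zero>\<^bsub>fun_mod I V\<^esub>} X i" by blast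
  then have "reldim K (W 0) {\<zero>\<^bsub>W 0\<^esub>} (cyc W \<delta> 0) i"
    using S.reldim_hom_cocycles[of i] X unfolding W_def \<delta>_def by simp
  note c = W.bar_cx.euler_concentrated[folded W_def \<delta>_def, OF S.hom_acyclic[OF char, folded W_def \<delta>_def] this]
  then have "total_finite K W \<delta>" "cx_euler K W \<delta> = int i" by simp_all
  moreover have "reldim K (fun_mod I V) {\<zero>\<^bsub>fun_mod I V\<^esub>} X j \<longleftrightarrow> i = j"
    using i P.reldim_unique[OF P.subspace_zero i] by blast
  ultimately show "total_finite K W \<delta>"
    "reldim K (fun_mod I V) {\<zero>\<^bsub>fun_mod I V\<^esub>} X j \<longleftrightarrow> cx_euler K W \<delta> = int j"
    by simp_all
qed

text \<open>Since the fixed tuples form a product over \<open>k\<close>, the isomorphism may be a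
  different one for each \<open>k\<close>; no common isomorphism of \<open>V\<close> with
  \<open>V'\<close> compatible with all the \<open>H k\<close> is asked for. Applied componentwise,
  they identify the two spaces of fixed tuples.\<close>

lemma hom_euler_cong:
  assumes V: "krep G K V act" "krep G K V' act'" and fin: "\<And>k. k \<in> I \<Longrightarrow> finite (H k)"
    and char: "\<And>k. k \<in> I \<Longrightarrow> [card (H k)] \<cdot>\<^bsub>K\<^esub> \<one>\<^bsub>K\<^esub> \<noteq> \<zero>\<^bsub>K\<^esub>"
    and dim: "reldim K V {\<zero>\<^bsub>V\<^esub>} (carrier V) n" "reldim K V' {\<zero>\<^bsub>V'\<^esub>} (carrier V') n'"
    and iso: "\<And>k. k \<in> I \<Longrightarrow> \<exists>\<psi>\<in>mod_hom K V V'. bij_betw \<psi> (carrier V) (carrier V') \<and>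
      (\<forall>h\<in>H k. \<forall>x\<in>carrier V. \<psi> (act h x) = act' h (\<psi> x))"
  shows "cx_euler K (bar G (hom_rep C V)) (bar_d G (hom_rep C V) (hom_act C (zact C) act)) =
    cx_euler K (bar G (hom_rep C V')) (bar_d G (hom_rep C V') (hom_act C (zact C) act'))"
proof -
  interpret V: krep G K V act by fact
  interpret V': krep G K V' act' by fact
  obtain \<psi> where \<psi>: "\<And>k. k \<in> I \<Longrightarrow> \<psi> k \<in> mod_hom K V V'" "\<And>k. k \<in> I \<Longrightarrow> bij_betw (\<psi> k) (carrier V) (carrier V')"
    "\<And>k h x. k \<in> I \<Longrightarrow> h \<in> H k \<Longrightarrow> x \<in> carrier V \<Longrightarrow> \<psi> k (act h x) = act' h (\<psi> k x)"
    using iso by metis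
  define X where "X = {v \<in> carrier (fun_mod I V). \<forall>k\<in>I. \<forall>h\<in>H k. act h (v k) = v k}"
  define X' where "X' = {v \<in> carrier (fun_mod I V'). \<forall>k\<in>I. \<forall>h\<in>H k. act' h (v k) = v k}"
  note E = hom_euler[OF V(1) fin char dim(1), folded X_def] and E' = hom_euler[OF V(2) fin char dim(2), folded X'_def]
  define \<Psi> where "\<Psi> v = (\<lambda>k\<in>I. \<psi> k (v k))" for v
  interpret \<Psi>: linear_map K "fun_mod I V" "fun_mod I V'" \<Psi>
  proof (intro linear_map.intro linear_map_axioms.intro V.V.vspace_fun_mod V'.V.vspace_fun_mod)
    show "\<Psi> \<in> mod_hom K (fun_mod I V) (fun_mod I V')"
      unfolding mod_hom_def using mod_homD[OF \<psi>(1)] by (auto simp: \<Psi>_def PiE_iff intro!: restrict_ext)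
  qed
  have Hc: "h \<in> carrier G" if "k \<in> I" "h \<in> H k" for k h using H[OF that(1)] that(2) subgroup.mem_carrier by metis
  have "inj_on \<Psi> (carrier (fun_mod I V))"
  proof (rule inj_onI, rule ext)
    fix v w k assume v: "v \<in> carrier (fun_mod I V)" "w \<in> carrier (fun_mod I V)" "\<Psi> v = \<Psi> w"
    show "v k = w k"
    proof (cases "k \<in> I")
      case True
      then have "\<psi> k (v k) = \<psi> k (w k)" using fun_cong[OF v(3), of k] by (simp add: \<Psi>_def)
      then show ?thesis using v True \<psi>(2)[OF True] by (auto simp: bij_betw_def dest: inj_onD)
    next
      case False then show ?thesis using v by (auto simp: PiE_iff extensional_def)
    qed
  qed
  then have ker: "\<Psi>.ker = {\<zero>\<^bsub>fun_mod I V\<^esub>}" using \<Psi>.inj_on_iff_ker by blast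
  have im: "\<Psi> ` X = X'"
  proof
    show "\<Psi> ` X \<subseteq> X'"
    proof
      fix w assume "w \<in> \<Psi> ` X"
      then obtain v where v: "v \<in> carrier (fun_mod I V)" "\<And>k h. k \<in> I \<Longrightarrow> h \<in> H k \<Longrightarrow> act h (v k) = v k" "w = \<Psi> v"
        by (auto simp: X_def)
      have "act' h (w k) = w k" if "k \<in> I" "h \<in> H k" for k h
      proof -
        have "v k \<in> carrier V" using v(1) that(1) by auto
        from \<psi>(3)[OF that this] show ?thesis using v(2)[OF that] that(1) by (simp add: v(3) \<Psi>_def)
      qed
      then show "w \<in> X'" using \<Psi>.map_closed[OF v(1)] v(3) by (auto simp: X'_def)
    qed
    show "X' \<subseteq> \<Psi> ` X"
    proof
      fix w assume w: "w \<in> X'"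
      define v where "v = (\<lambda>k\<in>I. inv_into (carrier V) (\<psi> k) (w k))"
      have wk: "w k \<in> \<psi> k ` carrier V" if "k \<in> I" for k
        using w that \<psi>(2)[OF that] by (auto simp: X'_def bij_betw_def)
      have vc: "v k \<in> carrier V" and vw: "\<psi> k (v k) = w k" if "k \<in> I" for k
        using inv_into_into[OF wk[OF that]] f_inv_into_f[OF wk[OF that]] that by (auto simp: v_def)
      have "act h (v k) = v k" if kh: "k \<in> I" "h \<in> H k" for k h
      proof -
        have "\<psi> k (act h (v k)) = \<psi> k (v k)"
          using \<psi>(3)[OF kh vc[OF kh(1)]] vw[OF kh(1)] w kh by (auto simp: X'_def)
        then show ?thesis
          using \<psi>(2)[OF kh(1)] vc[OF kh(1)] Hc[OF kh] by (auto simp: bij_betw_def dest: inj_onD)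
      qed
      then have "v \<in> X" using vc by (auto simp: X_def v_def)
      moreover have "\<Psi> v = w" using vw w by (intro ext) (auto simp: \<Psi>_def X'_def PiE_iff extensional_def)
      ultimately show "w \<in> \<Psi> ` X" by blast
    qed
  qed
  obtain j where "cx_euler K (bar G (hom_rep C V)) (bar_d G (hom_rep C V) (hom_act C (zact C) act)) = int j"
    and j: "reldim K (fun_mod I V) {\<zero>\<^bsub>fun_mod I V\<^esub>} X j"
  proof -
    note P = V.V.vspace_fun_mod[of I]
    obtain m where "reldim K (fun_mod I V) {\<zero>\<^bsub>fun_mod I V\<^esub>} (carrier (fun_mod I V)) m"
      using V.V.reldim_fun_mod[OF I dim(1)] by blast
    from vspace.reldim_split[OF P vspace.subspace_zero[OF P] this E(2)] subspace_ofD(1,2)[OF E(2)]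
    obtain j where "reldim K (fun_mod I V) {\<zero>\<^bsub>fun_mod I V\<^esub>} X j" by blast
    then show ?thesis using that E(3) by blast
  qed
  moreover have "reldim K (fun_mod I V') {\<zero>\<^bsub>fun_mod I V'\<^esub>} X' j"
    using \<Psi>.reldim_image[OF \<Psi>.V.subspace_zero j] ker im \<Psi>.map_zero by simp
  ultimately show ?thesis using E'(3) by simp
qed

end

section \<open>From the hypotheses on the group and the complex to the abstract setting\<close>

text \<open>By division with remainder, the least positive \<open>n\<close> with
  \<open>n 1 = 0\<close> divides every integer with this property. So \<open>|H| 1 = 0\<close> would
  make the characteristic positive and a divisor of \<open>|H|\<close>, hence of the least common
  multiple.\<close>

lemma card_finite_subgroup_nonzero:
  assumes "group G" "field K" "ring_char K = 0 \<or> \<not> ring_char K dvd lcm_finite_subgroups G"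
    and H: "H \<in> finite_subgroups G"
  shows "[card H] \<cdot>\<^bsub>K\<^esub> \<one>\<^bsub>K\<^esub> \<noteq> \<zero>\<^bsub>K\<^esub>"
proof
  interpret K: field K by fact
  let ?P = "\<lambda>n :: nat. 0 < n \<and> [n] \<cdot>\<^bsub>K\<^esub> \<one>\<^bsub>K\<^esub> = \<zero>\<^bsub>K\<^esub>"
  assume z: "[card H] \<cdot>\<^bsub>K\<^esub> \<one>\<^bsub>K\<^esub> = \<zero>\<^bsub>K\<^esub>"
  have "finite H" "H \<noteq> {}" using H subgroup.one_closed by (auto simp: finite_subgroups_def)
  then have P: "?P (card H)" using z by (auto simp: card_gt_0_iff)
  define p where "p = (LEAST n. ?P n)"
  have "\<exists>n. ?P n" using P by blast
  then have p: "ring_char K = p" unfolding ring_char_def p_def by (rule if_P)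
  have Pp: "?P p" unfolding p_def by (rule LeastI[of ?P, OF P])
  have "p dvd card H"
  proof (rule ccontr)
    assume "\<not> p dvd card H"
    then have r: "0 < card H mod p" by (simp add: mod_greater_zero_iff_not_dvd)
    have "[card H] \<cdot>\<^bsub>K\<^esub> \<one>\<^bsub>K\<^esub> = [(p * (card H div p) + card H mod p)] \<cdot>\<^bsub>K\<^esub> \<one>\<^bsub>K\<^esub>" by simp
    also have "\<dots> = [(p * (card H div p))] \<cdot>\<^bsub>K\<^esub> \<one>\<^bsub>K\<^esub> \<oplus>\<^bsub>K\<^esub> [(card H mod p)] \<cdot>\<^bsub>K\<^esub> \<one>\<^bsub>K\<^esub>"
      by (simp only: K.add.nat_pow_mult[symmetric] K.one_closed)
    also have "[(p * (card H div p))] \<cdot>\<^bsub>K\<^esub> \<one>\<^bsub>K\<^esub> = [(card H div p)] \<cdot>\<^bsub>K\<^esub> ([p] \<cdot>\<^bsub>K\<^esub> \<one>\<^bsub>K\<^esub>)"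
      by (simp only: K.add.nat_pow_pow K.one_closed)
    also have "[p] \<cdot>\<^bsub>K\<^esub> \<one>\<^bsub>K\<^esub> = \<zero>\<^bsub>K\<^esub>" using Pp by simp
    finally have "?P (card H mod p)" using r z K.add.nat_pow_one by simp
    then have "p \<le> card H mod p" unfolding p_def by (rule Least_le)
    moreover have "card H mod p < p" using Pp by (intro mod_less_divisor) simp
    ultimately show False by linarith
  qed
  moreover have "card H dvd lcm_finite_subgroups G"
    unfolding lcm_finite_subgroups_def using H by (intro dvd_Lcm) auto
  ultimately show False using assms(3) p Pp by (auto dest: dvd_trans)
qed

text \<open>In a zero quotient the coset of the cycle \<open>x\<close> is the subgroup of boundaries
  itself, and it contains \<open>x\<close> because 0 is a boundary.\<close>

lemma homology_zero:
  assumes "chain_complex R C d" "zero_module (homology C d i)" "x \<in> carrier (C i)" "d i x = \<zero>\<^bsub>C (i - 1)\<^esub>"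
  shows "x \<in> d (i + 1) ` carrier (C (i + 1))"
proof -
  interpret C: right_module R "C i" using assms(1) by (simp add: chain_complex_def)
  interpret C1: right_module R "C (i + 1)" using assms(1) by (simp add: chain_complex_def)
  have d: "d (i + 1) \<in> mod_hom R (C (i + 1)) (C i)" using assms(1) unfolding chain_complex_def by (metis add_diff_cancel_right')
  define W where "W = d (i + 1) ` carrier (C (i + 1))"
  have "d (i + 1) \<zero>\<^bsub>C (i + 1)\<^esub> \<oplus>\<^bsub>C i\<^esub> d (i + 1) \<zero>\<^bsub>C (i + 1)\<^esub> = d (i + 1) \<zero>\<^bsub>C (i + 1)\<^esub>"
    using mod_homD(2)[OF d, of "\<zero>\<^bsub>C (i + 1)\<^esub>" "\<zero>\<^bsub>C (i + 1)\<^esub>"] by simp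
  then have "d (i + 1) \<zero>\<^bsub>C (i + 1)\<^esub> = \<zero>\<^bsub>C i\<^esub>"
    using mod_homD(1)[OF d, of "\<zero>\<^bsub>C (i + 1)\<^esub>"] C.M.add.l_cancel_one' by simp
  then have 0: "\<zero>\<^bsub>C i\<^esub> \<in> W" unfolding W_def by (metis C1.M.zero_closed image_eqI)
  have "a_rcosets\<^bsub>(C i)\<lparr>carrier := {x \<in> carrier (C i). d i x = \<zero>\<^bsub>C (i - 1)\<^esub>}\<rparr>\<^esub> W = {W}"
    using assms(2) by (simp add: zero_module_def homology_def quot_module_def W_def)
  then have "W +>\<^bsub>(C i)\<lparr>carrier := {x \<in> carrier (C i). d i x = \<zero>\<^bsub>C (i - 1)\<^esub>}\<rparr>\<^esub> x = W"
    using assms(3,4) by (auto simp: A_RCOSETS_def')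
  moreover have "x \<in> W +>\<^bsub>(C i)\<lparr>carrier := {x \<in> carrier (C i). d i x = \<zero>\<^bsub>C (i - 1)\<^esub>}\<rparr>\<^esub> x"
    using 0 assms(3) by (force simp: a_r_coset_def')
  ultimately show ?thesis unfolding W_def by blast
qed

text \<open>Degree -1 is zero, so every element of degree 0 is a cycle and \<open>H_0\<close> is the
  quotient by the boundaries. The augmentation is the projection onto it followed by the given
  isomorphism with the integers; triviality of the action there gives invariance.\<close>

lemma augmentation:
  fixes G :: "'g monoid" and C :: "int \<Rightarrow> ('g \<Rightarrow> int, 'c) module"
  assumes "group G" "chain_complex (group_ring \<Z> G) C d" "acyclic_complex G C d"
  shows "\<exists>\<epsilon>. (\<forall>x\<in>carrier (C 0). \<forall>y\<in>carrier (C 0). \<epsilon> (x \<oplus>\<^bsub>C 0\<^esub> y) = \<epsilon> x + (\<epsilon> y :: int)) \<and>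
    (\<forall>x\<in>carrier (C 0). \<forall>g\<in>carrier G. \<epsilon> (zact (C 0) x g) = \<epsilon> x) \<and>
    (\<forall>x\<in>carrier (C 0). \<epsilon> x = 0 \<longleftrightarrow> x \<in> d 1 ` carrier (C 1)) \<and>
    (\<exists>c\<in>carrier (C 0). \<epsilon> c = 1)"
proof -
  let ?R = "group_ring \<Z> G"
  interpret G: group G by fact
  interpret C: right_module ?R "C 0" using assms(2) by (simp add: chain_complex_def)
  interpret C1: right_module ?R "C 1" using assms(2) by (simp add: chain_complex_def)
  have d: "d 1 \<in> mod_hom ?R (C 1) (C 0)" using assms(2) unfolding chain_complex_def by (metis diff_self)
  have d0: "d 0 \<in> mod_hom ?R (C 0) (C (0 - 1))" using assms(2) unfolding chain_complex_def by blast
  have "carrier (C (0 - 1)) = {\<zero>\<^bsub>C (0 - 1)\<^esub>}" using assms(3) by (simp add: acyclic_complex_def zero_module_def)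
  then have "{x \<in> carrier (C 0). d 0 x = \<zero>\<^bsub>C (0 - 1)\<^esub>} = carrier (C 0)" using mod_homD(1)[OF d0] by auto
  then have hom: "homology C d 0 = quot_module (C 0) (d 1 ` carrier (C 1))" by (simp add: homology_def)
  define W where "W = d 1 ` carrier (C 1)"
  have Wsub: "W \<subseteq> carrier (C 0)" using mod_homD(1)[OF d] by (auto simp: W_def)
  have Wsg: "subgroup W (add_monoid (C 0))"
  proof (rule group.subgroupI[OF C.M.a_group])
    show "W \<subseteq> carrier (add_monoid (C 0))" using Wsub by simp
    show "W \<noteq> {}" using C1.M.zero_closed by (auto simp: W_def)
    show "a \<otimes>\<^bsub>add_monoid (C 0)\<^esub> b \<in> W" if "a \<in> W" "b \<in> W" for a b
      using that mod_homD(2)[OF d, symmetric] by (auto simp: W_def)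
    show "inv\<^bsub>add_monoid (C 0)\<^esub> a \<in> W" if a: "a \<in> W" for a
    proof -
      obtain x where x: "x \<in> carrier (C 1)" "a = d 1 x" using a by (auto simp: W_def)
      have h: "restrict (d 1) (carrier (C 1)) \<in> add_homs (C 1) (C 0)"
        using mod_homD(1,2)[OF d] by (intro add_homsI C1.M.abelian_group_axioms) auto
      have "\<ominus>\<^bsub>C 0\<^esub> a = d 1 (\<ominus>\<^bsub>C 1\<^esub> x)"
        using add_homs_a_inv[OF C1.M.abelian_group_axioms C.M.abelian_group_axioms h x(1)] x by simp
      then show ?thesis using x by (simp add: a_inv_def[symmetric] W_def)
    qed
  qed
  interpret AS: abelian_subgroup W "C 0"
    by (rule abelian_subgroupI3[OF additive_subgroup.intro[OF Wsg] C.M.abelian_group_axioms])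
  obtain f where f: "f \<in> mod_hom ?R (quot_module (C 0) W) trivial_int_module"
    "bij_betw f (carrier (quot_module (C 0) W)) UNIV"
    using assms(3) unfolding acyclic_complex_def mod_isomorphic_def hom W_def[symmetric]
    by (auto simp: trivial_int_module_def)
  have car: "carrier (quot_module (C 0) W) = (\<lambda>x. W +>\<^bsub>C 0\<^esub> x) ` carrier (C 0)"
    by (auto simp: quot_module_def A_RCOSETS_def')
  define \<epsilon> where "\<epsilon> x = f (W +>\<^bsub>C 0\<^esub> x)" for x
  have \<epsilon>_add: "\<epsilon> (x \<oplus>\<^bsub>C 0\<^esub> y) = \<epsilon> x + \<epsilon> y" if "x \<in> carrier (C 0)" "y \<in> carrier (C 0)" for x y
  proof -
    have "(W +>\<^bsub>C 0\<^esub> x) \<oplus>\<^bsub>quot_module (C 0) W\<^esub> (W +>\<^bsub>C 0\<^esub> y) = W +>\<^bsub>C 0\<^esub> (x \<oplus>\<^bsub>C 0\<^esub> y)"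
      using AS.a_rcos_sum[OF that] by (simp add: quot_module_def)
    then show ?thesis
      using mod_homD(2)[OF f(1), of "W +>\<^bsub>C 0\<^esub> x" "W +>\<^bsub>C 0\<^esub> y"] that
      by (simp add: \<epsilon>_def car trivial_int_module_def)
  qed
  have s: "int_delta g \<in> carrier ?R" if "g \<in> carrier G" for g
    using that by (auto simp: group_ring_int_simps int_single_apply)
  have \<epsilon>_ract: "\<epsilon> (zact (C 0) x g) = \<epsilon> x" if xg: "x \<in> carrier (C 0)" "g \<in> carrier G" for x g
  proof -
    have "W +>\<^bsub>C 0\<^esub> zact (C 0) y g = W +>\<^bsub>C 0\<^esub> zact (C 0) x g" if y: "y \<in> W +>\<^bsub>C 0\<^esub> x" for y
    proof -
      obtain w where w: "w \<in> W" "y = w \<oplus>\<^bsub>C 0\<^esub> x" using y by (auto simp: a_r_coset_def')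
      then obtain z where z: "z \<in> carrier (C 1)" "w = d 1 z" by (auto simp: W_def)
      have "zact (C 0) w g = d 1 (zact (C 1) z g)" using z(2) mod_homD(3)[OF d s[OF xg(2)] z(1)] by simp
      moreover have "zact (C 1) z g \<in> carrier (C 1)" by (rule C1.smult_closed[OF s[OF xg(2)] z(1)])
      ultimately have "zact (C 0) w g \<in> W" unfolding W_def by blast
      moreover have "zact (C 0) y g = zact (C 0) w g \<oplus>\<^bsub>C 0\<^esub> zact (C 0) x g"
        using w Wsub s[OF xg(2)] xg by (auto simp: C.smult_r_distr)
      ultimately have "zact (C 0) y g \<in> W +>\<^bsub>C 0\<^esub> zact (C 0) x g" by (auto simp: a_r_coset_def')
      then show ?thesis using C.M.a_repr_independence[OF _ _ Wsg] s[OF xg(2)] xg(1) by blast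
    qed
    moreover have "x \<in> W +>\<^bsub>C 0\<^esub> x" using AS.zero_closed xg by (force simp: a_r_coset_def')
    ultimately have "(\<Union>y\<in>W +>\<^bsub>C 0\<^esub> x. W +>\<^bsub>C 0\<^esub> zact (C 0) y g) = W +>\<^bsub>C 0\<^esub> zact (C 0) x g"
      by blast
    then have "int_delta g \<odot>\<^bsub>quot_module (C 0) W\<^esub> (W +>\<^bsub>C 0\<^esub> x) = W +>\<^bsub>C 0\<^esub> zact (C 0) x g"
      by (simp add: quot_module_def)
    then show ?thesis using mod_homD(3)[OF f(1) s[OF xg(2)], of "W +>\<^bsub>C 0\<^esub> x"] xg
      by (simp add: \<epsilon>_def car trivial_int_module_def sum_single)
  qed
  have \<epsilon>_exact: "\<epsilon> x = 0 \<longleftrightarrow> x \<in> W" if x: "x \<in> carrier (C 0)" for x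
  proof -
    have 0: "\<epsilon> \<zero>\<^bsub>C 0\<^esub> = 0" using \<epsilon>_add[of "\<zero>\<^bsub>C 0\<^esub>" "\<zero>\<^bsub>C 0\<^esub>"] by simp
    have "\<epsilon> x = \<epsilon> \<zero>\<^bsub>C 0\<^esub> \<longleftrightarrow> W +>\<^bsub>C 0\<^esub> x = W +>\<^bsub>C 0\<^esub> \<zero>\<^bsub>C 0\<^esub>"
      using bij_betw_imp_inj_on[OF f(2)] x by (auto simp: \<epsilon>_def car inj_on_def)
    also have "\<dots> \<longleftrightarrow> x \<in> W"
      using C.M.a_coset_join1[OF _ x Wsg] C.M.a_coset_join2[OF x Wsg] Wsub by auto
    finally show ?thesis using 0 by simp
  qed
  have "(1 :: int) \<in> f ` carrier (quot_module (C 0) W)" using f(2) by (simp add: bij_betw_def)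
  then have "\<exists>c\<in>carrier (C 0). \<epsilon> c = 1" by (auto simp: car \<epsilon>_def)
  then show ?thesis using \<epsilon>_add \<epsilon>_ract \<epsilon>_exact unfolding W_def by (intro exI[of _ \<epsilon>]) simp
qed

section \<open>The three assertions about the Euler characteristic\<close>

locale permutation_resolution =
  fixes G :: "'g monoid" and K :: "'k ring"
    and C :: "int \<Rightarrow> ('g \<Rightarrow> int, 'c) module" and d :: "int \<Rightarrow> 'c \<Rightarrow> 'c"
  assumes G: "group G"
    and cx: "chain_complex (group_ring \<Z> G) C d"
    and ac: "acyclic_complex G C d"
    and fd: "finite_dimensional_complex C"
    and perm: "\<forall>i\<ge>0. \<exists>(m::nat) (H :: nat \<Rightarrow> 'g set).
           (\<forall>k\<in>{1..m}. H k \<in> finite_subgroups G) \<and>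
           mod_isomorphic (group_ring \<Z> G) (C i) (direct_sum {1..m} (\<lambda>k. perm_module G (H k)))"
    and K: "field K"
    and char: "ring_char K = 0 \<or> \<not> ring_char K dvd lcm_finite_subgroups G"
begin

abbreviation "Cn p \<equiv> C (int p)"

lemma C_module: "right_module (group_ring \<Z> G) (C i)"
  using cx by (simp add: chain_complex_def)

lemma d_hom: "d (int (Suc p)) \<in> mod_hom (group_ring \<Z> G) (Cn (Suc p)) (Cn p)"
proof -
  have "d (int (Suc p)) \<in> mod_hom (group_ring \<Z> G) (Cn (Suc p)) (C (int (Suc p) - 1))"
    using cx unfolding chain_complex_def by blast
  then show ?thesis by simp
qed

lemma perm_data:
  obtains m :: "nat \<Rightarrow> nat" and H \<phi> where "\<And>p. perm_iso G (Cn p) {1..m p} (H p) (\<phi> p)"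
    "\<And>p k. k \<in> {1..m p} \<Longrightarrow> H p k \<in> finite_subgroups G"
proof -
  have "\<forall>p. \<exists>m H \<phi>. perm_iso G (Cn p) {1..m :: nat} H \<phi> \<and> (\<forall>k\<in>{1..m}. H k \<in> finite_subgroups G)"
  proof
    fix p
    obtain m :: nat and H where H: "\<forall>k\<in>{1..m}. H k \<in> finite_subgroups G"
      "mod_isomorphic (group_ring \<Z> G) (Cn p) (direct_sum {1..m} (\<lambda>k. perm_module G (H k)))"
      using perm[rule_format, of "int p"] by auto
    then obtain \<phi> where \<phi>: "\<phi> \<in> mod_hom (group_ring \<Z> G) (Cn p) (direct_sum {1..m} (\<lambda>k. perm_module G (H k)))"
      "bij_betw \<phi> (carrier (Cn p)) (carrier (direct_sum {1..m} (\<lambda>k. perm_module G (H k))))"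
      by (auto simp: mod_isomorphic_def)
    have "perm_iso G (Cn p) {1..m} H \<phi>"
      by (intro perm_iso.intro G C_module \<phi>) (use H(1) in \<open>auto simp: finite_subgroups_def\<close>)
    then show "\<exists>m H \<phi>. perm_iso G (Cn p) {1..m :: nat} H \<phi> \<and> (\<forall>k\<in>{1..m}. H k \<in> finite_subgroups G)"
      using H(1) by blast
  qed
  then show ?thesis using that by metis
qed

lemma resolution: "\<exists>\<epsilon> N. finite_resolution G Cn (\<lambda>p. zact (Cn p)) (\<lambda>p. d (int (Suc p))) \<epsilon> N"
proof -
  from augmentation[OF G cx ac] obtain \<epsilon> where
    \<epsilon>: "(\<forall>x\<in>carrier (C 0). \<forall>y\<in>carrier (C 0). \<epsilon> (x \<oplus>\<^bsub>C 0\<^esub> y) = \<epsilon> x + (\<epsilon> y :: int)) \<and>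
    (\<forall>x\<in>carrier (C 0). \<forall>g\<in>carrier G. \<epsilon> (zact (C 0) x g) = \<epsilon> x) \<and>
    (\<forall>x\<in>carrier (C 0). \<epsilon> x = 0 \<longleftrightarrow> x \<in> d 1 ` carrier (C 1)) \<and>
    (\<exists>c\<in>carrier (C 0). \<epsilon> c = 1)" ..
  obtain N where N: "\<And>i. i > N \<Longrightarrow> zero_module (C i)" using fd by (auto simp: finite_dimensional_complex_def)
  obtain m :: "nat \<Rightarrow> nat" and H \<phi> where P: "\<And>p. perm_iso G (Cn p) {1..m p} (H p) (\<phi> p)"
    using perm_data by metis
  \<comment> \<open>The given bound is an integer and may be negative, while the resolution is
    indexed by naturals; beyond \<open>nat N\<close> all terms are zero in either case.\<close>
  have "finite_resolution G Cn (\<lambda>p. zact (Cn p)) (\<lambda>p. d (int (Suc p))) \<epsilon> (nat N)"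
  proof (rule finite_resolution.intro)
    fix p
    show "right_gmod G (Cn p) (zact (Cn p))" by (rule right_gmod_of_module[OF G C_module])
    show "d (int (Suc p)) x \<in> carrier (Cn p)" if "x \<in> carrier (Cn (Suc p))" for x
      by (rule mod_homD(1)[OF d_hom that])
    show "d (int (Suc p)) (x \<oplus>\<^bsub>Cn (Suc p)\<^esub> y) = d (int (Suc p)) x \<oplus>\<^bsub>Cn p\<^esub> d (int (Suc p)) y"
      if "x \<in> carrier (Cn (Suc p))" "y \<in> carrier (Cn (Suc p))" for x y
      by (rule mod_homD(2)[OF d_hom that])
    show "d (int (Suc p)) (zact (Cn (Suc p)) x g) = zact (Cn p) (d (int (Suc p)) x) g"
      if "x \<in> carrier (Cn (Suc p))" "g \<in> carrier G" for x g
      using that by (intro mod_homD(3)[OF d_hom]) (auto simp: group_ring_int_simps int_single_apply)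
    show "d (int (Suc p)) (d (int (Suc (Suc p))) x) = \<zero>\<^bsub>Cn p\<^esub>" if "x \<in> carrier (Cn (Suc (Suc p)))" for x
    proof -
      have "d (int (Suc (Suc p)) - 1) (d (int (Suc (Suc p))) x) = \<zero>\<^bsub>C (int (Suc (Suc p)) - 2)\<^esub>"
        using cx that unfolding chain_complex_def by blast
      then show ?thesis by simp
    qed
    show "x \<in> d (int (Suc (Suc p))) ` carrier (Cn (Suc (Suc p)))"
      if "x \<in> carrier (Cn (Suc p))" "d (int (Suc p)) x = \<zero>\<^bsub>Cn p\<^esub>" for x
    proof -
      have "zero_module (homology C d (int (Suc p)))" using ac by (simp add: acyclic_complex_def)
      from homology_zero[OF cx this that(1)] that(2) show ?thesis by (simp add: add.commute)
    qed
    show "\<exists>s\<in>add_homs (Cn p) (Cn (Suc p)). \<forall>c\<in>carrier (Cn p). d (int (Suc p)) (s c) = r c"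
      if r: "r \<in> add_homs (Cn p) (Cn p)" "\<And>c. c \<in> carrier (Cn p) \<Longrightarrow> r c \<in> d (int (Suc p)) ` carrier (Cn (Suc p))" for r
    proof -
      interpret P: perm_iso G "Cn p" "{1..m p}" "H p" "\<phi> p" by (rule P)
      interpret S: right_module "group_ring \<Z> G" "Cn (Suc p)" by (rule C_module)
      have f: "restrict (d (int (Suc p))) (carrier (Cn (Suc p))) \<in> add_homs (Cn (Suc p)) (Cn p)"
        using mod_homD(1,2)[OF d_hom] by (intro add_homsI S.M.abelian_group_axioms) auto
      have "\<exists>s\<in>add_homs (Cn p) (Cn (Suc p)). \<forall>c\<in>carrier (Cn p).
          restrict (d (int (Suc p))) (carrier (Cn (Suc p))) (s c) = r c"
        using r(2) by (intro P.lift[OF S.M.abelian_group_axioms f r(1)]) auto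
      then show ?thesis using add_homsD(1) by (metis restrict_apply')
    qed
    show "carrier (Cn p) = {\<zero>\<^bsub>Cn p\<^esub>}" if "p > nat N"
      using N[of "int p"] that by (simp add: zero_module_def)
  qed (use \<epsilon> in auto)
  then show ?thesis by blast
qed

lemma module_rep:
  assumes "fin_dim_group_module K G M"
  shows "krep G K (scal K G M) (gact K M)"
    "\<exists>n. reldim K (scal K G M) {\<zero>\<^bsub>scal K G M\<^esub>} (carrier (scal K G M)) n"
proof -
  show r: "krep G K (scal K G M) (gact K M)"
    using assms by (intro krep_of_module G K) (simp add: fin_dim_group_module_def)
  interpret krep G K "scal K G M" "gact K M" by (rule r)
  show "\<exists>n. reldim K (scal K G M) {\<zero>\<^bsub>scal K G M\<^esub>} (carrier (scal K G M)) n"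
    using assms V.finite_dim_iff by (simp add: fin_dim_group_module_def)
qed

lemma finite_subgroup_facts:
  assumes "S \<in> finite_subgroups G"
  shows "finite S" "[card S] \<cdot>\<^bsub>K\<^esub> \<one>\<^bsub>K\<^esub> \<noteq> \<zero>\<^bsub>K\<^esub>"
  using assms card_finite_subgroup_nonzero[OF G K char assms] by (auto simp: finite_subgroups_def)

lemma hom_total_finite:
  assumes M: "fin_dim_group_module K G M"
  shows "total_finite K (bar G (hom_rep (Cn p) (scal K G M)))
    (bar_d G (hom_rep (Cn p) (scal K G M)) (hom_act (Cn p) (zact (Cn p)) (gact K M)))"
proof -
  obtain m :: "nat \<Rightarrow> nat" and H \<phi> where P: "\<And>p. perm_iso G (Cn p) {1..m p} (H p) (\<phi> p)"
    "\<And>p k. k \<in> {1..m p} \<Longrightarrow> H p k \<in> finite_subgroups G"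
    using perm_data by metis
  obtain n where n: "reldim K (scal K G M) {\<zero>\<^bsub>scal K G M\<^esub>} (carrier (scal K G M)) n"
    using module_rep(2)[OF M] by blast
  show ?thesis
    by (rule perm_iso.hom_euler(1)[OF P(1) module_rep(1)[OF M] finite_subgroup_facts(1)[OF P(2)]
      finite_subgroup_facts(2)[OF P(2)] n])
qed

lemma module_euler:
  fixes M :: "('g \<Rightarrow> 'k, 'm) module"
  assumes M: "fin_dim_group_module K G M"
  shows "euler_char_finite K G M"
    and "total_finite K (bar G (scal K G M)) (bar_d G (scal K G M) (gact K M))"
    and "euler_char K G M = cx_euler K (bar G (scal K G M)) (bar_d G (scal K G M) (gact K M))"
proof -
  obtain \<epsilon> N where "finite_resolution G Cn (\<lambda>p. zact (Cn p)) (\<lambda>p. d (int (Suc p))) \<epsilon> N"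
    using resolution by blast
  then interpret R: finite_resolution G Cn "\<lambda>p. zact (Cn p)" "\<lambda>p. d (int (Suc p))" \<epsilon> N .
  show tf: "total_finite K (bar G (scal K G M)) (bar_d G (scal K G M) (gact K M))"
    by (rule R.euler_resolution(1)[OF module_rep(1)[OF M] hom_total_finite[OF M]])
  have lm: "left_module (group_ring K G) M" using M by (simp add: fin_dim_group_module_def)
  show "euler_char_finite K G M" using group_cohomology_bar(1)[OF G K lm] tf by simp
  show "euler_char K G M = cx_euler K (bar G (scal K G M)) (bar_d G (scal K G M) (gact K M))"
    by (rule group_cohomology_bar(2)[OF G K lm tf])
qed

lemma euler_char_cong:
  fixes M1 :: "('g \<Rightarrow> 'k, 'm1) module" and M2 :: "('g \<Rightarrow> 'k, 'm2) module"
  assumes M: "fin_dim_group_module K G M1" "fin_dim_group_module K G M2"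
    and iso: "\<forall>S\<in>finite_subgroups G. mod_isomorphic (group_ring K (G\<lparr>carrier := S\<rparr>)) M1 M2"
  shows "euler_char K G M1 = euler_char K G M2"
proof -
  obtain \<epsilon> N where "finite_resolution G Cn (\<lambda>p. zact (Cn p)) (\<lambda>p. d (int (Suc p))) \<epsilon> N"
    using resolution by blast
  then interpret R: finite_resolution G Cn "\<lambda>p. zact (Cn p)" "\<lambda>p. d (int (Suc p))" \<epsilon> N .
  obtain m :: "nat \<Rightarrow> nat" and H \<phi> where P: "\<And>p. perm_iso G (Cn p) {1..m p} (H p) (\<phi> p)"
    "\<And>p k. k \<in> {1..m p} \<Longrightarrow> H p k \<in> finite_subgroups G"
    using perm_data by metis
  obtain n1 n2 where n: "reldim K (scal K G M1) {\<zero>\<^bsub>scal K G M1\<^esub>} (carrier (scal K G M1)) n1"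
    "reldim K (scal K G M2) {\<zero>\<^bsub>scal K G M2\<^esub>} (carrier (scal K G M2)) n2"
    using module_rep(2)[OF M(1)] module_rep(2)[OF M(2)] by blast
  have iso': "\<exists>\<psi>\<in>mod_hom K (scal K G M1) (scal K G M2). bij_betw \<psi> (carrier (scal K G M1)) (carrier (scal K G M2)) \<and>
      (\<forall>h\<in>S. \<forall>x\<in>carrier (scal K G M1). \<psi> (gact K M1 h x) = gact K M2 h (\<psi> x))"
    if S: "S \<in> finite_subgroups G" for S
  proof -
    interpret F: field K by (rule K)
    obtain \<psi> where \<psi>: "\<psi> \<in> mod_hom (group_ring K (G\<lparr>carrier := S\<rparr>)) M1 M2" "bij_betw \<psi> (carrier M1) (carrier M2)"
      using iso S by (auto simp: mod_isomorphic_def)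
    \<comment> \<open>The ring \<open>K[S]\<close> contains both the scalars, as multiples of the
      identity of \<open>S\<close>, and the elements of \<open>S\<close>, so one isomorphism over it
      is \<open>K\<close>-linear and \<open>S\<close>-equivariant at once.\<close>
    have single: "gr_single K c g \<in> carrier (group_ring K (G\<lparr>carrier := S\<rparr>))" if "c \<in> carrier K" "g \<in> S" for c g
      using gr_single_closed[OF F.ring_axioms that(1), of g "G\<lparr>carrier := S\<rparr>"] that by simp
    have "\<one>\<^bsub>G\<^esub> \<in> S" using S subgroup.one_closed by (auto simp: finite_subgroups_def)
    then show ?thesis using \<psi>(2) mod_homD[OF \<psi>(1)] single
      by (intro bexI[of _ \<psi>]) (auto simp: mod_hom_def)
  qed
  have "cx_euler K (bar G (hom_rep (Cn p) (scal K G M1))) (bar_d G (hom_rep (Cn p) (scal K G M1)) (hom_act (Cn p) (zact (Cn p)) (gact K M1)))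
     = cx_euler K (bar G (hom_rep (Cn p) (scal K G M2))) (bar_d G (hom_rep (Cn p) (scal K G M2)) (hom_act (Cn p) (zact (Cn p)) (gact K M2)))" for p
    by (rule perm_iso.hom_euler_cong[OF P(1) module_rep(1)[OF M(1)] module_rep(1)[OF M(2)]
        finite_subgroup_facts(1)[OF P(2)] finite_subgroup_facts(2)[OF P(2)] n iso'[OF P(2)]])
  then show ?thesis
    unfolding module_euler(3)[OF M(1)] module_euler(3)[OF M(2)]
      R.euler_resolution(2)[OF module_rep(1)[OF M(1)] hom_total_finite[OF M(1)]]
      R.euler_resolution(2)[OF module_rep(1)[OF M(2)] hom_total_finite[OF M(2)]] by simp
qed

text \<open>The bar complex is exact in its coefficients, so \<open>cx_euler_add\<close> applies
  once finiteness is known for \<open>M\<close> and \<open>M'\<close>, and this comes from the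
  resolution through \<open>module_euler\<close>.\<close>

lemma euler_char_add:
  fixes M'' :: "('g \<Rightarrow> 'k, 'a) module" and M :: "('g \<Rightarrow> 'k, 'b) module" and M' :: "('g \<Rightarrow> 'k, 'e) module"
  assumes M: "fin_dim_group_module K G M''" "fin_dim_group_module K G M" "fin_dim_group_module K G M'"
    and ex: "short_exact (group_ring K G) M'' M M' f h"
  shows "euler_char K G M = euler_char K G M' + euler_char K G M''"
proof -
  interpret F: field K by (rule K)
  interpret G: group G by (rule G)
  have single: "gr_single K c g \<in> carrier (group_ring K G)" if "c \<in> carrier K" "g \<in> carrier G" for c g
    by (rule gr_single_closed[OF F.ring_axioms that])
  have f: "f \<in> mod_hom (group_ring K G) M'' M" and h: "h \<in> mod_hom (group_ring K G) M M'"
    and inj: "inj_on f (carrier M'')" and im: "f ` carrier M'' = {x \<in> carrier M. h x = \<zero>\<^bsub>M'\<^esub>}"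
    and surj: "h ` carrier M = carrier M'" using ex by (auto simp: short_exact_def)
  have "cx_exact K (bar G (scal K G M'')) (bar_d G (scal K G M'') (gact K M''))
     (bar G (scal K G M)) (bar_d G (scal K G M) (gact K M))
     (bar G (scal K G M')) (bar_d G (scal K G M') (gact K M'))
     (\<lambda>n x. \<lambda>gs\<in>tuples G n. f (x gs)) (\<lambda>n x. \<lambda>gs\<in>tuples G n. h (x gs))"
  proof (rule bar_exact[OF module_rep(1)[OF M(1)] module_rep(1)[OF M(2)] module_rep(1)[OF M(3)]])
    show "f \<in> mod_hom K (scal K G M'') (scal K G M)" "h \<in> mod_hom K (scal K G M) (scal K G M')"
      using mod_homD[OF f] mod_homD[OF h] single by (auto simp: mod_hom_def)
  qed (use mod_homD(3)[OF f] mod_homD(3)[OF h] single inj im surj in auto)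
  then interpret cx_exact K "bar G (scal K G M'')" "bar_d G (scal K G M'') (gact K M'')"
     "bar G (scal K G M)" "bar_d G (scal K G M) (gact K M)"
     "bar G (scal K G M')" "bar_d G (scal K G M') (gact K M')"
     "\<lambda>n x. \<lambda>gs\<in>tuples G n. f (x gs)" "\<lambda>n x. \<lambda>gs\<in>tuples G n. h (x gs)" .
  show ?thesis
    using cx_euler_add[OF module_euler(2)[OF M(2)] module_euler(2)[OF M(3)]]
    by (simp add: module_euler(3)[OF M(1)] module_euler(3)[OF M(2)] module_euler(3)[OF M(3)])
qed

end

theorem proposition2p10:
  fixes G :: "'g monoid" and K :: "'k ring"
    and C :: "int \<Rightarrow> ('g \<Rightarrow> int, 'c) module" and d :: "int \<Rightarrow> 'c \<Rightarrow> 'c"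
  assumes "group G"
    and "finitely_many_up_to_conj G (finite_subgroups G)"
    and "chain_complex (group_ring \<Z> G) C d"
    and "acyclic_complex G C d"
    and "finite_dimensional_complex C"
    and "\<forall>i\<ge>0. \<exists>(m::nat) (H :: nat \<Rightarrow> 'g set).
           (\<forall>k\<in>{1..m}. H k \<in> finite_subgroups G) \<and>
           mod_isomorphic (group_ring \<Z> G) (C i) (direct_sum {1..m} (\<lambda>k. perm_module G (H k)))"
    and "field K"
    and "ring_char K = 0 \<or> \<not> ring_char K dvd lcm_finite_subgroups G"
  shows "(\<forall>M :: ('g \<Rightarrow> 'k, 'm) module.
            fin_dim_group_module K G M \<longrightarrow> euler_char_finite K G M)
    \<and> (\<forall>(M1 :: ('g \<Rightarrow> 'k, 'm1) module) (M2 :: ('g \<Rightarrow> 'k, 'm2) module).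
            fin_dim_group_module K G M1 \<longrightarrow> fin_dim_group_module K G M2 \<longrightarrow>
            (\<forall>S\<in>finite_subgroups G.
               mod_isomorphic (group_ring K (G\<lparr>carrier := S\<rparr>)) M1 M2) \<longrightarrow>
            euler_char K G M1 = euler_char K G M2)
    \<and> (\<forall>(M'' :: ('g \<Rightarrow> 'k, 'a) module) (M :: ('g \<Rightarrow> 'k, 'b) module)
           (M' :: ('g \<Rightarrow> 'k, 'e) module) f h.
            fin_dim_group_module K G M'' \<longrightarrow> fin_dim_group_module K G M \<longrightarrow>
            fin_dim_group_module K G M' \<longrightarrow>
            short_exact (group_ring K G) M'' M M' f h \<longrightarrow>
            euler_char K G M = euler_char K G M' + euler_char K G M'')"
proof -
  interpret permutation_resolution G K C d by (rule permutation_resolution.intro) fact+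
  show ?thesis using module_euler(1) euler_char_cong euler_char_add by blast
qed

end
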